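(* Let $\dagger$ denote one of the four splittings ABOBA, AOBOA, BOAOB, OABAO, with transition kernel $Q^{\dagger,U}_{h,\gamma}$. Let $(K,L,d)\mapsto(h_{K,L,d},\gamma_{K,L,d})$ be any fixed-parameter tuning rule which is stable for $\dagger$ in the sense that $0<s_\dagger<2(1+\beta)/L$ for every $0<K<L$ and $d\ge1$, where $\beta$ and $s_\dagger$ are computed from $h=h_{K,L,d}$, $\gamma=\gamma_{K,L,d}$ by $\beta=e^{-\gamma h}$ and $s_\dagger=\frac{h^2}2(1+\beta)$ for ABOBA and OABAO, $s_\dagger=\sqrt\beta\,h^2$ for AOBOA and BOAOB. Write $h_\kappa=h_{1,\kappa,2}$, $\gamma_\kappa=\gamma_{1,\kappa,2}$. Let $C,c>0$ and $a,b\ge0$ be constants, let $\tau:(1,\infty)\to(0,\infty)$ satisfy $\tau(\kappa)=o(\kappa)$ as $\kappa\to\infty$, and let $\kappa_0>1$. Then there exist $\kappa\ge\kappa_0$ and $U\in\mathcal U_\kappa^2$ such that $Q_{h_\kappa,\gamma_\kappa}^{\dagger,U}$ has a unique invariant law $\pi$, and there are $z\in\mathbb R^4$ and $n\in\mathbb N$ for which $$\bigl\|\delta_z(Q_{h_\kappa,\gamma_\kappa}^{\dagger,U})^n-\pi\bigr\|_{\mathrm{TV}}>C\kappa^a\bigl(1+W_2(\delta_z,\pi)\bigr)^b\exp\!\left(-\frac{cn}{\tau(\kappa)}\right).$$ In particular, the assertion that the reverse inequality ($\le$) holds for all $\kappa\ge\kappa_0$, all $U\in\mathcal U_\kappa^2$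 for which $Q^{\dagger,U}_{h_\kappa,\gamma_\kappa}$ has a unique invariant law $\pi$, all $z\in\mathbb R^4$ and all $n\in\mathbb N$ fails with $\tau(\kappa)=\kappa^\alpha$ for any $\alpha<1$.
   Context: Splittings. For differentiable $U:\mathbb R^d\to\mathbb R$, $\gamma>0$ and $t>0$, define on $\mathbb R^d\times\mathbb R^d$ the maps $\mathrm A_t(x,v)=(x+tv,v)$, $\mathrm B_t(x,v)=(x,v-t\nabla U(x))$, $\mathrm O_t(x,v)=(x,e^{-\gamma t}v+(1-e^{-2\gamma t})^{1/2}\xi)$, where $\xi\sim\mathcal N(0,\mathrm{Id}_d)$ is drawn independently at each application of $\mathrm O_t$. One step with step size $h$ applies successively, in the order of the letters of the name: ABOBA: $\mathrm A_{h/2},\mathrm B_{h/2},\mathrm O_h,\mathrm B_{h/2},\mathrm A_{h/2}$; AOBOA: $\mathrm A_{h/2},\mathrm O_{h/2},\mathrm B_h,\mathrm O_{h/2},\mathrm A_{h/2}$; BOAOB: $\mathrm B_{h/2},\mathrm O_{h/2},\mathrm A_h,\mathrm O_{h/2},\mathrm B_{h/2}$; OABAO: $\mathrm O_{h/2},\mathrm A_{h/2},\mathrm B_h,\mathrm A_{h/2},\mathrm O_{h/2}$. Iterating defines a Markov chain on $\mathbb R^d\times\mathbb R^d$ with transition kernel $Q^{\dagger,U}_{h,\gamma}$. $\mathcal U_\kappa^d=\{U\in C^\infty(\mathbb R^d): \mathrm{Id}_d\preceq\nabla^2U(x)\preceq\kappa\,\mathrm{Id}_d\text{ for every }x\}$.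 A fixed-parameter tuning rule assigns to each triple $(K,L,d)$ with $0<K<L$ and integer $d\ge1$ a pair $(h_{K,L,d},\gamma_{K,L,d})\in(0,\infty)^2$. $\mathbb N=\{0,1,2,\dots\}$. $\|\nu-\widetilde\nu\|_{\mathrm{TV}}=\sup_A|\nu(A)-\widetilde\nu(A)|$; $W_2$ is the Euclidean $2$-Wasserstein distance; $\delta_z$ is the Dirac mass at $z$. *)

theory Defs
  imports "HOL-Probability.Probability" "HOL-Library.Landau_Symbols"
begin

section \<open>Potentials\<close>

text \<open>
  On a finite-dimensional space a function is \<open>C\<^sup>k\<^sup>+\<^sup>1\<close> iff it is differentiable and all its
  directional derivatives are \<open>C\<^sup>k\<close>.
\<close>

primrec C_k :: "nat \<Rightarrow> ('a::euclidean_space \<Rightarrow> real) \<Rightarrow> bool" where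
  "C_k 0 f \<longleftrightarrow> continuous_on UNIV f"
| "C_k (Suc k) f \<longleftrightarrow>
     f differentiable_on UNIV \<and> (\<forall>v. C_k k (\<lambda>x. frechet_derivative f (at x) v))"

definition C_infinity :: "('a::euclidean_space \<Rightarrow> real) \<Rightarrow> bool" where
  "C_infinity f \<longleftrightarrow> (\<forall>k. C_k k f)"

definition gradient :: "(real^'d \<Rightarrow> real) \<Rightarrow> real^'d \<Rightarrow> real^'d" where
  "gradient U x = (THE g. GDERIV U x :> g)"

definition hessian :: "(real^'d \<Rightarrow> real) \<Rightarrow> real^'d \<Rightarrow> real^'d^'d" where
  "hessian U x = jacobian (gradient U) (at x)"

definition loewner_le :: "real^'d^'d \<Rightarrow> real^'d^'d \<Rightarrow> bool" (infix "\<preceq>\<^sub>L" 50) where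
  "A \<preceq>\<^sub>L B \<longleftrightarrow> (\<forall>w. w \<bullet> (A *v w) \<le> w \<bullet> (B *v w))"

definition potentials :: "real \<Rightarrow> (real^'d \<Rightarrow> real) set" where
  "potentials \<kappa> =
     {U. C_infinity U \<and> (\<forall>x. mat 1 \<preceq>\<^sub>L hessian U x \<and> hessian U x \<preceq>\<^sub>L \<kappa> *\<^sub>R mat 1)}"

section \<open>Splitting schemes\<close>

type_synonym 'd phase = "(real^'d) \<times> (real^'d)"

type_synonym 'd kernel = "'d phase \<Rightarrow> 'd phase measure"

definition std_gaussian :: "(real^'d) measure" where
  "std_gaussian = density lborel (\<lambda>\<xi>. ennreal (\<Prod>i\<in>UNIV. std_normal_density (\<xi> $ i)))"

definition step_A :: "real \<Rightarrow> 'd::finite kernel" where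
  "step_A t = (\<lambda>(x, v). return borel (x + t *\<^sub>R v, v))"

definition step_B :: "(real^'d \<Rightarrow> real) \<Rightarrow> real \<Rightarrow> 'd::finite kernel" where
  "step_B U t = (\<lambda>(x, v). return borel (x, v - t *\<^sub>R gradient U x))"

definition step_O :: "real \<Rightarrow> real \<Rightarrow> 'd::finite kernel" where
  "step_O \<gamma> t = (\<lambda>(x, v). distr std_gaussian borel
     (\<lambda>\<xi>. (x, exp (- \<gamma> * t) *\<^sub>R v + sqrt (1 - exp (- 2 * \<gamma> * t)) *\<^sub>R \<xi>)))"

datatype splitting = ABOBA | AOBOA | BOAOB | OABAO

primrec splitting_steps ::
  "splitting \<Rightarrow> (real^'d \<Rightarrow> real) \<Rightarrow> real \<Rightarrow> real \<Rightarrow> 'd::finite kernel list" where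
  "splitting_steps ABOBA U h \<gamma> =
     [step_A (h/2), step_B U (h/2), step_O \<gamma> h, step_B U (h/2), step_A (h/2)]"
| "splitting_steps AOBOA U h \<gamma> =
     [step_A (h/2), step_O \<gamma> (h/2), step_B U h, step_O \<gamma> (h/2), step_A (h/2)]"
| "splitting_steps BOAOB U h \<gamma> =
     [step_B U (h/2), step_O \<gamma> (h/2), step_A h, step_O \<gamma> (h/2), step_B U (h/2)]"
| "splitting_steps OABAO U h \<gamma> =
     [step_O \<gamma> (h/2), step_A (h/2), step_B U h, step_A (h/2), step_O \<gamma> (h/2)]"

text \<open>The head of the list acts first.\<close>

definition splitting_kernel ::
  "splitting \<Rightarrow> (real^'d \<Rightarrow> real) \<Rightarrow> real \<Rightarrow> real \<Rightarrow> 'd::finite kernel" where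
  "splitting_kernel s U h \<gamma> z =
     foldl (\<lambda>\<mu> k. \<mu> \<bind> k) (return borel z) (splitting_steps s U h \<gamma>)"

text \<open>\<open>kernel_iterate Q n \<mu>\<close> is the law \<open>\<mu> Q\<^sup>n\<close> of the chain after \<open>n\<close> steps.\<close>

definition kernel_iterate ::
  "('a \<Rightarrow> 'a measure) \<Rightarrow> nat \<Rightarrow> 'a measure \<Rightarrow> 'a measure" where
  "kernel_iterate Q n = (\<lambda>\<mu>. \<mu> \<bind> Q) ^^ n"

definition invariant_law :: "('a::topological_space \<Rightarrow> 'a measure) \<Rightarrow> 'a measure \<Rightarrow> bool" where
  "invariant_law Q \<pi> \<longleftrightarrow> prob_space \<pi> \<and> sets \<pi> = sets borel \<and> \<pi> \<bind> Q = \<pi>"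

definition unique_invariant_law ::
  "('a::topological_space \<Rightarrow> 'a measure) \<Rightarrow> 'a measure \<Rightarrow> bool" where
  "unique_invariant_law Q \<pi> \<longleftrightarrow> invariant_law Q \<pi> \<and> (\<forall>\<pi>'. invariant_law Q \<pi>' \<longrightarrow> \<pi>' = \<pi>)"

section \<open>Stable tuning rules\<close>

definition damping :: "real \<Rightarrow> real \<Rightarrow> real" where
  "damping h \<gamma> = exp (- \<gamma> * h)"

primrec stability_param :: "splitting \<Rightarrow> real \<Rightarrow> real \<Rightarrow> real" where
  "stability_param ABOBA h \<gamma> = h\<^sup>2 / 2 * (1 + damping h \<gamma>)"
| "stability_param OABAO h \<gamma> = h\<^sup>2 / 2 * (1 + damping h \<gamma>)"
| "stability_param AOBOA h \<gamma> = sqrt (damping h \<gamma>) * h\<^sup>2"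
| "stability_param BOAOB h \<gamma> = sqrt (damping h \<gamma>) * h\<^sup>2"

text \<open>
  A tuning rule is given by two functions \<open>h\<close>, \<open>\<gamma>\<close> of \<open>(K, L, d)\<close>; their values matter
  only for \<open>0 < K < L\<close> and \<open>d \<ge> 1\<close>.
\<close>

definition tuning_rule ::
  "(real \<Rightarrow> real \<Rightarrow> nat \<Rightarrow> real) \<Rightarrow> (real \<Rightarrow> real \<Rightarrow> nat \<Rightarrow> real) \<Rightarrow> bool" where
  "tuning_rule h \<gamma> \<longleftrightarrow>
     (\<forall>K L d. 0 < K \<and> K < L \<and> 1 \<le> d \<longrightarrow> 0 < h K L d \<and> 0 < \<gamma> K L d)"

definition stable_rule ::
  "splitting \<Rightarrow> (real \<Rightarrow> real \<Rightarrow> nat \<Rightarrow> real) \<Rightarrow> (real \<Rightarrow> real \<Rightarrow> nat \<Rightarrow> real) \<Rightarrow> bool" where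
  "stable_rule s h \<gamma> \<longleftrightarrow>
     (\<forall>K L d. 0 < K \<and> K < L \<and> 1 \<le> d \<longrightarrow>
        0 < stability_param s (h K L d) (\<gamma> K L d) \<and>
        stability_param s (h K L d) (\<gamma> K L d) < 2 * (1 + damping (h K L d) (\<gamma> K L d)) / L)"

section \<open>Distances between laws\<close>

definition tv_dist :: "'a measure \<Rightarrow> 'a measure \<Rightarrow> real" where
  "tv_dist \<mu> \<nu> = (SUP A\<in>sets \<mu>. \<bar>measure \<mu> A - measure \<nu> A\<bar>)"

text \<open>
  Real powers on \<open>[0, \<infinity>]\<close>, with \<open>x\<^sup>0 = 1\<close> for \<open>x \<noteq> 0\<close> (including \<open>\<infinity>\<^sup>0 = 1\<close>). They let the
  Wasserstein distance to a law without second moment take its value \<open>\<infinity>\<close>.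
\<close>

definition ennreal_powr :: "ennreal \<Rightarrow> real \<Rightarrow> ennreal" (infixr "powr\<^sub>\<infinity>" 80) where
  "x powr\<^sub>\<infinity> b =
     (if x = \<infinity> then (if b = 0 then 1 else if b > 0 then \<infinity> else 0)
      else ennreal (enn2real x powr b))"

definition couplings :: "'a measure \<Rightarrow> 'b measure \<Rightarrow> ('a \<times> 'b) measure set" where
  "couplings \<mu> \<nu> =
     {\<omega>. sets \<omega> = sets (\<mu> \<Otimes>\<^sub>M \<nu>) \<and> distr \<omega> \<mu> fst = \<mu> \<and> distr \<omega> \<nu> snd = \<nu>}"

text \<open>
  On a product type the library's \<open>dist\<close> is \<open>sqrt ((dist x x')\<^sup>2 + (dist v v')\<^sup>2)\<close>, so on
  phase space this is the Euclidean Wasserstein distance.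
\<close>

definition W2 :: "'a::metric_space measure \<Rightarrow> 'a measure \<Rightarrow> ennreal" where
  "W2 \<mu> \<nu> = (INF \<omega>\<in>couplings \<mu> \<nu>. \<integral>\<^sup>+ (x, y). ennreal ((dist x y)\<^sup>2) \<partial>\<omega>) powr\<^sub>\<infinity> (1 / 2)"

end

theory Submission imports Defs begin

text \<open>
  Let \<open>\<beta> = exp (- \<gamma> * h)\<close> and let \<open>s\<close> be the stability parameter. Without noise and with a force
  \<open>\<Gamma>\<close> in place of the gradient, the positions at which any of the four schemes evaluates the force
  follow the heavy-ball recursion \<open>p (t + 2) = (1 + \<beta>) p (t + 1) - \<beta> p t - s \<Gamma> (p (t + 1))\<close>. Where
  \<open>\<Gamma>\<close> has slope one, a step is affine, and its linear part \<open>M\<close> is the step for the potential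
  \<open>(norm x)\<^sup>2 / 2\<close>. It satisfies \<open>M\<^sup>2 = (1 + \<beta> - s) M - \<beta>\<close> (\<open>splitting_word_trace\<close>), and stability
  makes it a contraction in a suitable norm (\<open>adapted_norm\<close>).

  A rate \<open>\<tau> \<kappa>\<close> of smaller order than \<open>\<kappa>\<close> fails because a tuning cannot be fast for two kinds of
  potentials at once. If \<open>u < 1\<close> is a rate per step with \<open>(1 - u) * \<kappa>\<close> large, then by \<open>spectral_trichotomy\<close>
  either \<open>M\<close> has spectral radius at least \<open>u\<close>, and the chain for \<open>(norm x)\<^sup>2 / 2\<close> forgets a distant
  starting point no faster than \<open>u\<close> allows (\<open>slow_decay_at_condition_number\<close>); or the friction
  \<open>1 - \<beta>\<close> is small compared to \<open>s * \<kappa>\<close>. In the second case the force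
  \<open>x + (\<kappa> - 1) * closest_point P x\<close>, for a suitable polygon \<open>P\<close>, has a cycle of heavy-ball positions near
  which the projection is locally constant (\<open>heavy_ball_cycle_exists\<close>). There the force has slope one,
  so the cycle attracts at the rate of \<open>M\<close> (\<open>attracting_cycle_at_condition_number\<close>).

  That force is the gradient of a function which is not smooth. Averaging the projection over a
  standard Gaussian displacement makes it smooth, keeps it monotone and 1-Lipschitz, and moves it by a
  bounded amount only, so the resulting potential belongs to the class (\<open>potential_in_potentials\<close>). Replacing \<open>P\<close> by
  \<open>R\<close> times \<open>P\<close> enlarges the cycle by the factor \<open>R\<close>, while the effect of the smoothing and the Gaussian
  noise of a step keep their size. Hence the chain started on the enlarged cycle follows it for
  \<open>n\<close> steps, except with probability of order \<open>n / R\<^sup>2\<close> (\<open>tv_near_cycle\<close>). Since \<open>W2\<close> between the starting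
  point and the invariant law grows at most linearly in \<open>R\<close>, the claimed bound tends to 0
  already for \<open>n\<close> of order \<open>ln R\<close> (\<open>scale_choice\<close>), whereas the total variation distance stays at least
  1/4.

  The invariant law exists and is unique because the squared adapted norm is a Lyapunov
  function, and because the law after two steps has, uniformly on bounded sets of starting points, a part
  proportional to Lebesgue measure (\<open>splitting_phase_spread\<close>); Nummelin's regeneration argument does the rest
  (\<open>unique_invariant_law_exists\<close>).
\<close>

section \<open>The standard Gaussian\<close>

lemma sets_std_gaussian [simp, measurable_cong]: "sets (std_gaussian :: (real^'d) measure) = sets borel"
  by (simp add: std_gaussian_def)

lemma space_std_gaussian [simp]: "space (std_gaussian :: (real^'d) measure) = UNIV"
  by (simp add: std_gaussian_def)

lemma nn_integral_lborel_prod_vec: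
  fixes g :: "'d::finite \<Rightarrow> real \<Rightarrow> ennreal"
  assumes [measurable]: "\<And>i. g i \<in> borel_measurable borel"
  shows "(\<integral>\<^sup>+y. (\<Prod>i\<in>UNIV. g i (y $ i)) \<partial>(lborel :: (real^'d) measure)) = (\<Prod>i\<in>UNIV. \<integral>\<^sup>+x. g i x \<partial>lborel)"
proof -
  define f where "f b = g (THE i. b = axis i (1::real))" for b :: "real^'d"
  have f: "f (axis i 1) = g i" for i
    by (simp add: f_def axis_eq_axis)
  have inj: "inj (\<lambda>i::'d. axis i (1::real))"
    by (simp add: inj_on_def axis_eq_axis)
  have Bas: "(Basis :: (real^'d) set) = (\<lambda>i. axis i 1) ` UNIV"
    by (auto simp: Basis_vec_def)
  have reindex: "(\<Prod>b\<in>Basis. F b) = (\<Prod>i\<in>UNIV. F (axis i 1))" for F :: "real^'d \<Rightarrow> ennreal"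
    unfolding Bas using prod.reindex[OF inj, of F] by simp
  have "(\<integral>\<^sup>+y. (\<Prod>b\<in>Basis. f b (y \<bullet> b)) \<partial>(lborel :: (real^'d) measure)) = (\<Prod>b\<in>Basis. \<integral>\<^sup>+x. f b x \<partial>lborel)"
    by (rule nn_integral_lborel_prod) (auto simp: Bas f)
  then show ?thesis
    by (simp add: reindex f cart_eq_inner_axis)
qed

lemma nn_integral_std_gaussian:
  assumes [measurable]: "f \<in> borel_measurable borel"
  shows "(\<integral>\<^sup>+y. f y \<partial>(std_gaussian :: (real^'d) measure)) =
     (\<integral>\<^sup>+y. ennreal (\<Prod>i\<in>UNIV. std_normal_density (y $ i)) * f y \<partial>lborel)"
  unfolding std_gaussian_def by (subst nn_integral_density) auto

lemma nn_integral_std_gaussian_prod: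
  fixes g :: "'d::finite \<Rightarrow> real \<Rightarrow> ennreal"
  assumes [measurable]: "\<And>i. g i \<in> borel_measurable borel"
  shows "(\<integral>\<^sup>+y. (\<Prod>i\<in>UNIV. g i (y $ i)) \<partial>(std_gaussian :: (real^'d) measure)) =
     (\<Prod>i\<in>UNIV. \<integral>\<^sup>+x. ennreal (std_normal_density x) * g i x \<partial>lborel)"
proof -
  have "(\<integral>\<^sup>+y. (\<Prod>i\<in>UNIV. g i (y $ i)) \<partial>(std_gaussian :: (real^'d) measure)) =
    (\<integral>\<^sup>+y. (\<Prod>i\<in>UNIV. ennreal (std_normal_density (y $ i)) * g i (y $ i)) \<partial>lborel)"
    by (subst nn_integral_std_gaussian) (auto simp: prod.distrib prod_ennreal)
  also have "\<dots> = (\<Prod>i\<in>UNIV. \<integral>\<^sup>+x. ennreal (std_normal_density x) * g i x \<partial>lborel)"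
    by (rule nn_integral_lborel_prod_vec) auto
  finally show ?thesis .
qed

lemma nn_integral_std_normal_density: "(\<integral>\<^sup>+x. ennreal (std_normal_density x) \<partial>lborel) = 1"
  using integral_std_normal_moment_even[of 0] std_normal_moment_even[of 0]
  by (subst nn_integral_eq_integral) auto

lemma prob_space_std_gaussian: "prob_space (std_gaussian :: (real^'d) measure)"
proof
  have "emeasure (std_gaussian :: (real^'d) measure) UNIV = (\<integral>\<^sup>+y. (\<Prod>i\<in>(UNIV::'d set). 1) \<partial>(std_gaussian :: (real^'d) measure))"
    by simp
  also have "\<dots> = 1"
    using nn_integral_std_gaussian_prod[of "\<lambda>_::'d. \<lambda>_::real. 1::ennreal"]
    by (simp add: nn_integral_std_normal_density)
  finally show "emeasure (std_gaussian :: (real^'d) measure) (space std_gaussian) = 1" by simp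
qed

lemma std_gaussian_second_moment:
  "(\<integral>\<^sup>+\<xi>. ennreal ((norm \<xi>)\<^sup>2) \<partial>(std_gaussian :: (real^'d) measure)) = ennreal (real CARD('d))"
proof -
  have coord: "(\<integral>\<^sup>+\<xi>. ennreal ((\<xi> $ j)\<^sup>2) \<partial>(std_gaussian :: (real^'d) measure)) = 1" for j
  proof -
    have "(\<integral>\<^sup>+\<xi>. ennreal ((\<xi> $ j)\<^sup>2) \<partial>(std_gaussian :: (real^'d) measure)) =
      (\<integral>\<^sup>+\<xi>. (\<Prod>i\<in>UNIV. (if i = j then ennreal ((\<xi> $ i)\<^sup>2) else 1)) \<partial>(std_gaussian :: (real^'d) measure))"
      by (simp add: prod.delta)
    also have "\<dots> = (\<Prod>i\<in>UNIV. \<integral>\<^sup>+x. ennreal (std_normal_density x) * (if i = j then ennreal (x\<^sup>2) else 1) \<partial>lborel)"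
      by (rule nn_integral_std_gaussian_prod[of "\<lambda>i x. if i = j then ennreal (x\<^sup>2) else 1"]) auto
    also have "\<dots> = 1"
    proof (rule prod.neutral, rule)
      fix i
      have "(\<integral>\<^sup>+x. ennreal (std_normal_density x * x\<^sup>2) \<partial>lborel) = 1"
        using std_normal_moment_even[of 1] by (subst nn_integral_eq_integral) (auto simp: has_bochner_integral_iff)
      then show "(\<integral>\<^sup>+x. ennreal (std_normal_density x) * (if i = j then ennreal (x\<^sup>2) else 1) \<partial>lborel) = 1"
        by (cases "i = j") (simp_all add: nn_integral_std_normal_density ennreal_mult)
    qed
    finally show ?thesis .
  qed
  have "(\<integral>\<^sup>+\<xi>. ennreal ((norm \<xi>)\<^sup>2) \<partial>(std_gaussian :: (real^'d) measure)) =
    (\<integral>\<^sup>+\<xi>. (\<Sum>j\<in>UNIV. ennreal ((\<xi> $ j)\<^sup>2)) \<partial>(std_gaussian :: (real^'d) measure))"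
    by (simp add: norm_vec_def L2_set_def sum_nonneg sum_ennreal)
  also have "\<dots> = (\<Sum>j\<in>(UNIV::'d set). 1)"
    by (subst nn_integral_sum) (auto simp: coord)
  finally show ?thesis by (simp add: ennreal_of_nat_eq_real_of_nat)
qed

text \<open>
  The weight \<open>exp (a * x)\<close> turns the one-dimensional Gaussian density into a shifted one, up to a
  constant; in several dimensions the norm is at most the sum of the coordinates.
\<close>

lemma std_gaussian_exp_norm:
  "integrable (std_gaussian :: (real^'d) measure) (\<lambda>y. exp (c * norm y))"
proof (rule integrableI_bounded)
  have one: "(\<integral>\<^sup>+x. ennreal (std_normal_density x) * ennreal (exp (a * \<bar>x\<bar>)) \<partial>lborel) < \<infinity>" if "a \<ge> 0" for a
  proof -
    have shift: "(\<integral>\<^sup>+x. ennreal (normal_density m 1 x) \<partial>lborel) = 1" for m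
    proof -
      interpret prob_space "density lborel (normal_density m 1)"
        by (rule prob_space_normal_density) simp
      show ?thesis using emeasure_space_1 by (subst (asm) emeasure_density) auto
    qed
    have eq: "std_normal_density x * exp (m * x) = exp (m\<^sup>2 / 2) * normal_density m 1 x" for m x
      by (simp add: normal_density_def exp_add[symmetric] power2_eq_square field_simps)
    have "(\<integral>\<^sup>+x. ennreal (std_normal_density x) * ennreal (exp (a * \<bar>x\<bar>)) \<partial>lborel)
      \<le> (\<integral>\<^sup>+x. ennreal (exp (a\<^sup>2 / 2)) * ennreal (normal_density a 1 x) + ennreal (exp (a\<^sup>2/2)) * ennreal (normal_density (-a) 1 x) \<partial>lborel)"
    proof (rule nn_integral_mono)
      fix x
      have "std_normal_density x * exp (a * \<bar>x\<bar>) \<le> std_normal_density x * (exp (a * x) + exp ((-a) * x))"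
        by (intro mult_left_mono) (auto simp: abs_if)
      also have "\<dots> = exp (a\<^sup>2 / 2) * normal_density a 1 x + exp (a\<^sup>2/2) * normal_density (-a) 1 x"
        by (simp only: distrib_left eq power2_minus)
      finally have *: "std_normal_density x * exp (a * \<bar>x\<bar>) \<le> exp (a\<^sup>2 / 2) * normal_density a 1 x + exp (a\<^sup>2/2) * normal_density (-a) 1 x" .
      show "ennreal (std_normal_density x) * ennreal (exp (a * \<bar>x\<bar>)) \<le> ennreal (exp (a\<^sup>2 / 2)) * ennreal (normal_density a 1 x) + ennreal (exp (a\<^sup>2/2)) * ennreal (normal_density (-a) 1 x)"
        using ennreal_leI[OF *] by (simp add: ennreal_mult)
    qed
    also have "\<dots> = ennreal (exp (a\<^sup>2 / 2)) + ennreal (exp (a\<^sup>2 / 2))"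
      by (subst nn_integral_add) (auto simp: nn_integral_cmult shift)
    also have "\<dots> < \<infinity>" by simp
    finally show ?thesis .
  qed
  have "(\<integral>\<^sup>+y. ennreal (norm (exp (c * norm y))) \<partial>(std_gaussian :: (real^'d) measure))
     \<le> (\<integral>\<^sup>+y. (\<Prod>i\<in>UNIV. ennreal (exp (\<bar>c\<bar> * \<bar>y $ i\<bar>))) \<partial>(std_gaussian :: (real^'d) measure))"
  proof (rule nn_integral_mono)
    fix y :: "real^'d"
    have "c * norm y \<le> \<bar>c\<bar> * (\<Sum>i\<in>UNIV. \<bar>y $ i\<bar>)"
      by (intro mult_mono norm_le_l1_cart) auto
    then show "ennreal (norm (exp (c * norm y))) \<le> (\<Prod>i\<in>UNIV. ennreal (exp (\<bar>c\<bar> * \<bar>y $ i\<bar>)))"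
      by (simp add: prod_ennreal sum_distrib_left flip: exp_sum)
  qed
  also have "\<dots> = (\<Prod>i\<in>(UNIV::'d set). \<integral>\<^sup>+x. ennreal (std_normal_density x) * ennreal (exp (\<bar>c\<bar> * \<bar>x\<bar>)) \<partial>lborel)"
    by (rule nn_integral_std_gaussian_prod) auto
  also have "\<dots> < \<infinity>"
    using one[of "\<bar>c\<bar>"] by (simp add: power_less_top_ennreal)
  finally show "(\<integral>\<^sup>+y. ennreal (norm (exp (c * norm y))) \<partial>(std_gaussian :: (real^'d) measure)) < \<infinity>" .
qed simp

lemma std_gaussian_density_eq:
  fixes y :: "real^'d"
  shows "(\<Prod>i\<in>UNIV. std_normal_density (y $ i)) = (1 / sqrt (2 * pi)) ^ CARD('d) * exp (- (norm y)\<^sup>2 / 2)"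
proof -
  have "(norm y)\<^sup>2 = (\<Sum>i\<in>UNIV. (y $ i)\<^sup>2)"
    by (simp add: norm_vec_def L2_set_def sum_nonneg)
  then show ?thesis
    by (simp add: normal_density_def prod.distrib power_one_over sum_divide_distrib prod_dividef flip: exp_sum sum_negf)
qed

text \<open>
  The Cameron-Martin formula. It turns a convolution with the Gaussian into an integral in which
  the argument \<open>x\<close> occurs only in an exponential, where it can be differentiated.
\<close>

lemma nn_integral_std_gaussian_shift:
  fixes x :: "real^'d"
  assumes [measurable]: "f \<in> borel_measurable borel"
  shows "(\<integral>\<^sup>+\<xi>. f (x + \<xi>) \<partial>std_gaussian) = (\<integral>\<^sup>+y. ennreal (exp (x \<bullet> y - (norm x)\<^sup>2 / 2)) * f y \<partial>std_gaussian)"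
proof -
  let ?G = "\<lambda>y::real^'d. \<Prod>i\<in>UNIV. std_normal_density (y $ i)"
  have G: "?G (y - x) = ?G y * exp (x \<bullet> y - (norm x)\<^sup>2 / 2)" for y
  proof -
    have "(norm (y - x))\<^sup>2 = (norm y)\<^sup>2 - 2 * (x \<bullet> y) + (norm x)\<^sup>2"
      by (simp add: power2_norm_eq_inner inner_diff inner_commute)
    then have "- (norm (y - x))\<^sup>2 / 2 = - (norm y)\<^sup>2 / 2 + (x \<bullet> y - (norm x)\<^sup>2 / 2)"
      by simp
    then show ?thesis unfolding std_gaussian_density_eq by (simp only: exp_add mult.assoc)
  qed
  have nonneg: "0 \<le> ?G y" for y by (intro prod_nonneg) auto
  have "(\<integral>\<^sup>+\<xi>. f (x + \<xi>) \<partial>std_gaussian) = (\<integral>\<^sup>+\<xi>. ennreal (?G \<xi>) * f (x + \<xi>) \<partial>lborel)"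
    by (subst nn_integral_std_gaussian) auto
  also have "\<dots> = (\<integral>\<^sup>+\<xi>. ennreal (?G ((x + \<xi>) - x)) * f (x + \<xi>) \<partial>lborel)" by simp
  also have "\<dots> = (\<integral>\<^sup>+y. ennreal (?G (y - x)) * f y \<partial>(distr lborel borel ((+) x)))"
    by (subst nn_integral_distr) auto
  also have "\<dots> = (\<integral>\<^sup>+y. ennreal (?G (y - x)) * f y \<partial>lborel)"
    by (simp add: lborel_distr_plus)
  also have "\<dots> = (\<integral>\<^sup>+y. ennreal (?G y) * (ennreal (exp (x \<bullet> y - (norm x)\<^sup>2 / 2)) * f y) \<partial>lborel)"
    unfolding G by (simp only: ennreal_mult[OF nonneg exp_ge_zero] mult.assoc)
  also have "\<dots> = (\<integral>\<^sup>+y. ennreal (exp (x \<bullet> y - (norm x)\<^sup>2 / 2)) * f y \<partial>std_gaussian)"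
    by (subst nn_integral_std_gaussian) auto
  finally show ?thesis .
qed

lemma std_gaussian_shift:
  fixes x :: "real^'d"
  assumes [measurable]: "f \<in> borel_measurable borel"
  shows "distr std_gaussian borel ((+) x) = density std_gaussian (\<lambda>y. ennreal (exp (x \<bullet> y - (norm x)\<^sup>2 / 2)))"
proof (rule measure_eqI)
  fix A assume "A \<in> sets (distr (std_gaussian :: (real^'d) measure) borel ((+) x))"
  then have [measurable]: "A \<in> sets borel" by simp
  have "emeasure (distr std_gaussian borel ((+) x)) A = (\<integral>\<^sup>+y. indicator A y \<partial>distr std_gaussian borel ((+) x))"
    by simp
  also have "\<dots> = (\<integral>\<^sup>+\<xi>. indicator A (x + \<xi>) \<partial>std_gaussian)"
    by (subst nn_integral_distr) auto
  also have "\<dots> = emeasure (density std_gaussian (\<lambda>y. ennreal (exp (x \<bullet> y - (norm x)\<^sup>2 / 2)))) A"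
    by (subst nn_integral_std_gaussian_shift) (auto simp: emeasure_density)
  finally show "emeasure (distr std_gaussian borel ((+) x)) A = emeasure (density std_gaussian (\<lambda>y. ennreal (exp (x \<bullet> y - (norm x)\<^sup>2 / 2)))) A" .
qed simp

lemma integral_std_gaussian_shift:
  fixes x :: "real^'d" and f :: "real^'d \<Rightarrow> real"
  assumes [measurable]: "f \<in> borel_measurable borel"
  shows "(\<integral>\<xi>. f (x + \<xi>) \<partial>std_gaussian) = exp (- (norm x)\<^sup>2 / 2) * (\<integral>y. f y * exp (x \<bullet> y) \<partial>std_gaussian)"
proof -
  have "(\<integral>\<xi>. f (x + \<xi>) \<partial>std_gaussian) = (\<integral>y. f y \<partial>distr std_gaussian borel ((+) x))"
    by (subst integral_distr) auto
  also have "\<dots> = (\<integral>y. exp (x \<bullet> y - (norm x)\<^sup>2 / 2) * f y \<partial>std_gaussian)"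
    unfolding std_gaussian_shift[OF assms] by (subst integral_density) auto
  also have "\<dots> = (\<integral>y. exp (- (norm x)\<^sup>2 / 2) * (f y * exp (x \<bullet> y)) \<partial>std_gaussian)"
  proof (intro Bochner_Integration.integral_cong refl)
    fix y :: "real^'d"
    have "exp (x \<bullet> y - (norm x)\<^sup>2 / 2) = exp (- (norm x)\<^sup>2 / 2) * exp (x \<bullet> y)"
      by (simp flip: exp_add)
    then show "exp (x \<bullet> y - (norm x)\<^sup>2 / 2) * f y = exp (- (norm x)\<^sup>2 / 2) * (f y * exp (x \<bullet> y))"
      by simp
  qed
  finally show ?thesis by (simp only: integral_mult_right_zero)
qed

text \<open>
  The density decreases with the norm, so on a ball it is at least its value on the boundary.
  Every minorization of the chain starts from this bound.
\<close>

lemma std_gaussian_ge_lebesgue_on_ball: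
  assumes "0 \<le> r"
  shows "\<exists>\<epsilon>>0. \<forall>f. f \<in> borel_measurable borel \<longrightarrow>
    ennreal \<epsilon> * (\<integral>\<^sup>+\<xi>. f \<xi> * indicator (cball 0 r) \<xi> \<partial>lborel) \<le> (\<integral>\<^sup>+\<xi>. f \<xi> \<partial>(std_gaussian :: (real^'d) measure))"
proof (intro exI conjI allI impI)
  let ?e = "(1 / sqrt (2 * pi)) ^ CARD('d) * exp (- r\<^sup>2 / 2)"
  show "?e > 0" by simp
  fix f :: "real^'d \<Rightarrow> ennreal" assume [measurable]: "f \<in> borel_measurable borel"
  have "ennreal ?e * (\<integral>\<^sup>+\<xi>. f \<xi> * indicator (cball 0 r) \<xi> \<partial>lborel) = (\<integral>\<^sup>+\<xi>. ennreal ?e * (f \<xi> * indicator (cball 0 r) \<xi>) \<partial>lborel)"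
    by (subst nn_integral_cmult) (auto intro!: borel_measurable_times_ennreal borel_measurable_indicator)
  also have "\<dots> \<le> (\<integral>\<^sup>+\<xi>. ennreal (\<Prod>i\<in>UNIV. std_normal_density (\<xi> $ i)) * f \<xi> \<partial>lborel)"
  proof (rule nn_integral_mono)
    fix \<xi> :: "real^'d"
    show "ennreal ?e * (f \<xi> * indicator (cball 0 r) \<xi>) \<le> ennreal (\<Prod>i\<in>UNIV. std_normal_density (\<xi> $ i)) * f \<xi>"
      unfolding std_gaussian_density_eq
      by (cases "\<xi> \<in> cball 0 r") (auto intro!: mult_right_mono ennreal_leI mult_left_mono power_mono)
  qed
  also have "\<dots> = (\<integral>\<^sup>+\<xi>. f \<xi> \<partial>(std_gaussian :: (real^'d) measure))"
    by (subst nn_integral_std_gaussian) auto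
  finally show "ennreal ?e * (\<integral>\<^sup>+\<xi>. f \<xi> * indicator (cball 0 r) \<xi> \<partial>lborel) \<le> (\<integral>\<^sup>+\<xi>. f \<xi> \<partial>(std_gaussian :: (real^'d) measure))" .
qed

section \<open>Smooth functions and Laplace transforms\<close>

text \<open>
  Integrating a quadratic bound for the first-order error is a short way to differentiate under
  an integral sign.
\<close>

lemma has_derivative_of_quadratic_error:
  fixes f :: "'a::euclidean_space \<Rightarrow> real"
  assumes lin: "linear f'" and err: "\<And>h. norm h \<le> 1 \<Longrightarrow> \<bar>f (x + h) - f x - f' h\<bar> \<le> M * (norm h)\<^sup>2"
  shows "(f has_derivative f') (at x)"
  unfolding has_derivative_at
proof (intro conjI)
  show "bounded_linear f'" using lin by (simp add: linear_conv_bounded_linear)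
  have lim: "((\<lambda>h::'a. \<bar>M\<bar> * norm h) \<longlongrightarrow> 0) (at 0)"
    by (rule tendsto_mult_right_zero[OF tendsto_norm_zero[OF tendsto_ident_at]])
  show "(\<lambda>h. norm (f (x + h) - f x - f' h) / norm h) \<midarrow>0\<rightarrow> 0"
  proof (rule tendsto_sandwich[OF _ _ tendsto_const lim])
    show "\<forall>\<^sub>F h in at 0. norm (f (x + h) - f x - f' h) / norm h \<le> \<bar>M\<bar> * norm h"
      unfolding eventually_at
    proof (intro exI[of _ 1] conjI ballI impI)
      fix h :: 'a assume h: "h \<noteq> 0 \<and> dist h 0 < 1"
      have "\<bar>f (x + h) - f x - f' h\<bar> \<le> M * (norm h)\<^sup>2" using h by (intro err) simp
      also have "\<dots> \<le> \<bar>M\<bar> * (norm h)\<^sup>2" by (intro mult_right_mono) auto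
      finally show "norm (f (x + h) - f x - f' h) / norm h \<le> \<bar>M\<bar> * norm h"
        using h by (simp add: field_simps power2_eq_square)
    qed simp
  qed simp
qed

lemma C_k_SucI:
  assumes "\<And>x. (f has_derivative f' x) (at x)" and "\<And>v. C_k k (\<lambda>x. f' x v)"
  shows "C_k (Suc k) f"
proof -
  have "f differentiable_on UNIV"
    using assms(1) by (auto simp: differentiable_on_def differentiable_def)
  moreover have "frechet_derivative f (at x) = f' x" for x
    using frechet_derivative_at[OF assms(1)] by simp
  ultimately show ?thesis using assms(2) by simp
qed

lemma C_k_Suc_has_derivative:
  "C_k (Suc k) f \<Longrightarrow> (f has_derivative frechet_derivative f (at x)) (at x)"
  by (simp add: differentiable_on_def frechet_derivative_works)

lemma C_k_Suc_imp: "C_k (Suc k) f \<Longrightarrow> C_k k f"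
proof (induction k arbitrary: f)
  case 0 then show ?case by (simp add: differentiable_imp_continuous_on)
next
  case (Suc k)
  have "C_k (Suc k) (\<lambda>x. frechet_derivative f (at x) v)" for v using Suc.prems by simp
  from Suc.IH[OF this] show ?case using Suc.prems unfolding C_k.simps by blast
qed

lemma C_k_const: "C_k k (\<lambda>x. c)"
proof (induction k arbitrary: c)
  case (Suc k) show ?case
    by (rule C_k_SucI[where f'="\<lambda>x h. 0"]) (auto intro: Suc)
qed simp

lemma C_k_add: "C_k k f \<Longrightarrow> C_k k g \<Longrightarrow> C_k k (\<lambda>x. f x + g x)"
proof (induction k arbitrary: f g)
  case 0 then show ?case by (simp add: continuous_on_add)
next
  case (Suc k) show ?case
    by (intro C_k_SucI[where f'="\<lambda>x h. frechet_derivative f (at x) h + frechet_derivative g (at x) h"]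
        has_derivative_add C_k_Suc_has_derivative[OF Suc.prems(1)] C_k_Suc_has_derivative[OF Suc.prems(2)] Suc.IH)
       (use Suc.prems in simp_all)
qed

lemma C_k_mult: "C_k k f \<Longrightarrow> C_k k g \<Longrightarrow> C_k k (\<lambda>x. f x * g x)"
proof (induction k arbitrary: f g)
  case 0 then show ?case by (simp add: continuous_on_mult)
next
  case (Suc k) show ?case
    by (intro C_k_SucI[where f'="\<lambda>x h. f x * frechet_derivative g (at x) h + frechet_derivative f (at x) h * g x"]
        has_derivative_mult C_k_Suc_has_derivative[OF Suc.prems(1)] C_k_Suc_has_derivative[OF Suc.prems(2)]
        C_k_add Suc.IH C_k_Suc_imp[OF Suc.prems(1)] C_k_Suc_imp[OF Suc.prems(2)])
       (use Suc.prems in simp_all)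
qed

lemma C_k_inner: "C_k k (\<lambda>x. x \<bullet> v)"
proof (cases k)
  case 0 then show ?thesis by (simp add: continuous_intros)
next
  case (Suc k')
  show ?thesis unfolding Suc
    by (rule C_k_SucI[where f'="\<lambda>x h. h \<bullet> v"]) (auto intro!: derivative_eq_intros C_k_const)
qed

lemma C_k_gaussian: "C_k k (\<lambda>x::'a::euclidean_space. exp (- (norm x)\<^sup>2 / 2))"
proof (induction k)
  case 0 show ?case by (auto intro!: continuous_intros)
next
  case (Suc k)
  show ?case
  proof (rule C_k_SucI[where f'="\<lambda>x h. (-1 * (x \<bullet> h)) * exp (- (norm x)\<^sup>2 / 2)"])
    show "((\<lambda>x::'a. exp (- (norm x)\<^sup>2 / 2)) has_derivative (\<lambda>h. (-1 * (x \<bullet> h)) * exp (- (norm x)\<^sup>2 / 2))) (at x)" for x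
      unfolding power2_norm_eq_inner by (auto intro!: derivative_eq_intros simp: inner_commute)
    show "C_k k (\<lambda>x::'a. (-1 * (x \<bullet> v)) * exp (- (norm x)\<^sup>2 / 2))" for v
      by (intro C_k_mult Suc C_k_const C_k_inner)
  qed
qed

lemma exp_second_order_remainder: "\<bar>exp t - 1 - t\<bar> \<le> t\<^sup>2 * exp \<bar>t\<bar>" for t :: real
proof -
  have up: "exp s - 1 \<le> s * exp s" for s :: real
  proof -
    have "(1 + (- s)) * exp s \<le> exp (- s) * exp s" by (intro mult_right_mono exp_ge_add_one_self) simp
    then show ?thesis by (simp add: algebra_simps flip: exp_add)
  qed
  have "\<bar>exp t - 1\<bar> \<le> \<bar>t\<bar> * exp \<bar>t\<bar>"
  proof (cases "0 \<le> t")
    case False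
    have "1 - exp t \<le> - t" using exp_ge_add_one_self[of t] by linarith
    also have "\<dots> \<le> \<bar>t\<bar> * exp \<bar>t\<bar>" using False mult_left_mono[of 1 "exp \<bar>t\<bar>" "\<bar>t\<bar>"] by simp
    finally show ?thesis using False by simp
  qed (use up[of t] in simp)
  then have "\<bar>t\<bar> * \<bar>exp t - 1\<bar> \<le> \<bar>t\<bar> * (\<bar>t\<bar> * exp \<bar>t\<bar>)" by (rule mult_left_mono) simp
  moreover have "exp t - 1 - t \<le> t * (exp t - 1)" using up[of t] by (simp add: algebra_simps)
  moreover have "t * (exp t - 1) \<le> \<bar>t\<bar> * \<bar>exp t - 1\<bar>" by (metis abs_ge_self abs_mult)
  moreover have "0 \<le> exp t - 1 - t" using exp_ge_add_one_self[of t] by linarith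
  ultimately show ?thesis by (simp add: power2_eq_square mult.assoc)
qed

lemma integrable_exp_growth:
  fixes p :: "real^'d \<Rightarrow> 'b::{banach, second_countable_topology}"
  assumes [measurable]: "p \<in> borel_measurable borel" and "\<And>y. norm (p y) \<le> A * exp (c * norm y)"
  shows "integrable std_gaussian p"
  by (rule Bochner_Integration.integrable_bound[where f="\<lambda>y. A * exp (c * norm y)"])
     (use assms(2) in \<open>auto intro!: std_gaussian_exp_norm intro: order_trans[OF _ abs_ge_self]\<close>)

text \<open>
  A derivative in direction \<open>h\<close> brings down the factor \<open>h \<bullet> y\<close>, and \<open>p y * (h \<bullet> y)\<close> again grows at
  most exponentially. Hence the transform is smooth however irregular \<open>p\<close> is.
\<close>

lemma C_k_laplace:
  fixes p :: "real^'d \<Rightarrow> real"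
  assumes "p \<in> borel_measurable borel" and "\<And>y. \<bar>p y\<bar> \<le> A * exp (c * norm y)"
  shows "C_k k (\<lambda>x. \<integral>y. p y * exp (x \<bullet> y) \<partial>std_gaussian)"
proof -
  have exp_le: "exp (x \<bullet> y) \<le> exp (norm x * norm y)" for x y :: "real^'d"
    using norm_cauchy_schwarz[of x y] by simp
  have deriv: "((\<lambda>x. \<integral>y. p y * exp (x \<bullet> y) \<partial>std_gaussian) has_derivative
      (\<lambda>h. \<integral>y. (p y * (h \<bullet> y)) * exp (x \<bullet> y) \<partial>std_gaussian)) (at x)"
    if p [measurable]: "p \<in> borel_measurable borel" and bd: "\<And>y. \<bar>p y\<bar> \<le> A * exp (c * norm y)"
    for p and A c and x :: "real^'d"
  proof -
    have A0: "A \<ge> 0" using bd[of 0] by simp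
    have b0: "\<bar>p y * exp (z \<bullet> y)\<bar> \<le> A * exp ((c + norm z) * norm y)" for y z
    proof -
      have "\<bar>p y * exp (z \<bullet> y)\<bar> \<le> (A * exp (c * norm y)) * exp (norm z * norm y)"
        unfolding abs_mult using A0 by (intro mult_mono bd) (auto simp: norm_cauchy_schwarz)
      then show ?thesis by (simp add: exp_add distrib_right)
    qed
    have int0: "integrable std_gaussian (\<lambda>y. p y * exp (z \<bullet> y))" for z
      by (rule integrable_exp_growth) (use b0[of _ z] in auto)
    have b1: "\<bar>(p y * (h \<bullet> y)) * exp (z \<bullet> y)\<bar> \<le> (A * norm h) * exp ((c + norm z + 1) * norm y)" for y z h
    proof -
      have "norm y \<le> exp (norm y)" using exp_ge_add_one_self[of "norm y"] by linarith
      then have "\<bar>h \<bullet> y\<bar> \<le> norm h * exp (norm y)"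
        using Cauchy_Schwarz_ineq2[of h y] by (meson mult_left_mono norm_ge_zero order_trans)
      then have "\<bar>h \<bullet> y\<bar> * \<bar>p y * exp (z \<bullet> y)\<bar> \<le> (norm h * exp (norm y)) * (A * exp ((c + norm z) * norm y))"
        by (intro mult_mono b0) auto
      then show ?thesis by (simp add: abs_mult exp_add distrib_right distrib_left mult_ac)
    qed
    have int1: "integrable std_gaussian (\<lambda>y. (p y * (h \<bullet> y)) * exp (z \<bullet> y))" for z h
      by (rule integrable_exp_growth) (use b1[of _ h z] in auto)
    let ?M = "\<integral>y. (A * exp ((c + norm x + 3) * norm y)) \<partial>(std_gaussian :: (real^'d) measure)"
    have intM: "integrable std_gaussian (\<lambda>y::real^'d. A * exp ((c + norm x + 3) * norm y))"
      by (intro integrable_mult_right std_gaussian_exp_norm)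
    show ?thesis
    \<comment> \<open>The factor \<open>exp (3 * norm y)\<close> in the constant absorbs \<open>(norm y)\<^sup>2\<close> and the remainder of \<open>exp (h \<bullet> y)\<close>.\<close>
    proof (rule has_derivative_of_quadratic_error[where M="?M"])
      show "linear (\<lambda>h. \<integral>y. (p y * (h \<bullet> y)) * exp (x \<bullet> y) \<partial>std_gaussian)"
      proof (rule linearI)
        show "(\<integral>y. (p y * ((h + h') \<bullet> y)) * exp (x \<bullet> y) \<partial>std_gaussian) =
          (\<integral>y. (p y * (h \<bullet> y)) * exp (x \<bullet> y) \<partial>std_gaussian) + (\<integral>y. (p y * (h' \<bullet> y)) * exp (x \<bullet> y) \<partial>std_gaussian)" for h h'
          using int1[of h x] int1[of h' x] by (simp add: inner_add_left distrib_left distrib_right)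
        show "(\<integral>y. (p y * ((a *\<^sub>R h) \<bullet> y)) * exp (x \<bullet> y) \<partial>std_gaussian) =
          a *\<^sub>R (\<integral>y. (p y * (h \<bullet> y)) * exp (x \<bullet> y) \<partial>std_gaussian)" for a h
          by (simp add: mult_ac flip: integral_mult_right_zero)
      qed
      fix h :: "real^'d" assume h: "norm h \<le> 1"
      have "(\<integral>y. p y * exp ((x + h) \<bullet> y) \<partial>std_gaussian) - (\<integral>y. p y * exp (x \<bullet> y) \<partial>std_gaussian)
          - (\<integral>y. (p y * (h \<bullet> y)) * exp (x \<bullet> y) \<partial>std_gaussian)
        = (\<integral>y. p y * exp ((x + h) \<bullet> y) - p y * exp (x \<bullet> y) - (p y * (h \<bullet> y)) * exp (x \<bullet> y) \<partial>std_gaussian)"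
        using int0[of "x + h"] int0[of x] int1[of h x] by simp
      also have "\<bar>\<dots>\<bar> \<le> (\<integral>y. (norm h)\<^sup>2 * (A * exp ((c + norm x + 3) * norm y)) \<partial>(std_gaussian :: (real^'d) measure))"
      proof (rule integral_abs_bound_integral)
        show "integrable std_gaussian (\<lambda>y. p y * exp ((x + h) \<bullet> y) - p y * exp (x \<bullet> y) - (p y * (h \<bullet> y)) * exp (x \<bullet> y))"
          using int0[of "x + h"] int0[of x] int1[of h x] by (intro Bochner_Integration.integrable_diff)
        show "integrable std_gaussian (\<lambda>y::real^'d. (norm h)\<^sup>2 * (A * exp ((c + norm x + 3) * norm y)))"
          using intM by (rule integrable_mult_right)
        fix y :: "real^'d"
        let ?n = "norm y"
        have cs: "\<bar>h \<bullet> y\<bar> \<le> norm h * ?n" by (rule Cauchy_Schwarz_ineq2)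
        also have "\<dots> \<le> ?n" using h by (simp add: mult_left_le_one_le)
        finally have hy: "\<bar>h \<bullet> y\<bar> \<le> ?n" .
        have n2: "?n\<^sup>2 \<le> exp (2 * ?n)"
        proof -
          have "?n \<le> exp ?n" using exp_ge_add_one_self[of ?n] by linarith
          then have "?n * ?n \<le> exp ?n * exp ?n" by (intro mult_mono) auto
          then show ?thesis by (simp add: power2_eq_square flip: exp_add)
        qed
        have "\<bar>exp (h \<bullet> y) - 1 - h \<bullet> y\<bar> \<le> (h \<bullet> y)\<^sup>2 * exp \<bar>h \<bullet> y\<bar>" by (rule exp_second_order_remainder)
        also have "\<dots> \<le> (norm h * ?n)\<^sup>2 * exp ?n"
          using power_mono[OF cs, of 2] hy by (intro mult_mono) auto
        also have "\<dots> \<le> (norm h)\<^sup>2 * (exp (2 * ?n) * exp ?n)"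
          using n2 by (simp add: power_mult_distrib mult.assoc mult_left_mono mult_right_mono)
        finally have r: "\<bar>exp (h \<bullet> y) - 1 - h \<bullet> y\<bar> \<le> (norm h)\<^sup>2 * exp (3 * ?n)"
          by (simp add: flip: exp_add)
        have "p y * exp ((x + h) \<bullet> y) - p y * exp (x \<bullet> y) - (p y * (h \<bullet> y)) * exp (x \<bullet> y)
          = (p y * exp (x \<bullet> y)) * (exp (h \<bullet> y) - 1 - h \<bullet> y)"
          by (simp add: inner_add_left exp_add algebra_simps)
        then have "\<bar>p y * exp ((x + h) \<bullet> y) - p y * exp (x \<bullet> y) - (p y * (h \<bullet> y)) * exp (x \<bullet> y)\<bar>
          = \<bar>p y * exp (x \<bullet> y)\<bar> * \<bar>exp (h \<bullet> y) - 1 - h \<bullet> y\<bar>"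
          by (simp add: abs_mult)
        also have "\<dots> \<le> (A * exp ((c + norm x) * ?n)) * ((norm h)\<^sup>2 * exp (3 * ?n))"
          using A0 by (intro mult_mono b0 r) auto
        also have "\<dots> = (norm h)\<^sup>2 * (A * exp ((c + norm x + 3) * ?n))"
          by (simp add: exp_add distrib_right)
        finally show "\<bar>p y * exp ((x + h) \<bullet> y) - p y * exp (x \<bullet> y) - (p y * (h \<bullet> y)) * exp (x \<bullet> y)\<bar> \<le> (norm h)\<^sup>2 * (A * exp ((c + norm x + 3) * ?n))" .
      qed
      also have "\<dots> = ?M * (norm h)\<^sup>2" by simp
      finally show "\<bar>(\<integral>y. p y * exp ((x + h) \<bullet> y) \<partial>std_gaussian) - (\<integral>y. p y * exp (x \<bullet> y) \<partial>std_gaussian)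
          - (\<integral>y. (p y * (h \<bullet> y)) * exp (x \<bullet> y) \<partial>std_gaussian)\<bar> \<le> ?M * (norm h)\<^sup>2" .
    qed
  qed
  show ?thesis using assms
  proof (induction k arbitrary: p A c)
    case 0
    have "(\<lambda>x. \<integral>y. p y * exp (x \<bullet> y) \<partial>std_gaussian) differentiable_on UNIV"
      using deriv[OF 0] by (auto simp: differentiable_on_def differentiable_def)
    then show ?case by (simp add: differentiable_imp_continuous_on)
  next
    case (Suc k)
    show ?case
    proof (rule C_k_SucI[OF deriv[OF Suc.prems]])
      fix h :: "real^'d"
      have [measurable]: "p \<in> borel_measurable borel" by fact
      show "C_k k (\<lambda>x. \<integral>y. (p y * (h \<bullet> y)) * exp (x \<bullet> y) \<partial>std_gaussian)"
      proof (rule Suc.IH[where A="A * norm h" and c="c + 1"])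
        fix y :: "real^'d"
        have "norm y \<le> exp (norm y)" using exp_ge_add_one_self[of "norm y"] by linarith
        then have "\<bar>h \<bullet> y\<bar> \<le> norm h * exp (norm y)"
          using Cauchy_Schwarz_ineq2[of h y] by (meson mult_left_mono norm_ge_zero order_trans)
        moreover have "0 \<le> A * exp (c * norm y)" using Suc.prems(2)[of y] by linarith
        ultimately have "\<bar>p y\<bar> * \<bar>h \<bullet> y\<bar> \<le> (A * exp (c * norm y)) * (norm h * exp (norm y))"
          by (intro mult_mono Suc.prems) auto
        then show "\<bar>p y * (h \<bullet> y)\<bar> \<le> A * norm h * exp ((c + 1) * norm y)"
          by (simp add: abs_mult exp_add distrib_right distrib_left mult_ac)
      qed simp
    qed
  qed
qed

section \<open>Potentials whose gradient is a smoothed projection\<close>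

text \<open>
  This is the maximum of \<open>x \<bullet> q - (norm q)\<^sup>2 / 2\<close> over \<open>q \<in> P\<close>, that is, half the difference between
  \<open>(norm x)\<^sup>2\<close> and the squared distance from \<open>x\<close> to \<open>P\<close>; its gradient is the projection onto \<open>P\<close>.
\<close>

definition soft_dual :: "(real^'d) set \<Rightarrow> real^'d \<Rightarrow> real" where
  "soft_dual P x = x \<bullet> closest_point P x - (norm (closest_point P x))\<^sup>2 / 2"

locale smoothed_projection =
  fixes P :: "(real^'d) set"
  assumes P: "convex P" "compact P" "P \<noteq> {}"
begin

abbreviation proj :: "real^'d \<Rightarrow> real^'d" where "proj \<equiv> closest_point P"

lemma closed_P: "closed P" using P(2) by (rule compact_imp_closed)

lemma proj_in: "proj x \<in> P" by (rule closest_point_in_set[OF closed_P P(3)])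

lemma proj_lipschitz: "norm (proj x - proj y) \<le> norm (x - y)"
  using closest_point_lipschitz[OF P(1) closed_P P(3), of x y] by (simp add: dist_norm)

lemma proj_cont: "continuous_on A proj"
  by (rule continuous_on_closest_point[OF P(1) closed_P P(3)])

lemma proj_meas [measurable]: "proj \<in> borel_measurable borel"
  by (rule borel_measurable_continuous_onI[OF proj_cont])

lemma proj_monotone: "0 \<le> (proj x - proj y) \<bullet> (x - y)"
proof -
  have "(x - proj x) \<bullet> (proj y - proj x) \<le> 0" "(y - proj y) \<bullet> (proj x - proj y) \<le> 0"
    by (simp_all add: P closed_P proj_in closest_point_dot)
  then have "(proj x - proj y) \<bullet> (proj x - proj y) \<le> (proj x - proj y) \<bullet> (x - y)"
    by (simp add: algebra_simps inner_commute)
  then show ?thesis using inner_ge_zero order_trans by blast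
qed

definition radius :: real where "radius = (SOME B. 0 < B \<and> (\<forall>q\<in>P. norm q \<le> B))"

lemma radius: "0 < radius" "norm (proj x) \<le> radius"
proof -
  have "\<exists>B. 0 < B \<and> (\<forall>q\<in>P. norm q \<le> B)"
    using compact_imp_bounded[OF P(2)] by (simp add: bounded_pos)
  from someI_ex[OF this] show "0 < radius" "norm (proj x) \<le> radius"
    using proj_in by (auto simp: radius_def)
qed

lemma soft_dual_ge: "q \<in> P \<Longrightarrow> x \<bullet> q - (norm q)\<^sup>2 / 2 \<le> soft_dual P x"
proof -
  assume "q \<in> P"
  then have "norm (x - proj x) \<le> norm (x - q)"
    using closest_point_le[OF closed_P, of q x] by (simp add: dist_norm)
  then have "(norm (x - proj x))\<^sup>2 \<le> (norm (x - q))\<^sup>2" by (intro power_mono) auto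
  then show ?thesis
    by (simp add: soft_dual_def power2_norm_eq_inner inner_diff inner_commute field_simps)
qed

text \<open>
  Inserting the maximizer for \<open>x\<close> at \<open>x + h\<close>, and the other way round, places the increment between
  \<open>h \<bullet> proj x\<close> and \<open>h \<bullet> proj (x + h)\<close>, and the projection is 1-Lipschitz.
\<close>

lemma soft_dual_expand:
  "0 \<le> soft_dual P (x + h) - soft_dual P x - h \<bullet> proj x"
  "soft_dual P (x + h) - soft_dual P x - h \<bullet> proj x \<le> (norm h)\<^sup>2"
proof -
  show "0 \<le> soft_dual P (x + h) - soft_dual P x - h \<bullet> proj x"
    using soft_dual_ge[OF proj_in, of "x + h" x] by (simp add: soft_dual_def inner_add_left)
  have "soft_dual P (x + h) - soft_dual P x \<le> h \<bullet> proj (x + h)"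
    using soft_dual_ge[OF proj_in, of x "x + h"] by (simp add: soft_dual_def inner_add_left)
  moreover have "h \<bullet> (proj (x + h) - proj x) \<le> norm h * norm h"
    using norm_cauchy_schwarz[of h "proj (x + h) - proj x"] mult_left_mono[OF proj_lipschitz[of "x + h" x], of "norm h"]
    by simp
  ultimately show "soft_dual P (x + h) - soft_dual P x - h \<bullet> proj x \<le> (norm h)\<^sup>2"
    by (simp add: inner_diff_right power2_eq_square)
qed

lemma soft_dual_bound: "\<bar>soft_dual P x\<bar> \<le> radius * norm x + radius\<^sup>2"
proof -
  have "\<bar>x \<bullet> proj x\<bar> \<le> radius * norm x"
    using Cauchy_Schwarz_ineq2[of x "proj x"] radius(2)[of x]
    by (metis mult.commute mult_right_mono norm_ge_zero order_trans)
  moreover have "(norm (proj x))\<^sup>2 \<le> radius\<^sup>2" using radius(2)[of x] by (intro power_mono) auto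
  moreover have "0 \<le> (norm (proj x))\<^sup>2" "0 \<le> radius\<^sup>2" by auto
  ultimately show ?thesis unfolding soft_dual_def by linarith
qed

lemma soft_dual_meas [measurable]: "soft_dual P \<in> borel_measurable borel"
  unfolding soft_dual_def[abs_def] by measurable

definition smooth_dual :: "real^'d \<Rightarrow> real" where
  "smooth_dual x = (\<integral>\<xi>. soft_dual P (x + \<xi>) \<partial>std_gaussian)"

definition smooth_proj :: "real^'d \<Rightarrow> real^'d" where
  "smooth_proj x = (\<integral>\<xi>. proj (x + \<xi>) \<partial>std_gaussian)"

lemma integrable_norm: "integrable (std_gaussian :: (real^'d) measure) norm"
proof (rule integrable_exp_growth[of _ 1 1])
  show "norm (norm y) \<le> 1 * exp (1 * norm y)" for y :: "real^'d"
    using exp_ge_add_one_self[of "norm y"] by (simp only: real_norm_def abs_norm_cancel mult_1)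
qed simp

lemma prob_std: "prob_space (std_gaussian :: (real^'d) measure)" by (rule prob_space_std_gaussian)

lemma measure_std [simp]: "measure (std_gaussian :: (real^'d) measure) UNIV = 1"
  using prob_space.prob_space[OF prob_std] by simp

lemma integrable_const_std [simp]: "integrable (std_gaussian :: (real^'d) measure) (\<lambda>_. c :: 'b :: {banach, second_countable_topology})"
  using finite_measure.integrable_const[OF prob_space.finite_measure[OF prob_std]] .

lemma integrable_soft_dual: "integrable std_gaussian (\<lambda>\<xi>. soft_dual P (x + \<xi>))"
proof (rule Bochner_Integration.integrable_bound[where f="\<lambda>\<xi>. radius * (norm x + norm \<xi>) + radius\<^sup>2"])
  show "AE \<xi> in std_gaussian. norm (soft_dual P (x + \<xi>)) \<le> norm (radius * (norm x + norm \<xi>) + radius\<^sup>2)"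
  proof (rule AE_I2)
    fix \<xi>
    have "\<bar>soft_dual P (x + \<xi>)\<bar> \<le> radius * norm (x + \<xi>) + radius\<^sup>2" by (rule soft_dual_bound)
    also have "\<dots> \<le> radius * (norm x + norm \<xi>) + radius\<^sup>2"
      using radius(1) norm_triangle_ineq[of x \<xi>] by simp
    finally show "norm (soft_dual P (x + \<xi>)) \<le> norm (radius * (norm x + norm \<xi>) + radius\<^sup>2)"
      by simp
  qed
qed (auto intro!: integrable_norm Bochner_Integration.integrable_add integrable_mult_right)

lemma integrable_proj: "integrable std_gaussian (\<lambda>\<xi>. proj (x + \<xi>))"
  by (rule finite_measure.integrable_const_bound[OF prob_space.finite_measure[OF prob_std], of _ radius])
     (auto intro: radius)

text \<open>
  The quadratic error bound for the dual does not depend on the base point, so it survives the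
  average over the Gaussian.
\<close>

lemma smooth_dual_has_derivative: "(smooth_dual has_derivative (\<lambda>h. h \<bullet> smooth_proj x)) (at x)"
proof (rule has_derivative_of_quadratic_error[where M=1])
  show "linear (\<lambda>h. h \<bullet> smooth_proj x)" by (auto intro!: linearI simp: inner_add_left)
  fix h :: "real^'d"
  let ?e = "\<lambda>\<xi>. soft_dual P (x + h + \<xi>) - soft_dual P (x + \<xi>) - h \<bullet> proj (x + \<xi>)"
  have int: "integrable std_gaussian ?e"
    by (intro Bochner_Integration.integrable_diff integrable_soft_dual integrable_inner_right integrable_proj)
  have eq: "smooth_dual (x + h) - smooth_dual x - h \<bullet> smooth_proj x = (\<integral>\<xi>. ?e \<xi> \<partial>std_gaussian)"
    unfolding smooth_dual_def smooth_proj_def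
    by (simp add: integrable_soft_dual integrable_proj integrable_inner_right)
  have e: "0 \<le> ?e \<xi>" "?e \<xi> \<le> (norm h)\<^sup>2" for \<xi>
    using soft_dual_expand[of "x + \<xi>" h] by (simp_all add: ac_simps)
  have "0 \<le> (\<integral>\<xi>. ?e \<xi> \<partial>std_gaussian)" by (rule Bochner_Integration.integral_nonneg) (rule e)
  moreover have "(\<integral>\<xi>. ?e \<xi> \<partial>std_gaussian) \<le> (\<integral>\<xi>. (norm h)\<^sup>2 \<partial>(std_gaussian :: (real^'d) measure))"
    by (rule integral_mono[OF int]) (use e in auto)
  ultimately show "\<bar>smooth_dual (x + h) - smooth_dual x - h \<bullet> smooth_proj x\<bar> \<le> 1 * (norm h)\<^sup>2"
    unfolding eq by simp
qed

lemma smooth_proj_lipschitz: "norm (smooth_proj x - smooth_proj y) \<le> norm (x - y)"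
proof -
  have "smooth_proj x - smooth_proj y = (\<integral>\<xi>. proj (x + \<xi>) - proj (y + \<xi>) \<partial>std_gaussian)"
    unfolding smooth_proj_def by (simp add: integrable_proj)
  also have "norm \<dots> \<le> (\<integral>\<xi>. norm (proj (x + \<xi>) - proj (y + \<xi>)) \<partial>std_gaussian)"
    by (rule integral_norm_bound)
  also have "\<dots> \<le> (\<integral>\<xi>. norm (x - y) \<partial>(std_gaussian :: (real^'d) measure))"
  proof (rule integral_mono)
    show "norm (proj (x + \<xi>) - proj (y + \<xi>)) \<le> norm (x - y)" for \<xi>
      using proj_lipschitz[of "x + \<xi>" "y + \<xi>"] by simp
  qed (auto intro!: integrable_norm integrable_proj Bochner_Integration.integrable_norm)
  finally show ?thesis by simp
qed

text \<open>
  The error is the mean norm of the noise, whatever \<open>P\<close> is: enlarging \<open>P\<close> makes the smoothing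
  negligible on the scale of \<open>P\<close>.
\<close>

lemma smooth_proj_close: "norm (smooth_proj x - proj x) \<le> (\<integral>\<xi>. norm \<xi> \<partial>(std_gaussian :: (real^'d) measure))"
proof -
  have "smooth_proj x - proj x = (\<integral>\<xi>. proj (x + \<xi>) - proj x \<partial>std_gaussian)"
    unfolding smooth_proj_def by (simp add: integrable_proj)
  also have "norm \<dots> \<le> (\<integral>\<xi>. norm (proj (x + \<xi>) - proj x) \<partial>std_gaussian)"
    by (rule integral_norm_bound)
  also have "\<dots> \<le> (\<integral>\<xi>. norm \<xi> \<partial>(std_gaussian :: (real^'d) measure))"
  proof (rule integral_mono)
    show "norm (proj (x + \<xi>) - proj x) \<le> norm \<xi>" for \<xi>
      using proj_lipschitz[of "x + \<xi>" x] by simp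
  qed (auto intro!: integrable_norm integrable_proj Bochner_Integration.integrable_norm)
  finally show ?thesis .
qed

lemma smooth_proj_monotone: "0 \<le> (smooth_proj x - smooth_proj y) \<bullet> (x - y)"
proof -
  have "(smooth_proj x - smooth_proj y) \<bullet> (x - y) = (\<integral>\<xi>. (proj (x + \<xi>) - proj (y + \<xi>)) \<bullet> (x - y) \<partial>std_gaussian)"
    unfolding smooth_proj_def by (simp add: integrable_proj inner_diff_left integrable_inner_left)
  also have "0 \<le> \<dots>"
  proof (rule Bochner_Integration.integral_nonneg)
    show "0 \<le> (proj (x + \<xi>) - proj (y + \<xi>)) \<bullet> (x - y)" for \<xi>
      using proj_monotone[of "x + \<xi>" "y + \<xi>"] by simp
  qed
  finally show ?thesis .
qed

text \<open>
  By the Cameron-Martin formula the average is a Gaussian factor times the Laplace transform of a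
  bounded function.
\<close>

lemma C_k_smooth_proj: "C_k k (\<lambda>x. smooth_proj x \<bullet> v)"
proof -
  have "smooth_proj x \<bullet> v = exp (- (norm x)\<^sup>2 / 2) * (\<integral>y. (proj y \<bullet> v) * exp (x \<bullet> y) \<partial>std_gaussian)" for x
  proof -
    have "smooth_proj x \<bullet> v = (\<integral>\<xi>. proj (x + \<xi>) \<bullet> v \<partial>std_gaussian)"
      unfolding smooth_proj_def by (simp add: integrable_proj)
    also have "\<dots> = exp (- (norm x)\<^sup>2 / 2) * (\<integral>y. (proj y \<bullet> v) * exp (x \<bullet> y) \<partial>std_gaussian)"
      by (rule integral_std_gaussian_shift) measurable
    finally show ?thesis .
  qed
  moreover have "C_k k (\<lambda>x. exp (- (norm x)\<^sup>2 / 2) * (\<integral>y. (proj y \<bullet> v) * exp (x \<bullet> y) \<partial>std_gaussian))"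
  proof (intro C_k_mult C_k_gaussian C_k_laplace[where A="radius * norm v" and c=0])
    show "\<bar>proj y \<bullet> v\<bar> \<le> radius * norm v * exp (0 * norm y)" for y
      using Cauchy_Schwarz_ineq2[of "proj y" v] radius(2)[of y]
      by simp (meson mult_right_mono norm_ge_zero order_trans)
  qed measurable
  ultimately show ?thesis by simp
qed

definition potential :: "real \<Rightarrow> real^'d \<Rightarrow> real" where
  "potential \<kappa> x = (norm x)\<^sup>2 / 2 + (\<kappa> - 1) * smooth_dual x"

definition force :: "real \<Rightarrow> real^'d \<Rightarrow> real^'d" where
  "force \<kappa> x = x + (\<kappa> - 1) *\<^sub>R smooth_proj x"

lemma potential_has_derivative: "(potential \<kappa> has_derivative (\<lambda>h. h \<bullet> force \<kappa> x)) (at x)"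
  unfolding potential_def[abs_def] force_def power2_norm_eq_inner
  by (auto intro!: derivative_eq_intros smooth_dual_has_derivative simp: inner_commute inner_add_right fun_eq_iff)

lemma gradient_potential: "gradient (potential \<kappa>) = force \<kappa>"
proof
  fix x
  show "gradient (potential \<kappa>) x = force \<kappa> x"
    unfolding gradient_def
  proof (rule the_equality)
    show "GDERIV (potential \<kappa>) x :> force \<kappa> x"
      using potential_has_derivative by (simp add: gderiv_def)
    fix g assume "GDERIV (potential \<kappa>) x :> g"
    then have "(potential \<kappa> has_derivative (\<lambda>h. h \<bullet> g)) (at x)" by (simp add: gderiv_def)
    from has_derivative_unique[OF this potential_has_derivative] have "h \<bullet> g = h \<bullet> force \<kappa> x" for h
      by meson
    then show "g = force \<kappa> x" using vector_eq_ldot by metis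
  qed
qed

lemma C_k_force: "C_k k (\<lambda>x. force \<kappa> x \<bullet> v)"
proof -
  have "C_k k (\<lambda>x. x \<bullet> v + (\<kappa> - 1) * (smooth_proj x \<bullet> v))"
    by (intro C_k_add C_k_mult C_k_const C_k_inner C_k_smooth_proj)
  then show ?thesis by (simp add: force_def inner_add_left)
qed

lemma C_infinity_potential: "C_infinity (potential \<kappa>)"
proof -
  have "C_k (Suc k) (potential \<kappa>)" for k
    by (rule C_k_SucI[OF potential_has_derivative]) (use C_k_force in \<open>simp add: inner_commute\<close>)
  then show ?thesis using C_k_Suc_imp unfolding C_infinity_def by blast
qed

lemma force_differentiable: "force \<kappa> differentiable (at x)"
proof (subst differentiable_componentwise_within, rule ballI)
  fix i :: "real^'d"
  show "(\<lambda>x. force \<kappa> x \<bullet> i) differentiable at x"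
    using C_k_force[of "Suc 0" \<kappa> i] by (simp add: differentiable_on_def)
qed

lemma force_has_derivative: "(force \<kappa> has_derivative frechet_derivative (force \<kappa>) (at x)) (at x)"
  using force_differentiable frechet_derivative_works by blast

lemma force_lipschitz: "1 \<le> \<kappa> \<Longrightarrow> norm (force \<kappa> x - force \<kappa> y) \<le> \<kappa> * norm (x - y)"
proof -
  assume k: "1 \<le> \<kappa>"
  have "force \<kappa> x - force \<kappa> y = (x - y) + (\<kappa> - 1) *\<^sub>R (smooth_proj x - smooth_proj y)"
    by (simp add: force_def algebra_simps)
  also have "norm \<dots> \<le> norm (x - y) + (\<kappa> - 1) * norm (smooth_proj x - smooth_proj y)"
    using k by (intro order_trans[OF norm_triangle_ineq]) simp
  also have "\<dots> \<le> norm (x - y) + (\<kappa> - 1) * norm (x - y)"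
    using k by (intro add_mono mult_left_mono smooth_proj_lipschitz) auto
  finally show ?thesis by (simp add: algebra_simps)
qed

text \<open>
  The projection is monotone and 1-Lipschitz, and both properties survive averaging; so the
  difference quotients of the force in direction \<open>w\<close>, tested against \<open>w\<close>, lie between \<open>w \<bullet> w\<close> and
  \<open>\<kappa> * (w \<bullet> w)\<close>.
\<close>

lemma force_derivative_bounds:
  fixes x w :: "real^'d"
  assumes "1 \<le> \<kappa>"
  defines "D \<equiv> frechet_derivative (force \<kappa>) (at x)"
  shows "w \<bullet> w \<le> w \<bullet> D w" and "w \<bullet> D w \<le> \<kappa> * (w \<bullet> w)"
proof -
  let ?\<phi> = "\<lambda>t. w \<bullet> force \<kappa> (x + t *\<^sub>R w)"
  have "(force \<kappa> has_derivative D) (at (x + 0 *\<^sub>R w))"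
    using force_has_derivative by (simp add: D_def)
  then have "((\<lambda>t. force \<kappa> (x + t *\<^sub>R w)) has_derivative (\<lambda>t. D (t *\<^sub>R w))) (at 0)"
    by (rule has_derivative_compose[rotated]) (auto intro!: derivative_eq_intros)
  then have "(?\<phi> has_derivative (\<lambda>t. w \<bullet> D (t *\<^sub>R w))) (at 0)"
    by (rule has_derivative_inner_right)
  moreover have "D (t *\<^sub>R w) = t *\<^sub>R D w" for t
    using has_derivative_linear[OF force_has_derivative] by (simp add: D_def linear_scale)
  ultimately have "(?\<phi> has_real_derivative w \<bullet> D w) (at 0)"
    by (simp add: has_field_derivative_def mult_commute_abs)
  then have "(?\<phi> has_real_derivative w \<bullet> D w) (at 0 within {0<..})"
    by (rule has_field_derivative_at_within)
  then have lim: "((\<lambda>t. (?\<phi> t - ?\<phi> 0) / t) \<longlongrightarrow> w \<bullet> D w) (at_right 0)"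
    by (simp add: has_field_derivative_iff)
  have bnd: "w \<bullet> w \<le> (?\<phi> t - ?\<phi> 0) / t \<and> (?\<phi> t - ?\<phi> 0) / t \<le> \<kappa> * (w \<bullet> w)" if t: "0 < t" for t
  proof
    have eq: "?\<phi> t - ?\<phi> 0 = t * (w \<bullet> w) + (\<kappa> - 1) * ((smooth_proj (x + t *\<^sub>R w) - smooth_proj x) \<bullet> w)"
      by (simp add: force_def algebra_simps inner_commute)
    have "0 \<le> (smooth_proj (x + t *\<^sub>R w) - smooth_proj x) \<bullet> w"
      using smooth_proj_monotone[of "x + t *\<^sub>R w" x] t by (simp add: zero_le_mult_iff)
    then show "w \<bullet> w \<le> (?\<phi> t - ?\<phi> 0) / t"
      unfolding eq using assms(1) t mult_nonneg_nonneg[of "\<kappa> - 1" "(smooth_proj (x + t *\<^sub>R w) - smooth_proj x) \<bullet> w"]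
      by (simp add: pos_le_divide_eq mult.commute)
    have "?\<phi> t - ?\<phi> 0 \<le> norm w * norm (force \<kappa> (x + t *\<^sub>R w) - force \<kappa> x)"
      using norm_cauchy_schwarz[of w "force \<kappa> (x + t *\<^sub>R w) - force \<kappa> x"] by (simp add: inner_diff_right)
    also have "\<dots> \<le> norm w * (\<kappa> * norm (x + t *\<^sub>R w - x))"
      by (intro mult_left_mono force_lipschitz assms) simp
    also have "\<dots> = t * (\<kappa> * (w \<bullet> w))" using t by (simp add: dot_square_norm power2_eq_square)
    finally show "(?\<phi> t - ?\<phi> 0) / t \<le> \<kappa> * (w \<bullet> w)" using t by (simp add: field_simps)
  qed
  have ev: "\<forall>\<^sub>F t in at_right (0::real). 0 < t" by (simp add: eventually_at_right_less)
  show "w \<bullet> w \<le> w \<bullet> D w"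
    by (rule tendsto_lowerbound[OF lim]) (use bnd in \<open>auto intro: eventually_mono[OF ev]\<close>)
  show "w \<bullet> D w \<le> \<kappa> * (w \<bullet> w)"
    by (rule tendsto_upperbound[OF lim]) (use bnd in \<open>auto intro: eventually_mono[OF ev]\<close>)
qed

lemma potential_in_potentials: "1 \<le> \<kappa> \<Longrightarrow> potential \<kappa> \<in> potentials \<kappa>"
proof -
  assume k: "1 \<le> \<kappa>"
  have H: "hessian (potential \<kappa>) x *v w = frechet_derivative (force \<kappa>) (at x) w" for x w
    unfolding hessian_def gradient_potential jacobian_def
    using matrix_vector_mul(2)[OF has_derivative_linear[OF force_has_derivative]] by metis
  have I: "(\<kappa> *\<^sub>R mat 1 :: real^'d^'d) *v w = \<kappa> *\<^sub>R w" for w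
    by (simp add: scaleR_matrix_vector_assoc[symmetric])
  show ?thesis
    using force_derivative_bounds[OF k] C_infinity_potential
    by (simp add: potentials_def loewner_le_def H I)
qed

end

section \<open>Splitting schemes as words of elementary steps\<close>

text \<open>
  Facts about all four schemes are proved for one elementary step and then by induction on the
  word. In the noise-free counterpart of a step, the force is an arbitrary map \<open>\<Gamma>\<close> and the
  \<open>O\<close> step is replaced by its mean.
\<close>

datatype letter = A_letter real | B_letter real | O_letter real

primrec letter_kernel :: "(real^'d \<Rightarrow> real) \<Rightarrow> real \<Rightarrow> letter \<Rightarrow> 'd::finite kernel" where
  "letter_kernel U \<gamma> (A_letter t) = step_A t"
| "letter_kernel U \<gamma> (B_letter t) = step_B U t"
| "letter_kernel U \<gamma> (O_letter t) = step_O \<gamma> t"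

primrec letter_map :: "(real^'d \<Rightarrow> real^'d) \<Rightarrow> real \<Rightarrow> letter \<Rightarrow> 'd phase \<Rightarrow> 'd phase" where
  "letter_map \<Gamma> \<gamma> (A_letter t) z = (fst z + t *\<^sub>R snd z, snd z)"
| "letter_map \<Gamma> \<gamma> (B_letter t) z = (fst z, snd z - t *\<^sub>R \<Gamma> (fst z))"
| "letter_map \<Gamma> \<gamma> (O_letter t) z = (fst z, exp (- \<gamma> * t) *\<^sub>R snd z)"

definition word_kernel :: "(real^'d \<Rightarrow> real) \<Rightarrow> real \<Rightarrow> letter list \<Rightarrow> 'd::finite kernel" where
  "word_kernel U \<gamma> w z = foldl (\<lambda>\<mu> k. \<mu> \<bind> k) (return borel z) (map (letter_kernel U \<gamma>) w)"

definition word_map :: "(real^'d \<Rightarrow> real^'d) \<Rightarrow> real \<Rightarrow> letter list \<Rightarrow> 'd phase \<Rightarrow> 'd phase" where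
  "word_map \<Gamma> \<gamma> w z = fold (letter_map \<Gamma> \<gamma>) w z"

lemma word_kernel_simps [simp]:
  "word_kernel U \<gamma> [] z = return borel z"
  "word_kernel U \<gamma> (w @ [l]) z = word_kernel U \<gamma> w z \<bind> letter_kernel U \<gamma> l"
  by (simp_all add: word_kernel_def)

lemma word_map_simps [simp]:
  "word_map \<Gamma> \<gamma> [] z = z"
  "word_map \<Gamma> \<gamma> (l # w) z = word_map \<Gamma> \<gamma> w (letter_map \<Gamma> \<gamma> l z)"
  "word_map \<Gamma> \<gamma> (w @ w') z = word_map \<Gamma> \<gamma> w' (word_map \<Gamma> \<gamma> w z)"
  by (simp_all add: word_map_def)

primrec splitting_word :: "splitting \<Rightarrow> real \<Rightarrow> letter list" where
  "splitting_word ABOBA h = [A_letter (h/2), B_letter (h/2), O_letter h, B_letter (h/2), A_letter (h/2)]"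
| "splitting_word AOBOA h = [A_letter (h/2), O_letter (h/2), B_letter h, O_letter (h/2), A_letter (h/2)]"
| "splitting_word BOAOB h = [B_letter (h/2), O_letter (h/2), A_letter h, O_letter (h/2), B_letter (h/2)]"
| "splitting_word OABAO h = [O_letter (h/2), A_letter (h/2), B_letter h, A_letter (h/2), O_letter (h/2)]"

lemma splitting_kernel_eq_word_kernel: "splitting_kernel s U h \<gamma> = word_kernel U \<gamma> (splitting_word s h)"
  by (cases s) (auto simp: splitting_kernel_def word_kernel_def fun_eq_iff)

section \<open>Noisy steps near deterministic ones\<close>

lemma letter_kernel_prob:
  assumes [measurable]: "gradient U \<in> borel_measurable borel"
  shows "letter_kernel U \<gamma> l \<in> borel \<rightarrow>\<^sub>M prob_algebra borel"
proof (cases l)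
  case (A_letter t)
  have "(\<lambda>z::'a phase. (fst z + t *\<^sub>R snd z, snd z)) \<in> borel \<rightarrow>\<^sub>M borel"
    unfolding borel_prod[symmetric] by measurable
  from measurable_compose[OF this measurable_return_prob_space]
  show ?thesis by (simp add: A_letter step_A_def case_prod_beta')
next
  case (B_letter t)
  have "(\<lambda>z::'a phase. (fst z, snd z - t *\<^sub>R gradient U (fst z))) \<in> borel \<rightarrow>\<^sub>M borel"
    unfolding borel_prod[symmetric] by measurable
  from measurable_compose[OF this measurable_return_prob_space]
  show ?thesis by (simp add: B_letter step_B_def case_prod_beta')
next
  case (O_letter t)
  have G: "(\<lambda>z::'a phase. std_gaussian) \<in> borel \<rightarrow>\<^sub>M prob_algebra (borel :: (real^'a) measure)"
    by (rule measurable_const) (simp add: space_prob_algebra prob_space_std_gaussian)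
  have "(\<lambda>(z::'a phase, \<xi>). (fst z, exp (- \<gamma> * t) *\<^sub>R snd z + sqrt (1 - exp (- 2 * \<gamma> * t)) *\<^sub>R \<xi>)) \<in> borel \<Otimes>\<^sub>M borel \<rightarrow>\<^sub>M borel"
    unfolding borel_prod[symmetric] case_prod_beta' by measurable
  from measurable_distr_prob_space2[OF G this]
  show ?thesis by (simp add: O_letter step_O_def case_prod_beta')
qed

lemma word_kernel_prob:
  assumes "gradient U \<in> borel_measurable borel"
  shows "word_kernel U \<gamma> w \<in> borel \<rightarrow>\<^sub>M prob_algebra borel"
proof (induction w rule: rev_induct)
  case Nil show ?case by (simp add: measurable_return_prob_space[unfolded eta_contract_eq] cong: measurable_cong)
next
  case (snoc l w)
  then show ?case using measurable_bind_prob_space[OF snoc letter_kernel_prob[OF assms]] by simp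
qed

definition l2_close :: "('a::real_normed_vector \<Rightarrow> 'a measure) \<Rightarrow> ('a \<Rightarrow> 'a) \<Rightarrow> real \<Rightarrow> bool" where
  "l2_close K f e \<longleftrightarrow> (\<forall>z. (\<integral>\<^sup>+y. ennreal ((norm (y - f z))\<^sup>2) \<partial>K z) \<le> ennreal e)"

text \<open>
  At an intermediate point \<open>x\<close>, the error splits into the new one at \<open>x\<close> and the old one, which
  \<open>f'\<close> amplifies by at most \<open>l\<close>; the factor 2 comes from squaring the sum.
\<close>

lemma l2_close_bind:
  fixes K K' :: "'a::euclidean_space \<Rightarrow> 'a measure"
  assumes K: "K \<in> borel \<rightarrow>\<^sub>M prob_algebra borel" and K': "K' \<in> borel \<rightarrow>\<^sub>M prob_algebra borel"
    and f [measurable]: "f' \<in> borel_measurable borel"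
    and close: "l2_close K f e" "l2_close K' f' e'" and lip: "\<And>x y. norm (f' x - f' y) \<le> l * norm (x - y)"
    and nonneg: "0 \<le> e" "0 \<le> e'"
  shows "l2_close (\<lambda>z. K z \<bind> K') (\<lambda>z. f' (f z)) (2 * e' + 2 * l\<^sup>2 * e)"
  unfolding l2_close_def
proof
  fix z
  have [simp, measurable_cong]: "sets (K z) = sets borel" for z
    using measurable_space[OF K, of z] by (simp add: space_prob_algebra)
  have [simp, measurable_cong]: "sets (K' z) = sets borel" for z
    using measurable_space[OF K', of z] by (simp add: space_prob_algebra)
  have K1 [measurable]: "K \<in> borel \<rightarrow>\<^sub>M subprob_algebra borel" using K by (rule measurable_prob_algebraD)
  have K2 [measurable]: "K' \<in> borel \<rightarrow>\<^sub>M subprob_algebra borel" using K' by (rule measurable_prob_algebraD)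
  have prob: "prob_space (K z)" "prob_space (K' z)" for z
    using measurable_space[OF K, of z] measurable_space[OF K', of z] by (simp_all add: space_prob_algebra)
  have one: "emeasure (K z) (space (K z)) = 1" "emeasure (K' z) (space (K' z)) = 1" for z
    using prob by (auto intro: prob_space.emeasure_space_1)
  have pt: "ennreal ((norm (y - f' (f z)))\<^sup>2) \<le> 2 * ennreal ((norm (y - f' x))\<^sup>2) + ennreal (2 * l\<^sup>2) * ennreal ((norm (x - f z))\<^sup>2)" for x y
  proof -
    have "norm (y - f' (f z)) \<le> norm (y - f' x) + l * norm (x - f z)"
      using norm_triangle_ineq[of "y - f' x" "f' x - f' (f z)"] lip[of x "f z"] by simp
    then have "(norm (y - f' (f z)))\<^sup>2 \<le> (norm (y - f' x) + l * norm (x - f z))\<^sup>2" by (intro power_mono) auto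
    also have "\<dots> \<le> 2 * (norm (y - f' x))\<^sup>2 + 2 * (l * norm (x - f z))\<^sup>2"
      using zero_le_power2[of "norm (y - f' x) - l * norm (x - f z)"]
      by (simp only: power2_sum power2_diff)
    finally have "(norm (y - f' (f z)))\<^sup>2 \<le> 2 * (norm (y - f' x))\<^sup>2 + 2 * l\<^sup>2 * (norm (x - f z))\<^sup>2"
      by (simp add: power_mult_distrib)
    then have "ennreal ((norm (y - f' (f z)))\<^sup>2) \<le> ennreal (2 * (norm (y - f' x))\<^sup>2 + 2 * l\<^sup>2 * (norm (x - f z))\<^sup>2)"
      by (rule ennreal_leI)
    then show ?thesis by (simp add: ennreal_plus ennreal_mult)
  qed
  have "(\<integral>\<^sup>+y. ennreal ((norm (y - f' (f z)))\<^sup>2) \<partial>(K z \<bind> K')) = (\<integral>\<^sup>+x. \<integral>\<^sup>+y. ennreal ((norm (y - f' (f z)))\<^sup>2) \<partial>K' x \<partial>K z)"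
    by (rule nn_integral_bind[of _ borel]) measurable
  also have "\<dots> \<le> (\<integral>\<^sup>+x. ennreal (2 * e') + ennreal (2 * l\<^sup>2) * ennreal ((norm (x - f z))\<^sup>2) \<partial>K z)"
  proof (rule nn_integral_mono)
    fix x
    have "(\<integral>\<^sup>+y. ennreal ((norm (y - f' (f z)))\<^sup>2) \<partial>K' x) \<le> (\<integral>\<^sup>+y. 2 * ennreal ((norm (y - f' x))\<^sup>2) + ennreal (2 * l\<^sup>2) * ennreal ((norm (x - f z))\<^sup>2) \<partial>K' x)"
      by (intro nn_integral_mono pt)
    also have "\<dots> = 2 * (\<integral>\<^sup>+y. ennreal ((norm (y - f' x))\<^sup>2) \<partial>K' x) + ennreal (2 * l\<^sup>2) * ennreal ((norm (x - f z))\<^sup>2)"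
      by (subst nn_integral_add) (auto simp: nn_integral_cmult one)
    also have "\<dots> \<le> 2 * ennreal e' + ennreal (2 * l\<^sup>2) * ennreal ((norm (x - f z))\<^sup>2)"
      using close(2) by (intro add_mono mult_left_mono) (auto simp: l2_close_def)
    finally show "(\<integral>\<^sup>+y. ennreal ((norm (y - f' (f z)))\<^sup>2) \<partial>K' x) \<le> ennreal (2 * e') + ennreal (2 * l\<^sup>2) * ennreal ((norm (x - f z))\<^sup>2)"
      using nonneg by (simp add: ennreal_mult)
  qed
  also have "\<dots> = ennreal (2 * e') + ennreal (2 * l\<^sup>2) * (\<integral>\<^sup>+x. ennreal ((norm (x - f z))\<^sup>2) \<partial>K z)"
    by (subst nn_integral_add) (auto simp: nn_integral_cmult one)
  also have "\<dots> \<le> ennreal (2 * e') + ennreal (2 * l\<^sup>2) * ennreal e"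
    using close(1) by (intro add_mono mult_left_mono) (auto simp: l2_close_def)
  also have "\<dots> = ennreal (2 * e' + 2 * l\<^sup>2 * e)"
    using nonneg by (simp add: ennreal_mult ennreal_plus)
  finally show "(\<integral>\<^sup>+y. ennreal ((norm (y - f' (f z)))\<^sup>2) \<partial>(K z \<bind> K')) \<le> ennreal (2 * e' + 2 * l\<^sup>2 * e)" .
qed

lemma norm_fst_snd_le: "norm (fst z) \<le> norm z" "norm (snd z) \<le> norm z" for z :: "'a::real_normed_vector \<times> 'b::real_normed_vector"
  using norm_fst_le[of "fst z" "snd z"] norm_snd_le[of "snd z" "fst z"] by simp_all

lemma norm_le_fst_snd: "norm z \<le> norm (fst z) + norm (snd z)"
  for z :: "'a::real_normed_vector \<times> 'b::real_normed_vector"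
  by (cases z) (simp add: norm_Pair sqrt_sum_squares_le_sum)

text \<open>
  The constant is chosen before the force, because the same one has to serve a force that is
  blown up to larger and larger scales.
\<close>

lemma letter_map_lipschitz:
  fixes \<gamma> Lip :: real and l :: letter
  shows "\<exists>k\<ge>0. \<forall>\<Gamma>::real^'d \<Rightarrow> real^'d. (\<forall>x y. norm (\<Gamma> x - \<Gamma> y) \<le> Lip * norm (x - y)) \<longrightarrow>
     (\<forall>z z'. norm (letter_map \<Gamma> \<gamma> l z - letter_map \<Gamma> \<gamma> l z') \<le> k * norm (z - z'))"
proof -
  have e: "\<exists>k\<ge>0. \<forall>\<Gamma>::real^'d \<Rightarrow> real^'d. (\<forall>x y. norm (\<Gamma> x - \<Gamma> y) \<le> Lip * norm (x - y)) \<longrightarrow>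
     (\<forall>z z'. norm (letter_map \<Gamma> \<gamma> l z - letter_map \<Gamma> \<gamma> l z') \<le> k * norm (z - z'))"
    if "0 \<le> a" "\<And>(\<Gamma>::real^'d \<Rightarrow> real^'d) z z'. \<lbrakk>\<And>x y. norm (\<Gamma> x - \<Gamma> y) \<le> Lip * norm (x - y)\<rbrakk> \<Longrightarrow>
      norm (fst (letter_map \<Gamma> \<gamma> l z) - fst (letter_map \<Gamma> \<gamma> l z')) \<le> a * norm (z - z')"
      "0 \<le> b" "\<And>(\<Gamma>::real^'d \<Rightarrow> real^'d) z z'. \<lbrakk>\<And>x y. norm (\<Gamma> x - \<Gamma> y) \<le> Lip * norm (x - y)\<rbrakk> \<Longrightarrow>
      norm (snd (letter_map \<Gamma> \<gamma> l z) - snd (letter_map \<Gamma> \<gamma> l z')) \<le> b * norm (z - z')" for a b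
  proof (intro exI[of _ "a + b"] conjI allI impI)
    fix \<Gamma> :: "real^'d \<Rightarrow> real^'d" and z z' :: "'d phase"
    assume G: "\<forall>x y. norm (\<Gamma> x - \<Gamma> y) \<le> Lip * norm (x - y)"
    show "norm (letter_map \<Gamma> \<gamma> l z - letter_map \<Gamma> \<gamma> l z') \<le> (a + b) * norm (z - z')"
      using norm_le_fst_snd[of "letter_map \<Gamma> \<gamma> l z - letter_map \<Gamma> \<gamma> l z'"]
        that(2)[of \<Gamma> z z'] that(4)[of \<Gamma> z z'] G by (simp add: distrib_right)
  qed (use that in auto)
  have n: "norm (fst z - fst z') \<le> norm (z - z')" "norm (snd z - snd z') \<le> norm (z - z')" for z z' :: "'d phase"
    using norm_fst_snd_le[of "z - z'"] by simp_all
  show ?thesis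
  proof (cases l)
    case (A_letter t)
    show ?thesis
    proof (rule e[of "1 + \<bar>t\<bar>" 1])
      fix \<Gamma> :: "real^'d \<Rightarrow> real^'d" and z z' :: "'d phase"
      have "norm (fst (letter_map \<Gamma> \<gamma> l z) - fst (letter_map \<Gamma> \<gamma> l z')) = norm ((fst z - fst z') + t *\<^sub>R (snd z - snd z'))"
        by (simp add: A_letter algebra_simps)
      also have "\<dots> \<le> norm (fst z - fst z') + \<bar>t\<bar> * norm (snd z - snd z')"
        by (rule order_trans[OF norm_triangle_ineq]) simp
      also have "\<dots> \<le> norm (z - z') + \<bar>t\<bar> * norm (z - z')"
        by (intro add_mono mult_left_mono n) simp
      finally show "norm (fst (letter_map \<Gamma> \<gamma> l z) - fst (letter_map \<Gamma> \<gamma> l z')) \<le> (1 + \<bar>t\<bar>) * norm (z - z')"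
        by (simp add: algebra_simps)
    qed (auto simp: A_letter n)
  next
    case (B_letter t)
    show ?thesis
    proof (rule e[of 1 "1 + \<bar>t\<bar> * \<bar>Lip\<bar>"])
      fix \<Gamma> :: "real^'d \<Rightarrow> real^'d" and z z' :: "'d phase"
      assume G: "\<And>x y. norm (\<Gamma> x - \<Gamma> y) \<le> Lip * norm (x - y)"
      have "norm (snd (letter_map \<Gamma> \<gamma> l z) - snd (letter_map \<Gamma> \<gamma> l z')) = norm ((snd z - snd z') - t *\<^sub>R (\<Gamma> (fst z) - \<Gamma> (fst z')))"
        by (simp add: B_letter algebra_simps)
      also have "\<dots> \<le> norm (snd z - snd z') + \<bar>t\<bar> * norm (\<Gamma> (fst z) - \<Gamma> (fst z'))"
        by (rule order_trans[OF norm_triangle_ineq4]) simp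
      also have "\<dots> \<le> norm (z - z') + \<bar>t\<bar> * (\<bar>Lip\<bar> * norm (z - z'))"
      proof (intro add_mono mult_left_mono n)
        have "norm (\<Gamma> (fst z) - \<Gamma> (fst z')) \<le> \<bar>Lip\<bar> * norm (fst z - fst z')"
          using G[of "fst z" "fst z'"] by (meson abs_ge_self mult_right_mono norm_ge_zero order_trans)
        also have "\<dots> \<le> \<bar>Lip\<bar> * norm (z - z')" by (intro mult_left_mono n) simp
        finally show "norm (\<Gamma> (fst z) - \<Gamma> (fst z')) \<le> \<bar>Lip\<bar> * norm (z - z')" .
      qed simp
      finally show "norm (snd (letter_map \<Gamma> \<gamma> l z) - snd (letter_map \<Gamma> \<gamma> l z')) \<le> (1 + \<bar>t\<bar> * \<bar>Lip\<bar>) * norm (z - z')"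
        by (simp add: algebra_simps)
    qed (auto simp: B_letter n)
  next
    case (O_letter t)
    show ?thesis
    proof (rule e[of 1 "exp (- \<gamma> * t)"])
      fix \<Gamma> :: "real^'d \<Rightarrow> real^'d" and z z' :: "'d phase"
      have "snd (letter_map \<Gamma> \<gamma> l z) - snd (letter_map \<Gamma> \<gamma> l z') = exp (- \<gamma> * t) *\<^sub>R (snd z - snd z')"
        by (simp add: O_letter algebra_simps)
      then show "norm (snd (letter_map \<Gamma> \<gamma> l z) - snd (letter_map \<Gamma> \<gamma> l z')) \<le> exp (- \<gamma> * t) * norm (z - z')"
        using n[of z z'] by simp
    qed (auto simp: O_letter n)
  qed
qed

lemma word_map_lipschitz:
  fixes \<gamma> Lip :: real and w :: "letter list"
  shows "\<exists>k\<ge>0. \<forall>\<Gamma>::real^'d \<Rightarrow> real^'d. (\<forall>x y. norm (\<Gamma> x - \<Gamma> y) \<le> Lip * norm (x - y)) \<longrightarrow>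
     (\<forall>z z'. norm (word_map \<Gamma> \<gamma> w z - word_map \<Gamma> \<gamma> w z') \<le> k * norm (z - z'))"
proof (induction w)
  case Nil show ?case by (rule exI[of _ 1]) simp
next
  case (Cons l w)
  then obtain k where k: "0 \<le> k" "\<And>\<Gamma>::real^'d \<Rightarrow> real^'d. (\<forall>x y. norm (\<Gamma> x - \<Gamma> y) \<le> Lip * norm (x - y)) \<Longrightarrow>
     (\<forall>z z'. norm (word_map \<Gamma> \<gamma> w z - word_map \<Gamma> \<gamma> w z') \<le> k * norm (z - z'))" by blast
  obtain k' where k': "0 \<le> k'" "\<And>\<Gamma>::real^'d \<Rightarrow> real^'d. (\<forall>x y. norm (\<Gamma> x - \<Gamma> y) \<le> Lip * norm (x - y)) \<Longrightarrow>
     (\<forall>z z'. norm (letter_map \<Gamma> \<gamma> l z - letter_map \<Gamma> \<gamma> l z') \<le> k' * norm (z - z'))"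
    using letter_map_lipschitz[of Lip \<gamma> l] by blast
  show ?case
  proof (intro exI[of _ "k * k'"] conjI allI impI)
    fix \<Gamma> :: "real^'d \<Rightarrow> real^'d" and z z' :: "'d phase"
    assume G: "\<forall>x y. norm (\<Gamma> x - \<Gamma> y) \<le> Lip * norm (x - y)"
    have "norm (word_map \<Gamma> \<gamma> (l # w) z - word_map \<Gamma> \<gamma> (l # w) z') \<le> k * norm (letter_map \<Gamma> \<gamma> l z - letter_map \<Gamma> \<gamma> l z')"
      using k(2)[OF G, rule_format, of "letter_map \<Gamma> \<gamma> l z" "letter_map \<Gamma> \<gamma> l z'"] by simp
    also have "\<dots> \<le> k * (k' * norm (z - z'))"
      using k'(2)[OF G, rule_format, of z z'] k(1) by (intro mult_left_mono)
    finally show "norm (word_map \<Gamma> \<gamma> (l # w) z - word_map \<Gamma> \<gamma> (l # w) z') \<le> k * k' * norm (z - z')"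
      by (simp add: mult.assoc)
  qed (use k k' in simp)
qed

lemma letter_kernel_close:
  fixes U :: "real^'d \<Rightarrow> real"
  assumes [measurable]: "gradient U \<in> borel_measurable borel" and \<delta>: "\<And>x. norm (gradient U x - \<Gamma> x) \<le> \<delta>"
  shows "l2_close (letter_kernel U \<gamma> l) (letter_map \<Gamma> \<gamma> l)
    (case l of A_letter t \<Rightarrow> 0 | B_letter t \<Rightarrow> (t * \<delta>)\<^sup>2 | O_letter t \<Rightarrow> (sqrt (1 - exp (- 2 * \<gamma> * t)))\<^sup>2 * CARD('d))"
  unfolding l2_close_def
proof
  fix z :: "'d phase"
  show "(\<integral>\<^sup>+y. ennreal ((norm (y - letter_map \<Gamma> \<gamma> l z))\<^sup>2) \<partial>letter_kernel U \<gamma> l z)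
     \<le> ennreal (case l of A_letter t \<Rightarrow> 0 | B_letter t \<Rightarrow> (t * \<delta>)\<^sup>2 | O_letter t \<Rightarrow> (sqrt (1 - exp (- 2 * \<gamma> * t)))\<^sup>2 * CARD('d))"
  proof (cases l)
    case (A_letter t)
    then show ?thesis by (simp add: step_A_def case_prod_beta' nn_integral_return)
  next
    case (B_letter t)
    have "norm (- (t *\<^sub>R (gradient U (fst z) - \<Gamma> (fst z)))) \<le> \<bar>t * \<delta>\<bar>"
      using \<delta>[of "fst z"] by (simp add: abs_mult mult_left_mono)
    then have "(norm (- (t *\<^sub>R (gradient U (fst z) - \<Gamma> (fst z)))))\<^sup>2 \<le> (t * \<delta>)\<^sup>2"
      using power_mono[of _ "\<bar>t * \<delta>\<bar>" 2] by fastforce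
    then show ?thesis
      by (simp add: B_letter step_B_def case_prod_beta' nn_integral_return norm_Pair algebra_simps ennreal_leI)
  next
    case (O_letter t)
    let ?s = "sqrt (1 - exp (- 2 * \<gamma> * t))"
    have "(\<integral>\<^sup>+y. ennreal ((norm (y - letter_map \<Gamma> \<gamma> l z))\<^sup>2) \<partial>letter_kernel U \<gamma> l z)
      = (\<integral>\<^sup>+\<xi>. ennreal ((norm (fst z - fst z, ?s *\<^sub>R \<xi>))\<^sup>2) \<partial>(std_gaussian :: (real^'d) measure))"
      by (simp add: O_letter step_O_def case_prod_beta' nn_integral_distr)
    also have "\<dots> = (\<integral>\<^sup>+\<xi>. ennreal (?s\<^sup>2) * ennreal ((norm \<xi>)\<^sup>2) \<partial>(std_gaussian :: (real^'d) measure))"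
      by (intro nn_integral_cong) (simp add: norm_Pair power_mult_distrib ennreal_mult[symmetric])
    also have "\<dots> = ennreal (?s\<^sup>2) * ennreal CARD('d)"
      by (simp add: nn_integral_cmult std_gaussian_second_moment)
    finally show ?thesis by (simp add: O_letter ennreal_mult)
  qed
qed

text \<open>
  Again \<open>e\<close> is chosen before \<open>U\<close> and \<open>\<Gamma>\<close>: the noise level of a step stays fixed while \<open>\<Gamma>\<close> is
  blown up.
\<close>

lemma word_kernel_close:
  fixes \<gamma> Lip \<delta> :: real and w :: "letter list"
  shows "\<exists>e\<ge>0. \<forall>(U::real^'d \<Rightarrow> real) \<Gamma>. gradient U \<in> borel_measurable borel \<longrightarrow>
     (\<forall>x y. norm (\<Gamma> x - \<Gamma> y) \<le> Lip * norm (x - y)) \<longrightarrow> (\<forall>x. norm (gradient U x - \<Gamma> x) \<le> \<delta>) \<longrightarrow>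
     l2_close (word_kernel U \<gamma> w) (word_map \<Gamma> \<gamma> w) e"
proof (induction w rule: rev_induct)
  case Nil
  show ?case by (rule exI[of _ 0]) (simp add: l2_close_def nn_integral_return)
next
  case (snoc l w)
  then obtain e where e: "0 \<le> e" "\<And>(U::real^'d \<Rightarrow> real) \<Gamma>. gradient U \<in> borel_measurable borel \<Longrightarrow>
     (\<forall>x y. norm (\<Gamma> x - \<Gamma> y) \<le> Lip * norm (x - y)) \<Longrightarrow> (\<forall>x. norm (gradient U x - \<Gamma> x) \<le> \<delta>) \<Longrightarrow>
     l2_close (word_kernel U \<gamma> w) (word_map \<Gamma> \<gamma> w) e" by blast
  obtain k where k: "0 \<le> k" "\<And>\<Gamma>::real^'d \<Rightarrow> real^'d. (\<forall>x y. norm (\<Gamma> x - \<Gamma> y) \<le> Lip * norm (x - y)) \<Longrightarrow>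
     (\<forall>z z'. norm (letter_map \<Gamma> \<gamma> l z - letter_map \<Gamma> \<gamma> l z') \<le> k * norm (z - z'))"
    using letter_map_lipschitz[of Lip \<gamma> l] by blast
  define e' where "e' = (case l of A_letter t \<Rightarrow> 0 | B_letter t \<Rightarrow> (t * \<delta>)\<^sup>2 | O_letter t \<Rightarrow> (sqrt (1 - exp (- 2 * \<gamma> * t)))\<^sup>2 * CARD('d))"
  have e'0: "0 \<le> e'" by (auto simp: e'_def split: letter.splits)
  show ?case
  proof (intro exI[of _ "2 * e' + 2 * k\<^sup>2 * e"] conjI allI impI)
    fix U :: "real^'d \<Rightarrow> real" and \<Gamma>
    assume meas: "gradient U \<in> borel_measurable borel" and lip: "\<forall>x y. norm (\<Gamma> x - \<Gamma> y) \<le> Lip * norm (x - y)"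
      and \<delta>: "\<forall>x. norm (gradient U x - \<Gamma> x) \<le> \<delta>"
    have "continuous_on UNIV (letter_map \<Gamma> \<gamma> l)"
      using k(2)[OF lip] k(1)
      by (intro lipschitz_on_continuous_on[where L=k] lipschitz_onI) (auto simp: dist_norm)
    then have [measurable]: "letter_map \<Gamma> \<gamma> l \<in> borel_measurable borel" by (rule borel_measurable_continuous_onI)
    have "l2_close (\<lambda>z. word_kernel U \<gamma> w z \<bind> letter_kernel U \<gamma> l) (\<lambda>z. letter_map \<Gamma> \<gamma> l (word_map \<Gamma> \<gamma> w z)) (2 * e' + 2 * k\<^sup>2 * e)"
    proof (rule l2_close_bind[where f'="letter_map \<Gamma> \<gamma> l" and f="word_map \<Gamma> \<gamma> w" and l=k])
      show "l2_close (letter_kernel U \<gamma> l) (letter_map \<Gamma> \<gamma> l) e'"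
        unfolding e'_def by (rule letter_kernel_close[OF meas]) (use \<delta> in auto)
    qed (use word_kernel_prob[OF meas] letter_kernel_prob[OF meas] e(2)[OF meas lip \<delta>] k(2)[OF lip] e(1) e'0 in auto)
    then show "l2_close (word_kernel U \<gamma> (w @ [l])) (word_map \<Gamma> \<gamma> (w @ [l])) (2 * e' + 2 * k\<^sup>2 * e)"
      by (simp add: l2_close_def)
  qed (use e e'0 in simp)
qed

section \<open>The linear part of a step and its characteristic polynomial\<close>

lemma linear_word_map: "linear (word_map (\<lambda>x. x) \<gamma> w :: 'd::finite phase \<Rightarrow> 'd phase)"
proof (induction w)
  case Nil
  have "word_map (\<lambda>x. x) \<gamma> [] = (id :: 'd phase \<Rightarrow> 'd phase)" by (simp add: fun_eq_iff)
  then show ?case by (simp only: linear_id)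
next
  case (Cons l w)
  have "linear (letter_map (\<lambda>x. x) \<gamma> l :: 'd phase \<Rightarrow> 'd phase)"
    by (cases l) (auto intro!: linearI simp: algebra_simps)
  moreover have "word_map (\<lambda>x. x) \<gamma> (l # w) = word_map (\<lambda>x. x) \<gamma> w \<circ> (letter_map (\<lambda>x. x) \<gamma> l :: 'd phase \<Rightarrow> 'd phase)"
    by (simp add: fun_eq_iff)
  ultimately show ?case using linear_compose[OF _ Cons] by metis
qed

text \<open>
  The deviation of the force from the identity enters a bounded number of times, each time
  through linear maps; so the bound is linear in \<open>B\<close>.
\<close>

lemma word_map_near_linear:
  fixes \<gamma> :: real and w :: "letter list"
  shows "\<exists>k\<ge>0. \<forall>(\<Gamma>::real^'d \<Rightarrow> real^'d) B. (\<forall>x. norm (\<Gamma> x - x) \<le> B) \<longrightarrow>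
     (\<forall>z. norm (word_map \<Gamma> \<gamma> w z - word_map (\<lambda>x. x) \<gamma> w z) \<le> k * B)"
proof (induction w rule: rev_induct)
  case Nil show ?case by (rule exI[of _ 0]) simp
next
  case (snoc l w)
  then obtain k where k: "0 \<le> k" "\<And>(\<Gamma>::real^'d \<Rightarrow> real^'d) B z. (\<forall>x. norm (\<Gamma> x - x) \<le> B) \<Longrightarrow>
     norm (word_map \<Gamma> \<gamma> w z - word_map (\<lambda>x. x) \<gamma> w z) \<le> k * B" by blast
  obtain k' where k': "0 \<le> k'" "\<And>z z'::'d phase. norm (letter_map (\<lambda>x. x) \<gamma> l z - letter_map (\<lambda>x. x) \<gamma> l z') \<le> k' * norm (z - z')"
    using letter_map_lipschitz[of 1 \<gamma> l, where 'd='d] by force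
  define t where "t = (case l of B_letter t \<Rightarrow> \<bar>t\<bar> | _ \<Rightarrow> 0)"
  have t0: "0 \<le> t" by (auto simp: t_def split: letter.splits)
  show ?case
  proof (intro exI[of _ "t + k' * k"] conjI allI impI)
    fix \<Gamma> :: "real^'d \<Rightarrow> real^'d" and B and z :: "'d phase"
    assume B: "\<forall>x. norm (\<Gamma> x - x) \<le> B"
    let ?y = "word_map \<Gamma> \<gamma> w z" and ?y' = "word_map (\<lambda>x. x) \<gamma> w z"
    have "norm (letter_map \<Gamma> \<gamma> l ?y - letter_map (\<lambda>x. x) \<gamma> l ?y) \<le> t * B"
    proof (cases l)
      case (B_letter s)
      have "letter_map \<Gamma> \<gamma> l ?y - letter_map (\<lambda>x. x) \<gamma> l ?y = (0, - (s *\<^sub>R (\<Gamma> (fst ?y) - fst ?y)))"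
        by (simp add: B_letter algebra_simps)
      then show ?thesis using B by (simp add: B_letter t_def norm_Pair mult_left_mono)
    qed (auto simp: t_def)
    moreover have "norm (letter_map (\<lambda>x. x) \<gamma> l ?y - letter_map (\<lambda>x. x) \<gamma> l ?y') \<le> k' * (k * B)"
      using k'(2)[of ?y ?y'] mult_left_mono[OF k(2)[OF B, of z] k'(1)] by linarith
    ultimately show "norm (word_map \<Gamma> \<gamma> (w @ [l]) z - word_map (\<lambda>x. x) \<gamma> (w @ [l]) z) \<le> (t + k' * k) * B"
      using norm_triangle_ineq[of "letter_map \<Gamma> \<gamma> l ?y - letter_map (\<lambda>x. x) \<gamma> l ?y" "letter_map (\<lambda>x. x) \<gamma> l ?y - letter_map (\<lambda>x. x) \<gamma> l ?y'"]
      by (simp add: algebra_simps)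
  qed (use t0 k k' in simp)
qed

lemma word_map_scale:
  assumes "R \<noteq> 0"
  shows "word_map (\<lambda>x. R *\<^sub>R \<Gamma> (x /\<^sub>R R)) \<gamma> w (R *\<^sub>R z) = R *\<^sub>R word_map \<Gamma> \<gamma> w z"
proof (induction w arbitrary: z)
  case (Cons l w)
  have "letter_map (\<lambda>x. R *\<^sub>R \<Gamma> (x /\<^sub>R R)) \<gamma> l (R *\<^sub>R z) = R *\<^sub>R letter_map \<Gamma> \<gamma> l z"
    using assms by (cases l; cases z) (auto simp: algebra_simps)
  then show ?case using Cons by simp
qed simp

definition unit_slope_at :: "(real^'d \<Rightarrow> real^'d) \<Rightarrow> real^'d \<Rightarrow> bool" where
  "unit_slope_at \<Gamma> p \<longleftrightarrow> (\<exists>r>0. \<forall>x. norm (x - p) \<le> r \<longrightarrow> \<Gamma> x = \<Gamma> p + (x - p))"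

text \<open>
  Only \<open>B\<close> steps evaluate the force, so the condition concerns the positions at which they do.
\<close>

primrec regular_orbit :: "(real^'d \<Rightarrow> real^'d) \<Rightarrow> real \<Rightarrow> letter list \<Rightarrow> 'd phase \<Rightarrow> bool" where
  "regular_orbit \<Gamma> \<gamma> [] z \<longleftrightarrow> True"
| "regular_orbit \<Gamma> \<gamma> (l # w) z \<longleftrightarrow> (\<forall>t. l = B_letter t \<longrightarrow> unit_slope_at \<Gamma> (fst z)) \<and> regular_orbit \<Gamma> \<gamma> w (letter_map \<Gamma> \<gamma> l z)"

text \<open>
  Along the orbit of \<open>c\<close> the force acts as a translation near each point where it is evaluated, so
  deviations from the orbit evolve as under the linear force.
\<close>

lemma word_map_locally_affine:
  assumes "regular_orbit \<Gamma> \<gamma> w c"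
  shows "\<exists>r>0. \<forall>z. norm (z - c) \<le> r \<longrightarrow> word_map \<Gamma> \<gamma> w z = word_map \<Gamma> \<gamma> w c + word_map (\<lambda>x. x) \<gamma> w (z - c)"
  using assms
proof (induction w arbitrary: c)
  case Nil show ?case by (rule exI[of _ 1]) simp
next
  case (Cons l w)
  have letter: "\<exists>r>0. \<forall>z. norm (z - c) \<le> r \<longrightarrow> letter_map \<Gamma> \<gamma> l z = letter_map \<Gamma> \<gamma> l c + letter_map (\<lambda>x. x) \<gamma> l (z - c)"
  proof (cases l)
    case (B_letter t)
    then obtain r where r: "r > 0" "\<And>x. norm (x - fst c) \<le> r \<Longrightarrow> \<Gamma> x = \<Gamma> (fst c) + (x - fst c)"
      using Cons.prems by (auto simp: unit_slope_at_def)
    show ?thesis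
    proof (intro exI[of _ r] conjI allI impI)
      fix z assume "norm (z - c) \<le> r"
      then have "norm (fst z - fst c) \<le> r" using norm_fst_snd_le(1)[of "z - c"] by simp
      note e = r(2)[OF this]
      show "letter_map \<Gamma> \<gamma> l z = letter_map \<Gamma> \<gamma> l c + letter_map (\<lambda>x. x) \<gamma> l (z - c)"
        by (simp add: B_letter e prod_eq_iff algebra_simps)
    qed (use r in simp)
  qed (auto intro!: exI[of _ 1] simp: algebra_simps)
  obtain r where r: "r > 0" "\<And>z. norm (z - c) \<le> r \<Longrightarrow> letter_map \<Gamma> \<gamma> l z = letter_map \<Gamma> \<gamma> l c + letter_map (\<lambda>x. x) \<gamma> l (z - c)"
    using letter by blast
  obtain r' where r': "r' > 0" "\<And>z. norm (z - letter_map \<Gamma> \<gamma> l c) \<le> r' \<Longrightarrow> word_map \<Gamma> \<gamma> w z = word_map \<Gamma> \<gamma> w (letter_map \<Gamma> \<gamma> l c) + word_map (\<lambda>x. x) \<gamma> w (z - letter_map \<Gamma> \<gamma> l c)"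
    using Cons.IH[of "letter_map \<Gamma> \<gamma> l c"] Cons.prems by auto
  obtain k where k: "0 \<le> k" "\<And>z z'::'a phase. norm (letter_map (\<lambda>x. x) \<gamma> l z - letter_map (\<lambda>x. x) \<gamma> l z') \<le> k * norm (z - z')"
    using letter_map_lipschitz[of 1 \<gamma> l, where 'd='a] by force
  have zero: "letter_map (\<lambda>x. x) \<gamma> l 0 = (0 :: 'a phase)" by (cases l) (simp_all add: zero_prod_def[symmetric])
  show ?case
  proof (intro exI[of _ "min r (r' / (k + 1))"] conjI allI impI)
    fix z assume z: "norm (z - c) \<le> min r (r' / (k + 1))"
    then have "norm (z - c) \<le> r" by simp
    note 1 = r(2)[OF this]
    have "norm (letter_map (\<lambda>x. x) \<gamma> l (z - c)) \<le> k * norm (z - c)" using k(2)[of "z - c" 0] by (simp add: zero)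
    also have "\<dots> \<le> (k + 1) * (r' / (k + 1))" using z k(1) by (intro mult_mono) auto
    also have "\<dots> = r'" using k(1) by simp
    finally have "norm (letter_map \<Gamma> \<gamma> l z - letter_map \<Gamma> \<gamma> l c) \<le> r'" by (simp add: 1)
    from r'(2)[OF this] have "word_map \<Gamma> \<gamma> w (letter_map \<Gamma> \<gamma> l z) = word_map \<Gamma> \<gamma> w (letter_map \<Gamma> \<gamma> l c)
        + word_map (\<lambda>x. x) \<gamma> w (letter_map (\<lambda>x. x) \<gamma> l (z - c))"
      by (simp only: 1 add_diff_cancel_left')
    then show "word_map \<Gamma> \<gamma> (l # w) z = word_map \<Gamma> \<gamma> (l # w) c + word_map (\<lambda>x. x) \<gamma> (l # w) (z - c)"
      by (simp only: word_map_simps)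
  qed (use r(1) r'(1) k(1) in simp)
qed

text \<open>
  The symplectic form stands in for the determinant: \<open>A\<close> and \<open>B\<close> steps with linear force preserve
  it and \<open>O\<close> steps scale it.
\<close>

definition symp :: "'d::finite phase \<Rightarrow> 'd phase \<Rightarrow> real" where
  "symp z z' = fst z \<bullet> snd z' - snd z \<bullet> fst z'"

lemma symp_le: "\<bar>symp z z'\<bar> \<le> 2 * norm z * norm z'"
proof -
  have "\<bar>fst z \<bullet> snd z'\<bar> \<le> norm z * norm z'"
    by (rule order_trans[OF Cauchy_Schwarz_ineq2]) (intro mult_mono norm_fst_snd_le, auto)
  moreover have "\<bar>snd z \<bullet> fst z'\<bar> \<le> norm z * norm z'"
    by (rule order_trans[OF Cauchy_Schwarz_ineq2]) (intro mult_mono norm_fst_snd_le, auto)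
  ultimately show ?thesis unfolding symp_def by linarith
qed

primrec letter_factor :: "real \<Rightarrow> letter \<Rightarrow> real" where
  "letter_factor \<gamma> (A_letter t) = 1"
| "letter_factor \<gamma> (B_letter t) = 1"
| "letter_factor \<gamma> (O_letter t) = exp (- \<gamma> * t)"

lemma symp_word_map:
  "symp (word_map (\<lambda>x. x) \<gamma> w z) (word_map (\<lambda>x. x) \<gamma> w z') = prod_list (map (letter_factor \<gamma>) w) * symp z z'"
proof (induction w arbitrary: z z')
  case (Cons l w)
  have "symp (letter_map (\<lambda>x. x) \<gamma> l z) (letter_map (\<lambda>x. x) \<gamma> l z') = letter_factor \<gamma> l * symp z z'"
    by (cases l) (auto simp: symp_def algebra_simps inner_commute)
  then show ?case using Cons by simp
qed simp

lemma splitting_word_factor: "prod_list (map (letter_factor \<gamma>) (splitting_word s h)) = damping h \<gamma>"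
  by (cases s) (auto simp: damping_def simp flip: exp_add)

lemma cayley_hamilton_2:
  fixes M :: "'d::finite phase \<Rightarrow> 'd phase"
  assumes "\<And>x v. M (x, v) = (a *\<^sub>R x + b *\<^sub>R v, c *\<^sub>R x + d *\<^sub>R v)"
    and "a + d = T" and "a * d - b * c = D"
  shows "M (M z) = T *\<^sub>R M z - D *\<^sub>R z"
  unfolding assms(2,3)[symmetric] by (cases z) (simp add: assms(1) algebra_simps)

text \<open>
  A linear step acts on pairs \<open>(x, v)\<close> as a 2 by 2 matrix of scalars, with determinant \<open>\<beta>\<close>. The
  stability parameter is what its trace lacks from \<open>1 + \<beta>\<close>; in this sense the four schemes
  share one characteristic polynomial.
\<close>

lemma splitting_word_trace:
  fixes z :: "'d::finite phase" and h \<gamma> :: real and s :: splitting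
  defines "M \<equiv> word_map (\<lambda>x::real^'d. x) \<gamma> (splitting_word s h)"
  shows "M (M z) = (1 + damping h \<gamma> - stability_param s h \<gamma>) *\<^sub>R M z - damping h \<gamma> *\<^sub>R z"
proof -
  define r where "r = exp (- \<gamma> * (h / 2))"
  have r2: "exp (- \<gamma> * h) = r * r" and rpos: "0 < r" by (simp_all add: r_def flip: exp_add)
  have sq: "sqrt (damping h \<gamma>) = r" using rpos unfolding damping_def r2 by simp
  have bt: "damping h \<gamma> = r * r" unfolding damping_def r2 by simp
  have stab: "stability_param ABOBA h \<gamma> = h * h / 2 * (1 + r * r)" "stability_param OABAO h \<gamma> = h * h / 2 * (1 + r * r)"
    "stability_param AOBOA h \<gamma> = r * (h * h)" "stability_param BOAOB h \<gamma> = r * (h * h)"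
    unfolding stability_param.simps sq unfolding bt by (simp_all add: power2_eq_square)
  note stab = stab bt and [simp del] = stability_param.simps
  have O1: "letter_map (\<lambda>x::real^'d. x) \<gamma> (O_letter h) z = (fst z, (r * r) *\<^sub>R snd z)" for z
    by (simp only: letter_map.simps r2)
  have O2: "letter_map (\<lambda>x::real^'d. x) \<gamma> (O_letter (h / 2)) z = (fst z, r *\<^sub>R snd z)" for z
    by (simp only: letter_map.simps r_def)
  note [simp] = O1 O2 and [simp del] = letter_map.simps(3)
  show ?thesis
  proof (cases s)
    case ABOBA
    define c where "c = - (1 + r * r) * (h / 2)"
    define d where "d = r * r + c * (h / 2)"
    have "M (x, v) = ((1 + (h/2) * c) *\<^sub>R x + (h/2 + (h/2) * d) *\<^sub>R v, c *\<^sub>R x + d *\<^sub>R v)" for x v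
      by (simp add: ABOBA M_def prod_eq_iff vec_eq_iff c_def d_def field_simps)
    then show ?thesis
      by (rule cayley_hamilton_2) (unfold ABOBA stab c_def d_def, simp_all add: algebra_simps diff_divide_distrib)
  next
    case AOBOA
    define c where "c = - r * h"
    define d where "d = r * r + c * (h / 2)"
    have "M (x, v) = ((1 + (h/2) * c) *\<^sub>R x + (h/2 + (h/2) * d) *\<^sub>R v, c *\<^sub>R x + d *\<^sub>R v)" for x v
      by (simp add: AOBOA M_def prod_eq_iff vec_eq_iff c_def d_def field_simps)
    then show ?thesis
      by (rule cayley_hamilton_2) (unfold AOBOA stab c_def d_def, simp_all add: algebra_simps diff_divide_distrib)
  next
    case BOAOB
    define a where "a = 1 - r * h * (h / 2)"
    have "M (x, v) = (a *\<^sub>R x + (r * h) *\<^sub>R v, (- r * r * (h/2) - a * (h / 2)) *\<^sub>R x + (r * r - r * h * (h/2)) *\<^sub>R v)" for x v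
      by (simp add: BOAOB M_def prod_eq_iff vec_eq_iff a_def field_simps)
    then show ?thesis
      by (rule cayley_hamilton_2) (unfold BOAOB stab a_def, simp_all add: algebra_simps diff_divide_distrib)
  next
    case OABAO
    define d where "d = r - r * h * (h/2)"
    have "M (x, v) = ((1 - h * (h/2)) *\<^sub>R x + (r * (h/2) + (h/2) * d) *\<^sub>R v, (- r * h) *\<^sub>R x + (r * d) *\<^sub>R v)" for x v
      by (simp add: OABAO M_def prod_eq_iff vec_eq_iff d_def field_simps)
    then show ?thesis
      by (rule cayley_hamilton_2) (unfold OABAO stab d_def, simp_all add: algebra_simps diff_divide_distrib)
  qed
qed

section \<open>Adapted norms\<close>

lemma linear_funpow: "linear f \<Longrightarrow> linear (f ^^ n)" for f :: "'a::real_vector \<Rightarrow> 'a"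
  by (induction n) (auto intro: linear_compose linear_id[unfolded id_def] simp: linear_id)

text \<open>
  \<open>N\<close> sums the norms of \<open>M\<^sup>j z\<close> for \<open>j < m\<close> with weights \<open>a\<^sup>j\<close>, where \<open>a\<^sup>m = 2\<close>. Applying \<open>M\<close> shifts
  this sum, and the weighted norm of the entering term \<open>M\<^sup>m z\<close> is at most that of the leaving term \<open>z\<close>.
\<close>

lemma adapted_norm_of_power:
  fixes M :: "'a::euclidean_space \<Rightarrow> 'a"
  assumes M: "linear M" and m: "0 < m" "\<And>z. norm ((M ^^ m) z) \<le> norm z / 2"
  shows "\<exists>N c \<rho>. 0 \<le> \<rho> \<and> \<rho> < 1 \<and> (\<forall>x y. N (x + y) \<le> N x + N y) \<and> (\<forall>a x. N (a *\<^sub>R x) = \<bar>a\<bar> * N x) \<and>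
    (\<forall>z. norm z \<le> N z) \<and> (\<forall>z. N z \<le> c * norm z) \<and> (\<forall>z. N (M z) \<le> \<rho> * N z)"
proof -
  define a where "a = root m 2"
  have a: "a > 1" "a ^ m = 2" using m by (auto simp: a_def)
  define N where "N z = (\<Sum>j<m. a ^ j * norm ((M ^^ j) z))" for z
  have lin: "linear (M ^^ j)" for j by (rule linear_funpow[OF M])
  have "\<exists>B. \<forall>z. norm ((M ^^ j) z) \<le> B * norm z" for j
    using linear_bounded[OF lin[of j]] by blast
  then obtain B where B: "\<And>j z. norm ((M ^^ j) z) \<le> B j * norm z" by metis
  have 1: "N (x + y) \<le> N x + N y" for x y
    unfolding N_def sum.distrib[symmetric]
    using a by (intro sum_mono) (simp add: linear_add[OF lin] norm_triangle_ineq flip: distrib_left)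
  have 2: "N (r *\<^sub>R x) = \<bar>r\<bar> * N x" for r x
    unfolding N_def by (simp add: linear_scale[OF lin] sum_distrib_left mult_ac)
  have 3: "norm z \<le> N z" for z
  proof -
    have "a ^ 0 * norm ((M ^^ 0) z) \<le> N z"
      unfolding N_def using m a by (intro member_le_sum) auto
    then show ?thesis by simp
  qed
  have 4: "N z \<le> (\<Sum>j<m. a ^ j * B j) * norm z" for z
    unfolding N_def sum_distrib_right using a B by (intro sum_mono) (simp add: mult.assoc mult_left_mono)
  have 5: "N (M z) \<le> (1 / a) * N z" for z
  proof -
    let ?f = "\<lambda>j. a ^ j * norm ((M ^^ j) z)"
    have "a * N (M z) = (\<Sum>j<m. ?f (Suc j))"
      unfolding N_def sum_distrib_left by (simp add: funpow_swap1 mult.assoc)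
    also have "\<dots> = N z - norm z + ?f m"
      using sum.lessThan_Suc_shift[of ?f m] unfolding N_def by simp
    also have "\<dots> \<le> N z" using m(2)[of z] a by simp
    finally show ?thesis using a by (simp add: field_simps)
  qed
  show ?thesis
    by (rule exI[of _ N], rule exI[of _ "\<Sum>j<m. a ^ j * B j"], rule exI[of _ "1 / a"])
       (use a 1 2 3 4 5 in auto)
qed

text \<open>
  The condition on \<open>T\<close> is the Schur-Cohn criterion for both roots to lie in the unit disc. A
  quadratic Lyapunov function treats real and complex roots alike: \<open>W\<close> decreases along orbits by a
  multiple of the square of one linear form \<open>a\<close>, and the two values \<open>a z\<close> and \<open>a (M z)\<close> determine \<open>z\<close>,
  so the sum \<open>V\<close> of two consecutive values of \<open>W\<close> decreases geometrically.
\<close>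

lemma adapted_norm:
  fixes M :: "'a::euclidean_space \<Rightarrow> 'a"
  assumes M: "linear M" and CH: "\<And>z. M (M z) = T *\<^sub>R M z - \<beta> *\<^sub>R z"
    and b: "0 < \<beta>" "\<beta> < 1" and T: "\<bar>T\<bar> < 1 + \<beta>"
  shows "\<exists>N c \<rho>. 0 \<le> \<rho> \<and> \<rho> < 1 \<and> (\<forall>x y. N (x + y) \<le> N x + N y) \<and> (\<forall>a x. N (a *\<^sub>R x) = \<bar>a\<bar> * N x) \<and>
    (\<forall>z. norm z \<le> N z) \<and> (\<forall>z. N z \<le> c * norm z) \<and> (\<forall>z. N (M z) \<le> \<rho> * N z)"
proof -
  define S where "S z = (norm (M z))\<^sup>2 + (norm z)\<^sup>2" for z
  define W where "W z = (1 + \<beta>) * S z - 2 * T * (M z \<bullet> z)" for z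
  define V where "V z = W z + W (M z)" for z
  define a where "a z = T *\<^sub>R M z - (1 + \<beta>) *\<^sub>R z" for z
  define \<Delta> where "\<Delta> = (1 + \<beta>)\<^sup>2 - T\<^sup>2"
  have D: "\<Delta> > 0" using power_strict_mono[OF T, of 2] by (simp add: \<Delta>_def)
  have S0: "0 \<le> S z" for z by (simp add: S_def)
  have W_diff: "W z - W (M z) = (1 - \<beta>) * (norm (a z))\<^sup>2" for z
    unfolding W_def S_def a_def CH power2_norm_eq_inner
    by (simp add: inner_commute algebra_simps power2_eq_square)
  have cross: "\<bar>2 * (M z \<bullet> z)\<bar> \<le> S z" for z
  proof -
    have "\<bar>M z \<bullet> z\<bar> \<le> norm (M z) * norm z" by (rule Cauchy_Schwarz_ineq2)
    moreover have "0 \<le> (norm (M z) - norm z)\<^sup>2" by simp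
    ultimately show ?thesis unfolding S_def power2_diff by linarith
  qed
  have W_lower: "(1 + \<beta> - \<bar>T\<bar>) * S z \<le> W z" for z
  proof -
    have "T * (2 * (M z \<bullet> z)) \<le> \<bar>T\<bar> * S z"
      using cross[of z] by (metis abs_ge_self abs_ge_zero abs_mult mult_left_mono order_trans)
    then show ?thesis by (simp add: W_def algebra_simps)
  qed
  have W_upper: "W z \<le> (1 + \<beta> + \<bar>T\<bar>) * S z" for z
  proof -
    have "- (T * (2 * (M z \<bullet> z))) \<le> \<bar>T\<bar> * S z"
      using cross[of z] by (metis abs_ge_minus_self abs_ge_zero abs_mult mult_left_mono order_trans)
    then show ?thesis by (simp add: W_def algebra_simps)
  qed
  have sq: "(norm (p *\<^sub>R x - q *\<^sub>R y))\<^sup>2 \<le> 2 * p\<^sup>2 * (norm x)\<^sup>2 + 2 * q\<^sup>2 * (norm y)\<^sup>2" for p q and x y :: 'a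
  proof -
    have "(norm (p *\<^sub>R x - q *\<^sub>R y))\<^sup>2 \<le> (norm (p *\<^sub>R x) + norm (q *\<^sub>R y))\<^sup>2"
      by (intro power_mono norm_triangle_ineq4) auto
    also have "\<dots> \<le> 2 * (norm (p *\<^sub>R x))\<^sup>2 + 2 * (norm (q *\<^sub>R y))\<^sup>2"
      using zero_le_power2[of "norm (p *\<^sub>R x) - norm (q *\<^sub>R y)"] by (simp add: power2_sum power2_diff)
    finally show ?thesis by (simp add: power_mult_distrib)
  qed
  \<comment> \<open>These identities invert the linear system for \<open>z\<close> and \<open>M z\<close>, whose determinant is \<open>\<Delta>\<close>.\<close>
  have z_eq: "\<Delta> *\<^sub>R z = (T\<^sup>2 - 1 - \<beta>) *\<^sub>R a z - T *\<^sub>R a (M z)" for z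
    by (simp add: a_def CH \<Delta>_def algebra_simps power2_eq_square; simp only: mult_2 mult_2_right scaleR_add_left)
  have Mz_eq: "\<Delta> *\<^sub>R M z = (T * \<beta>) *\<^sub>R a z - (1 + \<beta>) *\<^sub>R a (M z)" for z
    by (simp add: a_def CH \<Delta>_def algebra_simps power2_eq_square; simp only: mult_2 mult_2_right scaleR_add_left)
  define K where "K = 2 * (T\<^sup>2 - 1 - \<beta>)\<^sup>2 + 2 * T\<^sup>2 + 2 * (T * \<beta>)\<^sup>2 + 2 * (1 + \<beta>)\<^sup>2"
  have K: "0 < K" using b by (simp add: K_def add_nonneg_pos)
  have S_le: "\<Delta>\<^sup>2 * S z \<le> K * ((norm (a z))\<^sup>2 + (norm (a (M z)))\<^sup>2)" for z
  proof -
    have "\<Delta>\<^sup>2 * S z = (norm (\<Delta> *\<^sub>R M z))\<^sup>2 + (norm (\<Delta> *\<^sub>R z))\<^sup>2"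
      by (simp add: S_def power_mult_distrib distrib_left)
    also have "\<dots> \<le> (2 * (T * \<beta>)\<^sup>2 * (norm (a z))\<^sup>2 + 2 * (1 + \<beta>)\<^sup>2 * (norm (a (M z)))\<^sup>2)
        + (2 * (T\<^sup>2 - 1 - \<beta>)\<^sup>2 * (norm (a z))\<^sup>2 + 2 * T\<^sup>2 * (norm (a (M z)))\<^sup>2)"
      unfolding Mz_eq z_eq[of z] by (intro add_mono sq)
    also have "\<dots> \<le> K * ((norm (a z))\<^sup>2 + (norm (a (M z)))\<^sup>2)"
      by (simp add: K_def algebra_simps)
    finally show ?thesis .
  qed
  have S_M: "S (M z) \<le> (1 + 2 * T\<^sup>2 + 2 * \<beta>\<^sup>2) * S z" for z
    using sq[of T "M z" \<beta> z] unfolding S_def CH by (simp add: algebra_simps) (smt (verit) mult_nonneg_nonneg zero_le_power2)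
  define C where "C = (1 + \<beta> + \<bar>T\<bar>) * (2 + 2 * T\<^sup>2 + 2 * \<beta>\<^sup>2)"
  have C: "0 < C" using b by (auto simp: C_def intro!: mult_pos_pos add_pos_nonneg)
  have V_upper: "V z \<le> C * S z" for z
  proof -
    have "V z \<le> (1 + \<beta> + \<bar>T\<bar>) * S z + (1 + \<beta> + \<bar>T\<bar>) * ((1 + 2 * T\<^sup>2 + 2 * \<beta>\<^sup>2) * S z)"
      unfolding V_def using b by (intro add_mono W_upper order_trans[OF W_upper] mult_left_mono S_M) auto
    then show ?thesis by (simp add: C_def algebra_simps)
  qed
  have V_lower: "(1 + \<beta> - \<bar>T\<bar>) * S z \<le> V z" for z
    using W_lower[of z] W_lower[of "M z"] S0[of "M z"] T by (simp add: V_def) (smt (verit) mult_nonneg_nonneg)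
  define \<eta> where "\<eta> = (1 - \<beta>) * \<Delta>\<^sup>2 / K / C"
  have \<eta>: "0 < \<eta>" using b D K C by (simp add: \<eta>_def)
  have V_dec: "V (M z) \<le> V z - \<eta> * V z" for z
  proof -
    have "V z - V (M z) = (1 - \<beta>) * ((norm (a z))\<^sup>2 + (norm (a (M z)))\<^sup>2)"
      using W_diff[of z] W_diff[of "M z"] by (simp add: V_def algebra_simps)
    also have "\<dots> \<ge> (1 - \<beta>) * (\<Delta>\<^sup>2 * S z / K)"
      using S_le[of z] K b by (intro mult_left_mono) (simp_all add: field_simps)
    also have "(1 - \<beta>) * (\<Delta>\<^sup>2 * S z / K) = \<eta> * (C * S z)"
      using C K by (simp add: \<eta>_def)
    also have "\<dots> \<ge> \<eta> * V z" using \<eta> V_upper[of z] by (intro mult_left_mono) auto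
    finally show ?thesis by linarith
  qed
  define q where "q = max 0 (1 - \<eta>)"
  have q: "0 \<le> q" "q < 1" using \<eta> by (auto simp: q_def)
  have V0: "0 \<le> V z" for z
    using V_lower[of z] S0[of z] T by (smt (verit) mult_nonneg_nonneg)
  have V_iter: "V ((M ^^ n) z) \<le> q ^ n * V z" for n z
  proof (induction n)
    case (Suc n)
    have "V ((M ^^ Suc n) z) \<le> (1 - \<eta>) * V ((M ^^ n) z)" using V_dec[of "(M ^^ n) z"] by (simp add: algebra_simps)
    also have "\<dots> \<le> q * V ((M ^^ n) z)" using V0 by (intro mult_right_mono) (auto simp: q_def)
    also have "\<dots> \<le> q * (q ^ n * V z)" using Suc q by (intro mult_left_mono)
    finally show ?case by simp
  qed simp
  obtain B where B: "B > 0" "\<And>z. norm (M z) \<le> B * norm z"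
    using linear_bounded_pos[OF M] by blast
  have S_norm: "S z \<le> (B\<^sup>2 + 1) * (norm z)\<^sup>2" for z
    using power_mono[OF B(2)[of z], of 2] by (simp add: S_def power_mult_distrib algebra_simps)
  define L where "L = 1 + \<beta> - \<bar>T\<bar>"
  have L: "0 < L" using T by (simp add: L_def)
  have "(\<lambda>n. q ^ n * (C * (B\<^sup>2 + 1))) \<longlonglongrightarrow> 0 * (C * (B\<^sup>2 + 1))"
    using q by (intro tendsto_mult LIMSEQ_power_zero tendsto_const) auto
  then have "\<forall>\<^sub>F n in sequentially. q ^ n * (C * (B\<^sup>2 + 1)) < L / 4"
    using L by (intro order_tendstoD) auto
  moreover have "\<forall>\<^sub>F n::nat in sequentially. 0 < n" by (rule eventually_gt_at_top)
  ultimately have "\<exists>m. q ^ m * (C * (B\<^sup>2 + 1)) < L / 4 \<and> 0 < m"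
    using eventually_happens'[OF sequentially_bot eventually_conj] by blast
  then obtain m where m: "q ^ m * (C * (B\<^sup>2 + 1)) < L / 4" "0 < m" by blast
  have half: "norm ((M ^^ m) z) \<le> norm z / 2" for z
  proof -
    have "L * (norm ((M ^^ m) z))\<^sup>2 \<le> L * S ((M ^^ m) z)"
      using L by (intro mult_left_mono) (auto simp: S_def)
    also have "\<dots> \<le> q ^ m * V z" using V_lower V_iter unfolding L_def by (rule order_trans)
    also have "\<dots> \<le> q ^ m * (C * ((B\<^sup>2 + 1) * (norm z)\<^sup>2))"
      using q C by (intro mult_left_mono order_trans[OF V_upper] S_norm) auto
    also have "\<dots> \<le> L / 4 * (norm z)\<^sup>2"
      using mult_right_mono[OF less_imp_le[OF m(1)], of "(norm z)\<^sup>2"] by (simp add: mult_ac)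
    also have "\<dots> = L * (norm z / 2)\<^sup>2" by (simp add: power2_eq_square)
    finally have "(norm ((M ^^ m) z))\<^sup>2 \<le> (norm z / 2)\<^sup>2" using L by simp
    then show ?thesis by (rule power2_le_imp_le) simp
  qed
  show ?thesis by (rule adapted_norm_of_power[OF M m(2) half])
qed

section \<open>Invariant laws from drift and minorization\<close>

text \<open>
  Nummelin's regeneration argument. From a point of \<open>C\<close> the chain renews itself, that is,
  forgets its position and restarts from \<open>\<nu>\<close>, with probability \<open>\<epsilon>\<close>. Killing it at the first
  renewal leaves the sub-Markov kernel \<open>residual\<close>, which dies out because of the drift. The time which
  the killed chain, started from \<open>\<nu>\<close>, spends in a set is then, up to normalization, the only
  invariant law.
\<close>

locale drift_minorization =
  fixes K :: "'a::topological_space \<Rightarrow> 'a measure" and C :: "'a set" and \<nu> :: "'a measure"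
    and \<epsilon> l b :: real and V :: "'a \<Rightarrow> real"
  assumes kernel: "K \<in> borel \<rightarrow>\<^sub>M prob_algebra borel"
    and C_meas [measurable]: "C \<in> sets borel"
    and nu: "prob_space \<nu>" and sets_nu [simp, measurable_cong]: "sets \<nu> = sets borel"
    and eps: "0 < \<epsilon>"
    and minor: "\<And>z A. z \<in> C \<Longrightarrow> A \<in> sets borel \<Longrightarrow> ennreal \<epsilon> * emeasure \<nu> A \<le> emeasure (K z) A"
    and V_meas [measurable]: "V \<in> borel_measurable borel"
    and V_ge: "\<And>z. 1 \<le> V z"
    and l: "0 \<le> l" "l < 1" and b: "0 \<le> b"
    and drift: "\<And>z. (\<integral>\<^sup>+y. ennreal (V y) \<partial>K z) \<le> ennreal (l * V z + b * indicator C z)"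
    and nu_V: "(\<integral>\<^sup>+y. ennreal (V y) \<partial>\<nu>) < \<infinity>"
begin

lemma sets_K [simp, measurable_cong]: "sets (K z) = sets borel"
  using measurable_space[OF kernel, of z] by (simp add: space_prob_algebra)

lemma prob_K: "prob_space (K z)"
  using measurable_space[OF kernel, of z] by (simp add: space_prob_algebra)

lemma K_subprob [measurable]: "K \<in> borel \<rightarrow>\<^sub>M subprob_algebra borel"
  using kernel by (rule measurable_prob_algebraD)

lemma space_nu [simp]: "space \<nu> = UNIV"
  using sets_eq_imp_space_eq[OF sets_nu] by simp

lemma space_K [simp]: "space (K z) = UNIV"
  using sets_eq_imp_space_eq[OF sets_K] by simp

definition residual :: "'a \<Rightarrow> 'a measure" where
  "residual z = diff_measure (K z) (scale_measure (ennreal \<epsilon> * indicator C z) \<nu>)"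

lemma sets_residual [simp, measurable_cong]: "sets (residual z) = sets borel"
  by (simp add: residual_def)

lemma space_residual [simp]: "space (residual z) = UNIV"
  by (simp add: residual_def)

lemma minor': "A \<in> sets borel \<Longrightarrow> ennreal \<epsilon> * indicator C z * emeasure \<nu> A \<le> emeasure (K z) A"
  using minor[of z A] by (auto simp: indicator_def)

lemma emeasure_nu_le: "emeasure \<nu> A \<le> 1"
  using prob_space.emeasure_le_1[OF nu] .

lemma emeasure_residual:
  assumes "A \<in> sets borel"
  shows "emeasure (residual z) A = emeasure (K z) A - ennreal \<epsilon> * indicator C z * emeasure \<nu> A"
proof -
  have "finite_measure (scale_measure (ennreal \<epsilon> * indicator C z) \<nu>)"
    using emeasure_nu_le[of UNIV]
    by (intro finite_measureI) (auto simp: space_scale_measure ennreal_mult_eq_top_iff indicator_def top_unique)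
  then show ?thesis
    unfolding residual_def using assms minor'
    by (subst emeasure_diff_measure) (auto intro: prob_space.finite_measure[OF prob_K])
qed

lemma K_decomp:
  assumes A: "A \<in> sets borel"
  shows "emeasure (K z) A = emeasure (residual z) A + ennreal \<epsilon> * indicator C z * emeasure \<nu> A"
  unfolding emeasure_residual[OF A] using minor'[OF A, of z] by (simp add: diff_add_cancel_ennreal)

lemma residual_kernel [measurable]: "residual \<in> borel \<rightarrow>\<^sub>M subprob_algebra borel"
proof (rule measurable_subprob_algebra)
  fix z
  have "emeasure (residual z) UNIV \<le> emeasure (K z) UNIV"
    using K_decomp[of UNIV z] by simp
  then show "subprob_space (residual z)"
    using prob_space.emeasure_space_1[OF prob_K[of z]] by (intro subprob_spaceI) auto
next
  fix A :: "'a set" assume [measurable]: "A \<in> sets borel"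
  show "(\<lambda>z. emeasure (residual z) A) \<in> borel_measurable borel"
    unfolding emeasure_residual[OF \<open>A \<in> sets borel\<close>] by measurable
qed simp

lemma nn_integral_K_decomp:
  assumes "f \<in> borel_measurable borel"
  shows "(\<integral>\<^sup>+y. f y \<partial>K z) = (\<integral>\<^sup>+y. f y \<partial>residual z) + ennreal \<epsilon> * indicator C z * (\<integral>\<^sup>+y. f y \<partial>\<nu>)"
  using assms
proof (induction rule: borel_measurable_induct)
  case (cong f g) then show ?case by (simp cong: nn_integral_cong)
next
  case (set A) then show ?case using K_decomp[of A z] by simp
next
  case (mult u c)
  then show ?case by (simp add: nn_integral_cmult distrib_left mult_ac)
next
  case (add u v) then show ?case by (simp add: nn_integral_add distrib_left add_ac)
next
  case (seq U)
  have [measurable]: "U i \<in> borel_measurable borel" for i by fact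
  have "(\<integral>\<^sup>+y. (SUP i. U i y) \<partial>M) = (SUP i. \<integral>\<^sup>+y. U i y \<partial>M)" if "sets M = sets borel" for M :: "'a measure"
    using that seq.hyps by (intro nn_integral_monotone_convergence_SUP) (auto cong: measurable_cong_sets)
  note * = this
  have inc: "incseq (\<lambda>i. \<integral>\<^sup>+y. U i y \<partial>M)" for M
    using \<open>incseq U\<close> by (auto simp: incseq_def le_fun_def intro!: nn_integral_mono)
  have inc': "incseq (\<lambda>i. ennreal \<epsilon> * indicator C z * (\<integral>\<^sup>+y. U i y \<partial>\<nu>))"
    using incseqD[OF inc[of \<nu>]] by (auto intro!: incseq_SucI mult_left_mono)
  show ?case
    unfolding SUP_apply *[OF sets_K] *[OF sets_residual] *[OF sets_nu] SUP_mult_left_ennreal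
    unfolding ennreal_SUP_add[OF inc inc', symmetric] by (simp add: seq.IH)
qed

primrec Rn :: "nat \<Rightarrow> 'a \<Rightarrow> 'a measure" where
  "Rn 0 z = return borel z"
| "Rn (Suc n) z = Rn n z \<bind> residual"

lemma Rn_kernel [measurable]: "Rn n \<in> borel \<rightarrow>\<^sub>M subprob_algebra borel"
proof (induction n)
  case 0 show ?case by (simp add: return_measurable)
next
  case (Suc n) then show ?case by (simp add: measurable_bind2[OF Suc residual_kernel])
qed

lemma sets_Rn [simp, measurable_cong]: "sets (Rn n z) = sets borel"
  using measurable_space[OF Rn_kernel, of z n] by (simp add: space_subprob_algebra)

lemma space_Rn [simp]: "space (Rn n z) = UNIV"
  using sets_eq_imp_space_eq[OF sets_Rn] by simp

lemma Rn_Suc_left: "Rn (Suc n) z = residual z \<bind> Rn n"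
proof (induction n)
  case 0 show ?case by (simp add: bind_return[OF residual_kernel] bind_return'')
next
  case (Suc n)
  have "Rn (Suc (Suc n)) z = (residual z \<bind> Rn n) \<bind> residual" using Suc by simp
  also have "\<dots> = residual z \<bind> (\<lambda>x. Rn n x \<bind> residual)"
    by (rule bind_assoc) measurable
  finally show ?case by simp
qed

lemma nn_integral_Rn_Suc:
  "f \<in> borel_measurable borel \<Longrightarrow> (\<integral>\<^sup>+y. f y \<partial>Rn (Suc n) z) = (\<integral>\<^sup>+x. \<integral>\<^sup>+y. f y \<partial>residual x \<partial>Rn n z)"
  by (simp add: nn_integral_bind[of _ borel])

text \<open>
  The total mass is split into what has been killed before time \<open>n\<close> and what is still alive.
\<close>

lemma Rn_mass: "(\<Sum>k<n. ennreal \<epsilon> * emeasure (Rn k z) C) + emeasure (Rn n z) UNIV = 1"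
proof (induction n)
  case 0 show ?case by simp
next
  case (Suc n)
  have "emeasure (Rn n z) UNIV = (\<integral>\<^sup>+x. emeasure (K x) UNIV \<partial>Rn n z)"
    using prob_space.emeasure_space_1[OF prob_K] by simp
  also have "\<dots> = (\<integral>\<^sup>+x. emeasure (residual x) UNIV + ennreal \<epsilon> * indicator C x \<partial>Rn n z)"
    using prob_space.emeasure_space_1[OF nu] by (simp add: K_decomp)
  also have "\<dots> = emeasure (Rn (Suc n) z) UNIV + ennreal \<epsilon> * emeasure (Rn n z) C"
    by (subst nn_integral_add) (auto simp: nn_integral_cmult emeasure_bind[of _ _ borel])
  finally show ?case using Suc by (simp add: ac_simps)
qed

lemma sum_C_le: "(\<Sum>k<n. emeasure (Rn k z) C) \<le> ennreal (1 / \<epsilon>)"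
proof -
  have "ennreal \<epsilon> * (\<Sum>k<n. emeasure (Rn k z) C) \<le> 1"
    using Rn_mass[of z n] by (metis le_add_same_cancel1 le_iff_add sum_distrib_left)
  then have "ennreal (1/\<epsilon>) * (ennreal \<epsilon> * (\<Sum>k<n. emeasure (Rn k z) C)) \<le> ennreal (1/\<epsilon>) * 1"
    by (rule mult_left_mono) simp
  then show ?thesis using eps by (simp add: mult.assoc[symmetric] flip: ennreal_mult)
qed

text \<open>
  The drift inequality telescopes along the killed chain; its constant term is collected only on
  visits to \<open>C\<close>, whose expected number is at most \<open>1 / \<epsilon>\<close> because each of them kills with
  probability \<open>\<epsilon>\<close>.
\<close>

lemma sum_V_le:
  "(\<Sum>k<n. \<integral>\<^sup>+y. ennreal (V y) \<partial>Rn k z) \<le> ennreal ((V z + b / \<epsilon>) / (1 - l))"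
proof (induction n)
  case 0 show ?case by simp
next
  case (Suc n)
  let ?B = "(V z + b / \<epsilon>) / (1 - l)"
  have B0: "0 \<le> ?B" using V_ge[of z] b eps l by simp
  have step: "(\<integral>\<^sup>+y. ennreal (V y) \<partial>Rn (Suc k) z) \<le> ennreal l * (\<integral>\<^sup>+y. ennreal (V y) \<partial>Rn k z) + ennreal b * emeasure (Rn k z) C" for k
  proof -
    have "(\<integral>\<^sup>+y. ennreal (V y) \<partial>Rn (Suc k) z) = (\<integral>\<^sup>+x. \<integral>\<^sup>+y. ennreal (V y) \<partial>residual x \<partial>Rn k z)"
      by (rule nn_integral_Rn_Suc) simp
    also have "\<dots> \<le> (\<integral>\<^sup>+x. \<integral>\<^sup>+y. ennreal (V y) \<partial>K x \<partial>Rn k z)"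
      by (intro nn_integral_mono) (simp add: nn_integral_K_decomp)
    also have "\<dots> \<le> (\<integral>\<^sup>+x. ennreal l * ennreal (V x) + ennreal b * indicator C x \<partial>Rn k z)"
    proof (rule nn_integral_mono)
      fix x
      have "ennreal (l * V x + b * indicator C x) = ennreal l * ennreal (V x) + ennreal b * indicator C x"
        using l b V_ge[of x] by (simp add: ennreal_mult ennreal_plus indicator_def)
      then show "(\<integral>\<^sup>+y. ennreal (V y) \<partial>K x) \<le> ennreal l * ennreal (V x) + ennreal b * indicator C x"
        using drift[of x] by simp
    qed
    also have "\<dots> = ennreal l * (\<integral>\<^sup>+y. ennreal (V y) \<partial>Rn k z) + ennreal b * emeasure (Rn k z) C"
      by (subst nn_integral_add) (auto simp: nn_integral_cmult)
    finally show ?thesis .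
  qed
  have "(\<Sum>k<Suc n. \<integral>\<^sup>+y. ennreal (V y) \<partial>Rn k z) = (\<integral>\<^sup>+y. ennreal (V y) \<partial>Rn 0 z) + (\<Sum>k<n. \<integral>\<^sup>+y. ennreal (V y) \<partial>Rn (Suc k) z)"
    by (rule sum.lessThan_Suc_shift)
  also have "\<dots> \<le> ennreal (V z) + (\<Sum>k<n. ennreal l * (\<integral>\<^sup>+y. ennreal (V y) \<partial>Rn k z) + ennreal b * emeasure (Rn k z) C)"
    by (intro add_mono sum_mono step) (simp add: nn_integral_return)
  also have "\<dots> = ennreal (V z) + (ennreal l * (\<Sum>k<n. \<integral>\<^sup>+y. ennreal (V y) \<partial>Rn k z) + ennreal b * (\<Sum>k<n. emeasure (Rn k z) C))"
    by (simp add: sum.distrib sum_distrib_left)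
  also have "\<dots> \<le> ennreal (V z) + (ennreal l * ennreal ?B + ennreal b * ennreal (1 / \<epsilon>))"
    by (intro add_mono mult_left_mono Suc sum_C_le) auto
  also have "\<dots> = ennreal (V z + (l * ?B + b * (1/\<epsilon>)))"
    using l b eps B0 V_ge[of z] by (simp add: ennreal_mult ennreal_plus del: times_divide_eq_right)
  also have "V z + (l * ?B + b * (1/\<epsilon>)) = ?B"
    using l eps by (simp add: field_simps)
  finally show ?case .
qed

lemma suminf_V_le: "(\<Sum>k. \<integral>\<^sup>+y. ennreal (V y) \<partial>Rn k z) \<le> ennreal ((V z + b / \<epsilon>) / (1 - l))"
  by (rule suminf_le_const) (auto intro: sum_V_le)

lemma Rn_le_V: "emeasure (Rn k z) A \<le> (\<integral>\<^sup>+y. ennreal (V y) \<partial>Rn k z)"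
proof -
  have "emeasure (Rn k z) A \<le> emeasure (Rn k z) UNIV" by (rule emeasure_mono) auto
  also have "\<dots> = (\<integral>\<^sup>+y. 1 \<partial>Rn k z)" by simp
  also have "\<dots> \<le> (\<integral>\<^sup>+y. ennreal (V y) \<partial>Rn k z)"
    using V_ge by (intro nn_integral_mono) simp
  finally show ?thesis .
qed

lemma Rn_tendsto_0: "(\<lambda>n. emeasure (Rn n z) A) \<longlonglongrightarrow> 0"
proof -
  have "(\<Sum>k. emeasure (Rn k z) A) \<le> (\<Sum>k. \<integral>\<^sup>+y. ennreal (V y) \<partial>Rn k z)"
    by (intro suminf_le Rn_le_V) auto
  also have "\<dots> < \<infinity>" using suminf_V_le[of z] by (simp add: le_less_trans)
  finally have "(\<Sum>k. emeasure (Rn k z) A) \<noteq> \<infinity>" by simp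
  moreover have fin: "emeasure (Rn k z) A = ennreal (measure (Rn k z) A)" for k
    using subprob_space.subprob_emeasure_le_1[OF subprob_space_kernel[OF Rn_kernel], of z k A]
    by (intro emeasure_eq_ennreal_measure) (auto simp: top_unique)
  ultimately have "summable (\<lambda>k. measure (Rn k z) A)"
    by (intro summable_suminf_not_top) auto
  from tendsto_ennrealI[OF summable_LIMSEQ_zero[OF this]] show ?thesis by (simp add: fin)
qed

text \<open>
  The expected time which the killed chain, started from \<open>\<nu>\<close>, spends in a set.
\<close>

definition occupation :: "'a measure" where
  "occupation = count_space UNIV \<bind> (\<lambda>n. \<nu> \<bind> Rn n)"

lemma nu_Rn: "(\<lambda>n. \<nu> \<bind> Rn n) \<in> count_space UNIV \<rightarrow>\<^sub>M subprob_algebra borel"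
proof -
  have "\<nu> \<in> space (subprob_algebra borel)"
    using nu by (simp add: space_subprob_algebra prob_space_imp_subprob_space)
  then have "\<nu> \<bind> Rn n \<in> space (subprob_algebra borel)" for n
    by (intro measurable_space[OF measurable_bind2[OF measurable_ident_sets[OF refl] Rn_kernel]])
  then show ?thesis by auto
qed

lemma sets_occupation [simp, measurable_cong]: "sets occupation = sets borel"
  unfolding occupation_def by (rule sets_bind) (use measurable_space[OF nu_Rn] in \<open>auto simp: space_subprob_algebra\<close>)

lemma space_occupation [simp]: "space occupation = UNIV"
  using sets_eq_imp_space_eq[OF sets_occupation] by simp

lemma nn_integral_occupation:
  assumes [measurable]: "f \<in> borel_measurable borel"
  shows "(\<integral>\<^sup>+x. f x \<partial>occupation) = (\<Sum>n. \<integral>\<^sup>+x. \<integral>\<^sup>+y. f y \<partial>Rn n x \<partial>\<nu>)"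
proof -
  have "(\<integral>\<^sup>+x. f x \<partial>(\<nu> \<bind> Rn n)) = (\<integral>\<^sup>+x. \<integral>\<^sup>+y. f y \<partial>Rn n x \<partial>\<nu>)" for n
    by (rule nn_integral_bind[of _ borel]) measurable
  then show ?thesis
    unfolding occupation_def
    by (subst nn_integral_bind[OF assms nu_Rn]) (simp add: nn_integral_count_space_nat)
qed

lemma emeasure_occupation:
  assumes A: "A \<in> sets borel"
  shows "emeasure occupation A = (\<Sum>n. \<integral>\<^sup>+x. emeasure (Rn n x) A \<partial>\<nu>)"
  using nn_integral_occupation[of "indicator A"] A by simp

lemma occupation_V: "(\<integral>\<^sup>+x. ennreal (V x) \<partial>occupation) < \<infinity>"
proof -
  have "(\<integral>\<^sup>+x. ennreal (V x) \<partial>occupation) = (\<integral>\<^sup>+x. (\<Sum>n. \<integral>\<^sup>+y. ennreal (V y) \<partial>Rn n x) \<partial>\<nu>)"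
    by (simp add: nn_integral_occupation nn_integral_suminf)
  also have "\<dots> \<le> (\<integral>\<^sup>+x. ennreal (1 / (1 - l)) * ennreal (V x) + ennreal (b / \<epsilon> / (1 - l)) \<partial>\<nu>)"
  proof (rule nn_integral_mono)
    fix x
    have "ennreal ((V x + b / \<epsilon>) / (1 - l)) = ennreal (1 / (1 - l)) * ennreal (V x) + ennreal (b / \<epsilon> / (1 - l))"
      using V_ge[of x] l b eps by (simp add: add_divide_distrib flip: ennreal_plus ennreal_mult)
    then show "(\<Sum>n. \<integral>\<^sup>+y. ennreal (V y) \<partial>Rn n x) \<le> ennreal (1 / (1 - l)) * ennreal (V x) + ennreal (b / \<epsilon> / (1 - l))"
      using suminf_V_le[of x] by simp
  qed
  also have "\<dots> = ennreal (1 / (1 - l)) * (\<integral>\<^sup>+x. ennreal (V x) \<partial>\<nu>) + ennreal (b / \<epsilon> / (1 - l))"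
    using prob_space.emeasure_space_1[OF nu] by (subst nn_integral_add) (auto simp: nn_integral_cmult)
  also have "\<dots> < \<infinity>" using nu_V by (simp add: ennreal_mult_less_top)
  finally show ?thesis .
qed

lemma occupation_mass_finite: "emeasure occupation UNIV < \<infinity>"
proof -
  have "emeasure occupation UNIV = (\<integral>\<^sup>+x. 1 \<partial>occupation)" by simp
  also have "\<dots> \<le> (\<integral>\<^sup>+x. ennreal (V x) \<partial>occupation)"
    using V_ge by (intro nn_integral_mono) simp
  finally show ?thesis using occupation_V by (rule le_less_trans)
qed

lemma occupation_mass_pos: "1 \<le> emeasure occupation UNIV"
proof -
  have "(\<Sum>n<1. \<integral>\<^sup>+x. emeasure (Rn n x) UNIV \<partial>\<nu>) \<le> emeasure occupation UNIV"
    unfolding emeasure_occupation[of UNIV, simplified] by (rule sum_le_suminf) auto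
  then show ?thesis using prob_space.emeasure_space_1[OF nu] by simp
qed

text \<open>
  Almost surely the killed chain is killed exactly once.
\<close>

lemma occupation_C: "ennreal \<epsilon> * emeasure occupation C = 1"
proof -
  have "ennreal \<epsilon> * (\<Sum>n. emeasure (Rn n x) C) = 1" for x
  proof -
    have "(\<lambda>n. (\<Sum>k<n. ennreal \<epsilon> * emeasure (Rn k x) C) + emeasure (Rn n x) UNIV) \<longlonglongrightarrow> (\<Sum>k. ennreal \<epsilon> * emeasure (Rn k x) C) + 0"
      by (intro tendsto_add summable_LIMSEQ summableI Rn_tendsto_0)
    then have "(\<lambda>n::nat. 1::ennreal) \<longlonglongrightarrow> (\<Sum>k. ennreal \<epsilon> * emeasure (Rn k x) C)"
      by (simp only: Rn_mass add_0_right)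
    then have "(\<Sum>k. ennreal \<epsilon> * emeasure (Rn k x) C) = 1"
      by (simp add: LIMSEQ_const_iff)
    then show ?thesis by (simp add: ennreal_suminf_cmult)
  qed
  then have "1 = (\<integral>\<^sup>+x. ennreal \<epsilon> * (\<Sum>n. emeasure (Rn n x) C) \<partial>\<nu>)"
    using prob_space.emeasure_space_1[OF nu] by simp
  also have "\<dots> = ennreal \<epsilon> * (\<Sum>n. \<integral>\<^sup>+x. emeasure (Rn n x) C \<partial>\<nu>)"
    by (simp add: nn_integral_cmult nn_integral_suminf)
  finally show ?thesis by (simp add: emeasure_occupation)
qed

text \<open>
  A step of \<open>K\<close> is a step of the killed chain or a renewal. The former shifts the series for the
  occupation measure by one; renewals happen at total rate one and supply the missing term \<open>n = 0\<close>.
\<close>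

lemma occupation_invariant:
  assumes A [measurable]: "A \<in> sets borel"
  shows "(\<integral>\<^sup>+x. emeasure (K x) A \<partial>occupation) = emeasure occupation A"
proof -
  have "(\<integral>\<^sup>+x. emeasure (K x) A \<partial>occupation) = (\<integral>\<^sup>+x. emeasure (residual x) A + ennreal \<epsilon> * emeasure \<nu> A * indicator C x \<partial>occupation)"
    by (simp add: K_decomp mult_ac)
  also have "\<dots> = (\<integral>\<^sup>+x. emeasure (residual x) A \<partial>occupation) + (ennreal \<epsilon> * emeasure occupation C) * emeasure \<nu> A"
    by (subst nn_integral_add, simp, simp, subst nn_integral_cmult_indicator) (simp_all add: mult_ac)
  also have "(\<integral>\<^sup>+x. emeasure (residual x) A \<partial>occupation) = (\<Sum>n. \<integral>\<^sup>+x. emeasure (Rn (Suc n) x) A \<partial>\<nu>)"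
    by (subst nn_integral_occupation) (auto simp: emeasure_bind[of _ _ borel])
  also have "emeasure \<nu> A = (\<integral>\<^sup>+x. emeasure (Rn 0 x) A \<partial>\<nu>)"
    by simp
  finally have "(\<integral>\<^sup>+x. emeasure (K x) A \<partial>occupation) = (\<Sum>n. \<integral>\<^sup>+x. emeasure (Rn (Suc n) x) A \<partial>\<nu>) + (\<integral>\<^sup>+x. emeasure (Rn 0 x) A \<partial>\<nu>)"
    unfolding occupation_C by simp
  also have "\<dots> = (\<Sum>n. \<integral>\<^sup>+x. emeasure (Rn n x) A \<partial>\<nu>)"
    using suminf_offset[of "\<lambda>n. \<integral>\<^sup>+x. emeasure (Rn n x) A \<partial>\<nu>" 1] by (simp add: add.commute)
  finally show ?thesis by (simp add: emeasure_occupation)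
qed

text \<open>
  Decomposing \<open>\<pi> = \<pi> \<bind> K\<close> repeatedly by the last renewal peels off the terms of the occupation
  measure, and the remainder vanishes because the killed chain dies out.
\<close>

lemma invariant_eq_occupation:
  assumes inv: "invariant_law K \<pi>" and A [measurable]: "A \<in> sets borel"
  shows "emeasure \<pi> A = ennreal \<epsilon> * emeasure \<pi> C * emeasure occupation A"
proof -
  have pi: "prob_space \<pi>" and [simp, measurable_cong]: "sets \<pi> = sets borel" and piK: "\<pi> \<bind> K = \<pi>"
    using inv by (auto simp: invariant_law_def)
  have [simp]: "space \<pi> = UNIV" using sets_eq_imp_space_eq[of \<pi> borel] by simp
  let ?a = "\<lambda>n. \<integral>\<^sup>+x. emeasure (Rn n x) A \<partial>\<pi>"
  let ?b = "\<lambda>n. \<integral>\<^sup>+x. emeasure (Rn n x) A \<partial>\<nu>"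
  have step: "?a n = ?a (Suc n) + ennreal \<epsilon> * emeasure \<pi> C * ?b n" for n
  proof -
    have "?a n = (\<integral>\<^sup>+x. emeasure (Rn n x) A \<partial>(\<pi> \<bind> K))" by (simp add: piK)
    also have "\<dots> = (\<integral>\<^sup>+x. \<integral>\<^sup>+y. emeasure (Rn n y) A \<partial>K x \<partial>\<pi>)"
      by (rule nn_integral_bind[of _ borel]) measurable
    also have "\<dots> = (\<integral>\<^sup>+x. (\<integral>\<^sup>+y. emeasure (Rn n y) A \<partial>residual x) + ennreal \<epsilon> * ?b n * indicator C x \<partial>\<pi>)"
      by (simp add: nn_integral_K_decomp mult_ac)
    also have "\<dots> = (\<integral>\<^sup>+x. (\<integral>\<^sup>+y. emeasure (Rn n y) A \<partial>residual x) \<partial>\<pi>) + ennreal \<epsilon> * ?b n * emeasure \<pi> C"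
      by (subst nn_integral_add) (auto simp: nn_integral_cmult)
    also have "(\<integral>\<^sup>+x. (\<integral>\<^sup>+y. emeasure (Rn n y) A \<partial>residual x) \<partial>\<pi>) = ?a (Suc n)"
      unfolding Rn_Suc_left by (simp add: emeasure_bind[of _ _ borel])
    finally show ?thesis by (simp add: mult_ac)
  qed
  have sum: "emeasure \<pi> A = ?a n + ennreal \<epsilon> * emeasure \<pi> C * (\<Sum>k<n. ?b k)" for n
  proof (induction n)
    case 0 show ?case by simp
  next
    case (Suc n) show ?case by (subst Suc, subst step) (simp add: distrib_left ac_simps)
  qed
  have "?a \<longlonglongrightarrow> (\<integral>\<^sup>+x. 0 \<partial>\<pi>)"
  proof (rule nn_integral_dominated_convergence[where w="\<lambda>_. 1"])
    show "AE x in \<pi>. emeasure (Rn n x) A \<le> 1" for n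
      using subprob_space.subprob_emeasure_le_1[OF subprob_space_kernel[OF Rn_kernel]] by simp
  qed (use Rn_tendsto_0 prob_space.emeasure_space_1[OF pi] in auto)
  then have "(\<lambda>n. ?a n + ennreal \<epsilon> * emeasure \<pi> C * (\<Sum>k<n. ?b k)) \<longlonglongrightarrow> 0 + ennreal \<epsilon> * emeasure \<pi> C * (\<Sum>k. ?b k)"
    using prob_space.emeasure_le_1[OF pi, of C]
    by (intro tendsto_add ennreal_tendsto_cmult summable_LIMSEQ summableI)
       (auto simp: ennreal_mult_less_top intro: le_less_trans)
  then have "(\<lambda>n::nat. emeasure \<pi> A) \<longlonglongrightarrow> ennreal \<epsilon> * emeasure \<pi> C * (\<Sum>k. ?b k)"
    by (simp only: sum[symmetric] add_0_left)
  then show ?thesis by (simp add: LIMSEQ_const_iff emeasure_occupation)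
qed

lemma unique_invariant_law_exists:
  "\<exists>\<pi>. unique_invariant_law K \<pi> \<and> (\<integral>\<^sup>+x. ennreal (V x) \<partial>\<pi>) < \<infinity>"
proof -
  let ?m = "emeasure occupation UNIV"
  define \<pi> where "\<pi> = scale_measure (1 / ?m) occupation"
  have m: "1 \<le> ?m" "?m < \<infinity>" "?m \<noteq> 0" using occupation_mass_pos occupation_mass_finite by auto
  have [simp]: "sets \<pi> = sets borel" "space \<pi> = UNIV" by (simp_all add: \<pi>_def space_scale_measure)
  have em: "emeasure \<pi> A = 1 / ?m * emeasure occupation A" for A by (simp add: \<pi>_def)
  have "prob_space \<pi>"
  proof
    show "emeasure \<pi> (space \<pi>) = 1" using m by (simp add: em ennreal_divide_times)
  qed
  moreover have "\<pi> \<bind> K = \<pi>"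
  proof (rule measure_eqI)
    show "sets (\<pi> \<bind> K) = sets \<pi>" by (simp add: sets_bind[of _ _ borel])
    fix A assume "A \<in> sets (\<pi> \<bind> K)"
    then have A [measurable]: "A \<in> sets borel" by (simp add: sets_bind[of _ _ borel])
    have "emeasure (\<pi> \<bind> K) A = (\<integral>\<^sup>+x. emeasure (K x) A \<partial>\<pi>)"
      using K_subprob by (intro emeasure_bind[OF _ _ A]) (simp_all add: measurable_cong_sets[of \<pi> borel, OF _ refl])
    also have "\<dots> = emeasure \<pi> A"
      unfolding \<pi>_def by (subst nn_integral_scale_measure) (auto simp: occupation_invariant)
    finally show "emeasure (\<pi> \<bind> K) A = emeasure \<pi> A" .
  qed
  ultimately have inv: "invariant_law K \<pi>" by (simp add: invariant_law_def)
  have uniq: "\<pi>' = \<pi>" if "invariant_law K \<pi>'" for \<pi>'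
  proof (rule measure_eqI)
    have pi: "prob_space \<pi>'" and [simp]: "sets \<pi>' = sets borel" using that by (auto simp: invariant_law_def)
    then show "sets \<pi>' = sets \<pi>" by simp
    have [simp]: "space \<pi>' = UNIV" using sets_eq_imp_space_eq[of \<pi>' borel] by simp
    fix A assume "A \<in> sets \<pi>'"
    then have A: "A \<in> sets borel" by simp
    let ?c = "ennreal \<epsilon> * emeasure \<pi>' C"
    have "1 = ?c * ?m"
      using invariant_eq_occupation[OF that, of UNIV] prob_space.emeasure_space_1[OF pi] by simp
    then have "1 / ?m = ?c * ?m / ?m" by simp
    also have "\<dots> = ?c" using m by (intro ennreal_mult_divide_eq) auto
    finally have "1 / ?m = ?c" .
    then show "emeasure \<pi>' A = emeasure \<pi> A"
      using invariant_eq_occupation[OF that A] by (simp add: em)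
  qed
  have "(\<integral>\<^sup>+x. ennreal (V x) \<partial>\<pi>) = 1 / ?m * (\<integral>\<^sup>+x. ennreal (V x) \<partial>occupation)"
    unfolding \<pi>_def by (subst nn_integral_scale_measure) auto
  also have "\<dots> < \<infinity>"
    using occupation_V m
    by (auto simp: ennreal_mult_eq_top_iff divide_ennreal_def less_top[symmetric])
  finally show ?thesis using inv uniq unfolding unique_invariant_law_def by blast
qed

end

text \<open>
  The image of \<open>\<pi>\<close> under \<open>Q\<close> is invariant under the square as well, hence equal to \<open>\<pi>\<close>; and a law
  invariant under \<open>Q\<close> is invariant under its square.
\<close>

lemma unique_invariant_law_of_square:
  fixes Q :: "'a::topological_space \<Rightarrow> 'a measure"
  assumes Q: "Q \<in> borel \<rightarrow>\<^sub>M prob_algebra borel"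
    and \<pi>: "unique_invariant_law (\<lambda>z. Q z \<bind> Q) \<pi>"
  shows "unique_invariant_law Q \<pi>"
proof -
  have Q': "Q \<in> borel \<rightarrow>\<^sub>M subprob_algebra borel" using Q by (rule measurable_prob_algebraD)
  have assoc: "\<mu> \<bind> (\<lambda>z. Q z \<bind> Q) = \<mu> \<bind> Q \<bind> Q" if "sets \<mu> = sets borel" for \<mu>
    using bind_assoc[of Q \<mu> borel Q borel] Q' that by (simp add: measurable_cong_sets[OF that refl])
  have QQ: "prob_space (\<mu> \<bind> Q)" "sets (\<mu> \<bind> Q) = sets borel" if "sets \<mu> = sets borel" "prob_space \<mu>" for \<mu>
  proof -
    have "\<mu> \<bind> Q \<in> space (prob_algebra borel)"
      using measurable_space[OF measurable_bind_prob_space[OF measurable_const Q, of \<mu> "borel :: 'a measure"]] that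
      by (simp add: space_prob_algebra)
    then show "prob_space (\<mu> \<bind> Q)" "sets (\<mu> \<bind> Q) = sets borel" by (auto simp: space_prob_algebra)
  qed
  have "invariant_law (\<lambda>z. Q z \<bind> Q) \<pi>"
    and uniq: "\<And>\<pi>'. invariant_law (\<lambda>z. Q z \<bind> Q) \<pi>' \<Longrightarrow> \<pi>' = \<pi>"
    using \<pi> unfolding unique_invariant_law_def by blast+
  then have inv: "prob_space \<pi>" "sets \<pi> = sets borel" "\<pi> \<bind> Q \<bind> Q = \<pi>"
    unfolding invariant_law_def using assoc[of \<pi>] by metis+
  have "invariant_law (\<lambda>z. Q z \<bind> Q) (\<pi> \<bind> Q)"
    using QQ[OF inv(2,1)] by (simp add: invariant_law_def assoc inv)
  then have "\<pi> \<bind> Q = \<pi>" by (rule uniq)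
  moreover have "\<pi>' = \<pi>" if "invariant_law Q \<pi>'" for \<pi>'
  proof (rule uniq)
    have "prob_space \<pi>'" "sets \<pi>' = sets borel" "\<pi>' \<bind> Q = \<pi>'"
      using that by (auto simp: invariant_law_def)
    then show "invariant_law (\<lambda>z. Q z \<bind> Q) \<pi>'" by (simp add: invariant_law_def assoc)
  qed
  ultimately show ?thesis
    using inv(1,2) unfolding unique_invariant_law_def invariant_law_def by blast
qed

section \<open>Lebesgue lower bounds along a word\<close>

lemma nn_integral_lborel_shift:
  fixes a :: "'a::euclidean_space"
  assumes [measurable]: "f \<in> borel_measurable borel"
  shows "(\<integral>\<^sup>+v. f (v + a) \<partial>lborel) = (\<integral>\<^sup>+v. f v \<partial>lborel)"
proof -
  have "(\<integral>\<^sup>+v. f v \<partial>lborel) = (\<integral>\<^sup>+v. f v \<partial>distr lborel borel ((+) a))" by (simp add: lborel_distr_plus)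
  also have "\<dots> = (\<integral>\<^sup>+v. f (a + v) \<partial>lborel)" by (subst nn_integral_distr) auto
  finally show ?thesis by (simp add: add.commute)
qed

lemma nn_integral_ball_shift:
  fixes a :: "'a::euclidean_space"
  assumes [measurable]: "g \<in> borel_measurable borel" and "r + norm a \<le> r'"
  shows "(\<integral>\<^sup>+u. g u * indicator (cball 0 r) u \<partial>lborel) \<le> (\<integral>\<^sup>+v. g (v + a) * indicator (cball 0 r') v \<partial>lborel)"
proof -
  have "(\<integral>\<^sup>+u. g u * indicator (cball 0 r) u \<partial>lborel) = (\<integral>\<^sup>+v. g (v + a) * indicator (cball 0 r) (v + a) \<partial>lborel)"
    by (rule nn_integral_lborel_shift[symmetric]) (auto intro!: borel_measurable_times_ennreal borel_measurable_indicator)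
  also have "\<dots> \<le> (\<integral>\<^sup>+v. g (v + a) * indicator (cball 0 r') v \<partial>lborel)"
  proof (intro nn_integral_mono mult_left_mono)
    fix v :: 'a
    have "norm v \<le> norm (v + a) + norm a" using norm_triangle_ineq4[of "v + a" a] by simp
    then show "indicator (cball 0 r) (v + a) \<le> (indicator (cball 0 r') v :: ennreal)"
      using assms(2) by (auto simp: indicator_def)
  qed simp
  finally show ?thesis .
qed

text \<open>
  One constant serves all bounded velocities: \<open>R\<close> is so large that the affine image of the ball of
  radius \<open>R\<close> contains the target ball.
\<close>

lemma gaussian_step_ge:
  fixes c \<sigma> B r :: real
  assumes \<sigma>: "0 < \<sigma>" and "0 \<le> r" "0 \<le> B"
  shows "\<exists>\<epsilon>>0. \<forall>(v::real^'d) g. norm v \<le> B \<longrightarrow> g \<in> borel_measurable borel \<longrightarrow>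
    ennreal \<epsilon> * (\<integral>\<^sup>+u. g u * indicator (cball 0 r) u \<partial>lborel) \<le> (\<integral>\<^sup>+\<xi>. g (c *\<^sub>R v + \<sigma> *\<^sub>R \<xi>) \<partial>std_gaussian)"
proof -
  define R where "R = (r + \<bar>c\<bar> * B) / \<sigma>"
  have "0 \<le> R" using assms by (simp add: R_def)
  from std_gaussian_ge_lebesgue_on_ball[OF this, where 'd='d] obtain \<epsilon> where \<epsilon>: "\<epsilon> > 0"
    "\<And>f :: real^'d \<Rightarrow> ennreal. f \<in> borel_measurable borel \<Longrightarrow>
      ennreal \<epsilon> * (\<integral>\<^sup>+\<xi>. f \<xi> * indicator (cball 0 R) \<xi> \<partial>lborel) \<le> (\<integral>\<^sup>+\<xi>. f \<xi> \<partial>std_gaussian)"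
    by blast
  define D where "D = \<sigma> ^ CARD('d)"
  have D: "D > 0" using \<sigma> by (simp add: D_def)
  show ?thesis
  proof (intro exI[of _ "\<epsilon> / D"] conjI allI impI)
    show "\<epsilon> / D > 0" using \<epsilon> D by simp
    fix v :: "real^'d" and g :: "real^'d \<Rightarrow> ennreal"
    assume v: "norm v \<le> B" and g [measurable]: "g \<in> borel_measurable borel"
    let ?T = "\<lambda>\<xi>. c *\<^sub>R v + \<sigma> *\<^sub>R \<xi>"
    have [measurable]: "(\<lambda>u. g u * indicator (cball 0 r) u) \<in> borel_measurable borel"
      by (auto intro!: borel_measurable_times_ennreal borel_measurable_indicator)
    have "(\<integral>\<^sup>+u. g u * indicator (cball 0 r) u \<partial>lborel)
      = (\<integral>\<^sup>+u. g u * indicator (cball 0 r) u \<partial>density (distr lborel borel ?T) (\<lambda>_. ennreal (\<bar>\<sigma>\<bar> ^ DIM(real^'d))))"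
      using \<sigma> lborel_affine[of \<sigma> "c *\<^sub>R v"] by simp
    also have "\<dots> = (\<integral>\<^sup>+\<xi>. ennreal D * (g (?T \<xi>) * indicator (cball 0 r) (?T \<xi>)) \<partial>lborel)"
      using \<sigma> by (simp add: nn_integral_density nn_integral_distr D_def)
    also have "\<dots> \<le> (\<integral>\<^sup>+\<xi>. ennreal D * (g (?T \<xi>) * indicator (cball 0 R) \<xi>) \<partial>lborel)"
    proof (intro nn_integral_mono mult_left_mono)
      fix \<xi> :: "real^'d"
      have "\<sigma> * norm \<xi> \<le> norm (?T \<xi>) + norm (c *\<^sub>R v)"
        using norm_triangle_ineq4[of "?T \<xi>" "c *\<^sub>R v"] \<sigma> by simp
      moreover have "norm (c *\<^sub>R v) \<le> \<bar>c\<bar> * B" using v by (simp add: mult_left_mono)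
      ultimately show "indicator (cball 0 r) (?T \<xi>) \<le> (indicator (cball 0 R) \<xi> :: ennreal)"
        using \<sigma> by (auto simp: indicator_def R_def field_simps)
    qed auto
    also have "\<dots> = ennreal D * (\<integral>\<^sup>+\<xi>. g (?T \<xi>) * indicator (cball 0 R) \<xi> \<partial>lborel)"
      by (rule nn_integral_cmult) (auto intro!: borel_measurable_times_ennreal borel_measurable_indicator)
    finally have "ennreal (\<epsilon> / D) * (\<integral>\<^sup>+u. g u * indicator (cball 0 r) u \<partial>lborel)
      \<le> ennreal (\<epsilon> / D) * (ennreal D * (\<integral>\<^sup>+\<xi>. g (?T \<xi>) * indicator (cball 0 R) \<xi> \<partial>lborel))"
      by (rule mult_left_mono) simp
    also have "\<dots> = ennreal \<epsilon> * (\<integral>\<^sup>+\<xi>. g (?T \<xi>) * indicator (cball 0 R) \<xi> \<partial>lborel)"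
      using \<epsilon> D by (simp add: mult.assoc[symmetric] flip: ennreal_mult')
    also have "\<dots> \<le> (\<integral>\<^sup>+\<xi>. g (?T \<xi>) \<partial>std_gaussian)" by (rule \<epsilon>(2)) simp
    finally show "ennreal (\<epsilon> / D) * (\<integral>\<^sup>+u. g u * indicator (cball 0 r) u \<partial>lborel) \<le> (\<integral>\<^sup>+\<xi>. g (?T \<xi>) \<partial>std_gaussian)" .
  qed
qed

lemma fst_snd_borel [measurable]:
  "fst \<in> borel \<rightarrow>\<^sub>M (borel :: 'a::euclidean_space measure)" "snd \<in> borel \<rightarrow>\<^sub>M (borel :: 'b::euclidean_space measure)"
  by (rule borel_measurable_continuous_onI[OF continuous_on_fst[OF continuous_on_id]],
      rule borel_measurable_continuous_onI[OF continuous_on_snd[OF continuous_on_id]])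

text \<open>
  Mass spreads in stages, always uniformly over bounded sets of starting points. After one noise
  the velocity is spread over a fibre with bounded position (\<open>fibre_spread\<close>); transport turns this
  into a spread position with bounded velocity (\<open>position_spread\<close>); a second noise spreads the
  velocity again (\<open>phase_spread\<close>).
\<close>

definition fibre_spread :: "'d::finite kernel \<Rightarrow> bool" where
  "fibre_spread F \<longleftrightarrow> (\<forall>\<rho>. \<exists>B\<ge>0. \<forall>r. \<exists>\<epsilon>>0. \<forall>z. norm z \<le> \<rho> \<longrightarrow> (\<exists>x. norm x \<le> B \<and> (\<forall>g\<in>borel_measurable borel.
     ennreal \<epsilon> * (\<integral>\<^sup>+v. g (x, v) * indicator (cball 0 r) v \<partial>lborel) \<le> (\<integral>\<^sup>+y. g y \<partial>F z))))"

definition position_spread :: "'d::finite kernel \<Rightarrow> bool" where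
  "position_spread F \<longleftrightarrow> (\<forall>\<rho> r. \<exists>\<epsilon>>0. \<exists>B\<ge>0. \<forall>z. norm z \<le> \<rho> \<longrightarrow> (\<forall>g\<in>borel_measurable borel.
     ennreal \<epsilon> * (\<integral>\<^sup>+x. g x * indicator (cball 0 r) x \<partial>lborel) \<le> (\<integral>\<^sup>+y. g (fst y) * indicator (cball 0 B) (snd y) \<partial>F z)))"

definition phase_spread :: "'d::finite kernel \<Rightarrow> bool" where
  "phase_spread F \<longleftrightarrow> (\<forall>\<rho> r. \<exists>\<epsilon>>0. \<forall>z. norm z \<le> \<rho> \<longrightarrow> (\<forall>g\<in>borel_measurable borel.
     ennreal \<epsilon> * (\<integral>\<^sup>+x. (\<integral>\<^sup>+v. g (x, v) * indicator (cball 0 r) v \<partial>lborel) * indicator (cball 0 r) x \<partial>lborel) \<le> (\<integral>\<^sup>+y. g y \<partial>F z)))"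

lemma unit_ball_content:
  assumes "0 < r"
  obtains c where "c > 0" "emeasure lborel (cball (0::'a::euclidean_space) r) = ennreal c"
proof
  show "measure lborel (cball (0::'a) r) > 0" using assms by (rule content_cball_pos)
  show "emeasure lborel (cball (0::'a) r) = ennreal (measure lborel (cball (0::'a) r))"
    using emeasure_lborel_cball_finite[of "0::'a" r] by (intro emeasure_eq_ennreal_measure) simp
qed

lemma nn_integral_step_O:
  fixes F :: "'d::finite kernel"
  assumes F: "F \<in> borel \<rightarrow>\<^sub>M prob_algebra borel" and g [measurable]: "g \<in> borel_measurable borel"
  shows "(\<integral>\<^sup>+y. g y \<partial>(F z \<bind> step_O \<gamma> t)) =
    (\<integral>\<^sup>+y. (\<integral>\<^sup>+\<xi>. g (fst y, exp (- \<gamma> * t) *\<^sub>R snd y + sqrt (1 - exp (- 2 * \<gamma> * t)) *\<^sub>R \<xi>) \<partial>std_gaussian) \<partial>F z)"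
proof -
  have sets: "sets (F z) = sets borel"
    using measurable_space[OF F, of z] by (simp add: space_prob_algebra)
  have "step_O \<gamma> t \<in> borel \<rightarrow>\<^sub>M subprob_algebra (borel :: 'd phase measure)"
    using letter_kernel_prob[of "\<lambda>_::real^'d. 0" \<gamma> "O_letter t"]
  proof -
    have "gradient (\<lambda>_::real^'d. 0) = (\<lambda>_. 0)"
    proof
      fix x :: "real^'d"
      show "gradient (\<lambda>_::real^'d. 0) x = 0" unfolding gradient_def
      proof (rule the_equality)
        show "GDERIV (\<lambda>_::real^'d. 0) x :> 0" by (simp add: gderiv_def)
        fix g assume "GDERIV (\<lambda>_::real^'d. 0) x :> g"
        then have "((\<lambda>_::real^'d. 0::real) has_derivative (\<lambda>h. h \<bullet> g)) (at x)" by (simp add: gderiv_def)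
        from has_derivative_unique[OF this has_derivative_const] show "g = 0" by (metis inner_eq_zero_iff)
      qed
    qed
    then have "letter_kernel (\<lambda>_::real^'d. 0) \<gamma> (O_letter t) \<in> borel \<rightarrow>\<^sub>M prob_algebra borel"
      by (intro letter_kernel_prob) simp
    then show ?thesis by (simp add: measurable_prob_algebraD)
  qed
  then have "(\<integral>\<^sup>+y. g y \<partial>(F z \<bind> step_O \<gamma> t)) = (\<integral>\<^sup>+x. \<integral>\<^sup>+y. g y \<partial>step_O \<gamma> t x \<partial>F z)"
    by (intro nn_integral_bind[of _ borel]) (simp_all add: measurable_cong_sets[OF sets refl])
  also have "\<dots> = (\<integral>\<^sup>+y. (\<integral>\<^sup>+\<xi>. g (fst y, exp (- \<gamma> * t) *\<^sub>R snd y + sqrt (1 - exp (- 2 * \<gamma> * t)) *\<^sub>R \<xi>) \<partial>std_gaussian) \<partial>F z)"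
    by (simp add: step_O_def case_prod_beta' nn_integral_distr)
  finally show ?thesis .
qed

lemma nn_integral_bind_return:
  fixes F :: "'d::finite kernel"
  assumes F: "F \<in> borel \<rightarrow>\<^sub>M prob_algebra borel" and g [measurable]: "g \<in> borel_measurable borel"
    and f [measurable]: "f \<in> borel \<rightarrow>\<^sub>M borel"
  shows "(\<integral>\<^sup>+y. g y \<partial>(F z \<bind> (\<lambda>y. return borel (f y)))) = (\<integral>\<^sup>+y. g (f y) \<partial>F z)"
proof -
  have sets: "sets (F z) = sets borel"
    using measurable_space[OF F, of z] by (simp add: space_prob_algebra)
  have "(\<lambda>y. return borel (f y)) \<in> borel \<rightarrow>\<^sub>M subprob_algebra borel"
    by (rule measurable_compose[OF f return_measurable])
  then have "(\<integral>\<^sup>+y. g y \<partial>(F z \<bind> (\<lambda>y. return borel (f y)))) = (\<integral>\<^sup>+x. \<integral>\<^sup>+y. g y \<partial>return borel (f x) \<partial>F z)"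
    by (intro nn_integral_bind[of _ borel]) (simp_all add: measurable_cong_sets[OF sets refl])
  then show ?thesis by (simp add: nn_integral_return)
qed

lemma nn_integral_phase_measurable [measurable]:
  fixes g :: "'d::finite phase \<Rightarrow> ennreal"
  assumes [measurable]: "g \<in> borel_measurable borel"
  shows "(\<lambda>v. g (x, v)) \<in> borel_measurable borel"
  by (rule measurable_compose[OF _ assms]) simp

lemma gaussian_average_measurable [measurable]:
  fixes g :: "'d::finite phase \<Rightarrow> ennreal"
  assumes [measurable]: "g \<in> borel_measurable borel"
  shows "(\<lambda>y. (\<integral>\<^sup>+\<xi>. g (fst y, a *\<^sub>R snd y + b *\<^sub>R \<xi>) \<partial>std_gaussian)) \<in> borel_measurable borel"
proof -
  interpret G: prob_space "std_gaussian :: (real^'d) measure" by (rule prob_space_std_gaussian)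
  have "(\<lambda>p::'d phase \<times> (real^'d). (fst (fst p), a *\<^sub>R snd (fst p) + b *\<^sub>R snd p)) \<in> borel \<rightarrow>\<^sub>M borel"
    by (intro borel_measurable_continuous_onI continuous_intros)
  then have "(\<lambda>(y::'d phase, \<xi>). (fst y, a *\<^sub>R snd y + b *\<^sub>R \<xi>)) \<in> borel \<Otimes>\<^sub>M std_gaussian \<rightarrow>\<^sub>M borel"
    unfolding case_prod_beta' measurable_cong_sets[OF sets_pair_measure_cong[OF refl sets_std_gaussian] refl]
    by (simp add: borel_prod)
  from measurable_compose[OF this assms]
  have "(\<lambda>(y::'d phase, \<xi>). g (fst y, a *\<^sub>R snd y + b *\<^sub>R \<xi>)) \<in> borel_measurable (borel \<Otimes>\<^sub>M std_gaussian)"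
    by (simp add: case_prod_beta')
  from G.borel_measurable_nn_integral[OF this] show ?thesis by simp
qed

lemma fibre_average_measurable [measurable]:
  fixes g :: "'d::finite phase \<Rightarrow> ennreal"
  assumes [measurable]: "g \<in> borel_measurable borel"
  shows "(\<lambda>x. \<integral>\<^sup>+v. g (x, v) * indicator (cball 0 r) v \<partial>lborel) \<in> borel_measurable borel"
proof -
  have "(\<lambda>p. g p * indicator (cball 0 r) (snd p)) \<in> borel_measurable borel"
    by (intro borel_measurable_times_ennreal assms measurable_compose[OF fst_snd_borel(2) borel_measurable_indicator]) simp
  then have "(\<lambda>(x, v). g (x, v) * indicator (cball 0 r) v) \<in> borel_measurable (borel \<Otimes>\<^sub>M lborel)"
    unfolding measurable_cong_sets[OF sets_pair_measure_cong[OF refl sets_lborel] refl]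
    by (simp add: borel_prod case_prod_beta')
  from lborel.borel_measurable_nn_integral[OF this] show ?thesis by simp
qed

context
  fixes \<gamma> t :: real
  assumes gt: "0 < \<gamma> * t"
begin

lemma noise_pos: "0 < sqrt (1 - exp (- 2 * \<gamma> * t))"
  using gt by simp

lemma fibre_spread_initial:
  fixes f :: "'d::finite phase \<Rightarrow> 'd phase"
  assumes F: "F \<in> borel \<rightarrow>\<^sub>M prob_algebra borel" and Ff: "\<And>z. F z = return borel (f z)"
    and f: "\<And>\<rho>. \<exists>B\<ge>0. \<forall>z. norm z \<le> \<rho> \<longrightarrow> norm (f z) \<le> B"
  shows "fibre_spread (\<lambda>z. F z \<bind> step_O \<gamma> t)"
  unfolding fibre_spread_def
proof
  fix \<rho>
  obtain B where B: "B \<ge> 0" "\<And>z. norm z \<le> \<rho> \<Longrightarrow> norm (f z) \<le> B" using f[of \<rho>] by blast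
  show "\<exists>B\<ge>0. \<forall>r. \<exists>\<epsilon>>0. \<forall>z. norm z \<le> \<rho> \<longrightarrow> (\<exists>x. norm x \<le> B \<and> (\<forall>g\<in>borel_measurable borel.
     ennreal \<epsilon> * (\<integral>\<^sup>+v. g (x, v) * indicator (cball 0 r) v \<partial>lborel) \<le> (\<integral>\<^sup>+y. g y \<partial>(F z \<bind> step_O \<gamma> t))))"
  proof (rule exI[of _ B], intro conjI allI B(1))
    fix r
    obtain \<epsilon> where \<epsilon>: "\<epsilon> > 0" "\<And>(v::real^'d) g. norm v \<le> B \<Longrightarrow> g \<in> borel_measurable borel \<Longrightarrow>
      ennreal \<epsilon> * (\<integral>\<^sup>+u. g u * indicator (cball 0 (max 0 r)) u \<partial>lborel) \<le> (\<integral>\<^sup>+\<xi>. g (exp (- \<gamma> * t) *\<^sub>R v + sqrt (1 - exp (- 2 * \<gamma> * t)) *\<^sub>R \<xi>) \<partial>std_gaussian)"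
      using gaussian_step_ge[OF noise_pos _ B(1), of "max 0 r" "exp (- \<gamma> * t)", where 'd='d] by auto
    show "\<exists>\<epsilon>>0. \<forall>z. norm z \<le> \<rho> \<longrightarrow> (\<exists>x. norm x \<le> B \<and> (\<forall>g\<in>borel_measurable borel.
     ennreal \<epsilon> * (\<integral>\<^sup>+v. g (x, v) * indicator (cball 0 r) v \<partial>lborel) \<le> (\<integral>\<^sup>+y. g y \<partial>(F z \<bind> step_O \<gamma> t))))"
    proof (intro exI[of _ \<epsilon>] conjI allI impI \<epsilon>(1))
      fix z :: "'d phase" assume z: "norm z \<le> \<rho>"
      have "norm (f z) \<le> B" using B z by blast
      then have n: "norm (fst (f z)) \<le> B" "norm (snd (f z)) \<le> B"
        using norm_fst_snd_le[of "f z"] by auto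
      show "\<exists>x. norm x \<le> B \<and> (\<forall>g\<in>borel_measurable borel.
        ennreal \<epsilon> * (\<integral>\<^sup>+v. g (x, v) * indicator (cball 0 r) v \<partial>lborel) \<le> (\<integral>\<^sup>+y. g y \<partial>(F z \<bind> step_O \<gamma> t)))"
      proof (intro exI[of _ "fst (f z)"] conjI ballI n)
        fix g :: "'d phase \<Rightarrow> ennreal" assume g [measurable]: "g \<in> borel_measurable borel"
        have "ennreal \<epsilon> * (\<integral>\<^sup>+v. g (fst (f z), v) * indicator (cball 0 r) v \<partial>lborel)
          \<le> ennreal \<epsilon> * (\<integral>\<^sup>+v. g (fst (f z), v) * indicator (cball 0 (max 0 r)) v \<partial>lborel)"
          by (intro mult_left_mono nn_integral_mono) (auto simp: indicator_def)
        also have "\<dots> \<le> (\<integral>\<^sup>+\<xi>. g (fst (f z), exp (- \<gamma> * t) *\<^sub>R snd (f z) + sqrt (1 - exp (- 2 * \<gamma> * t)) *\<^sub>R \<xi>) \<partial>std_gaussian)"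
          by (rule \<epsilon>(2)[OF n(2)]) measurable
        also have "\<dots> = (\<integral>\<^sup>+y. g y \<partial>(F z \<bind> step_O \<gamma> t))"
          by (subst nn_integral_step_O[OF F g]) (simp add: Ff nn_integral_return gaussian_average_measurable)
        finally show "ennreal \<epsilon> * (\<integral>\<^sup>+v. g (fst (f z), v) * indicator (cball 0 r) v \<partial>lborel) \<le> (\<integral>\<^sup>+y. g y \<partial>(F z \<bind> step_O \<gamma> t))" .
      qed
    qed
  qed
qed

text \<open>
  The velocities already spread charge the unit ball, and from each of its points fresh noise
  reaches any ball.
\<close>

lemma fibre_spread_O:
  fixes F :: "'d::finite kernel"
  assumes F: "F \<in> borel \<rightarrow>\<^sub>M prob_algebra borel" and sp: "fibre_spread F"
  shows "fibre_spread (\<lambda>z. F z \<bind> step_O \<gamma> t)"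
  unfolding fibre_spread_def
proof
  fix \<rho>
  obtain B where B: "B \<ge> 0" "\<And>r. \<exists>\<epsilon>>0. \<forall>z. norm z \<le> \<rho> \<longrightarrow> (\<exists>x. norm x \<le> B \<and> (\<forall>g\<in>borel_measurable borel.
     ennreal \<epsilon> * (\<integral>\<^sup>+v. g (x, v) * indicator (cball 0 r) v \<partial>lborel) \<le> (\<integral>\<^sup>+y. g y \<partial>F z)))"
    using sp unfolding fibre_spread_def by blast
  show "\<exists>B\<ge>0. \<forall>r. \<exists>\<epsilon>>0. \<forall>z. norm z \<le> \<rho> \<longrightarrow> (\<exists>x. norm x \<le> B \<and> (\<forall>g\<in>borel_measurable borel.
     ennreal \<epsilon> * (\<integral>\<^sup>+v. g (x, v) * indicator (cball 0 r) v \<partial>lborel) \<le> (\<integral>\<^sup>+y. g y \<partial>(F z \<bind> step_O \<gamma> t))))"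
  proof (rule exI[of _ B], intro conjI allI B(1))
    fix r
    obtain \<epsilon> where \<epsilon>: "\<epsilon> > 0" "\<And>z. norm z \<le> \<rho> \<Longrightarrow> (\<exists>x. norm x \<le> B \<and> (\<forall>g\<in>borel_measurable borel.
     ennreal \<epsilon> * (\<integral>\<^sup>+v. g (x, v) * indicator (cball 0 1) v \<partial>lborel) \<le> (\<integral>\<^sup>+y. g y \<partial>F z)))"
      using B(2)[of 1] by blast
    obtain \<delta> where \<delta>: "\<delta> > 0" "\<And>(v::real^'d) g. norm v \<le> 1 \<Longrightarrow> g \<in> borel_measurable borel \<Longrightarrow>
      ennreal \<delta> * (\<integral>\<^sup>+u. g u * indicator (cball 0 (max 0 r)) u \<partial>lborel) \<le> (\<integral>\<^sup>+\<xi>. g (exp (- \<gamma> * t) *\<^sub>R v + sqrt (1 - exp (- 2 * \<gamma> * t)) *\<^sub>R \<xi>) \<partial>std_gaussian)"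
      using gaussian_step_ge[OF noise_pos, of "max 0 r" 1 "exp (- \<gamma> * t)", where 'd='d] by auto
    obtain c where c: "c > 0" "emeasure lborel (cball (0::real^'d) 1) = ennreal c"
      using unit_ball_content[OF zero_less_one, where 'a="real^'d"] by blast
    show "\<exists>\<epsilon>>0. \<forall>z. norm z \<le> \<rho> \<longrightarrow> (\<exists>x. norm x \<le> B \<and> (\<forall>g\<in>borel_measurable borel.
     ennreal \<epsilon> * (\<integral>\<^sup>+v. g (x, v) * indicator (cball 0 r) v \<partial>lborel) \<le> (\<integral>\<^sup>+y. g y \<partial>(F z \<bind> step_O \<gamma> t))))"
    proof (intro exI[of _ "\<epsilon> * (\<delta> * c)"] conjI allI impI)
      show "\<epsilon> * (\<delta> * c) > 0" using \<epsilon> \<delta> c by simp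
      fix z :: "'d phase" assume z: "norm z \<le> \<rho>"
      obtain x where x: "norm x \<le> B" "\<And>g. g \<in> borel_measurable borel \<Longrightarrow>
        ennreal \<epsilon> * (\<integral>\<^sup>+v. g (x, v) * indicator (cball 0 1) v \<partial>lborel) \<le> (\<integral>\<^sup>+y. g y \<partial>F z)"
        using \<epsilon>(2)[OF z] by blast
      show "\<exists>x. norm x \<le> B \<and> (\<forall>g\<in>borel_measurable borel.
        ennreal (\<epsilon> * (\<delta> * c)) * (\<integral>\<^sup>+v. g (x, v) * indicator (cball 0 r) v \<partial>lborel) \<le> (\<integral>\<^sup>+y. g y \<partial>(F z \<bind> step_O \<gamma> t)))"
      proof (intro exI[of _ x] conjI ballI x(1))
        fix g :: "'d phase \<Rightarrow> ennreal" assume g [measurable]: "g \<in> borel_measurable borel"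
        let ?I = "\<integral>\<^sup>+v. g (x, v) * indicator (cball 0 (max 0 r)) v \<partial>lborel"
        let ?h = "\<lambda>y. \<integral>\<^sup>+\<xi>. g (fst y, exp (- \<gamma> * t) *\<^sub>R snd y + sqrt (1 - exp (- 2 * \<gamma> * t)) *\<^sub>R \<xi>) \<partial>std_gaussian"
        have "ennreal (\<epsilon> * (\<delta> * c)) * (\<integral>\<^sup>+v. g (x, v) * indicator (cball 0 r) v \<partial>lborel) \<le> ennreal (\<epsilon> * (\<delta> * c)) * ?I"
          by (intro mult_left_mono nn_integral_mono) (auto simp: indicator_def)
        also have "\<dots> = ennreal \<epsilon> * ((ennreal \<delta> * ?I) * emeasure lborel (cball (0::real^'d) 1))"
          using \<epsilon>(1) \<delta>(1) c by (simp add: ennreal_mult mult_ac)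
        also have "\<dots> = ennreal \<epsilon> * (\<integral>\<^sup>+v. (ennreal \<delta> * ?I) * indicator (cball (0::real^'d) 1) v \<partial>lborel)"
          by (subst nn_integral_cmult_indicator) auto
        also have "\<dots> \<le> ennreal \<epsilon> * (\<integral>\<^sup>+v. ?h (x, v) * indicator (cball 0 1) v \<partial>lborel)"
        proof (intro mult_left_mono nn_integral_mono)
          fix v :: "real^'d"
          show "ennreal \<delta> * ?I * indicator (cball 0 1) v \<le> ?h (x, v) * indicator (cball 0 1) v"
            using \<delta>(2)[of v "\<lambda>u. g (x, u)"] by (cases "norm v \<le> 1") auto
        qed simp
        also have "\<dots> \<le> (\<integral>\<^sup>+y. ?h y \<partial>F z)" by (rule x(2)) measurable
        also have "\<dots> = (\<integral>\<^sup>+y. g y \<partial>(F z \<bind> step_O \<gamma> t))"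
          by (rule nn_integral_step_O[OF F g, symmetric])
        finally show "ennreal (\<epsilon> * (\<delta> * c)) * (\<integral>\<^sup>+v. g (x, v) * indicator (cball 0 r) v \<partial>lborel) \<le> (\<integral>\<^sup>+y. g y \<partial>(F z \<bind> step_O \<gamma> t))" .
      qed
    qed
  qed
qed

text \<open>
  For each position the velocity is bounded, and fresh noise spreads it with a constant that depends
  only on this bound.
\<close>

lemma phase_spread_after_O:
  fixes F :: "'d::finite kernel"
  assumes F: "F \<in> borel \<rightarrow>\<^sub>M prob_algebra borel" and sp: "position_spread F"
  shows "phase_spread (\<lambda>z. F z \<bind> step_O \<gamma> t)"
  unfolding phase_spread_def
proof (intro allI)
  fix \<rho> r :: real
  obtain \<epsilon> B where \<epsilon>: "\<epsilon> > 0" and B: "B \<ge> 0" "\<And>z g. norm z \<le> \<rho> \<Longrightarrow> g \<in> borel_measurable borel \<Longrightarrow>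
     ennreal \<epsilon> * (\<integral>\<^sup>+x. g x * indicator (cball 0 r) x \<partial>lborel) \<le> (\<integral>\<^sup>+y. g (fst y) * indicator (cball 0 B) (snd y) \<partial>F z)"
    using sp[unfolded position_spread_def, rule_format, of \<rho> r] by blast
  obtain \<delta> where \<delta>: "\<delta> > 0" "\<And>(v::real^'d) g. norm v \<le> B \<Longrightarrow> g \<in> borel_measurable borel \<Longrightarrow>
      ennreal \<delta> * (\<integral>\<^sup>+u. g u * indicator (cball 0 (max 0 r)) u \<partial>lborel) \<le> (\<integral>\<^sup>+\<xi>. g (exp (- \<gamma> * t) *\<^sub>R v + sqrt (1 - exp (- 2 * \<gamma> * t)) *\<^sub>R \<xi>) \<partial>std_gaussian)"
    using gaussian_step_ge[OF noise_pos, of "max 0 r" B "exp (- \<gamma> * t)", where 'd='d] B(1) by auto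
  show "\<exists>\<epsilon>>0. \<forall>z. norm z \<le> \<rho> \<longrightarrow> (\<forall>g\<in>borel_measurable borel.
     ennreal \<epsilon> * (\<integral>\<^sup>+x. (\<integral>\<^sup>+v. g (x, v) * indicator (cball 0 r) v \<partial>lborel) * indicator (cball 0 r) x \<partial>lborel) \<le> (\<integral>\<^sup>+y. g y \<partial>(F z \<bind> step_O \<gamma> t)))"
  proof (intro exI[of _ "\<delta> * \<epsilon>"] conjI allI impI ballI)
    show "\<delta> * \<epsilon> > 0" using \<epsilon> \<delta> by simp
    fix z :: "'d phase" and g :: "'d phase \<Rightarrow> ennreal"
    assume z: "norm z \<le> \<rho>" and g [measurable]: "g \<in> borel_measurable borel"
    let ?I = "\<lambda>x. \<integral>\<^sup>+v. g (x, v) * indicator (cball 0 r) v \<partial>lborel"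
    let ?h = "\<lambda>y. \<integral>\<^sup>+\<xi>. g (fst y, exp (- \<gamma> * t) *\<^sub>R snd y + sqrt (1 - exp (- 2 * \<gamma> * t)) *\<^sub>R \<xi>) \<partial>std_gaussian"
    have sets: "sets (F z) = sets borel"
      using measurable_space[OF F, of z] by (simp add: space_prob_algebra)
    have I1: "(\<lambda>y. ?I (fst y) * indicator (cball 0 B) (snd y)) \<in> borel_measurable (F z)"
      unfolding measurable_cong_sets[OF sets refl]
      by (intro borel_measurable_times_ennreal measurable_compose[OF _ fibre_average_measurable[OF g]]
          measurable_compose[OF _ borel_measurable_indicator[of "cball 0 B" borel]] fst_snd_borel) simp
    have "ennreal (\<delta> * \<epsilon>) * (\<integral>\<^sup>+x. ?I x * indicator (cball 0 r) x \<partial>lborel) = ennreal \<delta> * (ennreal \<epsilon> * (\<integral>\<^sup>+x. ?I x * indicator (cball 0 r) x \<partial>lborel))"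
      using \<epsilon> \<delta> by (simp add: ennreal_mult mult.assoc)
    also have "\<dots> \<le> ennreal \<delta> * (\<integral>\<^sup>+y. ?I (fst y) * indicator (cball 0 B) (snd y) \<partial>F z)"
      by (intro mult_left_mono B(2)[OF z]) auto
    also have "\<dots> = (\<integral>\<^sup>+y. ennreal \<delta> * (?I (fst y) * indicator (cball 0 B) (snd y)) \<partial>F z)"
      by (rule nn_integral_cmult[OF I1, symmetric])
    also have "\<dots> \<le> (\<integral>\<^sup>+y. ?h y \<partial>F z)"
    proof (rule nn_integral_mono)
      fix y :: "'d phase"
      have "ennreal \<delta> * ?I (fst y) \<le> ?h y" if "norm (snd y) \<le> B"
      proof -
        have "ennreal \<delta> * ?I (fst y) \<le> ennreal \<delta> * (\<integral>\<^sup>+v. g (fst y, v) * indicator (cball 0 (max 0 r)) v \<partial>lborel)"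
          by (intro mult_left_mono nn_integral_mono) (auto simp: indicator_def)
        also have "\<dots> \<le> ?h y" using \<delta>(2)[OF that, of "\<lambda>u. g (fst y, u)"] by simp
        finally show ?thesis .
      qed
      then show "ennreal \<delta> * (?I (fst y) * indicator (cball 0 B) (snd y)) \<le> ?h y"
        by (auto simp: indicator_def)
    qed
    also have "\<dots> = (\<integral>\<^sup>+y. g y \<partial>(F z \<bind> step_O \<gamma> t))"
      by (rule nn_integral_step_O[OF F g, symmetric])
    finally show "ennreal (\<delta> * \<epsilon>) * (\<integral>\<^sup>+x. ?I x * indicator (cball 0 r) x \<partial>lborel) \<le> (\<integral>\<^sup>+y. g y \<partial>(F z \<bind> step_O \<gamma> t))" .
  qed
qed

end

lemma position_spread_of_phase_spread:
  fixes F :: "'d::finite kernel"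
  assumes sp: "phase_spread F"
  shows "position_spread F"
  unfolding position_spread_def
proof (intro allI)
  fix \<rho> r :: real
  define r' where "r' = max r 1"
  obtain \<epsilon> where \<epsilon>: "\<epsilon> > 0" "\<And>z g. norm z \<le> \<rho> \<Longrightarrow> g \<in> borel_measurable borel \<Longrightarrow>
     ennreal \<epsilon> * (\<integral>\<^sup>+x. (\<integral>\<^sup>+v. g (x, v) * indicator (cball 0 r') v \<partial>lborel) * indicator (cball 0 r') x \<partial>lborel) \<le> (\<integral>\<^sup>+y. g y \<partial>F z)"
    using sp[unfolded phase_spread_def, rule_format, of \<rho> r'] by blast
  have "0 < r'" by (simp add: r'_def)
  obtain c where c: "c > 0" "emeasure lborel (cball (0::real^'d) r') = ennreal c"
    using unit_ball_content[OF \<open>0 < r'\<close>, where 'a="real^'d"] by blast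
  show "\<exists>\<epsilon>>0. \<exists>B\<ge>0. \<forall>z. norm z \<le> \<rho> \<longrightarrow> (\<forall>g\<in>borel_measurable borel.
     ennreal \<epsilon> * (\<integral>\<^sup>+x. g x * indicator (cball 0 r) x \<partial>lborel) \<le> (\<integral>\<^sup>+y. g (fst y) * indicator (cball 0 B) (snd y) \<partial>F z))"
  proof (rule exI[of _ "\<epsilon> * c"], rule conjI)
    show "\<epsilon> * c > 0" using \<epsilon> c by simp
    show "\<exists>B\<ge>0. \<forall>z. norm z \<le> \<rho> \<longrightarrow> (\<forall>g\<in>borel_measurable borel.
     ennreal (\<epsilon> * c) * (\<integral>\<^sup>+x. g x * indicator (cball 0 r) x \<partial>lborel) \<le> (\<integral>\<^sup>+y. g (fst y) * indicator (cball 0 B) (snd y) \<partial>F z))"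
    proof (rule exI[of _ r'], intro conjI allI impI ballI)
    show "0 \<le> r'" by (auto simp: r'_def)
    fix z :: "'d phase" and g :: "real^'d \<Rightarrow> ennreal"
    assume z: "norm z \<le> \<rho>" and g [measurable]: "g \<in> borel_measurable borel"
    have m1: "(\<lambda>x. g x * indicator (cball 0 r) x) \<in> borel_measurable borel" for r
      by (auto intro!: borel_measurable_times_ennreal borel_measurable_indicator)
    have m: "(\<lambda>y::'d phase. g (fst y) * indicator (cball 0 r') (snd y)) \<in> borel_measurable borel"
      by (intro borel_measurable_times_ennreal measurable_compose[OF _ g]
          measurable_compose[OF _ borel_measurable_indicator[of "cball 0 r'" borel]] fst_snd_borel) simp
    have "ennreal (\<epsilon> * c) * (\<integral>\<^sup>+x. g x * indicator (cball 0 r) x \<partial>lborel)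
      \<le> ennreal (\<epsilon> * c) * (\<integral>\<^sup>+x. g x * indicator (cball 0 r') x \<partial>lborel)"
      by (intro mult_left_mono nn_integral_mono) (auto simp: indicator_def r'_def)
    also have "\<dots> = ennreal \<epsilon> * (ennreal c * (\<integral>\<^sup>+x. g x * indicator (cball 0 r') x \<partial>lborel))"
      using \<epsilon> c by (simp add: ennreal_mult mult.assoc)
    also have "\<dots> = ennreal \<epsilon> * (\<integral>\<^sup>+x. ennreal c * (g x * indicator (cball 0 r') x) \<partial>lborel)"
      using m1 by (subst nn_integral_cmult) auto
    also have "\<dots> = ennreal \<epsilon> * (\<integral>\<^sup>+x. (\<integral>\<^sup>+v. g x * indicator (cball (0::real^'d) r') v * indicator (cball (0::real^'d) r') v \<partial>lborel) * indicator (cball 0 r') x \<partial>lborel)"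
    proof -
      have "(\<integral>\<^sup>+v. g x * indicator (cball (0::real^'d) r') v * indicator (cball (0::real^'d) r') v \<partial>lborel) = g x * ennreal c" for x
      proof -
        have "(\<integral>\<^sup>+v. g x * indicator (cball (0::real^'d) r') v * indicator (cball (0::real^'d) r') v \<partial>lborel) = (\<integral>\<^sup>+v. g x * indicator (cball (0::real^'d) r') v \<partial>lborel)"
          by (intro nn_integral_cong) (auto simp: indicator_def)
        then show ?thesis by (simp add: nn_integral_cmult_indicator c)
      qed
      then show ?thesis by (simp add: mult_ac)
    qed
    also have "\<dots> \<le> (\<integral>\<^sup>+y. g (fst y) * indicator (cball 0 r') (snd y) \<partial>F z)"
      using \<epsilon>(2)[OF z m] by simp
    finally show "ennreal (\<epsilon> * c) * (\<integral>\<^sup>+x. g x * indicator (cball 0 r) x \<partial>lborel) \<le> (\<integral>\<^sup>+y. g (fst y) * indicator (cball 0 r') (snd y) \<partial>F z)" .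
    qed
  qed
qed

lemma derivative_norm_le_lipschitz:
  fixes f :: "real^'m \<Rightarrow> real^'m"
  assumes d: "(f has_derivative f') (at x)" and lip: "\<And>y. norm (f y - f x) \<le> L * norm (y - x)"
  shows "norm (f' w) \<le> L * norm w"
proof -
  let ?e = "f' w"
  let ?\<phi> = "\<lambda>t. ?e \<bullet> f (x + t *\<^sub>R w)"
  have "(f has_derivative f') (at (x + 0 *\<^sub>R w))" using d by simp
  then have "((\<lambda>t. f (x + t *\<^sub>R w)) has_derivative (\<lambda>t. f' (t *\<^sub>R w))) (at 0)"
    by (rule has_derivative_compose[rotated]) (auto intro!: derivative_eq_intros)
  then have "(?\<phi> has_derivative (\<lambda>t. ?e \<bullet> f' (t *\<^sub>R w))) (at 0)"
    by (rule has_derivative_inner_right)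
  moreover have "f' (t *\<^sub>R w) = t *\<^sub>R f' w" for t
    using has_derivative_linear[OF d] by (simp add: linear_scale)
  ultimately have "(?\<phi> has_real_derivative ?e \<bullet> f' w) (at 0)"
    by (simp add: has_field_derivative_def mult_commute_abs)
  then have "(?\<phi> has_real_derivative ?e \<bullet> f' w) (at 0 within {0<..})"
    by (rule has_field_derivative_at_within)
  then have lim: "((\<lambda>t. (?\<phi> t - ?\<phi> 0) / t) \<longlongrightarrow> ?e \<bullet> f' w) (at_right 0)"
    by (simp add: has_field_derivative_iff)
  have bnd: "(?\<phi> t - ?\<phi> 0) / t \<le> norm ?e * (L * norm w)" if t: "0 < t" for t
  proof -
    have "?\<phi> t - ?\<phi> 0 \<le> norm ?e * norm (f (x + t *\<^sub>R w) - f x)"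
      using norm_cauchy_schwarz[of ?e "f (x + t *\<^sub>R w) - f x"] by (simp add: inner_diff_right)
    also have "\<dots> \<le> norm ?e * (L * norm (x + t *\<^sub>R w - x))"
      by (intro mult_left_mono lip) simp
    also have "\<dots> = t * (norm ?e * (L * norm w))" using t by simp
    finally show ?thesis using t by (simp add: field_simps)
  qed
  have ev: "\<forall>\<^sub>F t in at_right (0::real). 0 < t" by (simp add: eventually_at_right_less)
  have "?e \<bullet> f' w \<le> norm ?e * (L * norm w)"
    by (rule tendsto_upperbound[OF lim]) (use bnd in \<open>auto intro: eventually_mono[OF ev]\<close>)
  then have "norm ?e * norm ?e \<le> norm ?e * (L * norm w)"
    by (simp add: dot_square_norm power2_eq_square)
  moreover have "0 \<le> L * norm w" if "norm ?e = 0"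
  proof -
    have "0 \<le> L * norm (x + w - x)" using lip[of "x + w"] norm_ge_zero order_trans by blast
    then show ?thesis by simp
  qed
  ultimately show ?thesis by (cases "norm ?e = 0") (auto simp: mult_le_cancel_left)
qed

lemma det_le_of_norm_le:
  fixes f :: "real^2 \<Rightarrow> real^2"
  assumes "\<And>w. norm (f w) \<le> L * norm w"
  shows "\<bar>det (matrix f)\<bar> \<le> 2 * L\<^sup>2"
proof -
  have e: "\<bar>matrix f $ i $ j\<bar> \<le> L" for i j
  proof -
    have "\<bar>matrix f $ i $ j\<bar> = \<bar>f (axis j 1) $ i\<bar>" by (simp add: matrix_def)
    also have "\<dots> \<le> norm (f (axis j 1))" by (rule component_le_norm_cart)
    also have "\<dots> \<le> L" using assms[of "axis j 1"] by (simp add: norm_axis_1)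
    finally show ?thesis .
  qed
  have "0 \<le> L" using e[of 1 1] by linarith
  then have p: "\<bar>matrix f $ i $ j * matrix f $ k $ l\<bar> \<le> L * L" for i j k l
    unfolding abs_mult by (intro mult_mono e) auto
  have "\<bar>det (matrix f)\<bar> \<le> \<bar>matrix f $ 1 $ 1 * matrix f $ 2 $ 2\<bar> + \<bar>matrix f $ 1 $ 2 * matrix f $ 2 $ 1\<bar>"
    unfolding det_2 by (rule abs_triangle_ineq4)
  also have "\<dots> \<le> L * L + L * L" by (intro add_mono p)
  finally show ?thesis by (simp add: power2_eq_square)
qed

text \<open>
  By the area formula the image of a set has measure at most \<open>2 * L\<^sup>2\<close> times that of the set. Points
  hit several times only add mass, so it suffices that \<open>\<phi>\<close> covers the ball.
\<close>

lemma lebesgue_covered_image: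
  fixes \<phi> :: "real^2 \<Rightarrow> real^2"
  assumes deriv: "\<And>v. (\<phi> has_derivative \<phi>' v) (at v)" and bound: "\<And>v w. norm (\<phi>' v w) \<le> L * norm w"
    and onto: "\<And>w. norm w \<le> r \<Longrightarrow> \<exists>v. norm v \<le> r' \<and> \<phi> v = w"
    and g: "g \<in> borel_measurable borel"
  shows "ennreal (1 / (2 * L\<^sup>2 + 1)) * (\<integral>\<^sup>+w. g w * indicator (cball 0 r) w \<partial>lborel) \<le> (\<integral>\<^sup>+v. g (\<phi> v) * indicator (cball 0 r') v \<partial>lborel)"
proof -
  define D where "D = 2 * L\<^sup>2 + 1"
  have D: "D > 0" unfolding D_def by (intro add_nonneg_pos) auto
  have cont: "continuous_on UNIV \<phi>"
    by (intro continuous_at_imp_continuous_on ballI has_derivative_continuous[OF deriv])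
  then have m [measurable]: "\<phi> \<in> borel \<rightarrow>\<^sub>M borel" by (rule borel_measurable_continuous_onI)
  let ?M1 = "scale_measure (ennreal (1 / D)) (density lborel (indicator (cball (0::real^2) r)))"
  let ?M2 = "distr (density lborel (indicator (cball (0::real^2) r'))) borel \<phi>"
  have "emeasure ?M1 E \<le> emeasure ?M2 E" if E: "E \<in> sets borel" for E
  proof -
    define S where "S = cball 0 r' \<inter> \<phi> -` E"
    have S: "S \<in> sets borel"
      unfolding S_def using measurable_sets[OF m E] by simp
    have fin: "emeasure lborel S < \<infinity>"
      using emeasure_mono[of S "cball 0 r'" lborel] emeasure_lborel_cball_finite[of "0::real^2" r']
      by (auto simp: S_def intro: le_less_trans)
    then have Slm: "S \<in> lmeasurable" using S by (intro fmeasurableI) auto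
    have d: "(\<phi> has_derivative \<phi>' v) (at v within S)" for v using deriv by (rule has_derivative_at_withinI)
    have det: "\<bar>det (matrix (\<phi>' v))\<bar> \<le> D" for v
      using det_le_of_norm_le[of "\<phi>' v" L] bound by (simp add: D_def)
    have int: "(\<lambda>v. \<bar>det (matrix (\<phi>' v))\<bar>) integrable_on S"
    proof (rule measurable_bounded_by_integrable_imp_integrable[where g="\<lambda>_. D"])
      have "(\<lambda>v. det (matrix (\<phi>' v))) \<in> borel_measurable (lebesgue_on S)"
        by (rule borel_measurable_det_Jacobian[OF fmeasurableD[OF Slm] d])
      then show "(\<lambda>v. \<bar>det (matrix (\<phi>' v))\<bar>) \<in> borel_measurable (lebesgue_on S)" by measurable
      show "(\<lambda>_. D) integrable_on S" using Slm by (rule integrable_on_const)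
    qed (use det Slm in auto)
    have img: "\<phi> ` S \<in> lmeasurable" "measure lebesgue (\<phi> ` S) \<le> D * measure lebesgue S"
      using measurable_bounded_differentiable_image[OF Slm d int det] measure_bounded_differentiable_image[OF Slm d int det] by auto
    have "E \<inter> cball 0 r \<subseteq> \<phi> ` S" using onto by (auto simp: S_def) (metis (mono_tags) imageI IntI mem_cball_0 vimageI)
    then have "emeasure lebesgue (E \<inter> cball 0 r) \<le> emeasure lebesgue (\<phi> ` S)"
      using img by (intro emeasure_mono) auto
    also have "\<dots> = ennreal (measure lebesgue (\<phi> ` S))" by (rule emeasure_eq_measure2[OF img(1)])
    also have "\<dots> \<le> ennreal (D * measure lebesgue S)" by (rule ennreal_leI[OF img(2)])
    also have "\<dots> = ennreal D * emeasure lebesgue S"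
      using D by (simp add: ennreal_mult emeasure_eq_measure2[OF Slm])
    finally have "emeasure lborel (E \<inter> cball 0 r) \<le> ennreal D * emeasure lborel S"
      using E S by simp
    then have "ennreal (1 / D) * emeasure lborel (E \<inter> cball 0 r) \<le> ennreal (1 / D) * (ennreal D * emeasure lborel S)"
      by (rule mult_left_mono) simp
    also have "\<dots> = emeasure lborel S" using D by (simp add: mult.assoc[symmetric] flip: ennreal_mult)
    finally have "ennreal (1 / D) * emeasure lborel (E \<inter> cball 0 r) \<le> emeasure lborel S" .
    moreover have "emeasure ?M1 E = ennreal (1 / D) * emeasure lborel (E \<inter> cball 0 r)"
    proof -
      have "emeasure (density lborel (indicator (cball (0::real^2) r))) E = (\<integral>\<^sup>+v. indicator (cball 0 r) v * indicator E v \<partial>lborel)"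
        by (rule emeasure_density) (use E in \<open>auto intro!: borel_measurable_indicator\<close>)
      also have "\<dots> = (\<integral>\<^sup>+v. indicator (E \<inter> cball 0 r) v \<partial>lborel)"
        by (intro nn_integral_cong) (auto simp: indicator_def)
      also have "\<dots> = emeasure lborel (E \<inter> cball 0 r)" using E by (intro nn_integral_indicator) auto
      finally show ?thesis by simp
    qed
    moreover have "emeasure ?M2 E = emeasure lborel S"
    proof -
      have "emeasure ?M2 E = (\<integral>\<^sup>+v. indicator (cball 0 r') v * indicator (\<phi> -` E) v \<partial>lborel)"
        using E measurable_sets[OF m E] emeasure_density[of "indicator (cball (0::real^2) r')" lborel "\<phi> -` E"]
        by (simp add: emeasure_distr borel_measurable_indicator)
      also have "\<dots> = (\<integral>\<^sup>+v. indicator S v \<partial>lborel)"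
        by (intro nn_integral_cong) (auto simp: S_def indicator_def)
      finally show ?thesis using S by simp
    qed
    ultimately show ?thesis by simp
  qed
  then have "emeasure ?M1 E \<le> emeasure ?M2 E" for E
    by (cases "E \<in> sets borel") (simp_all add: emeasure_notin_sets)
  then have "?M1 \<le> ?M2"
    by (auto simp: le_measure_iff space_scale_measure intro!: le_funI)
  then have "(\<integral>\<^sup>+w. g w \<partial>?M1) \<le> (\<integral>\<^sup>+w. g w \<partial>?M2)" by (intro nn_integral_mono_measure) simp_all
  moreover have "(\<integral>\<^sup>+w. g w \<partial>?M1) = ennreal (1 / D) * (\<integral>\<^sup>+w. g w * indicator (cball 0 r) w \<partial>lborel)"
  proof -
    have "(\<integral>\<^sup>+w. g w \<partial>density lborel (indicator (cball (0::real^2) r))) = (\<integral>\<^sup>+w. indicator (cball 0 r) w * g w \<partial>lborel)"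
      using g by (intro nn_integral_density borel_measurable_indicator) auto
    then show ?thesis using g by (subst nn_integral_scale_measure) (auto simp: mult.commute)
  qed
  moreover have "(\<integral>\<^sup>+w. g w \<partial>?M2) = (\<integral>\<^sup>+v. g (\<phi> v) * indicator (cball 0 r') v \<partial>lborel)"
  proof -
    have "(\<integral>\<^sup>+v. g (\<phi> v) \<partial>density lborel (indicator (cball (0::real^2) r'))) = (\<integral>\<^sup>+v. indicator (cball 0 r') v * g (\<phi> v) \<partial>lborel)"
      using g by (intro nn_integral_density borel_measurable_indicator) auto
    then show ?thesis using g by (simp add: nn_integral_distr mult.commute)
  qed
  ultimately show ?thesis by (simp add: D_def)
qed

text \<open>
  The property of the deterministic steps between two noises that turns spread velocities into
  spread positions.
\<close>

definition spreads :: "('d::finite phase \<Rightarrow> 'd phase) \<Rightarrow> bool" where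
  "spreads f \<longleftrightarrow> f \<in> borel \<rightarrow>\<^sub>M borel \<and> (\<forall>\<rho>. \<exists>B\<ge>0. \<forall>z. norm z \<le> \<rho> \<longrightarrow> norm (f z) \<le> B) \<and>
    (\<forall>B r. \<exists>r' c. 0 < c \<and> (\<forall>x. norm x \<le> B \<longrightarrow> (\<forall>g\<in>borel_measurable borel.
      ennreal c * (\<integral>\<^sup>+w. g w * indicator (cball 0 r) w \<partial>lborel) \<le> (\<integral>\<^sup>+v. g (fst (f (x, v))) * indicator (cball 0 r') v \<partial>lborel))))"

lemma position_spread_of_fibre_spread:
  fixes F :: "'d::finite kernel"
  assumes F: "F \<in> borel \<rightarrow>\<^sub>M prob_algebra borel" and sp: "fibre_spread F" and f: "spreads f"
  shows "position_spread (\<lambda>z. F z \<bind> (\<lambda>y. return borel (f y)))"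
  unfolding position_spread_def
proof (intro allI)
  fix \<rho> r :: real
  have fm [measurable]: "f \<in> borel \<rightarrow>\<^sub>M borel" using f by (simp add: spreads_def)
  obtain B where B: "B \<ge> 0" "\<And>r. \<exists>\<epsilon>>0. \<forall>z. norm z \<le> \<rho> \<longrightarrow> (\<exists>x. norm x \<le> B \<and> (\<forall>g\<in>borel_measurable borel.
     ennreal \<epsilon> * (\<integral>\<^sup>+v. g (x, v) * indicator (cball 0 r) v \<partial>lborel) \<le> (\<integral>\<^sup>+y. g y \<partial>F z)))"
    using sp unfolding fibre_spread_def by blast
  obtain r' c where c: "0 < c" "\<And>x g. norm x \<le> B \<Longrightarrow> g \<in> borel_measurable borel \<Longrightarrow>
      ennreal c * (\<integral>\<^sup>+w. g w * indicator (cball 0 r) w \<partial>lborel) \<le> (\<integral>\<^sup>+v. g (fst (f (x, v))) * indicator (cball 0 r') v \<partial>lborel)"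
    using f unfolding spreads_def by blast
  obtain \<epsilon> where \<epsilon>: "\<epsilon> > 0" "\<And>z. norm z \<le> \<rho> \<Longrightarrow> (\<exists>x. norm x \<le> B \<and> (\<forall>g\<in>borel_measurable borel.
     ennreal \<epsilon> * (\<integral>\<^sup>+v. g (x, v) * indicator (cball 0 r') v \<partial>lborel) \<le> (\<integral>\<^sup>+y. g y \<partial>F z)))"
    using B(2)[of r'] by blast
  obtain B' where B': "B' \<ge> 0" "\<And>z. norm z \<le> B + \<bar>r'\<bar> \<Longrightarrow> norm (f z) \<le> B'"
    using f unfolding spreads_def by blast
  show "\<exists>\<epsilon>>0. \<exists>B\<ge>0. \<forall>z. norm z \<le> \<rho> \<longrightarrow> (\<forall>g\<in>borel_measurable borel.
     ennreal \<epsilon> * (\<integral>\<^sup>+x. g x * indicator (cball 0 r) x \<partial>lborel) \<le> (\<integral>\<^sup>+y. g (fst y) * indicator (cball 0 B) (snd y) \<partial>(F z \<bind> (\<lambda>y. return borel (f y)))))"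
  proof (rule exI[of _ "\<epsilon> * c"], rule conjI)
    show "\<epsilon> * c > 0" using \<epsilon> c by simp
    show "\<exists>B\<ge>0. \<forall>z. norm z \<le> \<rho> \<longrightarrow> (\<forall>g\<in>borel_measurable borel.
     ennreal (\<epsilon> * c) * (\<integral>\<^sup>+x. g x * indicator (cball 0 r) x \<partial>lborel) \<le> (\<integral>\<^sup>+y. g (fst y) * indicator (cball 0 B) (snd y) \<partial>(F z \<bind> (\<lambda>y. return borel (f y)))))"
    proof (rule exI[of _ B'], intro conjI allI impI ballI)
      show "0 \<le> B'" by fact
      fix z :: "'d phase" and g :: "real^'d \<Rightarrow> ennreal"
      assume z: "norm z \<le> \<rho>" and g [measurable]: "g \<in> borel_measurable borel"
      obtain x where x: "norm x \<le> B" "\<And>g. g \<in> borel_measurable borel \<Longrightarrow>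
        ennreal \<epsilon> * (\<integral>\<^sup>+v. g (x, v) * indicator (cball 0 r') v \<partial>lborel) \<le> (\<integral>\<^sup>+y. g y \<partial>F z)"
        using \<epsilon>(2)[OF z] by blast
      let ?G = "\<lambda>y::'d phase. g (fst y) * indicator (cball 0 B') (snd y)"
      have m: "?G \<in> borel_measurable borel"
        by (intro borel_measurable_times_ennreal measurable_compose[OF _ g]
          measurable_compose[OF _ borel_measurable_indicator[of "cball 0 B'" borel]] fst_snd_borel) simp
      have "ennreal (\<epsilon> * c) * (\<integral>\<^sup>+x. g x * indicator (cball 0 r) x \<partial>lborel) = ennreal \<epsilon> * (ennreal c * (\<integral>\<^sup>+x. g x * indicator (cball 0 r) x \<partial>lborel))"
        using \<epsilon> c by (simp add: ennreal_mult mult.assoc)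
      also have "\<dots> \<le> ennreal \<epsilon> * (\<integral>\<^sup>+v. g (fst (f (x, v))) * indicator (cball 0 r') v \<partial>lborel)"
        by (intro mult_left_mono c(2) x g) simp
      also have "\<dots> \<le> ennreal \<epsilon> * (\<integral>\<^sup>+v. ?G (f (x, v)) * indicator (cball 0 r') v \<partial>lborel)"
      proof (intro mult_left_mono nn_integral_mono)
        fix v :: "real^'d"
        have "norm (snd (f (x, v))) \<le> B'" if "norm v \<le> r'"
        proof -
          have "norm (x, v) \<le> B + \<bar>r'\<bar>" using norm_le_fst_snd[of "(x, v)"] x(1) that by simp
          from B'(2)[OF this] show ?thesis using norm_fst_snd_le(2)[of "f (x, v)"] by linarith
        qed
        then show "g (fst (f (x, v))) * indicator (cball 0 r') v \<le> ?G (f (x, v)) * indicator (cball 0 r') v"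
          by (auto simp: indicator_def)
      qed simp
      also have "\<dots> \<le> (\<integral>\<^sup>+y. ?G (f y) \<partial>F z)"
        by (rule x(2)) (rule measurable_compose[OF fm m])
      also have "\<dots> = (\<integral>\<^sup>+y. ?G y \<partial>(F z \<bind> (\<lambda>y. return borel (f y))))"
        by (rule nn_integral_bind_return[OF F m fm, symmetric])
      finally show "ennreal (\<epsilon> * c) * (\<integral>\<^sup>+x. g x * indicator (cball 0 r) x \<partial>lborel) \<le> (\<integral>\<^sup>+y. ?G y \<partial>(F z \<bind> (\<lambda>y. return borel (f y))))" .
    qed
  qed
qed

text \<open>
  The maps in question are shears, hence preserve volume; so full spreading survives as soon as
  each box is covered by the image of a larger one.
\<close>

lemma phase_spread_of_box_cover:
  fixes F :: "'d::finite kernel"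
  assumes F: "F \<in> borel \<rightarrow>\<^sub>M prob_algebra borel" and sp: "phase_spread F" and f [measurable]: "f \<in> borel \<rightarrow>\<^sub>M borel"
    and cover: "\<And>r. \<exists>r'. \<forall>g\<in>borel_measurable borel.
      (\<integral>\<^sup>+x. (\<integral>\<^sup>+v. g (x, v) * indicator (cball 0 r) v \<partial>lborel) * indicator (cball 0 r) x \<partial>lborel)
       \<le> (\<integral>\<^sup>+x. (\<integral>\<^sup>+v. g (f (x, v)) * indicator (cball 0 r') v \<partial>lborel) * indicator (cball 0 r') x \<partial>lborel)"
  shows "phase_spread (\<lambda>z. F z \<bind> (\<lambda>y. return borel (f y)))"
  unfolding phase_spread_def
proof (intro allI)
  fix \<rho> r :: real
  obtain r' where r': "\<And>g. g \<in> borel_measurable borel \<Longrightarrow>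
      (\<integral>\<^sup>+x. (\<integral>\<^sup>+v. g (x, v) * indicator (cball 0 r) v \<partial>lborel) * indicator (cball 0 r) x \<partial>lborel)
       \<le> (\<integral>\<^sup>+x. (\<integral>\<^sup>+v. g (f (x, v)) * indicator (cball 0 r') v \<partial>lborel) * indicator (cball 0 r') x \<partial>lborel)"
    using cover by blast
  obtain \<epsilon> where \<epsilon>: "\<epsilon> > 0" "\<And>z g. norm z \<le> \<rho> \<Longrightarrow> g \<in> borel_measurable borel \<Longrightarrow>
     ennreal \<epsilon> * (\<integral>\<^sup>+x. (\<integral>\<^sup>+v. g (x, v) * indicator (cball 0 r') v \<partial>lborel) * indicator (cball 0 r') x \<partial>lborel) \<le> (\<integral>\<^sup>+y. g y \<partial>F z)"
    using sp[unfolded phase_spread_def, rule_format, of \<rho> r'] by blast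
  show "\<exists>\<epsilon>>0. \<forall>z. norm z \<le> \<rho> \<longrightarrow> (\<forall>g\<in>borel_measurable borel.
     ennreal \<epsilon> * (\<integral>\<^sup>+x. (\<integral>\<^sup>+v. g (x, v) * indicator (cball 0 r) v \<partial>lborel) * indicator (cball 0 r) x \<partial>lborel) \<le> (\<integral>\<^sup>+y. g y \<partial>(F z \<bind> (\<lambda>y. return borel (f y)))))"
  proof (rule exI[of _ \<epsilon>], intro conjI allI impI ballI)
    fix z :: "'d phase" and g :: "'d phase \<Rightarrow> ennreal"
    assume z: "norm z \<le> \<rho>" and g [measurable]: "g \<in> borel_measurable borel"
    have "ennreal \<epsilon> * (\<integral>\<^sup>+x. (\<integral>\<^sup>+v. g (x, v) * indicator (cball 0 r) v \<partial>lborel) * indicator (cball 0 r) x \<partial>lborel)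
      \<le> ennreal \<epsilon> * (\<integral>\<^sup>+x. (\<integral>\<^sup>+v. g (f (x, v)) * indicator (cball 0 r') v \<partial>lborel) * indicator (cball 0 r') x \<partial>lborel)"
      by (intro mult_left_mono r' g) simp
    also have "\<dots> \<le> (\<integral>\<^sup>+y. g (f y) \<partial>F z)" by (rule \<epsilon>(2)[OF z]) measurable
    also have "\<dots> = (\<integral>\<^sup>+y. g y \<partial>(F z \<bind> (\<lambda>y. return borel (f y))))"
      by (rule nn_integral_bind_return[OF F g f, symmetric])
    finally show "ennreal \<epsilon> * (\<integral>\<^sup>+x. (\<integral>\<^sup>+v. g (x, v) * indicator (cball 0 r) v \<partial>lborel) * indicator (cball 0 r) x \<partial>lborel) \<le> (\<integral>\<^sup>+y. g y \<partial>(F z \<bind> (\<lambda>y. return borel (f y))))" .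
  qed (use \<epsilon> in simp)
qed

lemma box_cover_A:
  fixes g :: "'d::finite phase \<Rightarrow> ennreal"
  assumes [measurable]: "g \<in> borel_measurable borel" and r': "r + \<bar>t\<bar> * \<bar>r\<bar> \<le> r'" "r \<le> r'"
  shows "(\<integral>\<^sup>+x. (\<integral>\<^sup>+v. g (x, v) * indicator (cball 0 r) v \<partial>lborel) * indicator (cball 0 r) x \<partial>lborel)
       \<le> (\<integral>\<^sup>+x. (\<integral>\<^sup>+v. g (x + t *\<^sub>R v, v) * indicator (cball 0 r') v \<partial>lborel) * indicator (cball 0 r') x \<partial>lborel)"
proof -
  have ind: "(\<lambda>p::'d phase. indicator (cball 0 r) (fst p) :: ennreal) \<in> borel_measurable borel"
    "(\<lambda>p::'d phase. indicator (cball 0 r) (snd p) :: ennreal) \<in> borel_measurable borel" for r :: real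
    by (rule measurable_compose[OF fst_snd_borel(1) borel_measurable_indicator], simp)
       (rule measurable_compose[OF fst_snd_borel(2) borel_measurable_indicator], simp)
  have prod: "(\<lambda>(x, v). G (x, v)) \<in> borel_measurable (lborel \<Otimes>\<^sub>M lborel)" if "G \<in> borel_measurable borel" for G :: "'d phase \<Rightarrow> ennreal"
    using that unfolding lborel_prod by (simp add: case_prod_beta')
  have swap: "(\<integral>\<^sup>+x. (\<integral>\<^sup>+v. G (x, v) * indicator (cball 0 r) v \<partial>lborel) * indicator (cball 0 r) x \<partial>lborel)
      = (\<integral>\<^sup>+v. (\<integral>\<^sup>+x. G (x, v) * indicator (cball 0 r) x \<partial>lborel) * indicator (cball 0 r) v \<partial>lborel)"
    if G: "G \<in> borel_measurable borel" for G :: "'d phase \<Rightarrow> ennreal" and r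
  proof -
    have m: "(\<lambda>v. G (x, v) * indicator (cball 0 r) v) \<in> borel_measurable borel" "(\<lambda>v. G (v, x) * indicator (cball 0 r) v) \<in> borel_measurable borel" for x
      by (intro borel_measurable_times_ennreal measurable_compose[OF _ G] borel_measurable_indicator, simp_all)+
    have "(\<integral>\<^sup>+x. (\<integral>\<^sup>+v. G (x, v) * indicator (cball 0 r) v \<partial>lborel) * indicator (cball 0 r) x \<partial>lborel)
      = (\<integral>\<^sup>+x. \<integral>\<^sup>+v. G (x, v) * indicator (cball 0 r) v * indicator (cball 0 r) x \<partial>lborel \<partial>lborel)"
      using m by (simp add: nn_integral_multc)
    also have "\<dots> = (\<integral>\<^sup>+v. \<integral>\<^sup>+x. G (x, v) * indicator (cball 0 r) v * indicator (cball 0 r) x \<partial>lborel \<partial>lborel)"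
    proof (rule lborel_pair.Fubini'[symmetric])
      show "(\<lambda>(x, v). G (x, v) * indicator (cball 0 r) v * indicator (cball 0 r) x) \<in> borel_measurable (lborel \<Otimes>\<^sub>M lborel)"
        using prod[of "\<lambda>p. G p * indicator (cball 0 r) (snd p) * indicator (cball 0 r) (fst p)"] G ind by simp
    qed
    also have "\<dots> = (\<integral>\<^sup>+v. (\<integral>\<^sup>+x. G (x, v) * indicator (cball 0 r) x \<partial>lborel) * indicator (cball 0 r) v \<partial>lborel)"
    proof (rule nn_integral_cong)
      fix v :: "real^'d"
      have "(\<integral>\<^sup>+x. G (x, v) * indicator (cball 0 r) v * indicator (cball 0 r) x \<partial>lborel)
        = (\<integral>\<^sup>+x. (G (x, v) * indicator (cball 0 r) x) * indicator (cball 0 r) v \<partial>lborel)"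
        by (simp add: mult_ac)
      also have "\<dots> = (\<integral>\<^sup>+x. G (x, v) * indicator (cball 0 r) x \<partial>lborel) * indicator (cball 0 r) v"
        using m by (intro nn_integral_multc) simp
      finally show "(\<integral>\<^sup>+x. G (x, v) * indicator (cball 0 r) v * indicator (cball 0 r) x \<partial>lborel)
        = (\<integral>\<^sup>+x. G (x, v) * indicator (cball 0 r) x \<partial>lborel) * indicator (cball 0 r) v" .
    qed
    finally show ?thesis .
  qed
  have T: "(\<lambda>p::'d phase. (fst p + t *\<^sub>R snd p, snd p)) \<in> borel \<rightarrow>\<^sub>M borel"
    by (intro borel_measurable_continuous_onI continuous_intros)
  have gT: "(\<lambda>p. g (fst p + t *\<^sub>R snd p, snd p)) \<in> borel_measurable borel"
    by (rule measurable_compose[OF T assms(1)])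
  have "(\<integral>\<^sup>+x. (\<integral>\<^sup>+v. g (x, v) * indicator (cball 0 r) v \<partial>lborel) * indicator (cball 0 r) x \<partial>lborel)
    = (\<integral>\<^sup>+v. (\<integral>\<^sup>+x. g (x, v) * indicator (cball 0 r) x \<partial>lborel) * indicator (cball 0 r) v \<partial>lborel)"
    by (rule swap) simp
  also have "\<dots> \<le> (\<integral>\<^sup>+v. (\<integral>\<^sup>+x. g (x + t *\<^sub>R v, v) * indicator (cball 0 r') x \<partial>lborel) * indicator (cball 0 r') v \<partial>lborel)"
  proof (rule nn_integral_mono)
    fix v :: "real^'d"
    show "(\<integral>\<^sup>+x. g (x, v) * indicator (cball 0 r) x \<partial>lborel) * indicator (cball 0 r) v
      \<le> (\<integral>\<^sup>+x. g (x + t *\<^sub>R v, v) * indicator (cball 0 r') x \<partial>lborel) * indicator (cball 0 r') v"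
    proof (cases "norm v \<le> r")
      case True
      have "norm v \<le> \<bar>r\<bar>" using True by linarith
      then have "\<bar>t\<bar> * norm v \<le> \<bar>t\<bar> * \<bar>r\<bar>" by (rule mult_left_mono) simp
      then have "r + norm (t *\<^sub>R v) \<le> r'" using r' by simp
      then have "(\<integral>\<^sup>+x. g (x, v) * indicator (cball 0 r) x \<partial>lborel) \<le> (\<integral>\<^sup>+x. g (x + t *\<^sub>R v, v) * indicator (cball 0 r') x \<partial>lborel)"
        by (intro nn_integral_ball_shift[of "\<lambda>x. g (x, v)"] measurable_compose[OF _ assms(1)]) simp_all
      then show ?thesis using True r' by simp
    qed simp
  qed
  also have "\<dots> = (\<integral>\<^sup>+x. (\<integral>\<^sup>+v. g (x + t *\<^sub>R v, v) * indicator (cball 0 r') v \<partial>lborel) * indicator (cball 0 r') x \<partial>lborel)"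
    using swap[OF gT, of r'] by simp
  finally show ?thesis .
qed

lemma box_cover_B:
  fixes g :: "'d::finite phase \<Rightarrow> ennreal"
  assumes [measurable]: "g \<in> borel_measurable borel" and B: "\<And>x. norm x \<le> r \<Longrightarrow> norm (\<Gamma> x) \<le> B"
    and r': "r + \<bar>t\<bar> * B \<le> r'" "r \<le> r'"
  shows "(\<integral>\<^sup>+x. (\<integral>\<^sup>+v. g (x, v) * indicator (cball 0 r) v \<partial>lborel) * indicator (cball 0 r) x \<partial>lborel)
       \<le> (\<integral>\<^sup>+x. (\<integral>\<^sup>+v. g (x, v - t *\<^sub>R \<Gamma> x) * indicator (cball 0 r') v \<partial>lborel) * indicator (cball 0 r') x \<partial>lborel)"
proof (rule nn_integral_mono)
  fix x :: "real^'d"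
  show "(\<integral>\<^sup>+v. g (x, v) * indicator (cball 0 r) v \<partial>lborel) * indicator (cball 0 r) x
      \<le> (\<integral>\<^sup>+v. g (x, v - t *\<^sub>R \<Gamma> x) * indicator (cball 0 r') v \<partial>lborel) * indicator (cball 0 r') x"
  proof (cases "norm x \<le> r")
    case True
    have "r + norm (- (t *\<^sub>R \<Gamma> x)) \<le> r'" using r' mult_left_mono[OF B[OF True], of "\<bar>t\<bar>"] by simp
    from nn_integral_ball_shift[OF _ this, of "\<lambda>v. g (x, v)"]
    have "(\<integral>\<^sup>+v. g (x, v) * indicator (cball 0 r) v \<partial>lborel) \<le> (\<integral>\<^sup>+v. g (x, v - t *\<^sub>R \<Gamma> x) * indicator (cball 0 r') v \<partial>lborel)"
      by simp
    then show ?thesis using True r' by simp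
  qed simp
qed

lemma fibre_spread_B:
  fixes F :: "'d::finite kernel"
  assumes F: "F \<in> borel \<rightarrow>\<^sub>M prob_algebra borel" and sp: "fibre_spread F"
    and f: "(\<lambda>y::'d phase. (fst y, snd y - t *\<^sub>R \<Gamma> (fst y))) \<in> borel \<rightarrow>\<^sub>M borel"
    and bd: "\<And>r. \<exists>B. \<forall>x. norm x \<le> r \<longrightarrow> norm (\<Gamma> x) \<le> B"
  shows "fibre_spread (\<lambda>z. F z \<bind> (\<lambda>y. return borel (fst y, snd y - t *\<^sub>R \<Gamma> (fst y))))"
  unfolding fibre_spread_def
proof
  fix \<rho> :: real
  obtain B where B: "B \<ge> 0" "\<And>r. \<exists>\<epsilon>>0. \<forall>z. norm z \<le> \<rho> \<longrightarrow> (\<exists>x. norm x \<le> B \<and> (\<forall>g\<in>borel_measurable borel.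
     ennreal \<epsilon> * (\<integral>\<^sup>+v. g (x, v) * indicator (cball 0 r) v \<partial>lborel) \<le> (\<integral>\<^sup>+y. g y \<partial>F z)))"
    using sp unfolding fibre_spread_def by blast
  obtain G where G: "\<And>x. norm x \<le> B \<Longrightarrow> norm (\<Gamma> x) \<le> G" using bd by blast
  let ?K = "\<lambda>z. F z \<bind> (\<lambda>y. return borel (fst y, snd y - t *\<^sub>R \<Gamma> (fst y)))"
  show "\<exists>B\<ge>0. \<forall>r. \<exists>\<epsilon>>0. \<forall>z. norm z \<le> \<rho> \<longrightarrow> (\<exists>x. norm x \<le> B \<and> (\<forall>g\<in>borel_measurable borel.
     ennreal \<epsilon> * (\<integral>\<^sup>+v. g (x, v) * indicator (cball 0 r) v \<partial>lborel) \<le> (\<integral>\<^sup>+y. g y \<partial>?K z)))"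
  proof (rule exI[of _ B], intro conjI allI B(1))
    fix r :: real
    define r' where "r' = r + \<bar>t\<bar> * G"
    obtain \<epsilon> where \<epsilon>: "\<epsilon> > 0" "\<And>z. norm z \<le> \<rho> \<Longrightarrow> (\<exists>x. norm x \<le> B \<and> (\<forall>g\<in>borel_measurable borel.
     ennreal \<epsilon> * (\<integral>\<^sup>+v. g (x, v) * indicator (cball 0 r') v \<partial>lborel) \<le> (\<integral>\<^sup>+y. g y \<partial>F z)))"
      using B(2)[of r'] by blast
    show "\<exists>\<epsilon>>0. \<forall>z. norm z \<le> \<rho> \<longrightarrow> (\<exists>x. norm x \<le> B \<and> (\<forall>g\<in>borel_measurable borel.
     ennreal \<epsilon> * (\<integral>\<^sup>+v. g (x, v) * indicator (cball 0 r) v \<partial>lborel) \<le> (\<integral>\<^sup>+y. g y \<partial>?K z)))"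
    proof (rule exI[of _ \<epsilon>], intro conjI allI impI \<epsilon>(1))
      fix z :: "'d phase" assume z: "norm z \<le> \<rho>"
      obtain x where x: "norm x \<le> B" "\<And>g. g \<in> borel_measurable borel \<Longrightarrow>
        ennreal \<epsilon> * (\<integral>\<^sup>+v. g (x, v) * indicator (cball 0 r') v \<partial>lborel) \<le> (\<integral>\<^sup>+y. g y \<partial>F z)"
        using \<epsilon>(2)[OF z] by blast
      show "\<exists>x. norm x \<le> B \<and> (\<forall>g\<in>borel_measurable borel.
         ennreal \<epsilon> * (\<integral>\<^sup>+v. g (x, v) * indicator (cball 0 r) v \<partial>lborel) \<le> (\<integral>\<^sup>+y. g y \<partial>?K z))"
      proof (rule exI[of _ x], intro conjI ballI x(1))
        fix g :: "'d phase \<Rightarrow> ennreal" assume g [measurable]: "g \<in> borel_measurable borel"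
        have "r + norm (- (t *\<^sub>R \<Gamma> x)) \<le> r'" using mult_left_mono[OF G[OF x(1)], of "\<bar>t\<bar>"] by (simp add: r'_def)
        from nn_integral_ball_shift[OF _ this, of "\<lambda>v. g (x, v)"]
        have "ennreal \<epsilon> * (\<integral>\<^sup>+v. g (x, v) * indicator (cball 0 r) v \<partial>lborel) \<le> ennreal \<epsilon> * (\<integral>\<^sup>+v. g (x, v - t *\<^sub>R \<Gamma> x) * indicator (cball 0 r') v \<partial>lborel)"
          by (intro mult_left_mono) simp_all
        also have "\<dots> \<le> (\<integral>\<^sup>+y. g (fst y, snd y - t *\<^sub>R \<Gamma> (fst y)) \<partial>F z)"
          using x(2)[OF measurable_compose[OF f g]] by simp
        also have "\<dots> = (\<integral>\<^sup>+y. g y \<partial>?K z)"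
          by (rule nn_integral_bind_return[OF F g f, symmetric])
        finally show "ennreal \<epsilon> * (\<integral>\<^sup>+v. g (x, v) * indicator (cball 0 r) v \<partial>lborel) \<le> (\<integral>\<^sup>+y. g y \<partial>?K z)" .
      qed
    qed
  qed
qed

lemma word_kernel_append_deterministic:
  assumes meas: "gradient U \<in> borel_measurable borel" and w': "\<And>t. O_letter t \<notin> set w'"
    and maps: "\<And>w. word_map (gradient U) \<gamma> w \<in> borel \<rightarrow>\<^sub>M borel"
  shows "word_kernel U \<gamma> (w @ w') z = word_kernel U \<gamma> w z \<bind> (\<lambda>y. return borel (word_map (gradient U) \<gamma> w' y))"
  using w'
proof (induction w' rule: rev_induct)
  case Nil
  have "sets (word_kernel U \<gamma> w z) = sets borel"
    using measurable_space[OF word_kernel_prob[OF meas], of z] by (simp add: space_prob_algebra)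
  then show ?case by (simp add: bind_return'')
next
  case (snoc l w')
  let ?f = "word_map (gradient U) \<gamma> w'"
  have sets: "sets (word_kernel U \<gamma> w z) = sets borel"
    using measurable_space[OF word_kernel_prob[OF meas], of z] by (simp add: space_prob_algebra)
  have L: "letter_kernel U \<gamma> l \<in> borel \<rightarrow>\<^sub>M subprob_algebra borel"
    by (rule measurable_prob_algebraD[OF letter_kernel_prob[OF meas]])
  have R: "(\<lambda>y. return borel (?f y)) \<in> borel \<rightarrow>\<^sub>M subprob_algebra borel"
    by (rule measurable_compose[OF maps return_measurable])
  have l: "letter_kernel U \<gamma> l y = return borel (letter_map (gradient U) \<gamma> l y)" for y
    using snoc.prems by (cases l) (auto simp: step_A_def step_B_def case_prod_beta')
  have "word_kernel U \<gamma> (w @ w' @ [l]) z = word_kernel U \<gamma> ((w @ w') @ [l]) z" by simp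
  also have "\<dots> = word_kernel U \<gamma> w z \<bind> (\<lambda>y. return borel (?f y)) \<bind> letter_kernel U \<gamma> l"
    unfolding word_kernel_simps(2) using snoc by simp
  also have "\<dots> = word_kernel U \<gamma> w z \<bind> (\<lambda>y. return borel (?f y) \<bind> letter_kernel U \<gamma> l)"
    by (rule bind_assoc[OF _ L]) (use R in \<open>simp add: measurable_cong_sets[OF sets refl]\<close>)
  also have "\<dots> = word_kernel U \<gamma> w z \<bind> (\<lambda>y. return borel (word_map (gradient U) \<gamma> (w' @ [l]) y))"
    by (simp add: bind_return[OF L] l)
  finally show ?case .
qed

lemma word_kernel_append:
  assumes meas: "gradient U \<in> borel_measurable borel"
  shows "word_kernel U \<gamma> (w @ w') z = word_kernel U \<gamma> w z \<bind> word_kernel U \<gamma> w'"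
proof (induction w' rule: rev_induct)
  case Nil
  have "sets (word_kernel U \<gamma> w z) = sets borel"
    using measurable_space[OF word_kernel_prob[OF meas], of z] by (simp add: space_prob_algebra)
  then show ?case by (simp add: bind_return'')
next
  case (snoc l w')
  have sets: "sets (word_kernel U \<gamma> w z) = sets borel"
    using measurable_space[OF word_kernel_prob[OF meas], of z] by (simp add: space_prob_algebra)
  have L: "letter_kernel U \<gamma> l \<in> borel \<rightarrow>\<^sub>M subprob_algebra borel"
    by (rule measurable_prob_algebraD[OF letter_kernel_prob[OF meas]])
  have W: "word_kernel U \<gamma> w' \<in> borel \<rightarrow>\<^sub>M subprob_algebra borel"
    by (rule measurable_prob_algebraD[OF word_kernel_prob[OF meas]])
  have "word_kernel U \<gamma> (w @ w' @ [l]) z = word_kernel U \<gamma> ((w @ w') @ [l]) z" by simp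
  also have "\<dots> = word_kernel U \<gamma> w z \<bind> word_kernel U \<gamma> w' \<bind> letter_kernel U \<gamma> l"
    unfolding word_kernel_simps(2) using snoc by simp
  also have "\<dots> = word_kernel U \<gamma> w z \<bind> (\<lambda>y. word_kernel U \<gamma> w' y \<bind> letter_kernel U \<gamma> l)"
    by (rule bind_assoc[OF _ L]) (use W in \<open>simp add: measurable_cong_sets[OF sets refl]\<close>)
  finally show ?case by simp
qed

section \<open>Two steps of a splitting reach all of phase space\<close>

locale lipschitz_gradient =
  fixes U :: "real^2 \<Rightarrow> real" and \<kappa> :: real
  assumes kappa: "0 < \<kappa>" and lip: "\<And>x y. norm (gradient U x - gradient U y) \<le> \<kappa> * norm (x - y)"
    and diff: "\<And>x. gradient U differentiable (at x)"
begin

abbreviation \<Gamma> :: "real^2 \<Rightarrow> real^2" where "\<Gamma> \<equiv> gradient U"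

lemma gradient_continuous: "continuous_on A \<Gamma>"
  using differentiable_imp_continuous_within[OF diff] continuous_at_imp_continuous_on by blast

lemma gradient_measurable [measurable]: "\<Gamma> \<in> borel_measurable borel"
  by (rule borel_measurable_continuous_onI[OF gradient_continuous])

lemma word_map_lip: "\<exists>k\<ge>0. \<forall>z z'. norm (word_map \<Gamma> \<gamma> w z - word_map \<Gamma> \<gamma> w z') \<le> k * norm (z - z')"
  using word_map_lipschitz[of \<kappa> \<gamma> w] lip by blast

lemma word_map_measurable [measurable]: "word_map \<Gamma> \<gamma> w \<in> borel \<rightarrow>\<^sub>M borel"
proof -
  obtain k where k: "k \<ge> 0" "\<And>z z'. norm (word_map \<Gamma> \<gamma> w z - word_map \<Gamma> \<gamma> w z') \<le> k * norm (z - z')"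
    using word_map_lip by blast
  show ?thesis
    by (intro borel_measurable_continuous_onI lipschitz_on_continuous_on[where L=k] lipschitz_onI)
       (use k in \<open>auto simp only: dist_norm\<close>)
qed

lemma word_map_bounded: "\<exists>B\<ge>0. \<forall>z. norm z \<le> \<rho> \<longrightarrow> norm (word_map \<Gamma> \<gamma> w z) \<le> B"
proof -
  obtain k where k: "k \<ge> 0" "\<And>z z'. norm (word_map \<Gamma> \<gamma> w z - word_map \<Gamma> \<gamma> w z') \<le> k * norm (z - z')"
    using word_map_lip by blast
  show ?thesis
  proof (rule exI[of _ "norm (word_map \<Gamma> \<gamma> w 0) + k * \<bar>\<rho>\<bar>"], intro conjI allI impI)
    fix z :: "2 phase" assume z: "norm z \<le> \<rho>"
    have "norm (word_map \<Gamma> \<gamma> w z) \<le> norm (word_map \<Gamma> \<gamma> w 0) + norm (word_map \<Gamma> \<gamma> w z - word_map \<Gamma> \<gamma> w 0)"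
      using norm_triangle_sub by blast
    also have "norm (word_map \<Gamma> \<gamma> w z - word_map \<Gamma> \<gamma> w 0) \<le> k * norm z" using k(2)[of z 0] by simp
    also have "\<dots> \<le> k * \<bar>\<rho>\<bar>" using z k(1) by (intro mult_left_mono) auto
    finally show "norm (word_map \<Gamma> \<gamma> w z) \<le> norm (word_map \<Gamma> \<gamma> w 0) + k * \<bar>\<rho>\<bar>" by simp
  qed (use k in simp)
qed

lemma gradient_bounded: "\<exists>B. \<forall>x. norm x \<le> r \<longrightarrow> norm (\<Gamma> x) \<le> B"
proof (intro exI allI impI)
  fix x :: "real^2" assume "norm x \<le> r"
  then have "\<kappa> * norm x \<le> \<kappa> * r" using kappa by simp
  moreover have "norm (\<Gamma> x) \<le> norm (\<Gamma> 0) + norm (\<Gamma> x - \<Gamma> 0)" using norm_triangle_sub by blast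
  ultimately show "norm (\<Gamma> x) \<le> norm (\<Gamma> 0) + \<kappa> * r" using lip[of x 0] by simp
qed

text \<open>
  To reach the position \<open>y\<close> one solves for the velocity. This is a fixed point problem for a map
  with Lipschitz constant \<open>s * \<kappa> / 2 < 1\<close>, and the contraction also bounds the solution.
\<close>

lemma spreads_of_position_form:
  assumes t: "0 < t" and s: "0 \<le> s" "s * \<kappa> < 2"
    and form: "\<And>x v. fst (word_map \<Gamma> \<gamma> w (x, v)) = x + t *\<^sub>R v - s *\<^sub>R \<Gamma> (x + (t / 2) *\<^sub>R v)"
  shows "spreads (word_map \<Gamma> \<gamma> w)"
  unfolding spreads_def
proof (intro conjI allI)
  show "word_map \<Gamma> \<gamma> w \<in> borel \<rightarrow>\<^sub>M borel" by measurable
  show "\<exists>B\<ge>0. \<forall>z. norm z \<le> \<rho> \<longrightarrow> norm (word_map \<Gamma> \<gamma> w z) \<le> B" for \<rho> by (rule word_map_bounded)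
  fix B r :: real
  define q where "q = s * \<kappa> / 2"
  have q: "0 \<le> q" "q < 1" using s kappa by (auto simp: q_def)
  define L where "L = t + s * (\<kappa> * (t / 2))"
  define r' where "r' = (\<bar>r\<bar> + \<bar>B\<bar> + s * (norm (\<Gamma> 0) + \<kappa> * \<bar>B\<bar>)) / t / (1 - q)"
  show "\<exists>r' c. 0 < c \<and> (\<forall>x. norm x \<le> B \<longrightarrow> (\<forall>g\<in>borel_measurable borel.
      ennreal c * (\<integral>\<^sup>+w. g w * indicator (cball 0 r) w \<partial>lborel) \<le> (\<integral>\<^sup>+v. g (fst (word_map \<Gamma> \<gamma> w (x, v))) * indicator (cball 0 r') v \<partial>lborel)))"
  proof (rule exI[of _ r'], rule exI[of _ "1 / (2 * L\<^sup>2 + 1)"], intro conjI allI impI ballI)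
    show "0 < 1 / (2 * L\<^sup>2 + 1)" by (intro divide_pos_pos add_nonneg_pos) auto
    fix x :: "real^2" and g :: "real^2 \<Rightarrow> ennreal" assume x: "norm x \<le> B" and g: "g \<in> borel_measurable borel"
    let ?D = "\<lambda>y. frechet_derivative \<Gamma> (at y)"
    let ?\<phi> = "\<lambda>v. x + t *\<^sub>R v - s *\<^sub>R \<Gamma> (x + (t / 2) *\<^sub>R v)"
    let ?\<phi>' = "\<lambda>v w. t *\<^sub>R w - s *\<^sub>R ?D (x + (t / 2) *\<^sub>R v) ((t / 2) *\<^sub>R w)"
    have D: "(\<Gamma> has_derivative ?D y) (at y)" for y using diff frechet_derivative_works by blast
    have "ennreal (1 / (2 * L\<^sup>2 + 1)) * (\<integral>\<^sup>+w. g w * indicator (cball 0 r) w \<partial>lborel) \<le> (\<integral>\<^sup>+v. g (?\<phi> v) * indicator (cball 0 r') v \<partial>lborel)"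
    proof (rule lebesgue_covered_image[where \<phi>'="?\<phi>'"])
      fix v :: "real^2"
      have "((\<lambda>v. \<Gamma> (x + (t / 2) *\<^sub>R v)) has_derivative (\<lambda>w. ?D (x + (t / 2) *\<^sub>R v) ((t / 2) *\<^sub>R w))) (at v)"
        by (rule has_derivative_compose[OF _ D]) (auto intro!: derivative_eq_intros)
      then show "(?\<phi> has_derivative ?\<phi>' v) (at v)"
        by (auto intro!: derivative_eq_intros)
    next
      fix v w :: "real^2"
      have "norm (?D (x + (t / 2) *\<^sub>R v) ((t / 2) *\<^sub>R w)) \<le> \<kappa> * norm ((t / 2) *\<^sub>R w)"
        by (rule derivative_norm_le_lipschitz[OF D lip])
      then have "norm (s *\<^sub>R ?D (x + (t / 2) *\<^sub>R v) ((t / 2) *\<^sub>R w)) \<le> s * (\<kappa> * ((t / 2) * norm w))"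
        using s t mult_left_mono[of "norm (?D (x + (t / 2) *\<^sub>R v) ((t / 2) *\<^sub>R w))" "\<kappa> * ((t / 2) * norm w)" s] by simp
      then show "norm (?\<phi>' v w) \<le> L * norm w"
        using norm_triangle_ineq4[of "t *\<^sub>R w" "s *\<^sub>R ?D (x + (t / 2) *\<^sub>R v) ((t / 2) *\<^sub>R w)"] t
        by (simp add: L_def algebra_simps)
    next
      fix y :: "real^2" assume y: "norm y \<le> r"
      define \<Theta> where "\<Theta> v = (1 / t) *\<^sub>R (y - x + s *\<^sub>R \<Gamma> (x + (t / 2) *\<^sub>R v))" for v
      have con: "norm (\<Theta> v - \<Theta> v') \<le> q * norm (v - v')" for v v'
      proof -
        have "\<Theta> v - \<Theta> v' = (s / t) *\<^sub>R (\<Gamma> (x + (t / 2) *\<^sub>R v) - \<Gamma> (x + (t / 2) *\<^sub>R v'))"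
          by (simp add: \<Theta>_def algebra_simps)
        then have "norm (\<Theta> v - \<Theta> v') = (s / t) * norm (\<Gamma> (x + (t / 2) *\<^sub>R v) - \<Gamma> (x + (t / 2) *\<^sub>R v'))"
          using s t by simp
        also have "\<dots> \<le> (s / t) * (\<kappa> * norm ((x + (t / 2) *\<^sub>R v) - (x + (t / 2) *\<^sub>R v')))"
          using s t by (intro mult_left_mono lip) auto
        also have "(x + (t / 2) *\<^sub>R v) - (x + (t / 2) *\<^sub>R v') = (t / 2) *\<^sub>R (v - v')" by (simp add: algebra_simps)
        finally show ?thesis using t by (simp add: q_def)
      qed
      then have "\<forall>v v'. dist (\<Theta> v) (\<Theta> v') \<le> q * dist v v'" by (simp only: dist_norm) blast
      from banach_fix_type[OF q this] obtain v where v: "\<Theta> v = v" by blast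
      have "norm v \<le> norm (\<Theta> 0) + q * norm v"
        using con[of v 0] norm_triangle_sub[of "\<Theta> v" "\<Theta> 0"] v by simp
      moreover have "norm (\<Theta> 0) \<le> (\<bar>r\<bar> + \<bar>B\<bar> + s * (norm (\<Gamma> 0) + \<kappa> * \<bar>B\<bar>)) / t"
      proof -
        have "norm (\<Gamma> x) \<le> norm (\<Gamma> 0) + \<kappa> * norm x"
          using norm_triangle_sub[of "\<Gamma> x" "\<Gamma> 0"] lip[of x 0] by simp
        also have "\<dots> \<le> norm (\<Gamma> 0) + \<kappa> * \<bar>B\<bar>" using x kappa by simp
        finally have "norm (s *\<^sub>R \<Gamma> x) \<le> s * (norm (\<Gamma> 0) + \<kappa> * \<bar>B\<bar>)" using s by (simp add: mult_left_mono)
        moreover have "norm (y - x + s *\<^sub>R \<Gamma> x) \<le> norm y + norm x + norm (s *\<^sub>R \<Gamma> x)"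
          using norm_triangle_ineq[of "y - x" "s *\<^sub>R \<Gamma> x"] norm_triangle_ineq4[of y x] by linarith
        ultimately have "norm (y - x + s *\<^sub>R \<Gamma> x) \<le> \<bar>r\<bar> + \<bar>B\<bar> + s * (norm (\<Gamma> 0) + \<kappa> * \<bar>B\<bar>)"
          using x y by linarith
        then show ?thesis using t by (simp add: \<Theta>_def divide_right_mono)
      qed
      ultimately have "(1 - q) * norm v \<le> (\<bar>r\<bar> + \<bar>B\<bar> + s * (norm (\<Gamma> 0) + \<kappa> * \<bar>B\<bar>)) / t"
        by (simp add: algebra_simps)
      then have "norm v \<le> r'"
        unfolding r'_def using q(2) by (subst pos_le_divide_eq) (simp_all only: mult.commute diff_gt_0_iff_gt)
      moreover have "?\<phi> v = y"
      proof -
        have "t *\<^sub>R v = t *\<^sub>R \<Theta> v" by (simp add: v)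
        also have "\<dots> = y - x + s *\<^sub>R \<Gamma> (x + (t / 2) *\<^sub>R v)" using t by (simp add: \<Theta>_def)
        finally show ?thesis by simp
      qed
      ultimately show "\<exists>v. norm v \<le> r' \<and> ?\<phi> v = y" by blast
    qed (rule g)
    then show "ennreal (1 / (2 * L\<^sup>2 + 1)) * (\<integral>\<^sup>+w. g w * indicator (cball 0 r) w \<partial>lborel) \<le> (\<integral>\<^sup>+v. g (fst (word_map \<Gamma> \<gamma> w (x, v))) * indicator (cball 0 r') v \<partial>lborel)"
      by (simp only: form)
  qed
qed

lemma wk_prob: "word_kernel U \<gamma> w \<in> borel \<rightarrow>\<^sub>M prob_algebra borel"
  by (rule word_kernel_prob) measurable

lemma wk_det: "(\<And>t. O_letter t \<notin> set w') \<Longrightarrow> word_kernel U \<gamma> (w @ w') = (\<lambda>z. word_kernel U \<gamma> w z \<bind> (\<lambda>y. return borel (word_map \<Gamma> \<gamma> w' y)))"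
  using word_kernel_append_deterministic[of U w' \<gamma> w] by (auto simp: fun_eq_iff)

lemma wk_O: "word_kernel U \<gamma> (w @ [O_letter t]) = (\<lambda>z. word_kernel U \<gamma> w z \<bind> step_O \<gamma> t)"
  by (simp add: fun_eq_iff)

lemma fibre_start:
  assumes "\<And>t. O_letter t \<notin> set w" "0 < \<gamma> * t"
  shows "fibre_spread (word_kernel U \<gamma> (w @ [O_letter t]))"
  unfolding wk_O
proof (rule fibre_spread_initial[OF assms(2) wk_prob])
  show "word_kernel U \<gamma> w z = return borel (word_map \<Gamma> \<gamma> w z)" for z
    using wk_det[OF assms(1), of \<gamma> "[]"] by (simp add: bind_return[OF measurable_compose[OF word_map_measurable return_measurable]])
qed (rule word_map_bounded)

lemma fibre_O: "fibre_spread (word_kernel U \<gamma> w) \<Longrightarrow> 0 < \<gamma> * t \<Longrightarrow> fibre_spread (word_kernel U \<gamma> (w @ [O_letter t]))"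
  unfolding wk_O by (rule fibre_spread_O[OF _ wk_prob])

lemma B_map: "word_map \<Gamma> \<gamma> [B_letter t] = (\<lambda>y. (fst y, snd y - t *\<^sub>R \<Gamma> (fst y)))"
  by (simp add: fun_eq_iff)

lemma fibre_B: "fibre_spread (word_kernel U \<gamma> w) \<Longrightarrow> fibre_spread (word_kernel U \<gamma> (w @ [B_letter t]))"
  using fibre_spread_B[OF wk_prob, of \<gamma> w t \<Gamma>] word_map_measurable[of \<gamma> "[B_letter t]"] gradient_bounded
  by (subst wk_det) (auto simp: B_map)

lemma position_after:
  "fibre_spread (word_kernel U \<gamma> w) \<Longrightarrow> (\<And>t. O_letter t \<notin> set w') \<Longrightarrow> spreads (word_map \<Gamma> \<gamma> w') \<Longrightarrow>
    position_spread (word_kernel U \<gamma> (w @ w'))"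
  by (subst wk_det) (auto intro: position_spread_of_fibre_spread[OF wk_prob])

lemma phase_O: "position_spread (word_kernel U \<gamma> w) \<Longrightarrow> 0 < \<gamma> * t \<Longrightarrow> phase_spread (word_kernel U \<gamma> (w @ [O_letter t]))"
  unfolding wk_O by (rule phase_spread_after_O[OF _ wk_prob])

text \<open>
  Noise renews the spread of the velocities, and \<open>A\<close> and \<open>B\<close> steps are shears.
\<close>

lemma phase_letter:
  assumes sp: "phase_spread (word_kernel U \<gamma> w)" and l: "\<And>t. l = O_letter t \<Longrightarrow> 0 < \<gamma> * t"
  shows "phase_spread (word_kernel U \<gamma> (w @ [l]))"
proof (cases l)
  case (O_letter t)
  then show ?thesis using phase_O[OF position_spread_of_phase_spread[OF sp]] l by simp
next
  case (A_letter t)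
  have cover: "\<exists>r'. \<forall>g\<in>borel_measurable borel.
      (\<integral>\<^sup>+x. (\<integral>\<^sup>+v. g (x, v) * indicator (cball 0 r) v \<partial>lborel) * indicator (cball 0 r) x \<partial>lborel)
       \<le> (\<integral>\<^sup>+x. (\<integral>\<^sup>+v. g (word_map \<Gamma> \<gamma> [l] (x, v)) * indicator (cball 0 r') v \<partial>lborel) * indicator (cball 0 r') x \<partial>lborel)" for r
    using box_cover_A[of _ r t "r + \<bar>t\<bar> * \<bar>r\<bar>", where 'd=2]
    by (intro exI[of _ "r + \<bar>t\<bar> * \<bar>r\<bar>"]) (auto simp: A_letter)
  have "phase_spread (\<lambda>z. word_kernel U \<gamma> w z \<bind> (\<lambda>y. return borel (word_map \<Gamma> \<gamma> [l] y)))"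
    by (rule phase_spread_of_box_cover[OF wk_prob sp word_map_measurable cover])
  then show ?thesis by (subst wk_det) (auto simp: A_letter)
next
  case (B_letter t)
  have cover: "\<exists>r'. \<forall>g\<in>borel_measurable borel.
      (\<integral>\<^sup>+x. (\<integral>\<^sup>+v. g (x, v) * indicator (cball 0 r) v \<partial>lborel) * indicator (cball 0 r) x \<partial>lborel)
       \<le> (\<integral>\<^sup>+x. (\<integral>\<^sup>+v. g (word_map \<Gamma> \<gamma> [l] (x, v)) * indicator (cball 0 r') v \<partial>lborel) * indicator (cball 0 r') x \<partial>lborel)" for r
  proof -
    obtain B where B: "\<And>x. norm x \<le> r \<Longrightarrow> norm (\<Gamma> x) \<le> B" using gradient_bounded by blast
    then have "\<And>x. norm x \<le> r \<Longrightarrow> norm (\<Gamma> x) \<le> \<bar>B\<bar>" by fastforce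
    then show ?thesis
      using box_cover_B[where \<Gamma>=\<Gamma> and B="\<bar>B\<bar>" and r=r and t=t and r'="r + \<bar>t\<bar> * \<bar>B\<bar>"]
      by (intro exI[of _ "r + \<bar>t\<bar> * \<bar>B\<bar>"]) (auto simp: B_letter)
  qed
  have "phase_spread (\<lambda>z. word_kernel U \<gamma> w z \<bind> (\<lambda>y. return borel (word_map \<Gamma> \<gamma> [l] y)))"
    by (rule phase_spread_of_box_cover[OF wk_prob sp word_map_measurable cover])
  then show ?thesis by (subst wk_det) (auto simp: B_letter)
qed

lemma phase_word:
  assumes "phase_spread (word_kernel U \<gamma> w)" "\<And>t. O_letter t \<in> set w' \<Longrightarrow> 0 < \<gamma> * t"
  shows "phase_spread (word_kernel U \<gamma> (w @ w'))"
  using assms(2)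
proof (induction w' rule: rev_induct)
  case Nil show ?case using assms(1) by simp
next
  case (snoc l w')
  have "phase_spread (word_kernel U \<gamma> ((w @ w') @ [l]))"
    by (rule phase_letter) (use snoc in auto)
  then show ?case by (simp only: append_assoc)
qed

text \<open>
  ABOBA has a single noise per step, and spreading needs two noises with an \<open>A\<close> step in between,
  hence the two steps. Between the two noises the position is an invertible function of the velocity;
  in OABAO it involves the force, and \<open>h\<^sup>2 * \<kappa> < 4\<close> makes it invertible.
\<close>

lemma splitting_phase_spread:
  assumes h: "0 < h" and g: "0 < \<gamma>" and OABAO: "s = OABAO \<Longrightarrow> h\<^sup>2 * \<kappa> < 4"
  shows "phase_spread (word_kernel U \<gamma> (splitting_word s h @ splitting_word s h))"
proof -
  have gt: "0 < \<gamma> * h" "0 < \<gamma> * (h / 2)" using h g by auto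
  show ?thesis
  proof (cases s)
    case ABOBA
    have "fibre_spread (word_kernel U \<gamma> ([A_letter (h/2), B_letter (h/2)] @ [O_letter h]))"
      by (rule fibre_start) (use gt in auto)
    from fibre_B[OF this, of "h/2"]
    have "position_spread (word_kernel U \<gamma> ((([A_letter (h/2), B_letter (h/2)] @ [O_letter h]) @ [B_letter (h/2)]) @ [A_letter (h/2), A_letter (h/2), B_letter (h/2)]))"
      by (rule position_after)
         (use h in \<open>auto intro!: spreads_of_position_form[of h 0] simp: vec_eq_iff\<close>)
    from phase_word[OF phase_O[OF this gt(1)], of "[B_letter (h/2), A_letter (h/2)]"]
    show ?thesis by (simp add: ABOBA)
  next
    case AOBOA
    have "fibre_spread (word_kernel U \<gamma> ([A_letter (h/2)] @ [O_letter (h/2)]))"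
      by (rule fibre_start) (use gt in auto)
    from fibre_O[OF fibre_B[OF this, of h] gt(2)]
    have "position_spread (word_kernel U \<gamma> (((([A_letter (h/2)] @ [O_letter (h/2)]) @ [B_letter h]) @ [O_letter (h/2)]) @ [A_letter (h/2), A_letter (h/2)]))"
      by (rule position_after)
         (use h in \<open>auto intro!: spreads_of_position_form[of h 0] simp: vec_eq_iff\<close>)
    from phase_word[OF phase_O[OF this gt(2)], of "[B_letter h, O_letter (h/2), A_letter (h/2)]"]
    show ?thesis using h g by (auto simp: AOBOA)
  next
    case BOAOB
    have "fibre_spread (word_kernel U \<gamma> ([B_letter (h/2)] @ [O_letter (h/2)]))"
      by (rule fibre_start) (use gt in auto)
    then have "position_spread (word_kernel U \<gamma> (([B_letter (h/2)] @ [O_letter (h/2)]) @ [A_letter h]))"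
      by (rule position_after)
         (use h in \<open>auto intro!: spreads_of_position_form[of h 0]\<close>)
    from phase_word[OF phase_O[OF this gt(2)], of "[B_letter (h/2), B_letter (h/2), O_letter (h/2), A_letter h, O_letter (h/2), B_letter (h/2)]"]
    show ?thesis using h g by (auto simp: BOAOB)
  next
    case OABAO
    have "fibre_spread (word_kernel U \<gamma> ([] @ [O_letter (h/2)]))"
      by (rule fibre_start) (use gt in auto)
    then have "position_spread (word_kernel U \<gamma> (([] @ [O_letter (h/2)]) @ [A_letter (h/2), B_letter h, A_letter (h/2)]))"
    proof (rule position_after)
      show "spreads (word_map \<Gamma> \<gamma> [A_letter (h/2), B_letter h, A_letter (h/2)])"
      proof (rule spreads_of_position_form[of h "h * h / 2"])
        show "h * h / 2 * \<kappa> < 2" using assms(3)[OF OABAO] by (simp add: power2_eq_square)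
        show "fst (word_map \<Gamma> \<gamma> [A_letter (h/2), B_letter h, A_letter (h/2)] (x, v)) = x + h *\<^sub>R v - (h * h / 2) *\<^sub>R \<Gamma> (x + (h / 2) *\<^sub>R v)" for x v
        proof -
          have "h *\<^sub>R v = (h/2) *\<^sub>R v + (h/2) *\<^sub>R v" by (simp add: scaleR_add_left[symmetric])
          then show ?thesis by (simp add: scaleR_diff_right)
        qed
      qed (use h in auto)
    qed auto
    from phase_word[OF phase_O[OF this gt(2)], of "[O_letter (h/2), A_letter (h/2), B_letter h, A_letter (h/2), O_letter (h/2)]"]
    show ?thesis using h g by (auto simp: OABAO)
  qed
qed

end

section \<open>Attracting cycles of the heavy-ball recursion\<close>

text \<open>
  The gradient of the potential before smoothing.
\<close>

definition heavy_ball_force :: "real \<Rightarrow> (real^'d) set \<Rightarrow> real^'d \<Rightarrow> real^'d" where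
  "heavy_ball_force \<kappa> P x = x + (\<kappa> - 1) *\<^sub>R closest_point P x"

lemma closest_point_hull_vertex:
  fixes x :: "'a::euclidean_space"
  assumes S: "finite S" "q \<in> S" and obt: "\<And>u. u \<in> S \<Longrightarrow> (x - q) \<bullet> (u - q) \<le> 0"
  shows "closest_point (convex hull S) x = q"
proof (rule closest_point_unique[symmetric])
  show "convex (convex hull S)" by (rule convex_convex_hull)
  show "closed (convex hull S)" using S by (intro compact_imp_closed finite_imp_compact_convex_hull)
  show "q \<in> convex hull S" using S hull_inc by metis
  have "S \<subseteq> {z. (x - q) \<bullet> z \<le> (x - q) \<bullet> q}" using obt by (auto simp: inner_diff_right)
  then have sub: "convex hull S \<subseteq> {z. (x - q) \<bullet> z \<le> (x - q) \<bullet> q}" by (rule hull_minimal) (rule convex_halfspace_le)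
  show "\<forall>z\<in>convex hull S. dist x q \<le> dist x z"
  proof
    fix z assume "z \<in> convex hull S"
    with sub have "(x - q) \<bullet> (z - q) \<le> 0" by (auto simp: inner_diff_right)
    moreover have "(norm (x - z))\<^sup>2 = (norm (x - q))\<^sup>2 + (norm (z - q))\<^sup>2 - 2 * ((x - q) \<bullet> (z - q))"
      by (simp add: power2_norm_eq_inner inner_diff inner_commute algebra_simps)
    ultimately have "(norm (x - q))\<^sup>2 \<le> (norm (x - z))\<^sup>2" using zero_le_power2[of "norm (z - q)"] by linarith
    then have "norm (x - q) \<le> norm (x - z)" by (rule power2_le_imp_le) simp
    then show "dist x q \<le> dist x z" by (simp add: dist_norm)
  qed
qed

lemma closest_point_scaleR:
  fixes P :: "(real^'d) set"
  assumes P: "convex P" "compact P" "P \<noteq> {}" and R: "0 < R"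
  shows "closest_point ((*\<^sub>R) R ` P) x = R *\<^sub>R closest_point P (x /\<^sub>R R)"
proof (rule closest_point_unique[symmetric])
  have cl: "closed P" using P by (simp add: compact_imp_closed)
  show "convex ((*\<^sub>R) R ` P)" using P by (simp add: convex_scaling)
  show "closed ((*\<^sub>R) R ` P)" using P by (intro compact_imp_closed compact_scaling)
  show "R *\<^sub>R closest_point P (x /\<^sub>R R) \<in> (*\<^sub>R) R ` P" using closest_point_in_set[OF cl P(3)] by blast
  show "\<forall>z\<in>(*\<^sub>R) R ` P. dist x (R *\<^sub>R closest_point P (x /\<^sub>R R)) \<le> dist x z"
  proof
    fix z assume "z \<in> (*\<^sub>R) R ` P"
    then obtain q where q: "q \<in> P" "z = R *\<^sub>R q" by auto
    have d: "dist x (R *\<^sub>R y) = R * dist (x /\<^sub>R R) y" for y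
    proof -
      have "x - R *\<^sub>R y = R *\<^sub>R (x /\<^sub>R R - y)" using R by (simp add: algebra_simps)
      then show ?thesis using R by (simp add: dist_norm)
    qed
    show "dist x (R *\<^sub>R closest_point P (x /\<^sub>R R)) \<le> dist x z"
      unfolding q(2) d using closest_point_le[OF cl q(1), of "x /\<^sub>R R"] R by simp
  qed
qed

lemma heavy_ball_force_scaleR:
  assumes "convex P" "compact P" "P \<noteq> {}" "0 < R"
  shows "heavy_ball_force \<kappa> ((*\<^sub>R) R ` P) = (\<lambda>x. R *\<^sub>R heavy_ball_force \<kappa> P (x /\<^sub>R R))"
  using assms by (simp add: fun_eq_iff heavy_ball_force_def closest_point_scaleR algebra_simps)

definition unit_vec :: "real \<Rightarrow> real^2" where
  "unit_vec a = vector [cos a, sin a]"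

lemma unit_vec_nth [simp]: "unit_vec a $ 1 = cos a" "unit_vec a $ 2 = sin a"
  by (simp_all add: unit_vec_def)

text \<open>
  Doubling an angle multiplies \<open>1 - cos\<close> by at most 4, so the dyadic angles cannot jump over a window
  whose ends have ratio 4.
\<close>

lemma dyadic_angle:
  assumes "0 < \<sigma>" "\<sigma> < 2"
  shows "\<exists>K. (4::nat) \<le> K \<and> 3 / 16 * \<sigma> < 1 - cos (2 * pi / K) \<and> 1 - cos (2 * pi / K) \<le> 3 / 4 * \<sigma>"
proof -
  define \<theta> where "\<theta> m = pi / 2 ^ m" for m :: nat
  have "(\<lambda>m. pi * (1/2) ^ m) \<longlonglongrightarrow> pi * 0" by (intro tendsto_mult tendsto_const LIMSEQ_power_zero) simp
  then have "\<theta> \<longlonglongrightarrow> 0" by (simp add: \<theta>_def[abs_def] power_one_over field_simps)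
  then have "(\<lambda>m. 1 - cos (\<theta> m)) \<longlonglongrightarrow> 1 - cos 0" by (intro tendsto_intros)
  then have "\<forall>\<^sub>F m in sequentially. 1 - cos (\<theta> m) < 3 / 4 * \<sigma>" using assms by (intro order_tendstoD) auto
  from eventually_happens'[OF sequentially_bot this] have ex: "\<exists>m. 1 - cos (\<theta> m) \<le> 3 / 4 * \<sigma>"
    by (auto intro: less_imp_le)
  define m where "m = (LEAST m. 1 - cos (\<theta> m) \<le> 3 / 4 * \<sigma>)"
  have m: "1 - cos (\<theta> m) \<le> 3 / 4 * \<sigma>" unfolding m_def by (rule LeastI_ex[OF ex])
  have "m \<noteq> 0"
  proof
    assume "m = 0" then show False using m assms by (simp add: \<theta>_def)
  qed
  then obtain k where k: "m = Suc k" by (cases m) auto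
  have "\<not> 1 - cos (\<theta> k) \<le> 3 / 4 * \<sigma>"
    using not_less_Least[of k "\<lambda>m. 1 - cos (\<theta> m) \<le> 3 / 4 * \<sigma>", folded m_def] k by blast
  moreover have "\<theta> k = 2 * \<theta> m" by (simp add: \<theta>_def k)
  ultimately have "3 / 4 * \<sigma> < 1 - cos (2 * \<theta> m)" by simp
  also have "1 - cos (2 * \<theta> m) = 2 * (1 - cos (\<theta> m)) * (1 + cos (\<theta> m))"
    unfolding cos_double_cos by (simp add: algebra_simps power2_eq_square)
  also have "\<dots> \<le> 2 * (1 - cos (\<theta> m)) * 2" by (intro mult_left_mono) auto
  finally have "3 / 16 * \<sigma> < 1 - cos (\<theta> m)" by simp
  moreover have e: "\<theta> m = 2 * pi / real (2 ^ Suc m)" by (simp add: \<theta>_def)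
  moreover have "4 \<le> (2::nat) ^ Suc m" using k by simp
  ultimately show ?thesis using m unfolding e by blast
qed

lemma cos_sin_between:
  fixes k K :: nat
  assumes "1 \<le> k" "k < K" "4 \<le> K"
  defines "\<phi> \<equiv> k * (pi / K)"
  shows "\<bar>cos \<phi>\<bar> \<le> cos (pi / K)" "sin (pi / K) \<le> sin \<phi>" "0 < sin (pi / K)" "0 < cos (pi / K)"
proof -
  have K: "0 < real K" using assms by simp
  have p: "0 < pi / K" "pi / K < pi / 2" using assms by (auto simp: field_simps)
  have lo: "pi / K \<le> \<phi>" using assms K by (simp add: \<phi>_def field_simps)
  have hi: "\<phi> \<le> pi - pi / K"
  proof -
    have "real k + 1 \<le> real K" using assms by linarith
    then have "(real k + 1) * (pi / K) \<le> real K * (pi / K)" by (intro mult_right_mono) auto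
    then show ?thesis using K by (simp add: \<phi>_def algebra_simps add_divide_distrib)
  qed
  have "cos \<phi> \<le> cos (pi / K)" using lo hi p by (intro cos_monotone_0_pi_le) auto
  moreover have "cos (pi - pi / K) \<le> cos \<phi>" using lo hi p by (intro cos_monotone_0_pi_le) auto
  ultimately show c: "\<bar>cos \<phi>\<bar> \<le> cos (pi / K)" by simp
  show c0: "0 < cos (pi / K)" by (rule cos_gt_zero[OF p])
  show s0: "0 < sin (pi / K)" by (rule sin_gt_zero[OF p(1)]) (use p pi_gt_zero in linarith)
  have "(cos \<phi>)\<^sup>2 \<le> (cos (pi / K))\<^sup>2" using power_mono[OF c, of 2] by simp
  then have "(sin (pi / K))\<^sup>2 \<le> (sin \<phi>)\<^sup>2" by (simp add: sin_squared_eq)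
  moreover have "0 \<le> sin \<phi>" using lo hi p by (intro sin_ge_zero) auto
  ultimately show "sin (pi / K) \<le> sin \<phi>" using power2_le_imp_le by blast
qed

text \<open>
  The orbit \<open>p\<close> runs through a regular \<open>K\<close>-gon with angle \<open>\<theta>\<close>. The recursion dictates the force on it,
  hence the projection \<open>q t\<close> of \<open>p t\<close>: in complex notation \<open>q t = w * p t\<close> with a fixed number
  \<open>w = wr + \<i> * wi\<close>. One takes for \<open>P\<close> the polygon with vertices \<open>q t\<close>; what has to be shown is that
  \<open>q t\<close> is the point of \<open>P\<close> closest to \<open>p t\<close>, and strictly so, for then the projection is constant
  near \<open>p t\<close> and the force has slope one there.

  By rotation, strict closeness follows from the inequality \<open>\<bar>wi\<bar> * \<bar>sin (j * \<theta>)\<bar> < (1 - cos (j * \<theta>)) * A\<close> for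
  \<open>1 \<le> j < K\<close>, where \<open>A = wr - \<bar>w\<bar>\<^sup>2\<close>. The angle is chosen such that \<open>1 - cos \<theta>\<close> is comparable to
  \<open>s * \<kappa> / (1 + \<beta>)\<close>, which keeps \<open>wr\<close> between 1/8 and 3/4 and \<open>A\<close> away from 0, while \<open>wi\<close> is
  proportional to the friction \<open>1 - \<beta>\<close>, which is small compared to \<open>s * \<kappa>\<close>.
\<close>

lemma heavy_ball_cycle_exists:
  fixes \<beta> s \<kappa> :: real
  assumes b: "0 < \<beta>" "\<beta> < 1" and s: "0 < s" "s * \<kappa> < 2 * (1 + \<beta>)" and k: "17 \<le> \<kappa>"
    and fric: "64 * (1 - \<beta>) \<le> s * \<kappa>"
  shows "\<exists>(P :: (real^2) set) p (K::nat). convex P \<and> compact P \<and> P \<noteq> {} \<and> 0 < K \<and>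
    (\<forall>t. p (t + 2) = (1 + \<beta>) *\<^sub>R p (t + 1) - \<beta> *\<^sub>R p t - s *\<^sub>R heavy_ball_force \<kappa> P (p (t + 1))) \<and>
    (\<forall>t. unit_slope_at (heavy_ball_force \<kappa> P) (p t)) \<and> (\<forall>t. p (t + 1) \<noteq> p t) \<and> (\<forall>t. p (t + K) = p t)"
proof -
  define \<sigma> where "\<sigma> = s * \<kappa> / (1 + \<beta>)"
  have \<sigma>: "0 < \<sigma>" "\<sigma> < 2" using b s k by (auto simp: \<sigma>_def pos_divide_less_eq)
  obtain K where K: "(4::nat) \<le> K" "3 / 16 * \<sigma> < 1 - cos (2 * pi / K)" "1 - cos (2 * pi / K) \<le> 3 / 4 * \<sigma>"
    using dyadic_angle[OF \<sigma>] by blast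
  define \<theta> where "\<theta> = 2 * pi / K"
  have Kt: "real K * \<theta> = 2 * pi" using K by (simp add: \<theta>_def)
  define wr where "wr = ((1 + \<beta>) * (1 - cos \<theta>) / s - 1) / (\<kappa> - 1)"
  define wi where "wi = - ((1 - \<beta>) * sin \<theta> / (s * (\<kappa> - 1)))"
  define p where "p t = unit_vec (real t * \<theta>)" for t :: nat
  define q where "q t = wr *\<^sub>R unit_vec (real t * \<theta>) + wi *\<^sub>R unit_vec (real t * \<theta> + pi / 2)" for t :: nat
  define A where "A = wr - wr\<^sup>2 - wi\<^sup>2"
  have k1: "0 < \<kappa> - 1" using k by simp
  \<comment> \<open>The friction relative to the force: \<open>wi = - y * sin \<theta>\<close>.\<close>
  define y where "y = (1 - \<beta>) / (s * (\<kappa> - 1))"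
  have y: "0 \<le> y" "y \<le> 1 / 32"
  proof -
    show "0 \<le> y" using b s k1 by (simp add: y_def)
    have "32 * (1 - \<beta>) \<le> s * (\<kappa> - 1)"
    proof -
      have "s * \<kappa> \<le> s * (2 * (\<kappa> - 1))" using s k by (intro mult_left_mono) auto
      then show ?thesis using fric by (simp add: algebra_simps)
    qed
    then show "y \<le> 1 / 32" using s k1 by (simp add: y_def field_simps)
  qed
  have wi_y: "\<bar>wi\<bar> = y * \<bar>sin \<theta>\<bar>" using b s k1 by (simp add: wi_def y_def abs_mult abs_divide)
  \<comment> \<open>The choice of \<open>\<theta>\<close> bounds \<open>X\<close>, which differs from \<open>wr\<close> by a term of order \<open>1 / \<kappa>\<close>.\<close>
  define X where "X = (1 - cos \<theta>) / \<sigma>"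
  have X: "3 / 16 < X" "X \<le> 3 / 4" using K \<sigma> by (auto simp: X_def \<theta>_def field_simps)
  have wr_X: "wr = (X * \<kappa> - 1) / (\<kappa> - 1)"
    using b s k by (simp add: wr_def X_def \<sigma>_def field_simps)
  have wr: "1 / 8 \<le> wr" "wr \<le> 3 / 4"
  proof -
    have "1 / 8 * (\<kappa> - 1) \<le> 3 / 16 * \<kappa> - 1" using k by simp
    also have "\<dots> \<le> X * \<kappa> - 1" using X k by (simp add: mult_right_mono)
    finally show "1 / 8 \<le> wr" using k1 by (simp add: wr_X pos_le_divide_eq)
    have "X * \<kappa> - 1 \<le> 3 / 4 * \<kappa> - 1" using X k by (simp add: mult_right_mono)
    also have "\<dots> \<le> 3 / 4 * (\<kappa> - 1)" by simp
    finally show "wr \<le> 3 / 4" using k1 by (simp add: wr_X pos_divide_le_eq)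
  qed
  have A_y: "2 * y < A"
  proof -
    have "0 \<le> (wr - 1 / 8) * (3 / 4 - wr)" using wr by (intro mult_nonneg_nonneg) auto
    then have "7 / 64 \<le> wr - wr\<^sup>2" using wr by (simp add: algebra_simps power2_eq_square)
    moreover have "wi\<^sup>2 \<le> y\<^sup>2"
    proof -
      have "\<bar>wi\<bar> \<le> y" unfolding wi_y using y by (intro mult_left_le) auto
      then have "\<bar>wi\<bar>\<^sup>2 \<le> y\<^sup>2" by (rule power_mono) simp
      then show ?thesis by simp
    qed
    moreover have "y\<^sup>2 \<le> 1 / 32 * y" using mult_left_mono[OF y(2) y(1)] by (simp add: power2_eq_square)
    ultimately show ?thesis using y by (simp add: A_def)
  qed
  have A0: "0 < A" using A_y y by linarith
  have key: "\<bar>wi\<bar> * \<bar>sin (real j * \<theta>)\<bar> < (1 - cos (real j * \<theta>)) * A" if j: "1 \<le> j" "j < K" for j :: nat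
  proof -
    \<comment> \<open>In terms of half angles the claim reduces to \<open>\<bar>wi\<bar> * \<bar>cos \<phi>\<bar> < A * sin \<phi>\<close>.\<close>
    define \<phi> where "\<phi> = real j * (pi / K)"
    note cs = cos_sin_between[OF j K(1), folded \<phi>_def]
    have d: "real j * \<theta> = 2 * \<phi>" by (simp add: \<phi>_def \<theta>_def)
    have sth: "\<bar>sin \<theta>\<bar> = 2 * sin (pi / K) * cos (pi / K)"
      using sin_double[of "pi / K"] cs by (simp add: \<theta>_def abs_mult)
    have sp: "0 < sin \<phi>" using cs by linarith
    have "\<bar>wi\<bar> * \<bar>cos \<phi>\<bar> \<le> (y * (2 * sin (pi / K) * cos (pi / K))) * 1"
      unfolding wi_y sth using y cs by (intro mult_mono) auto
    also have "\<dots> \<le> y * (2 * sin (pi / K) * 1)"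
      using y cs by (simp add: mult_left_mono)
    also have "\<dots> = (2 * y) * sin (pi / K)" by simp
    also have "\<dots> < A * sin (pi / K)" using A_y cs by (intro mult_strict_right_mono) auto
    also have "\<dots> \<le> A * sin \<phi>" using A0 cs by (intro mult_left_mono) auto
    finally have "(2 * sin \<phi>) * (\<bar>wi\<bar> * \<bar>cos \<phi>\<bar>) < (2 * sin \<phi>) * (A * sin \<phi>)"
      using sp by (intro mult_strict_left_mono) auto
    moreover have "(2 * sin \<phi>) * (\<bar>wi\<bar> * \<bar>cos \<phi>\<bar>) = \<bar>wi\<bar> * \<bar>sin (real j * \<theta>)\<bar>"
      using sp by (simp add: d sin_double abs_mult)
    moreover have "(2 * sin \<phi>) * (A * sin \<phi>) = (1 - cos (real j * \<theta>)) * A"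
      by (simp add: d cos_double_sin power2_eq_square)
    ultimately show ?thesis by simp
  qed
  have inner: "(p t - q t) \<bullet> (q u - q t) = - ((1 - cos (real u * \<theta> - real t * \<theta>)) * A) - wi * sin (real u * \<theta> - real t * \<theta>)" for t u
  proof -
    define a b where "a = real t * \<theta>" and "b = real u * \<theta>"
    have 1: "(p t - q t) \<bullet> (q u - q t) = ((1 - wr) * cos a + wi * sin a) * ((wr * cos b - wi * sin b) - (wr * cos a - wi * sin a))
      + ((1 - wr) * sin a - wi * cos a) * ((wr * sin b + wi * cos b) - (wr * sin a + wi * cos a))"
      unfolding p_def q_def a_def[symmetric] b_def[symmetric]
      by (simp add: inner_vec_def sum_2 cos_add sin_add algebra_simps)
    have one: "cos a * cos a + sin a * sin a = 1" by (rule sin_cos_squared_add3)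
    have "((1 - wr) * cos a + wi * sin a) * ((wr * cos b - wi * sin b) - (wr * cos a - wi * sin a))
      + ((1 - wr) * sin a - wi * cos a) * ((wr * sin b + wi * cos b) - (wr * sin a + wi * cos a))
      = A * (cos b * cos a + sin b * sin a) - wi * (sin b * cos a - cos b * sin a) - A * (cos a * cos a + sin a * sin a)"
      by (simp add: A_def algebra_simps power2_eq_square del: sin_cos_squared_add3)
    also have "\<dots> = - ((1 - cos (b - a)) * A) - wi * sin (b - a)"
      unfolding one cos_diff sin_diff by (simp add: algebra_simps)
    finally show ?thesis unfolding 1 a_def b_def .
  qed
  have strict: "(p t - q t) \<bullet> (q u - q t) < 0" if "t < K" "u < K" "u \<noteq> t" for t u
  proof -
    have "\<exists>j. 1 \<le> j \<and> j < K \<and> \<bar>real u * \<theta> - real t * \<theta>\<bar> = real j * \<theta>"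
    proof (cases "t < u")
      case True
      have "\<bar>real u * \<theta> - real t * \<theta>\<bar> = \<bar>(real u - real t) * \<theta>\<bar>" by (simp add: left_diff_distrib)
      also have "\<dots> = real (u - t) * \<theta>"
        using True that by (simp add: of_nat_diff \<theta>_def abs_mult)
      finally show ?thesis using True that by (intro exI[of _ "u - t"]) auto
    next
      case False
      have "\<bar>real u * \<theta> - real t * \<theta>\<bar> = \<bar>(real u - real t) * \<theta>\<bar>" by (simp add: left_diff_distrib)
      also have "\<dots> = real (t - u) * \<theta>"
        using False that by (simp add: of_nat_diff \<theta>_def abs_mult)
      finally show ?thesis using False that by (intro exI[of _ "t - u"]) auto
    qed
    then obtain j where j: "1 \<le> j" "j < K" "\<bar>real u * \<theta> - real t * \<theta>\<bar> = real j * \<theta>" by blast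
    let ?d = "real u * \<theta> - real t * \<theta>"
    have "cos ?d = cos (real j * \<theta>)" by (metis cos_abs_real j(3))
    moreover have "\<bar>sin ?d\<bar> = \<bar>sin (real j * \<theta>)\<bar>"
    proof -
      have "\<bar>sin x\<bar> = \<bar>sin \<bar>x\<bar>\<bar>" for x :: real by (cases "0 \<le> x") auto
      from this[of ?d] show ?thesis unfolding j(3) .
    qed
    moreover have "- (wi * sin ?d) \<le> \<bar>wi\<bar> * \<bar>sin ?d\<bar>" by (metis abs_ge_minus_self abs_mult)
    ultimately show ?thesis unfolding inner using key[OF j(1,2)] by simp
  qed
  define P where "P = convex hull (q ` {..<K})"
  have per: "unit_vec (real (t + K) * \<theta> + c) = unit_vec (real t * \<theta> + c)" for t c
  proof -
    have e: "real (t + K) * \<theta> + c = (real t * \<theta> + c) + 2 * pi" using Kt by (simp add: distrib_right)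
    show ?thesis unfolding unit_vec_def e sin_periodic cos_periodic ..
  qed
  have pK: "p (t + K) = p t" and qK: "q (t + K) = q t" for t
    using per[of t 0] per[of t "pi / 2"] by (simp_all add: p_def q_def)
  have mod: "p t = p (t mod K)" "q t = q (t mod K)" for t
  proof -
    have "p (m + n * K) = p m \<and> q (m + n * K) = q m" for m n
    proof (induction n)
      case (Suc n)
      have e: "m + Suc n * K = (m + n * K) + K" by simp
      show ?case unfolding e pK qK using Suc .
    qed simp
    from this[of "t mod K" "t div K"] show "p t = p (t mod K)" "q t = q (t mod K)" by simp_all
  qed
  have near: "\<exists>r>0. \<forall>x. norm (x - p t) \<le> r \<longrightarrow> closest_point P x = q t" for t
  proof -
    have base: "\<exists>r>0. \<forall>x. norm (x - p t) \<le> r \<longrightarrow> closest_point P x = q t" if t: "t < K" for t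
    proof -
      \<comment> \<open>The open set on which all the finitely many strict inequalities persist.\<close>
      define S where "S = (\<Inter>u\<in>{..<K} - {t}. {x. (q u - q t) \<bullet> x < (q u - q t) \<bullet> q t})"
      have "open S" unfolding S_def by (intro open_INT ballI open_halfspace_lt) auto
      moreover have "p t \<in> S"
        unfolding S_def
      proof (intro INT_I CollectI)
        fix u assume "u \<in> {..<K} - {t}"
        then have "(q u - q t) \<bullet> (p t - q t) < 0" using strict[OF t, of u] by (simp add: inner_commute)
        then show "(q u - q t) \<bullet> p t < (q u - q t) \<bullet> q t" by (simp add: inner_diff_right)
      qed
      ultimately obtain r where r: "r > 0" "cball (p t) r \<subseteq> S" by (meson open_contains_cball)
      show ?thesis
      proof (intro exI[of _ r] conjI allI impI r(1))
        fix x assume "norm (x - p t) \<le> r"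
        then have x: "x \<in> S" using r by (auto simp: mem_cball dist_norm norm_minus_commute)
        show "closest_point P x = q t" unfolding P_def
        proof (rule closest_point_hull_vertex)
          fix u assume "u \<in> q ` {..<K}"
          then obtain v where v: "v < K" "u = q v" by auto
          show "(x - q t) \<bullet> (u - q t) \<le> 0"
          proof (cases "v = t")
            case False
            then have "(q v - q t) \<bullet> x < (q v - q t) \<bullet> q t" using x v by (auto simp: S_def)
            then have "(q v - q t) \<bullet> (x - q t) \<le> 0" by (simp add: inner_diff_right)
            then show ?thesis by (simp add: v inner_commute)
          qed (simp add: v)
        qed (use t in auto)
      qed
    qed
    show ?thesis using base[of "t mod K"] mod[of t] K by simp
  qed
  have clp: "closest_point P (p t) = q t" for t using near[of t] by force
  have force: "heavy_ball_force \<kappa> P (p t) = p t + (\<kappa> - 1) *\<^sub>R q t" for t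
    by (simp add: heavy_ball_force_def clp)
  have rec: "p (t + 2) = (1 + \<beta>) *\<^sub>R p (t + 1) - \<beta> *\<^sub>R p t - s *\<^sub>R heavy_ball_force \<kappa> P (p (t + 1))" for t
  proof -
    define a where "a = real (t + 1) * \<theta>"
    have pt: "p t = unit_vec (a - \<theta>)" "p (t + 1) = unit_vec a" "p (t + 2) = unit_vec (a + \<theta>)"
      by (simp_all add: p_def a_def algebra_simps)
    have 1: "(\<kappa> - 1) * wr = (1 + \<beta>) * (1 - cos \<theta>) / s - 1" using k1 by (simp add: wr_def)
    have 2: "s * ((\<kappa> - 1) * wr) = (1 + \<beta>) * (1 - cos \<theta>) - s" unfolding 1 using s(1) by (simp add: field_simps)
    have 3: "s * ((\<kappa> - 1) * wi) = - ((1 - \<beta>) * sin \<theta>)" using s k1 by (simp add: wi_def)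
    have "s *\<^sub>R heavy_ball_force \<kappa> P (p (t + 1)) = (s + s * ((\<kappa> - 1) * wr)) *\<^sub>R unit_vec a + (s * ((\<kappa> - 1) * wi)) *\<^sub>R unit_vec (a + pi / 2)"
      unfolding force[of "t + 1"] unfolding pt(2) q_def a_def[symmetric] by (simp add: algebra_simps)
    also have "\<dots> = ((1 + \<beta>) * (1 - cos \<theta>)) *\<^sub>R unit_vec a - ((1 - \<beta>) * sin \<theta>) *\<^sub>R unit_vec (a + pi / 2)"
      unfolding 2 3 by simp
    finally have sF: "s *\<^sub>R heavy_ball_force \<kappa> P (p (t + 1)) = ((1 + \<beta>) * (1 - cos \<theta>)) *\<^sub>R unit_vec a - ((1 - \<beta>) * sin \<theta>) *\<^sub>R unit_vec (a + pi / 2)" .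
    show ?thesis unfolding sF unfolding pt
      by (simp add: vec_eq_iff forall_2 cos_add sin_add cos_diff sin_diff algebra_simps)
  qed
  have slope: "unit_slope_at (heavy_ball_force \<kappa> P) (p t)" for t
  proof -
    obtain r where r: "r > 0" "\<And>x. norm (x - p t) \<le> r \<Longrightarrow> closest_point P x = q t" using near by blast
    show ?thesis unfolding unit_slope_at_def
    proof (intro exI[of _ r] conjI allI impI r(1))
      fix x assume "norm (x - p t) \<le> r"
      from r(2)[OF this] show "heavy_ball_force \<kappa> P x = heavy_ball_force \<kappa> P (p t) + (x - p t)"
        unfolding force by (simp add: heavy_ball_force_def)
    qed
  qed
  have neq: "p (t + 1) \<noteq> p t" for t
  proof
    assume eq: "p (t + 1) = p t"
    have "p (t + 1) \<bullet> p t = cos (real (t + 1) * \<theta> - real t * \<theta>)"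
      by (simp add: p_def inner_vec_def sum_2 cos_diff)
    moreover have "p t \<bullet> p t = 1"
      using sin_cos_squared_add3[of "real t * \<theta>"] by (simp add: p_def inner_vec_def sum_2)
    ultimately have "cos \<theta> = 1" using eq by (simp add: algebra_simps)
    then show False using K(2) \<sigma> by (simp add: \<theta>_def)
  qed
  have "convex P" "compact P" "P \<noteq> {}"
    using K by (auto simp: P_def convex_convex_hull lessThan_empty_iff intro!: finite_imp_compact_convex_hull)
  then show ?thesis using rec slope neq pK K
    by (intro exI[of _ P] exI[of _ p] exI[of _ K]) auto
qed

section \<open>Cycles of the splitting schemes\<close>

lemma periodic_uniform:
  fixes Pr :: "nat \<Rightarrow> real \<Rightarrow> bool"
  assumes ex: "\<And>t. \<exists>r>0. Pr t r" and mono: "\<And>t r r'. Pr t r \<Longrightarrow> 0 < r' \<Longrightarrow> r' \<le> r \<Longrightarrow> Pr t r'"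
    and per: "\<And>t r. Pr (t + K) r = Pr t r" and K: "0 < K"
  shows "\<exists>r>0. \<forall>t. Pr t r"
proof -
  obtain f where f: "\<And>t. f t > 0" "\<And>t. Pr t (f t)" using ex by metis
  define r where "r = Min (f ` {..<K})"
  have r0: "0 < r" using K f by (auto simp: r_def lessThan_empty_iff)
  have base: "Pr t r" if "t < K" for t
    using mono[OF f(2)[of t] r0] that K by (simp add: r_def)
  have "Pr (t + m * K) r" if "t < K" for t m
  proof (induction m)
    case (Suc m)
    then show ?case using per[of "t + m * K" r] by (simp add: ac_simps)
  qed (simp add: base that)
  from this[of "t mod K" "t div K" for t] have "Pr t r" for t using K by simp
  then show ?thesis using r0 by blast
qed

text \<open>
  One eliminates the velocity: positions at which a scheme evaluates the force satisfy the heavy-ball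
  recursion, with the stability parameter as step size. Conversely the velocities are recovered
  from the differences of \<open>p\<close>. Schemes that begin with an \<open>A\<close> step evaluate the force half a step
  later, so their phase points sit half a step before \<open>p (t + 1)\<close>.
\<close>

lemma splitting_phase_cycle:
  fixes p :: "nat \<Rightarrow> real^'d" and \<Gamma> :: "real^'d \<Rightarrow> real^'d"
  assumes h: "0 < h"
    and rec: "\<And>t. p (t + 2) = (1 + damping h \<gamma>) *\<^sub>R p (t + 1) - damping h \<gamma> *\<^sub>R p t - stability_param s h \<gamma> *\<^sub>R \<Gamma> (p (t + 1))"
    and slope: "\<And>t. unit_slope_at \<Gamma> (p t)" and neq: "\<And>t. p (t + 1) \<noteq> p t" and per: "\<And>t. p (t + K) = p t"
  shows "\<exists>Z. (\<forall>t. word_map \<Gamma> \<gamma> (splitting_word s h) (Z t) = Z (t + 1)) \<and>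
    (\<forall>t. regular_orbit \<Gamma> \<gamma> (splitting_word s h) (Z t)) \<and> (\<forall>t. Z (t + 1) \<noteq> Z t) \<and> (\<forall>t. Z (t + K) = Z t)"
proof -
  define r where "r = exp (- \<gamma> * (h / 2))"
  have r2: "exp (- \<gamma> * h) = r * r" and rpos: "0 < r" by (simp_all add: r_def flip: exp_add)
  have sq: "sqrt (damping h \<gamma>) = r" using rpos unfolding damping_def r2 by simp
  have bt: "damping h \<gamma> = r * r" unfolding damping_def r2 by simp
  have stab: "stability_param ABOBA h \<gamma> = h * h / 2 * (1 + r * r)" "stability_param OABAO h \<gamma> = h * h / 2 * (1 + r * r)"
    "stability_param AOBOA h \<gamma> = r * (h * h)" "stability_param BOAOB h \<gamma> = r * (h * h)"
    unfolding stability_param.simps sq unfolding bt by (simp_all add: power2_eq_square)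
  have O1: "letter_map \<Gamma> \<gamma> (O_letter h) z = (fst z, (r * r) *\<^sub>R snd z)" for z
    by (simp only: letter_map.simps r2)
  have O2: "letter_map \<Gamma> \<gamma> (O_letter (h / 2)) z = (fst z, r *\<^sub>R snd z)" for z
    by (simp only: letter_map.simps r_def)
  note [simp] = O1 O2 and [simp del] = letter_map.simps(3)
  have pos1: "0 < 1 + r * r" using rpos by (simp add: add_pos_pos)
  have p_per: "p (Suc (t + K)) = p (Suc t)" "p (Suc (Suc (t + K))) = p (Suc (Suc t))" for t
    using per[of "Suc t"] per[of "Suc (Suc t)"] by simp_all
  have nq: "p (Suc (Suc t)) \<noteq> p (Suc t)" for t using neq[of "Suc t"] by simp
  have sl: "unit_slope_at \<Gamma> (p t)" for t by (rule slope)
  let ?w = "splitting_word s h"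
  have A_form: ?thesis
    if s: "s = ABOBA \<or> s = AOBOA"
  proof -
    define V where "V t = (1 / h) *\<^sub>R (p (t + 1) - p t)" for t
    define Z where "Z t = (p (t + 1) - (h / 2) *\<^sub>R V t, V t)" for t
    have mid: "p (t + 1) - (h / 2) *\<^sub>R V t + (h / 2) *\<^sub>R V t = p (t + 1)" for t by simp
    have V1: "V (t + 1) = (r * r) *\<^sub>R V t - (stability_param s h \<gamma> / h) *\<^sub>R \<Gamma> (p (t + 1))" for t
      using h rec[of t] by (simp add: V_def bt vec_eq_iff field_simps)
    have fin: "p (t + 1) + (h / 2) *\<^sub>R V (t + 1) = p (t + 2) - (h / 2) *\<^sub>R V (t + 1)" for t
      using h by (simp add: V_def vec_eq_iff field_simps)
    have "word_map \<Gamma> \<gamma> ?w (Z t) = (p (t + 1) + (h / 2) *\<^sub>R V (t + 1), V (t + 1))" for t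
    proof -
      have "word_map \<Gamma> \<gamma> ?w (Z t) = (p (t + 1) + (h / 2) *\<^sub>R ((r * r) *\<^sub>R V t - (stability_param s h \<gamma> / h) *\<^sub>R \<Gamma> (p (t + 1))), (r * r) *\<^sub>R V t - (stability_param s h \<gamma> / h) *\<^sub>R \<Gamma> (p (t + 1)))"
        using s h by (auto simp: Z_def stab simp del: stability_param.simps; simp add: vec_eq_iff field_simps)
      then show ?thesis unfolding V1 .
    qed
    then have "word_map \<Gamma> \<gamma> ?w (Z t) = Z (t + 1)" for t unfolding fin by (simp add: Z_def)
    moreover have "regular_orbit \<Gamma> \<gamma> ?w (Z t)" for t
      using s sl[of "Suc t"] by (auto simp: Z_def)
    moreover have "Z (t + 1) \<noteq> Z t" for t
    proof
      assume "Z (t + 1) = Z t"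
      then have "fst (Z (t + 1)) + (h / 2) *\<^sub>R snd (Z (t + 1)) = fst (Z t) + (h / 2) *\<^sub>R snd (Z t)" by simp
      then show False using nq[of t] by (simp add: Z_def)
    qed
    moreover have "Z (t + K) = Z t" for t by (simp add: Z_def V_def p_per per)
    ultimately show ?thesis by blast
  qed
  show ?thesis
  proof (cases s)
    case ABOBA then show ?thesis using A_form by blast
  next
    case AOBOA then show ?thesis using A_form by blast
  next
    case BOAOB
    define V where "V t = (1 / (h * r)) *\<^sub>R (p (t + 2) - p (t + 1))" for t
    define Z where "Z t = (p (t + 1), V t + (h / 2) *\<^sub>R \<Gamma> (p (t + 1)))" for t
    have x1: "p (t + 1) + h *\<^sub>R (r *\<^sub>R V t) = p (t + 2)" for t
      using h rpos by (simp add: V_def)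
    have V1: "V (t + 1) = (r * r) *\<^sub>R V t - h *\<^sub>R \<Gamma> (p (t + 2))" for t
    proof -
      have "p (t + 1 + 2) = (1 + r * r) *\<^sub>R p (t + 2) - (r * r) *\<^sub>R p (t + 1) - (r * (h * h)) *\<^sub>R \<Gamma> (p (t + 2))"
        using rec[of "t + 1"] by (simp add: bt BOAOB stab del: stability_param.simps)
      then have "p (t + 1 + 2) - p (t + 1 + 1) = (r * r) *\<^sub>R (p (t + 2) - p (t + 1)) - (r * (h * h)) *\<^sub>R \<Gamma> (p (t + 2))"
        by (simp add: algebra_simps)
      then have "V (t + 1) = (1 / (h * r)) *\<^sub>R ((r * r) *\<^sub>R (p (t + 2) - p (t + 1)) - (r * (h * h)) *\<^sub>R \<Gamma> (p (t + 2)))"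
        unfolding V_def by simp
      then show ?thesis using h rpos by (simp add: V_def scaleR_diff_right mult_ac)
    qed
    have "word_map \<Gamma> \<gamma> ?w (Z t) = (p (t + 2), r *\<^sub>R r *\<^sub>R V t - (h / 2) *\<^sub>R \<Gamma> (p (t + 2)))" for t
      using x1[of t] by (simp add: BOAOB Z_def)
    moreover have "r *\<^sub>R r *\<^sub>R V t - (h / 2) *\<^sub>R \<Gamma> (p (t + 2)) = V (t + 1) + (h / 2) *\<^sub>R \<Gamma> (p (t + 2))" for t
      unfolding V1 by (simp add: vec_eq_iff field_simps)
    ultimately have "word_map \<Gamma> \<gamma> ?w (Z t) = Z (t + 1)" for t by (simp add: Z_def)
    moreover have "regular_orbit \<Gamma> \<gamma> ?w (Z t)" for t
      using sl[of "Suc t"] sl[of "t + 2"] x1[of t] by (simp add: BOAOB Z_def)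
    moreover have "Z (t + 1) \<noteq> Z t" for t using nq[of t] by (simp add: Z_def)
    moreover have "Z (t + K) = Z t" for t by (simp add: Z_def V_def p_per)
    ultimately show ?thesis by blast
  next
    case OABAO
    \<comment> \<open>The velocity just before the last \<open>O\<close> step; half of the path between two force evaluations
       is run with \<open>W\<close> and half with \<open>r * r * W\<close>, so that \<open>h / 2 * (1 + r * r) * W\<close> is the difference.\<close>
    define W where "W t = (2 / (h * (1 + r * r))) *\<^sub>R (p (t + 1) - p t)" for t
    define Z where "Z t = (p (t + 1) - (h / 2) *\<^sub>R ((r * r) *\<^sub>R W t), r *\<^sub>R W t)" for t
    have W1: "W (t + 1) = (r * r) *\<^sub>R W t - h *\<^sub>R \<Gamma> (p (t + 1))" for t
    proof -
      have "p (t + 2) - p (t + 1) = (r * r) *\<^sub>R (p (t + 1) - p t) - (h * h / 2 * (1 + r * r)) *\<^sub>R \<Gamma> (p (t + 1))"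
        using rec[of t] by (simp add: bt OABAO stab algebra_simps del: stability_param.simps)
      then have "W (t + 1) = (2 / (h * (1 + r * r))) *\<^sub>R ((r * r) *\<^sub>R (p (t + 1) - p t) - (h * h / 2 * (1 + r * r)) *\<^sub>R \<Gamma> (p (t + 1)))"
        unfolding W_def by simp
      moreover have "2 / (h * (1 + r * r)) * (h * h / 2 * (1 + r * r)) = h"
      proof -
        have "2 / (h * c) * (h * h / 2 * c) = h" if "c \<noteq> 0" for c using h that by (simp add: field_simps)
        then show ?thesis using pos1 by simp
      qed
      ultimately show ?thesis by (simp only: W_def scaleR_diff_right scaleR_scaleR mult.commute)
    qed
    have x1: "p (t + 1) + (h / 2) *\<^sub>R W (t + 1) = p (t + 2) - (h / 2) *\<^sub>R ((r * r) *\<^sub>R W (t + 1))" for t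
    proof -
      have "(h / 2 * (1 + r * r)) *\<^sub>R W (t + 1) = p (t + 2) - p (t + 1)"
        using h pos1 by (simp add: W_def)
      then have "(h / 2) *\<^sub>R W (t + 1) + (h / 2) *\<^sub>R ((r * r) *\<^sub>R W (t + 1)) = p (t + 2) - p (t + 1)"
        by (simp only: distrib_left mult_1_right scaleR_add_left scaleR_scaleR)
      then show ?thesis by (simp only: algebra_simps)
    qed
    have "word_map \<Gamma> \<gamma> ?w (Z t) = (p (t + 1) + (h / 2) *\<^sub>R W (t + 1), r *\<^sub>R W (t + 1))" for t
      unfolding W1 by (simp add: OABAO Z_def)
    then have "word_map \<Gamma> \<gamma> ?w (Z t) = Z (t + 1)" for t unfolding x1 by (simp add: Z_def)
    moreover have "regular_orbit \<Gamma> \<gamma> ?w (Z t)" for t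
      using sl[of "Suc t"] by (simp add: OABAO Z_def)
    moreover have "Z (t + 1) \<noteq> Z t" for t
    proof
      assume "Z (t + 1) = Z t"
      then have "fst (Z (t + 1)) + (h / 2) *\<^sub>R r *\<^sub>R snd (Z (t + 1)) = fst (Z t) + (h / 2) *\<^sub>R r *\<^sub>R snd (Z t)" by simp
      then show False using nq[of t] by (simp add: Z_def)
    qed
    moreover have "Z (t + K) = Z t" for t by (simp add: Z_def W_def p_per per)
    ultimately show ?thesis by blast
  qed
qed

section \<open>Noisy perturbations of a linear contraction\<close>

lemma ennreal_plus_mult:
  "0 \<le> a \<Longrightarrow> 0 \<le> k \<Longrightarrow> 0 \<le> t \<Longrightarrow> ennreal (a + k * t) = ennreal a + ennreal k * ennreal t"
  by (simp add: ennreal_plus ennreal_mult)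

locale contracting_norm =
  fixes M :: "2 phase \<Rightarrow> 2 phase" and N :: "2 phase \<Rightarrow> real" and c \<rho> :: real
  assumes linM: "linear M" and rho: "0 \<le> \<rho>" "\<rho> < 1"
    and N_add: "\<And>x y. N (x + y) \<le> N x + N y" and N_scale: "\<And>a x. N (a *\<^sub>R x) = \<bar>a\<bar> * N x"
    and N_ge: "\<And>z. norm z \<le> N z" and N_le: "\<And>z. N z \<le> c * norm z"
    and N_M: "\<And>z. N (M z) \<le> \<rho> * N z"
begin

lemma N_nonneg: "0 \<le> N z" using N_ge[of z] norm_ge_zero[of z] by linarith

lemma N_minus: "N (- z) = N z" using N_scale[of "- 1" z] by simp

lemma N_diff: "N x - N y \<le> N (x - y)" using N_add[of "x - y" y] by simp

lemma N_commute: "N (x - y) = N (y - x)" using N_minus[of "x - y"] by simp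

lemma c_pos: "1 \<le> c"
proof -
  have "norm (axis 1 1 :: real^2, 0 :: real^2) \<le> c * norm (axis 1 1 :: real^2, 0 :: real^2)"
    using N_ge N_le order_trans by blast
  then show ?thesis by (simp add: norm_Pair norm_axis_1)
qed

lemma N_cont: "continuous_on A N"
proof (rule lipschitz_on_continuous_on[where L=c], rule lipschitz_onI)
  show "dist (N x) (N y) \<le> c * dist x y" for x y
    using N_diff[of x y] N_diff[of y x] N_commute[of x y] N_le[of "x - y"] by (simp add: dist_norm)
qed (use c_pos in simp)

lemma N_meas [measurable]: "N \<in> borel_measurable borel"
  by (rule borel_measurable_continuous_onI[OF N_cont])

lemma M_pow: "linear (M ^^ n)" by (rule linear_funpow[OF linM])

text \<open>
  The estimate allows the centre to move from \<open>m\<close> to \<open>m'\<close>. With both equal to 0 it yields the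
  Lyapunov inequality, with \<open>m' = M m\<close> the fluctuation about a deterministic orbit.
\<close>

lemma drift_pointwise:
  assumes "norm (d - (m' + M (z - m))) \<le> B" "0 \<le> B"
  shows "(N (y - m'))\<^sup>2 \<le> \<rho> * (N (z - m))\<^sup>2 + 2 * c\<^sup>2 / (1 - \<rho>) * ((norm (y - d))\<^sup>2 + B\<^sup>2)"
proof -
  let ?a = "N (z - m)" and ?e = "c * (norm (y - d) + B)"
  have "N (y - m') \<le> N (y - m' - M (z - m)) + N (M (z - m))"
    using N_add[of "y - m' - M (z - m)" "M (z - m)"] by simp
  also have "N (y - m' - M (z - m)) \<le> c * norm ((y - d) + (d - (m' + M (z - m))))"
    using N_le[of "y - m' - M (z - m)"] by (simp add: algebra_simps)
  also have "\<dots> \<le> c * (norm (y - d) + B)"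
    using c_pos norm_triangle_ineq[of "y - d" "d - (m' + M (z - m))"] assms by (intro mult_left_mono) linarith+
  also have "N (M (z - m)) \<le> \<rho> * ?a" by (rule N_M)
  finally have le: "N (y - m') \<le> \<rho> * ?a + ?e" by simp
  have e0: "0 \<le> ?e" using c_pos assms by simp
  have q: "0 < 1 - \<rho>" using rho by simp
  have "(N (y - m'))\<^sup>2 \<le> (\<rho> * ?a + ?e)\<^sup>2" by (rule power_mono[OF le N_nonneg])
  also have "\<dots> \<le> \<rho> * ?a\<^sup>2 + ?e\<^sup>2 / (1 - \<rho>)"
  proof -
    \<comment> \<open>Convexity of the square with weights \<open>\<rho>\<close> and \<open>1 - \<rho>\<close>.\<close>
    have "0 \<le> \<rho> * ((1 - \<rho>) * ?a - ?e)\<^sup>2" using rho by simp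
    then have "(1 - \<rho>) * (\<rho> * ?a + ?e)\<^sup>2 \<le> (1 - \<rho>) * (\<rho> * ?a\<^sup>2) + ?e\<^sup>2"
      by (simp add: power2_eq_square algebra_simps)
    then show ?thesis using q by (simp add: field_simps)
  qed
  also have "?e\<^sup>2 / (1 - \<rho>) \<le> (2 * c\<^sup>2) * ((norm (y - d))\<^sup>2 + B\<^sup>2) / (1 - \<rho>)"
  proof (rule divide_right_mono)
    have "(norm (y - d) + B)\<^sup>2 \<le> 2 * ((norm (y - d))\<^sup>2 + B\<^sup>2)"
      using zero_le_power2[of "norm (y - d) - B"] by (simp add: power2_sum power2_diff)
    then have "c\<^sup>2 * (norm (y - d) + B)\<^sup>2 \<le> c\<^sup>2 * (2 * ((norm (y - d))\<^sup>2 + B\<^sup>2))" by (rule mult_left_mono) simp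
    then show "?e\<^sup>2 \<le> (2 * c\<^sup>2) * ((norm (y - d))\<^sup>2 + B\<^sup>2)" unfolding power_mult_distrib by (simp only: mult_ac)
  qed (use q in simp)
  finally show ?thesis by simp
qed

end

text \<open>
  \<open>Q\<close> is a step of a scheme, \<open>D\<close> its noise-free version with the force before smoothing, and \<open>M\<close> its linear
  part. The mean square noise \<open>e\<close> and the distance \<open>B\<close> to the linear part are kept apart because
  only the latter grows with the scale of the cycle.
\<close>

locale contracting_chain = contracting_norm M N c \<rho>
  for M :: "2 phase \<Rightarrow> 2 phase" and N c \<rho> +
  fixes Q :: "2 kernel" and D :: "2 phase \<Rightarrow> 2 phase" and e B :: real
  assumes Q: "Q \<in> borel \<rightarrow>\<^sub>M prob_algebra borel" and close: "l2_close Q D e" and e: "0 \<le> e"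
    and D_meas [measurable]: "D \<in> borel \<rightarrow>\<^sub>M borel"
    and near: "\<And>z. norm (D z - M z) \<le> B" and B: "0 \<le> B"
begin

lemma sets_Q [simp, measurable_cong]: "sets (Q z) = sets borel"
  using measurable_space[OF Q, of z] by (simp add: space_prob_algebra)

lemma prob_Q: "prob_space (Q z)"
  using measurable_space[OF Q, of z] by (simp add: space_prob_algebra)

lemma space_Q [simp]: "space (Q z) = UNIV"
  using sets_eq_imp_space_eq[OF sets_Q] by simp

lemma Q_sub [measurable]: "Q \<in> borel \<rightarrow>\<^sub>M subprob_algebra borel"
  using Q by (rule measurable_prob_algebraD)

lemma one_Q [simp]: "emeasure (Q z) UNIV = 1"
  using prob_space.emeasure_space_1[OF prob_Q[of z]] by simp

lemma drift_centered:
  assumes "norm (D z - (m' + M (z - m))) \<le> B'" "0 \<le> B'"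
  shows "(\<integral>\<^sup>+y. ennreal ((N (y - m'))\<^sup>2) \<partial>Q z) \<le> ennreal (\<rho> * (N (z - m))\<^sup>2 + 2 * c\<^sup>2 / (1 - \<rho>) * (e + B'\<^sup>2))"
proof -
  let ?k = "2 * c\<^sup>2 / (1 - \<rho>)"
  have k: "0 \<le> ?k" using rho by simp
  have "(\<integral>\<^sup>+y. ennreal ((N (y - m'))\<^sup>2) \<partial>Q z) \<le> (\<integral>\<^sup>+y. ennreal (\<rho> * (N (z - m))\<^sup>2 + ?k * B'\<^sup>2) + ennreal ?k * ennreal ((norm (y - D z))\<^sup>2) \<partial>Q z)"
  proof (rule nn_integral_mono)
    fix y
    have "(N (y - m'))\<^sup>2 \<le> (\<rho> * (N (z - m))\<^sup>2 + ?k * B'\<^sup>2) + ?k * (norm (y - D z))\<^sup>2"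
      using drift_pointwise[OF assms, of y] by (simp add: distrib_left algebra_simps)
    then have "ennreal ((N (y - m'))\<^sup>2) \<le> ennreal ((\<rho> * (N (z - m))\<^sup>2 + ?k * B'\<^sup>2) + ?k * (norm (y - D z))\<^sup>2)"
      by (rule ennreal_leI)
    then show "ennreal ((N (y - m'))\<^sup>2) \<le> ennreal (\<rho> * (N (z - m))\<^sup>2 + ?k * B'\<^sup>2) + ennreal ?k * ennreal ((norm (y - D z))\<^sup>2)"
      by (subst (asm) ennreal_plus_mult) (use k rho in auto)
  qed
  also have "\<dots> = ennreal (\<rho> * (N (z - m))\<^sup>2 + ?k * B'\<^sup>2) + ennreal ?k * (\<integral>\<^sup>+y. ennreal ((norm (y - D z))\<^sup>2) \<partial>Q z)"
    by (subst nn_integral_add) (auto simp: nn_integral_cmult)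
  also have "\<dots> \<le> ennreal (\<rho> * (N (z - m))\<^sup>2 + ?k * B'\<^sup>2) + ennreal ?k * ennreal e"
    using close[unfolded l2_close_def, rule_format, of z] by (intro add_mono mult_left_mono) auto
  also have "\<dots> = ennreal (\<rho> * (N (z - m))\<^sup>2 + ?k * B'\<^sup>2 + ?k * e)"
  proof -
    have "ennreal (\<rho> * (N (z - m))\<^sup>2 + ?k * B'\<^sup>2) + ennreal ?k * ennreal e = ennreal (\<rho> * (N (z - m))\<^sup>2 + ?k * B'\<^sup>2) + ennreal (?k * e)"
      using ennreal_mult[OF k e] by simp
    also have "\<dots> = ennreal (\<rho> * (N (z - m))\<^sup>2 + ?k * B'\<^sup>2 + ?k * e)"
      by (rule ennreal_plus[symmetric]) (use k e rho in auto)
    finally show ?thesis .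
  qed
  finally show ?thesis by (simp add: distrib_left add_ac)
qed

definition drift_const :: real where "drift_const = 2 * c\<^sup>2 / (1 - \<rho>) * (e + B\<^sup>2)"

lemma drift_const: "0 \<le> drift_const" using rho e by (simp add: drift_const_def)

lemma drift: "(\<integral>\<^sup>+y. ennreal ((N y)\<^sup>2) \<partial>Q z) \<le> ennreal (\<rho> * (N z)\<^sup>2 + drift_const)"
  using drift_centered[of z 0 0 B] near[of z] B by (simp add: drift_const_def)

lemma drift_bind:
  assumes [measurable_cong]: "sets \<mu> = sets borel" and mu: "prob_space \<mu>"
  shows "(\<integral>\<^sup>+y. ennreal ((N y)\<^sup>2) \<partial>(\<mu> \<bind> Q)) \<le> ennreal \<rho> * (\<integral>\<^sup>+y. ennreal ((N y)\<^sup>2) \<partial>\<mu>) + ennreal drift_const"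
proof -
  have [simp]: "space \<mu> = UNIV" using sets_eq_imp_space_eq[OF assms(1)] by simp
  have "(\<integral>\<^sup>+y. ennreal ((N y)\<^sup>2) \<partial>(\<mu> \<bind> Q)) = (\<integral>\<^sup>+x. \<integral>\<^sup>+y. ennreal ((N y)\<^sup>2) \<partial>Q x \<partial>\<mu>)"
    by (rule nn_integral_bind[of _ borel]) measurable
  also have "\<dots> \<le> (\<integral>\<^sup>+x. ennreal \<rho> * ennreal ((N x)\<^sup>2) + ennreal drift_const \<partial>\<mu>)"
  proof (rule nn_integral_mono)
    fix x
    have "ennreal (\<rho> * (N x)\<^sup>2 + drift_const) = ennreal \<rho> * ennreal ((N x)\<^sup>2) + ennreal drift_const"
      using rho drift_const by (subst ennreal_plus) (auto simp: ennreal_mult)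
    then show "(\<integral>\<^sup>+y. ennreal ((N y)\<^sup>2) \<partial>Q x) \<le> ennreal \<rho> * ennreal ((N x)\<^sup>2) + ennreal drift_const"
      using drift[of x] by simp
  qed
  also have "\<dots> = ennreal \<rho> * (\<integral>\<^sup>+y. ennreal ((N y)\<^sup>2) \<partial>\<mu>) + ennreal drift_const"
    using prob_space.emeasure_space_1[OF mu] by (subst nn_integral_add) (auto simp: nn_integral_cmult)
  finally show ?thesis .
qed

text \<open>
  The drift inequality, integrated against an invariant law, bounds the second moment by itself
  times \<open>\<rho>\<close> plus a constant.
\<close>

lemma invariant_second_moment:
  assumes inv: "invariant_law Q \<pi>" and fin: "(\<integral>\<^sup>+y. ennreal ((N y)\<^sup>2) \<partial>\<pi>) < \<infinity>"
  shows "(\<integral>\<^sup>+y. ennreal ((N y)\<^sup>2) \<partial>\<pi>) \<le> ennreal (drift_const / (1 - \<rho>))"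
proof -
  obtain x where x: "0 \<le> x" "(\<integral>\<^sup>+y. ennreal ((N y)\<^sup>2) \<partial>\<pi>) = ennreal x"
    using fin by (cases "\<integral>\<^sup>+y. ennreal ((N y)\<^sup>2) \<partial>\<pi>") auto
  have "ennreal x \<le> ennreal \<rho> * ennreal x + ennreal drift_const"
    using drift_bind[of \<pi>] inv x by (simp add: invariant_law_def)
  also have "\<dots> = ennreal (\<rho> * x + drift_const)"
    using x rho drift_const by (simp add: ennreal_mult ennreal_plus)
  finally have "x \<le> \<rho> * x + drift_const" using x rho drift_const by (subst (asm) ennreal_le_iff) auto
  then have "x * (1 - \<rho>) \<le> drift_const" by (simp add: algebra_simps)
  then have "x \<le> drift_const / (1 - \<rho>)" using rho by (simp add: pos_le_divide_eq)
  then show ?thesis unfolding x(2) by (rule ennreal_leI)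
qed

text \<open>
  For two steps, \<open>1 + (N z)\<^sup>2\<close> satisfies a drift condition outside a ball, and on that ball full
  spreading gives a minorization by the uniform law on a product of two unit balls.
\<close>

lemma unique_invariant_law_of_phase_spread:
  assumes sp: "phase_spread (\<lambda>z. Q z \<bind> Q)"
  shows "\<exists>\<pi>. unique_invariant_law Q \<pi> \<and> (\<integral>\<^sup>+y. ennreal ((N y)\<^sup>2) \<partial>\<pi>) \<le> ennreal (drift_const / (1 - \<rho>))"
proof -
  define K where "K z = Q z \<bind> Q" for z
  have K: "K \<in> borel \<rightarrow>\<^sub>M prob_algebra borel"
    unfolding K_def[abs_def] by (rule measurable_bind_prob_space[OF Q Q])
  have sets_K [simp, measurable_cong]: "sets (K z) = sets borel" for z
    using measurable_space[OF K, of z] by (simp add: space_prob_algebra)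
  have prob_K: "prob_space (K z)" for z
    using measurable_space[OF K, of z] by (simp add: space_prob_algebra)
  have [simp]: "space (K z) = UNIV" for z using sets_eq_imp_space_eq[OF sets_K] by simp
  have one: "emeasure (K z) UNIV = 1" for z using prob_space.emeasure_space_1[OF prob_K[of z]] by simp
  define b where "b = \<rho> * drift_const + drift_const + 1"
  have b: "1 \<le> b" using rho drift_const by (simp add: b_def)
  define V where "V y = 1 + (N y)\<^sup>2" for y
  define l where "l = (1 + \<rho>) / 2"
  have l: "0 \<le> l" "l < 1" "\<rho> < l" using rho by (auto simp: l_def)
  \<comment> \<open>Beyond this radius the gap between \<open>\<rho>\<close> and \<open>l\<close> pays for the constant \<open>b\<close>.\<close>
  define R0 where "R0 = b / (l - \<rho>)"
  define C where "C = {z. (N z)\<^sup>2 \<le> R0}"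
  have KN: "(\<integral>\<^sup>+y. ennreal ((N y)\<^sup>2) \<partial>K z) \<le> ennreal (\<rho> * (N z)\<^sup>2 + \<rho> * drift_const + drift_const)" for z
  proof -
    have "(\<integral>\<^sup>+y. ennreal ((N y)\<^sup>2) \<partial>K z) \<le> ennreal \<rho> * (\<integral>\<^sup>+y. ennreal ((N y)\<^sup>2) \<partial>Q z) + ennreal drift_const"
      unfolding K_def by (rule drift_bind) (use prob_Q in auto)
    also have "\<dots> \<le> ennreal \<rho> * ennreal (\<rho> * (N z)\<^sup>2 + drift_const) + ennreal drift_const"
      by (intro add_mono mult_left_mono drift) auto
    also have "\<dots> = ennreal (\<rho> * (\<rho> * (N z)\<^sup>2 + drift_const) + drift_const)"
      using rho drift_const by (simp add: ennreal_mult ennreal_plus)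
    also have "\<dots> \<le> ennreal (\<rho> * (N z)\<^sup>2 + \<rho> * drift_const + drift_const)"
    proof (rule ennreal_leI)
      have "\<rho> * (\<rho> * (N z)\<^sup>2) \<le> 1 * (\<rho> * (N z)\<^sup>2)" using rho by (intro mult_right_mono) auto
      then show "\<rho> * (\<rho> * (N z)\<^sup>2 + drift_const) + drift_const \<le> \<rho> * (N z)\<^sup>2 + \<rho> * drift_const + drift_const"
        by (simp add: algebra_simps)
    qed
    finally show ?thesis .
  qed
  have V_meas [measurable]: "V \<in> borel_measurable borel" unfolding V_def[abs_def] by measurable
  have KV0: "(\<integral>\<^sup>+y. ennreal (V y) \<partial>K z) \<le> ennreal (\<rho> * (N z)\<^sup>2 + b)" for z
  proof -
    have "(\<integral>\<^sup>+y. ennreal (V y) \<partial>K z) = (\<integral>\<^sup>+y. 1 + ennreal ((N y)\<^sup>2) \<partial>K z)"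
      by (intro nn_integral_cong) (simp add: V_def ennreal_plus flip: ennreal_1)
    also have "\<dots> = 1 + (\<integral>\<^sup>+y. ennreal ((N y)\<^sup>2) \<partial>K z)"
      by (subst nn_integral_add) (auto simp: one)
    also have "\<dots> \<le> 1 + ennreal (\<rho> * (N z)\<^sup>2 + \<rho> * drift_const + drift_const)" by (intro add_mono KN) simp
    also have "\<dots> = ennreal (\<rho> * (N z)\<^sup>2 + b)"
    proof -
      have "0 \<le> \<rho> * (N z)\<^sup>2 + \<rho> * drift_const + drift_const" using rho drift_const by simp
      then have "1 + ennreal (\<rho> * (N z)\<^sup>2 + \<rho> * drift_const + drift_const) = ennreal (1 + (\<rho> * (N z)\<^sup>2 + \<rho> * drift_const + drift_const))"
        by (simp only: ennreal_plus[OF zero_le_one] ennreal_1)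
      then show ?thesis by (simp add: b_def add_ac)
    qed
    finally show ?thesis .
  qed
  have KV: "(\<integral>\<^sup>+y. ennreal (V y) \<partial>K z) \<le> ennreal (l * V z + b * indicator C z)" for z
  proof (rule order_trans[OF KV0 ennreal_leI])
    show "\<rho> * (N z)\<^sup>2 + b \<le> l * V z + b * indicator C z"
    proof (cases "z \<in> C")
      case True
      have "\<rho> * (N z)\<^sup>2 \<le> l * (N z)\<^sup>2" using l by (intro mult_right_mono) auto
      then show ?thesis using True l by (simp add: V_def algebra_simps)
    next
      case False
      then have "b < (l - \<rho>) * (N z)\<^sup>2" using l by (simp add: C_def R0_def field_simps)
      then show ?thesis using False l by (simp add: V_def algebra_simps)
    qed
  qed
  let ?U = "uniform_measure lborel (cball (0::real^2) 1)"
  obtain k where k: "k > 0" "emeasure lborel (cball (0::real^2) 1) = ennreal k"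
    using unit_ball_content[OF zero_less_one, where 'a="real^2"] by blast
  have U: "prob_space ?U" using k by (intro prob_space_uniform_measure) auto
  interpret U: prob_space ?U by (rule U)
  interpret UU: pair_prob_space ?U ?U ..
  define \<nu> where "\<nu> = ?U \<Otimes>\<^sub>M ?U"
  have sets_nu: "sets \<nu> = sets borel"
  proof -
    have "sets \<nu> = sets ((borel :: (real^2) measure) \<Otimes>\<^sub>M (borel :: (real^2) measure))"
      unfolding \<nu>_def by (rule sets_pair_measure_cong) auto
    then show ?thesis by (simp only: borel_prod)
  qed
  have nu: "prob_space \<nu>" unfolding \<nu>_def by (rule UU.prob_space_axioms)
  have nn_nu: "(\<integral>\<^sup>+y. g y \<partial>\<nu>) = ennreal (1 / (k * k)) * (\<integral>\<^sup>+x. (\<integral>\<^sup>+v. g (x, v) * indicator (cball 0 1) v \<partial>lborel) * indicator (cball 0 1) x \<partial>lborel)"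
    if g: "g \<in> borel_measurable borel" for g :: "2 phase \<Rightarrow> ennreal"
  proof -
    have uni: "(\<integral>\<^sup>+x. f x \<partial>?U) = ennreal (1 / k) * (\<integral>\<^sup>+x. f x * indicator (cball 0 1) x \<partial>lborel)" if "f \<in> borel_measurable borel" for f :: "real^2 \<Rightarrow> ennreal"
    proof -
      have "(\<integral>\<^sup>+x. f x \<partial>?U) = (\<integral>\<^sup>+x. f x * indicator (cball 0 1) x \<partial>lborel) / ennreal k"
        using that by (subst nn_integral_uniform_measure) (auto simp: k)
      also have "\<dots> = ennreal (1 / k) * (\<integral>\<^sup>+x. f x * indicator (cball 0 1) x \<partial>lborel)"
        using k(1) by (simp add: divide_ennreal_def inverse_ennreal mult.commute inverse_eq_divide)
      finally show ?thesis .
    qed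
    have gm: "(\<lambda>v. g (x, v)) \<in> borel_measurable borel" for x using g by measurable
    have "(\<integral>\<^sup>+y. g y \<partial>\<nu>) = (\<integral>\<^sup>+x. \<integral>\<^sup>+v. g (x, v) \<partial>?U \<partial>?U)"
      unfolding \<nu>_def
      by (rule U.nn_integral_fst[symmetric]) (use g sets_nu in \<open>simp add: \<nu>_def[symmetric] measurable_cong_sets[OF sets_nu refl]\<close>)
    also have "\<dots> = (\<integral>\<^sup>+x. ennreal (1 / k) * (\<integral>\<^sup>+v. g (x, v) * indicator (cball 0 1) v \<partial>lborel) \<partial>?U)"
      by (simp only: uni[OF gm])
    also have "\<dots> = ennreal (1 / k) * (\<integral>\<^sup>+x. ennreal (1 / k) * (\<integral>\<^sup>+v. g (x, v) * indicator (cball 0 1) v \<partial>lborel) * indicator (cball 0 1) x \<partial>lborel)"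
      by (rule uni) (rule borel_measurable_times_ennreal[OF borel_measurable_const fibre_average_measurable[OF g]])
    also have "\<dots> = ennreal (1 / k) * (ennreal (1 / k) * (\<integral>\<^sup>+x. (\<integral>\<^sup>+v. g (x, v) * indicator (cball 0 1) v \<partial>lborel) * indicator (cball 0 1) x \<partial>lborel))"
    proof -
      have "(\<lambda>x. (\<integral>\<^sup>+v. g (x, v) * indicator (cball 0 1) v \<partial>lborel) * indicator (cball 0 1) x) \<in> borel_measurable borel"
        by (rule borel_measurable_times_ennreal[OF fibre_average_measurable[OF g] borel_measurable_indicator]) simp
      then have "(\<lambda>x. (\<integral>\<^sup>+v. g (x, v) * indicator (cball 0 1) v \<partial>lborel) * indicator (cball 0 1) x) \<in> borel_measurable lborel"
        by simp
      from nn_integral_cmult[OF this, of "ennreal (1 / k)"] show ?thesis by (simp only: mult.assoc)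
    qed
    also have "\<dots> = ennreal (1 / (k * k)) * (\<integral>\<^sup>+x. (\<integral>\<^sup>+v. g (x, v) * indicator (cball 0 1) v \<partial>lborel) * indicator (cball 0 1) x \<partial>lborel)"
      using k by (simp add: mult.assoc[symmetric] flip: ennreal_mult)
    finally show ?thesis .
  qed
  obtain \<epsilon> where \<epsilon>: "\<epsilon> > 0" "\<And>z g. norm z \<le> sqrt R0 \<Longrightarrow> g \<in> borel_measurable borel \<Longrightarrow>
     ennreal \<epsilon> * (\<integral>\<^sup>+x. (\<integral>\<^sup>+v. g (x, v) * indicator (cball 0 1) v \<partial>lborel) * indicator (cball 0 1) x \<partial>lborel) \<le> (\<integral>\<^sup>+y. g y \<partial>K z)"
    using sp[unfolded phase_spread_def, rule_format, of "sqrt R0" 1] unfolding K_def by blast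
  have minor: "ennreal (\<epsilon> * (k * k)) * (\<integral>\<^sup>+y. g y \<partial>\<nu>) \<le> (\<integral>\<^sup>+y. g y \<partial>K z)"
    if "norm z \<le> sqrt R0" "g \<in> borel_measurable borel" for z and g :: "2 phase \<Rightarrow> ennreal"
  proof -
    have "ennreal (\<epsilon> * (k * k)) * ennreal (1 / (k * k)) = ennreal \<epsilon>"
      using \<epsilon> k by (simp flip: ennreal_mult)
    then have "ennreal (\<epsilon> * (k * k)) * (\<integral>\<^sup>+y. g y \<partial>\<nu>) = ennreal \<epsilon> * (\<integral>\<^sup>+x. (\<integral>\<^sup>+v. g (x, v) * indicator (cball 0 1) v \<partial>lborel) * indicator (cball 0 1) x \<partial>lborel)"
      unfolding nn_nu[OF that(2)] by (simp add: mult.assoc[symmetric])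
    then show ?thesis using \<epsilon>(2)[OF that] by simp
  qed
  have R0: "0 \<le> R0" using b l by (simp add: R0_def)
  interpret DM: drift_minorization K C \<nu> "\<epsilon> * (k * k)" l b V
  proof (rule drift_minorization.intro)
    show "C \<in> sets borel" unfolding C_def by measurable
    show "ennreal (\<epsilon> * (k * k)) * emeasure \<nu> A \<le> emeasure (K z) A" if "z \<in> C" "A \<in> sets borel" for z A
    proof -
      have "N z \<le> sqrt R0" using that(1) by (auto simp: C_def intro: real_le_rsqrt)
      then have "norm z \<le> sqrt R0" using N_ge[of z] by linarith
      from minor[OF this, of "indicator A"] that(2) show ?thesis by (simp add: sets_nu)
    qed
    have "ennreal (\<epsilon> * (k * k)) * (\<integral>\<^sup>+y. ennreal (V y) \<partial>\<nu>) \<le> (\<integral>\<^sup>+y. ennreal (V y) \<partial>K 0)"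
      using R0 by (intro minor) auto
    also have "\<dots> < \<infinity>" using KV0[of 0] by (rule le_less_trans) simp
    finally have "ennreal (\<epsilon> * (k * k)) * (\<integral>\<^sup>+y. ennreal (V y) \<partial>\<nu>) < \<infinity>" .
    moreover have "ennreal (\<epsilon> * (k * k)) \<noteq> 0" using \<epsilon> k by simp
    ultimately show "(\<integral>\<^sup>+y. ennreal (V y) \<partial>\<nu>) < \<infinity>"
      unfolding infinity_ennreal_def ennreal_mult_less_top by (elim disjE) auto
    show "0 < \<epsilon> * (k * k)" using \<epsilon> k by simp
    show "1 \<le> V z" for z by (simp add: V_def)
    show "0 \<le> b" using b by simp
  qed (rule K nu sets_nu V_meas l KV)+
  obtain \<pi> where \<pi>: "unique_invariant_law K \<pi>" "(\<integral>\<^sup>+y. ennreal (V y) \<partial>\<pi>) < \<infinity>"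
    using DM.unique_invariant_law_exists by blast
  have uQ: "unique_invariant_law Q \<pi>"
    by (rule unique_invariant_law_of_square[OF Q]) (use \<pi>(1) in \<open>simp add: K_def[abs_def]\<close>)
  have "(\<integral>\<^sup>+y. ennreal ((N y)\<^sup>2) \<partial>\<pi>) \<le> (\<integral>\<^sup>+y. ennreal (V y) \<partial>\<pi>)"
    by (intro nn_integral_mono ennreal_leI) (simp add: V_def)
  then have "(\<integral>\<^sup>+y. ennreal ((N y)\<^sup>2) \<partial>\<pi>) < \<infinity>" using \<pi>(2) by (rule le_less_trans)
  moreover have "invariant_law Q \<pi>" using uQ unfolding unique_invariant_law_def by blast
  ultimately show ?thesis using invariant_second_moment uQ by blast
qed

end

section \<open>Wasserstein and total variation distances\<close>

lemma ennreal_powr_le: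
  assumes "x \<le> ennreal a" "0 \<le> a" "0 \<le> p"
  shows "x powr\<^sub>\<infinity> p \<le> ennreal (a powr p)"
proof -
  have x: "x \<noteq> \<infinity>" using assms(1) by (auto simp: top_unique)
  have "enn2real x \<le> a" using assms by (intro enn2real_leI) auto
  then have "enn2real x powr p \<le> a powr p" using assms by (intro powr_mono2) auto
  then show ?thesis using x by (simp add: ennreal_powr_def ennreal_leI)
qed

text \<open>
  The product measure couples \<open>\<pi>\<close> with a Dirac mass.
\<close>

lemma W2_return_le:
  fixes \<pi> :: "'a::{metric_space, second_countable_topology} measure"
  assumes pi: "prob_space \<pi>" and sets [measurable_cong]: "sets \<pi> = sets borel"
    and le: "(\<integral>\<^sup>+y. ennreal ((dist z y)\<^sup>2) \<partial>\<pi>) \<le> ennreal d" and d: "0 \<le> d"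
  shows "W2 (return borel z) \<pi> \<le> ennreal (sqrt d)"
proof -
  have [simp]: "space \<pi> = UNIV" using sets_eq_imp_space_eq[OF sets] by simp
  let ?w = "distr \<pi> (borel \<Otimes>\<^sub>M borel) (\<lambda>y. (z, y))"
  have m: "(\<lambda>y. (z, y)) \<in> \<pi> \<rightarrow>\<^sub>M borel \<Otimes>\<^sub>M borel" by measurable
  have "?w \<in> couplings (return borel z) \<pi>"
    unfolding couplings_def
  proof (intro CollectI conjI)
    show "sets ?w = sets (return borel z \<Otimes>\<^sub>M \<pi>)"
      using sets_pair_measure_cong[of "return borel z" borel \<pi> borel] sets by simp
    have fst: "fst \<in> borel \<Otimes>\<^sub>M borel \<rightarrow>\<^sub>M return borel z" and snd: "snd \<in> borel \<Otimes>\<^sub>M borel \<rightarrow>\<^sub>M \<pi>"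
      by (simp_all add: measurable_cong_sets[OF refl sets_return] measurable_cong_sets[OF refl sets])
    have "distr ?w (return borel z) fst = distr \<pi> (return borel z) (\<lambda>_. z)"
      by (simp add: distr_distr[OF fst m] comp_def)
    also have "\<dots> = return borel z"
    proof (rule measure_eqI)
      fix A assume "A \<in> sets (distr \<pi> (return borel z) (\<lambda>_. z))"
      then have A: "A \<in> sets borel" by simp
      have "emeasure (distr \<pi> (return borel z) (\<lambda>_. z)) A = emeasure \<pi> ((\<lambda>_. z) -` A)"
        using A by (subst emeasure_distr) auto
      also have "(\<lambda>_. z) -` A = (if z \<in> A then UNIV else ({} :: 'a set))" by auto
      finally show "emeasure (distr \<pi> (return borel z) (\<lambda>_. z)) A = emeasure (return borel z) A"
        using prob_space.emeasure_space_1[OF pi] A by (simp split: if_splits)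
    qed simp
    finally show "distr ?w (return borel z) fst = return borel z" .
    have "distr ?w \<pi> snd = distr \<pi> \<pi> (\<lambda>y. y)"
      by (simp add: distr_distr[OF snd m] comp_def)
    then show "distr ?w \<pi> snd = \<pi>" by (simp add: distr_id2)
  qed
  then have "(INF \<omega>\<in>couplings (return borel z) \<pi>. \<integral>\<^sup>+ (x, y). ennreal ((dist x y)\<^sup>2) \<partial>\<omega>) \<le> (\<integral>\<^sup>+ (x, y). ennreal ((dist x y)\<^sup>2) \<partial>?w)"
    by (rule INF_lower)
  also have "\<dots> = (\<integral>\<^sup>+y. ennreal ((dist z y)\<^sup>2) \<partial>\<pi>)"
    using m by (subst nn_integral_distr) (auto simp: case_prod_beta')
  finally have "(INF \<omega>\<in>couplings (return borel z) \<pi>. \<integral>\<^sup>+ (x, y). ennreal ((dist x y)\<^sup>2) \<partial>\<omega>) \<le> ennreal d"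
    using le by (rule order_trans)
  from ennreal_powr_le[OF this d, of "1 / 2"] show ?thesis
    using d by (simp add: W2_def powr_half_sqrt)
qed

lemma tv_dist_ge:
  assumes "prob_space \<mu>" "prob_space \<nu>" "A \<in> sets \<mu>"
  shows "\<bar>measure \<mu> A - measure \<nu> A\<bar> \<le> tv_dist \<mu> \<nu>"
  unfolding tv_dist_def
proof (rule cSUP_upper[OF assms(3)])
  show "bdd_above ((\<lambda>A. \<bar>measure \<mu> A - measure \<nu> A\<bar>) ` sets \<mu>)"
  proof (intro bdd_aboveI2[where M=1])
    fix A
    have "0 \<le> measure \<mu> A" "measure \<mu> A \<le> 1" "0 \<le> measure \<nu> A" "measure \<nu> A \<le> 1"
      using assms by (auto intro: prob_space.prob_le_1)
    then show "\<bar>measure \<mu> A - measure \<nu> A\<bar> \<le> 1" by linarith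
  qed
qed

lemma second_moment_tail:
  fixes u :: "'a \<Rightarrow> real"
  assumes [measurable]: "u \<in> borel_measurable M" and le: "(\<integral>\<^sup>+y. ennreal ((u y)\<^sup>2) \<partial>M) \<le> ennreal E" and s: "0 < s" "0 \<le> E"
  shows "emeasure M {y \<in> space M. s < u y} \<le> ennreal (E / s\<^sup>2)"
proof -
  have "emeasure M {y \<in> space M. s < u y} = (\<integral>\<^sup>+y. indicator {y \<in> space M. s < u y} y \<partial>M)" by simp
  also have "\<dots> \<le> (\<integral>\<^sup>+y. ennreal (1 / s\<^sup>2) * ennreal ((u y)\<^sup>2) \<partial>M)"
  proof (rule nn_integral_mono)
    fix y
    have "1 \<le> 1 / s\<^sup>2 * (u y)\<^sup>2" if "s < u y"
      using power_strict_mono[OF that, of 2] s by (simp add: field_simps)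
    then have "ennreal 1 \<le> ennreal (1 / s\<^sup>2) * ennreal ((u y)\<^sup>2)" if "s < u y"
      using that by (subst ennreal_mult[symmetric]) (auto intro: ennreal_leI simp del: ennreal_1)
    then show "indicator {y \<in> space M. s < u y} y \<le> ennreal (1 / s\<^sup>2) * ennreal ((u y)\<^sup>2)"
      by (auto simp: indicator_def)
  qed
  also have "\<dots> = ennreal (1 / s\<^sup>2) * (\<integral>\<^sup>+y. ennreal ((u y)\<^sup>2) \<partial>M)" by (rule nn_integral_cmult) measurable
  also have "\<dots> \<le> ennreal (1 / s\<^sup>2) * ennreal E" by (intro mult_left_mono le) simp
  also have "\<dots> = ennreal (E / s\<^sup>2)" using s by (simp flip: ennreal_mult)
  finally show ?thesis .
qed

lemma kernel_iterate_simps [simp]: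
  "kernel_iterate Q 0 \<mu> = \<mu>" "kernel_iterate Q (Suc n) \<mu> = kernel_iterate Q n \<mu> \<bind> Q"
  by (simp_all add: kernel_iterate_def)

context contracting_chain
begin

abbreviation it :: "nat \<Rightarrow> 2 phase \<Rightarrow> 2 phase measure" where
  "it n z \<equiv> kernel_iterate Q n (return borel z)"

lemma it_in: "it n z \<in> space (prob_algebra borel)"
proof (induction n)
  case 0 show ?case by (simp add: space_prob_algebra prob_space_return)
next
  case (Suc n)
  from measurable_space[OF measurable_bind_prob_space[OF measurable_ident_sets[OF refl] Q] this]
  show ?case by simp
qed

lemma sets_it [simp, measurable_cong]: "sets (it n z) = sets borel" and prob_it: "prob_space (it n z)"
  using it_in[of n z] by (simp_all add: space_prob_algebra)

lemma space_it [simp]: "space (it n z) = UNIV"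
  using sets_eq_imp_space_eq[OF sets_it] by simp

text \<open>
  A union bound over the times at which the chain leaves the tube formed by the sets \<open>A n\<close>.
\<close>

lemma it_escape:
  assumes A: "\<And>n. A n \<in> sets borel" and z: "z \<in> A 0"
    and step: "\<And>n y. y \<in> A n \<Longrightarrow> emeasure (Q y) (- A (Suc n)) \<le> ennreal \<delta>" and d: "0 \<le> \<delta>"
  shows "emeasure (it n z) (- A n) \<le> ennreal (real n * \<delta>)"
proof (induction n)
  case 0
  then show ?case using A[of 0] z by simp
next
  case (Suc n)
  have [measurable]: "- A k \<in> sets borel" for k using A by simp
  have "emeasure (it (Suc n) z) (- A (Suc n)) = (\<integral>\<^sup>+y. emeasure (Q y) (- A (Suc n)) \<partial>it n z)"
    by (simp add: emeasure_bind[of _ _ borel])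
  also have "\<dots> \<le> (\<integral>\<^sup>+y. indicator (- A n) y + ennreal \<delta> \<partial>it n z)"
  proof (rule nn_integral_mono)
    fix y
    show "emeasure (Q y) (- A (Suc n)) \<le> indicator (- A n) y + ennreal \<delta>"
    proof (cases "y \<in> A n")
      case True then show ?thesis using step[OF True] by simp
    next
      case False
      have "emeasure (Q y) (- A (Suc n)) \<le> 1" by (rule prob_space.emeasure_le_1[OF prob_Q])
      also have "\<dots> \<le> 1 + ennreal \<delta>" by simp
      finally show ?thesis using False by simp
    qed
  qed
  also have "\<dots> = emeasure (it n z) (- A n) + ennreal \<delta>"
    using prob_space.emeasure_space_1[OF prob_it[of n z]] by (subst nn_integral_add) auto
  also have "\<dots> \<le> ennreal (real n * \<delta>) + ennreal \<delta>" by (intro add_mono Suc) simp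
  also have "\<dots> = ennreal (real (Suc n) * \<delta>)" using d by (simp add: distrib_right add.commute flip: ennreal_plus)
  finally show ?case .
qed

lemma prob_of_compl_le:
  assumes \<mu>: "prob_space \<mu>" "sets \<mu> = sets borel" and A: "A \<in> sets borel" and le: "emeasure \<mu> (- A) \<le> ennreal \<delta>" "0 \<le> \<delta>"
  shows "1 - \<delta> \<le> measure \<mu> A"
proof -
  interpret prob_space \<mu> by fact
  have [simp]: "space \<mu> = UNIV" using sets_eq_imp_space_eq[OF \<mu>(2)] by simp
  have "measure \<mu> (- A) \<le> \<delta>" using le by (simp add: emeasure_eq_measure)
  moreover have "measure \<mu> (space \<mu> - A) = 1 - measure \<mu> A" using A \<mu> by (intro prob_compl) simp
  ultimately show ?thesis by (simp add: Compl_eq_Diff_UNIV)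
qed

text \<open>
  Inside the ball of radius \<open>r\<close> about \<open>Y n\<close> a noise-free step contracts towards \<open>Y (Suc n)\<close> by \<open>\<rho>\<close>, so
  leaving the tube takes noise of size \<open>(1 - \<rho>) * r / c\<close>, and Chebyshev's inequality bounds its
  probability. Two consecutive balls are disjoint; an invariant law gives at most half its mass to one of
  them, while the chain has at least 3/4 of its mass there at the corresponding time.
\<close>

lemma tv_near_cycle:
  assumes \<pi>: "prob_space \<pi>" "sets \<pi> = sets borel" and r: "0 < r"
    and affine: "\<And>n z. N (z - Y n) \<le> r \<Longrightarrow> D z = Y (Suc n) + M (z - Y n)"
    and sep: "\<And>n. 2 * r < norm (Y (Suc n) - Y n)"
    and n: "real (Suc n) * (e / ((1 - \<rho>) * r / c)\<^sup>2) \<le> 1 / 4"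
  shows "1 / 4 \<le> tv_dist (it n (Y 0)) \<pi> \<or> 1 / 4 \<le> tv_dist (it (Suc n) (Y 0)) \<pi>"
proof -
  define \<delta> where "\<delta> = e / ((1 - \<rho>) * r / c)\<^sup>2"
  have d0: "0 \<le> \<delta>" using e by (simp add: \<delta>_def)
  define A where "A n = {z. N (z - Y n) \<le> r}" for n
  have A: "A n \<in> sets borel" for n
    unfolding A_def by measurable
  have s: "0 < (1 - \<rho>) * r / c" using rho r c_pos by simp
  have step: "emeasure (Q y) (- A (Suc n)) \<le> ennreal \<delta>" if y: "y \<in> A n" for n y
  proof -
    have "- A (Suc n) \<subseteq> {x \<in> space (Q y). (1 - \<rho>) * r / c < norm (x - D y)}"
    proof
      fix x assume "x \<in> - A (Suc n)"
      then have "r < N (x - Y (Suc n))" by (simp add: A_def)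
      also have "x - Y (Suc n) = (x - D y) + M (y - Y n)"
        using affine[of y n] y by (simp add: A_def)
      also have "N \<dots> \<le> c * norm (x - D y) + \<rho> * r"
      proof -
        have "N (M (y - Y n)) \<le> \<rho> * r"
          using N_M[of "y - Y n"] y rho mult_left_mono[of "N (y - Y n)" r \<rho>] by (simp add: A_def)
        then show ?thesis using N_add[of "x - D y" "M (y - Y n)"] N_le[of "x - D y"] by linarith
      qed
      finally have "(1 - \<rho>) * r < c * norm (x - D y)" by (simp add: algebra_simps)
      then show "x \<in> {x \<in> space (Q y). (1 - \<rho>) * r / c < norm (x - D y)}"
        using c_pos by (simp add: pos_divide_less_eq mult.commute)
    qed
    then have "emeasure (Q y) (- A (Suc n)) \<le> emeasure (Q y) {x \<in> space (Q y). (1 - \<rho>) * r / c < norm (x - D y)}"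
      by (rule emeasure_mono) measurable
    also have "\<dots> \<le> ennreal \<delta>" unfolding \<delta>_def
      by (rule second_moment_tail) (use close[unfolded l2_close_def, rule_format, of y] s e in auto)
    finally show ?thesis .
  qed
  have z0: "Y 0 \<in> A 0" using N_scale[of 0 0] r by (simp add: A_def)
  have P: "1 - real n * \<delta> \<le> measure (it n (Y 0)) (A n)" for n
    by (rule prob_of_compl_le[OF prob_it sets_it A it_escape[OF A z0 step d0]]) (use d0 in auto)
  have nd: "real n * \<delta> \<le> 1 / 4" "real (Suc n) * \<delta> \<le> 1 / 4"
    using assms(6) d0 by (auto simp: \<delta>_def[symmetric] distrib_right)
  have disj: "A n \<inter> A (Suc n) = {}"
  proof (rule ccontr)
    assume "A n \<inter> A (Suc n) \<noteq> {}"
    then obtain z where z: "N (z - Y n) \<le> r" "N (z - Y (Suc n)) \<le> r" by (auto simp: A_def)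
    have "norm (Y (Suc n) - Y n) \<le> N ((z - Y n) + - (z - Y (Suc n)))" using N_ge[of "Y (Suc n) - Y n"] by simp
    also have "\<dots> \<le> N (z - Y n) + N (z - Y (Suc n))" using N_add N_minus by metis
    finally show False using z sep[of n] by linarith
  qed
  interpret pi: prob_space \<pi> by (rule \<pi>(1))
  have "measure \<pi> (A n) + measure \<pi> (A (Suc n)) = measure \<pi> (A n \<union> A (Suc n))"
    using A \<pi>(2) disj by (intro pi.finite_measure_Union[symmetric]) auto
  also have "\<dots> \<le> 1" by (rule pi.prob_le_1)
  finally have "measure \<pi> (A n) \<le> 1 / 2 \<or> measure \<pi> (A (Suc n)) \<le> 1 / 2" by linarith
  moreover have tv: "measure (it n (Y 0)) (A n) - measure \<pi> (A n) \<le> tv_dist (it n (Y 0)) \<pi>" for n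
    using tv_dist_ge[OF prob_it \<pi>(1), of "A n" n "Y 0"] A by simp
  ultimately show ?thesis using P[of n] P[of "Suc n"] nd tv[of n] tv[of "Suc n"] by linarith
qed

text \<open>
  The deviation from the deterministic orbit obeys the drift inequality and starts at 0, so its second
  moment never exceeds the fixed point of that inequality.
\<close>

lemma it_second_moment:
  assumes D: "\<And>z. D z = M z"
  shows "(\<integral>\<^sup>+y. ennreal ((N (y - (M ^^ n) z))\<^sup>2) \<partial>it n z) \<le> ennreal (drift_const / (1 - \<rho>))"
proof (induction n)
  case 0
  have "N 0 = 0" using N_scale[of 0 0] by simp
  then show ?case by (simp add: nn_integral_return)
next
  case (Suc n)
  let ?E = "drift_const / (1 - \<rho>)"
  have E: "0 \<le> ?E" using drift_const rho by simp
  have k: "2 * c\<^sup>2 / (1 - \<rho>) * (e + 0\<^sup>2) \<le> drift_const"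
    unfolding drift_const_def using rho by (intro mult_left_mono) auto
  have "(\<integral>\<^sup>+y. ennreal ((N (y - (M ^^ Suc n) z))\<^sup>2) \<partial>it (Suc n) z)
    = (\<integral>\<^sup>+x. \<integral>\<^sup>+y. ennreal ((N (y - (M ^^ Suc n) z))\<^sup>2) \<partial>Q x \<partial>it n z)"
    unfolding kernel_iterate_simps by (rule nn_integral_bind[of _ borel]) measurable
  also have "\<dots> \<le> (\<integral>\<^sup>+x. ennreal drift_const + ennreal \<rho> * ennreal ((N (x - (M ^^ n) z))\<^sup>2) \<partial>it n z)"
  proof (rule nn_integral_mono)
    fix x
    have "norm (D x - ((M ^^ Suc n) z + M (x - (M ^^ n) z))) \<le> 0"
      by (simp add: D linear_diff[OF linM])
    from drift_centered[OF this]
    have "(\<integral>\<^sup>+y. ennreal ((N (y - (M ^^ Suc n) z))\<^sup>2) \<partial>Q x) \<le> ennreal (\<rho> * (N (x - (M ^^ n) z))\<^sup>2 + 2 * c\<^sup>2 / (1 - \<rho>) * (e + 0\<^sup>2))"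
      by simp
    also have "\<dots> \<le> ennreal (drift_const + \<rho> * (N (x - (M ^^ n) z))\<^sup>2)" using k by (intro ennreal_leI) simp
    also have "\<dots> = ennreal drift_const + ennreal \<rho> * ennreal ((N (x - (M ^^ n) z))\<^sup>2)"
      by (rule ennreal_plus_mult) (use drift_const rho in auto)
    finally show "(\<integral>\<^sup>+y. ennreal ((N (y - (M ^^ Suc n) z))\<^sup>2) \<partial>Q x) \<le> ennreal drift_const + ennreal \<rho> * ennreal ((N (x - (M ^^ n) z))\<^sup>2)" .
  qed
  also have "\<dots> = ennreal drift_const + ennreal \<rho> * (\<integral>\<^sup>+x. ennreal ((N (x - (M ^^ n) z))\<^sup>2) \<partial>it n z)"
    using prob_space.emeasure_space_1[OF prob_it[of n z]] by (subst nn_integral_add) (auto simp: nn_integral_cmult)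
  also have "\<dots> \<le> ennreal drift_const + ennreal \<rho> * ennreal ?E"
    by (intro add_mono mult_left_mono Suc) auto
  also have "\<dots> = ennreal (drift_const + \<rho> * ?E)"
    by (rule ennreal_plus_mult[symmetric]) (use drift_const rho E in auto)
  also have "drift_const + \<rho> * ?E = ?E" using rho by (simp add: field_simps)
  finally show ?case .
qed

text \<open>
  The chain stays within \<open>r\<close> of \<open>M\<^sup>n z\<close> and the invariant law within \<open>r\<close> of the origin, each with
  probability at least 3/4, and these two regions are disjoint.
\<close>

lemma tv_slow_decay:
  assumes D: "\<And>z. D z = M z" and \<pi>: "prob_space \<pi>" "sets \<pi> = sets borel"
    and mom: "(\<integral>\<^sup>+y. ennreal ((N y)\<^sup>2) \<partial>\<pi>) \<le> ennreal (drift_const / (1 - \<rho>))"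
    and r: "0 < r" "4 * (drift_const / (1 - \<rho>)) \<le> r\<^sup>2" and far: "2 * r < norm ((M ^^ n) z)"
  shows "1 / 4 \<le> tv_dist (it n z) \<pi>"
proof -
  let ?E = "drift_const / (1 - \<rho>)"
  have E: "0 \<le> ?E" using drift_const rho by simp
  have Er: "ennreal (?E / r\<^sup>2) \<le> ennreal (1 / 4)"
  proof (rule ennreal_leI)
    have "E / r\<^sup>2 \<le> 1 / 4" if "4 * E \<le> r\<^sup>2" for E using that r(1) by (simp add: field_simps)
    then show "?E / r\<^sup>2 \<le> 1 / 4" using r(2) by blast
  qed
  define A where "A = {y. N (y - (M ^^ n) z) \<le> r}"
  have A: "A \<in> sets borel" unfolding A_def by measurable
  have "emeasure (it n z) (- A) \<le> ennreal (?E / r\<^sup>2)"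
  proof -
    have "- A = {y \<in> space (it n z). r < N (y - (M ^^ n) z)}" by (auto simp: A_def)
    then show ?thesis using second_moment_tail[OF _ it_second_moment[OF D] r(1) E, of n z] by simp
  qed
  then have 1: "1 - 1 / 4 \<le> measure (it n z) A"
    using Er by (intro prob_of_compl_le[OF prob_it sets_it A]) (auto intro: order_trans)
  have [simp]: "space \<pi> = UNIV" using sets_eq_imp_space_eq[OF \<pi>(2)] by simp
  interpret pi: prob_space \<pi> by (rule \<pi>(1))
  have N_pi: "N \<in> borel_measurable \<pi>" using N_meas by (simp add: measurable_cong_sets[OF \<pi>(2) refl])
  have "A \<subseteq> {y \<in> space \<pi>. r < N y}"
  proof
    fix y assume "y \<in> A"
    have "norm ((M ^^ n) z) \<le> N (y - (y - (M ^^ n) z))" using N_ge[of "(M ^^ n) z"] by simp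
    also have "\<dots> \<le> N y + N (y - (M ^^ n) z)"
      using N_add[of y "- (y - (M ^^ n) z)"] N_minus[of "y - (M ^^ n) z"] by simp
    finally show "y \<in> {y \<in> space \<pi>. r < N y}" using \<open>y \<in> A\<close> far by (simp add: A_def)
  qed
  moreover have "{y \<in> space \<pi>. r < N y} \<in> sets \<pi>" using N_pi[unfolded borel_measurable_iff_greater] by blast
  ultimately have "emeasure \<pi> A \<le> emeasure \<pi> {y \<in> space \<pi>. r < N y}" by (rule emeasure_mono)
  also have "\<dots> \<le> ennreal (?E / r\<^sup>2)" by (rule second_moment_tail[OF N_pi mom r(1) E])
  also have "\<dots> \<le> ennreal (1 / 4)" by (rule Er)
  finally have "measure \<pi> A \<le> 1 / 4" by (simp add: pi.emeasure_eq_measure)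
  moreover have "\<bar>measure (it n z) A - measure \<pi> A\<bar> \<le> tv_dist (it n z) \<pi>"
    by (rule tv_dist_ge[OF prob_it \<pi>(1)]) (simp add: A)
  ultimately show ?thesis using 1 by linarith
qed

lemma W2_le:
  assumes \<pi>: "prob_space \<pi>" "sets \<pi> = sets borel"
    and mom: "(\<integral>\<^sup>+y. ennreal ((N y)\<^sup>2) \<partial>\<pi>) \<le> ennreal E" and E: "0 \<le> E"
  shows "W2 (return borel z) \<pi> \<le> ennreal (sqrt (2 * (norm z)\<^sup>2 + 2 * E))"
proof (rule W2_return_le[OF \<pi>])
  have N_pi [measurable]: "N \<in> borel_measurable \<pi>" using N_meas by (simp add: measurable_cong_sets[OF \<pi>(2) refl])
  have [simp]: "space \<pi> = UNIV" using sets_eq_imp_space_eq[OF \<pi>(2)] by simp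
  have one: "emeasure \<pi> UNIV = 1" using prob_space.emeasure_space_1[OF \<pi>(1)] by simp
  have "(\<integral>\<^sup>+y. ennreal ((dist z y)\<^sup>2) \<partial>\<pi>) \<le> (\<integral>\<^sup>+y. ennreal (2 * (norm z)\<^sup>2) + ennreal 2 * ennreal ((N y)\<^sup>2) \<partial>\<pi>)"
  proof (rule nn_integral_mono)
    fix y
    have "(dist z y)\<^sup>2 \<le> (norm z + norm y)\<^sup>2" unfolding dist_norm by (intro power_mono norm_triangle_ineq4) auto
    also have "\<dots> \<le> 2 * (norm z)\<^sup>2 + 2 * (norm y)\<^sup>2"
      using zero_le_power2[of "norm z - norm y"] by (simp add: power2_sum power2_diff)
    also have "(norm y)\<^sup>2 \<le> (N y)\<^sup>2" by (intro power_mono N_ge) auto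
    finally have "ennreal ((dist z y)\<^sup>2) \<le> ennreal (2 * (norm z)\<^sup>2 + 2 * (N y)\<^sup>2)" by (intro ennreal_leI) simp
    then show "ennreal ((dist z y)\<^sup>2) \<le> ennreal (2 * (norm z)\<^sup>2) + ennreal 2 * ennreal ((N y)\<^sup>2)"
      by (subst (asm) ennreal_plus_mult) auto
  qed
  also have "\<dots> = ennreal (2 * (norm z)\<^sup>2) + ennreal 2 * (\<integral>\<^sup>+y. ennreal ((N y)\<^sup>2) \<partial>\<pi>)"
    by (subst nn_integral_add) (auto simp: nn_integral_cmult one)
  also have "\<dots> \<le> ennreal (2 * (norm z)\<^sup>2) + ennreal 2 * ennreal E" by (intro add_mono mult_left_mono mom) auto
  also have "\<dots> = ennreal (2 * (norm z)\<^sup>2 + 2 * E)" by (rule ennreal_plus_mult[symmetric]) (use E in auto)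
  finally show "(\<integral>\<^sup>+y. ennreal ((dist z y)\<^sup>2) \<partial>\<pi>) \<le> ennreal (2 * (norm z)\<^sup>2 + 2 * E)" .
qed (use E in simp)

end

section \<open>Slow modes\<close>

text \<open>
  The characteristic polynomial is \<open>s > 0\<close> at 1. If it is not positive at \<open>u\<close>, it has a real root
  between \<open>u\<close> and 1. If it is positive there, either the product \<open>\<beta>\<close> of the roots is at least
  \<open>u\<^sup>2\<close>, or rearranging the positivity gives the last alternative: the friction \<open>1 - \<beta>\<close> is small
  compared to \<open>s / (1 - u)\<close>.
\<close>

lemma spectral_trichotomy:
  fixes \<beta> s u :: real
  assumes b: "0 < \<beta>" "\<beta> < 1" and s: "0 < s" and u: "0 < u" "u < 1"
  shows "u\<^sup>2 \<le> \<beta> \<or> (\<exists>l. u \<le> l \<and> l\<^sup>2 - (1 + \<beta> - s) * l + \<beta> = 0) \<or> (1 - u) * (1 - \<beta>) \<le> 2 * s"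
proof (cases "u\<^sup>2 - (1 + \<beta> - s) * u + \<beta> \<le> 0")
  case True
  have "\<exists>l. u \<le> l \<and> l \<le> 1 \<and> l\<^sup>2 - (1 + \<beta> - s) * l + \<beta> = 0"
    by (rule IVT') (use True s u in \<open>auto intro!: continuous_intros\<close>)
  then show ?thesis by blast
next
  case False
  define \<eta> where "\<eta> = 1 - u"
  have e: "0 < \<eta>" "\<eta> < 1" using u by (auto simp: \<eta>_def)
  have A: "\<eta> * (1 - \<beta>) - \<eta>\<^sup>2 < s * (1 - \<eta>)" using False by (simp add: \<eta>_def power2_eq_square algebra_simps)
  have "\<eta> * (1 - \<beta>) \<le> 2 * s" if "\<beta> < u\<^sup>2"
  proof -
    have B: "\<eta> * (2 - \<eta>) \<le> 1 - \<beta>" using that by (simp add: \<eta>_def power2_eq_square algebra_simps)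
    have "2 * \<eta> \<le> \<eta> * (2 - \<eta>) * (1 + \<eta>)"
    proof -
      have "0 \<le> \<eta> * (\<eta> * (1 - \<eta>))" using e by simp
      then show ?thesis by (simp add: algebra_simps)
    qed
    also have "\<dots> \<le> (1 - \<beta>) * (1 + \<eta>)" using B e by (intro mult_right_mono) auto
    finally have "\<eta> * (2 * \<eta>) \<le> \<eta> * ((1 - \<beta>) * (1 + \<eta>))" using e by (intro mult_left_mono) auto
    then have "(\<eta> * (1 - \<beta>)) * (1 - \<eta>) \<le> (2 * s) * (1 - \<eta>)" using A by (simp add: power2_eq_square algebra_simps)
    then show ?thesis using e by simp
  qed
  then show ?thesis by (auto simp: \<eta>_def not_le)
qed

text \<open>
  If \<open>u\<^sup>2 \<le> \<beta>\<close>, the symplectic form of the \<open>n\<close>-th iterates of \<open>z1\<close> and \<open>z2\<close> is \<open>\<beta>\<^sup>n\<close>, so they cannot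
  both be short, whether the roots are real or complex. Otherwise there is a real root \<open>l \<ge> u\<close> with
  an eigenvector.
\<close>

lemma slow_vector:
  fixes \<gamma> h u :: real and s :: splitting
  defines "M \<equiv> word_map (\<lambda>x::real^2. x) \<gamma> (splitting_word s h)"
  defines "\<beta> \<equiv> damping h \<gamma>" and "T \<equiv> 1 + damping h \<gamma> - stability_param s h \<gamma>"
  assumes u: "0 < u" and slow: "u\<^sup>2 \<le> \<beta> \<or> (\<exists>l. u \<le> l \<and> l\<^sup>2 - T * l + \<beta> = 0)"
  shows "\<exists>z. norm z \<le> 1 \<and> u ^ n / 2 \<le> norm ((M ^^ n) z)"
proof -
  have lin: "linear M" unfolding M_def by (rule linear_word_map)
  have CH: "M (M z) = T *\<^sub>R M z - \<beta> *\<^sub>R z" for z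
    unfolding M_def T_def \<beta>_def by (rule splitting_word_trace)
  have sy: "symp (M z) (M z') = \<beta> * symp z z'" for z z'
    unfolding M_def \<beta>_def symp_word_map splitting_word_factor ..
  have b0: "0 < \<beta>" by (simp add: \<beta>_def damping_def)
  define z1 z2 :: "2 phase" where "z1 = (axis 1 1, 0)" and "z2 = (0, axis 1 1)"
  have n1: "norm z1 = 1" "norm z2 = 1" by (simp_all add: z1_def z2_def norm_Pair norm_axis_1)
  have s12: "symp z1 z2 = 1" by (simp add: symp_def z1_def z2_def inner_axis_axis)
  show ?thesis
  proof (cases "u\<^sup>2 \<le> \<beta>")
    case True
    have "symp ((M ^^ n) z) ((M ^^ n) z') = \<beta> ^ n * symp z z'" for z z'
      by (induction n) (simp_all add: sy)
    then have "\<beta> ^ n = symp ((M ^^ n) z1) ((M ^^ n) z2)" by (simp add: s12)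
    also have "\<dots> \<le> 2 * norm ((M ^^ n) z1) * norm ((M ^^ n) z2)" using symp_le abs_le_D1 by blast
    finally have le: "\<beta> ^ n \<le> 2 * norm ((M ^^ n) z1) * norm ((M ^^ n) z2)" .
    show ?thesis
    proof (rule ccontr)
      assume "\<not> ?thesis"
      then have short: "\<not> (norm z \<le> 1 \<and> u ^ n / 2 \<le> norm ((M ^^ n) z))" for z by blast
      have "norm ((M ^^ n) z1) < u ^ n / 2" "norm ((M ^^ n) z2) < u ^ n / 2"
        using short[of z1] short[of z2] n1 by linarith+
      then have "norm ((M ^^ n) z1) * norm ((M ^^ n) z2) \<le> (u ^ n / 2) * (u ^ n / 2)"
        using u by (intro mult_mono) auto
      then have "\<beta> ^ n \<le> (u ^ n * u ^ n) / 2" using le by simp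
      moreover have "u ^ n * u ^ n = (u\<^sup>2) ^ n" by (simp add: power2_eq_square power_mult_distrib)
      moreover have "(u\<^sup>2) ^ n \<le> \<beta> ^ n" using True u by (intro power_mono) auto
      ultimately show False using zero_less_power[OF b0, of n] by linarith
    qed
  next
    case False
    then obtain l where l: "u \<le> l" "l\<^sup>2 - T * l + \<beta> = 0" using slow by blast
    define l' where "l' = T - l"
    have Tl: "T = l + l'" by (simp add: l'_def)
    have bl: "\<beta> = l * l'" using l(2) by (simp add: l'_def power2_eq_square algebra_simps)
    have eig: "\<exists>z. norm z = 1 \<and> M z = l *\<^sub>R z"
    proof -
      \<comment> \<open>By Cayley-Hamilton, \<open>M - l'\<close> maps into the eigenspace of \<open>l\<close>; if it vanishes, comparing
         the factors of the symplectic form shows \<open>l' = l\<close>.\<close>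
      have E: "M (M z - l' *\<^sub>R z) = l *\<^sub>R (M z - l' *\<^sub>R z)" for z
        by (simp add: linear_diff[OF lin] linear_scale[OF lin] CH bl Tl algebra_simps)
      have unit: ?thesis if "M z - l' *\<^sub>R z \<noteq> 0" for z
      proof -
        let ?w = "M z - l' *\<^sub>R z"
        show ?thesis
          using that E[of z] by (intro exI[of _ "?w /\<^sub>R norm ?w"]) (simp add: linear_scale[OF lin])
      qed
      show ?thesis
      proof (cases "M z1 - l' *\<^sub>R z1 = 0 \<and> M z2 - l' *\<^sub>R z2 = 0")
        case True
        then have m: "M z1 = l' *\<^sub>R z1" "M z2 = l' *\<^sub>R z2" by auto
        have "symp (l' *\<^sub>R z1) (l' *\<^sub>R z2) = l' * l' * symp z1 z2" by (simp add: symp_def algebra_simps)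
        then have "\<beta> = l' * l'" using sy[of z1 z2] m s12 by simp
        then have "l' = l" using bl b0 by auto
        then show ?thesis using m n1 by (intro exI[of _ z1]) simp
      next
        case False then show ?thesis using unit by blast
      qed
    qed
    then obtain z where z: "norm z = 1" "M z = l *\<^sub>R z" by blast
    have "(M ^^ n) z = l ^ n *\<^sub>R z"
      by (induction n) (simp_all add: linear_scale[OF lin] z mult.commute)
    then have "norm ((M ^^ n) z) = l ^ n" using z l u by simp
    moreover have "u ^ n \<le> l ^ n" using l u by (intro power_mono) auto
    moreover have "0 \<le> u ^ n" using u by simp
    ultimately show ?thesis using z(1) by (intro exI[of _ z]) simp
  qed
qed

section \<open>The chain driven by a smoothed projection\<close>

text \<open>
  The order of the quantifiers matters. The contraction and the noise level \<open>e\<close> are fixed before the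
  set \<open>P\<close>, so that they stay the same when \<open>P\<close> is enlarged; only the distance to the linear chain grows,
  in proportion to the size of \<open>P\<close>.
\<close>

lemma splitting_chain:
  fixes h \<gamma> \<kappa> :: real and s :: splitting
  assumes h: "0 < h" and g: "0 < \<gamma>" and k: "1 < \<kappa>"
    and stab: "0 < stability_param s h \<gamma>" "stability_param s h \<gamma> < 2 * (1 + damping h \<gamma>) / \<kappa>"
  shows "\<exists>N c \<rho> e k. 0 \<le> k \<and> (\<forall>P RP. convex P \<longrightarrow> compact P \<longrightarrow> P \<noteq> {} \<longrightarrow> (\<forall>q\<in>P. norm q \<le> RP) \<longrightarrow>
    smoothed_projection.potential P \<kappa> \<in> potentials \<kappa> \<and>
    contracting_chain (word_map (\<lambda>x::real^2. x) \<gamma> (splitting_word s h)) N c \<rho>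
      (splitting_kernel s (smoothed_projection.potential P \<kappa>) h \<gamma>)
      (word_map (heavy_ball_force \<kappa> P) \<gamma> (splitting_word s h)) e (k * RP) \<and>
    phase_spread (\<lambda>z. splitting_kernel s (smoothed_projection.potential P \<kappa>) h \<gamma> z \<bind> splitting_kernel s (smoothed_projection.potential P \<kappa>) h \<gamma>))"
proof -
  let ?w = "splitting_word s h" and ?b = "damping h \<gamma>" and ?s = "stability_param s h \<gamma>"
  let ?M = "word_map (\<lambda>x::real^2. x) \<gamma> ?w"
  have b: "0 < ?b" "?b < 1" using h g by (simp_all add: damping_def)
  have sk: "?s * \<kappa> < 2 * (1 + ?b)" using stab(2) k by (simp add: pos_less_divide_eq)
  have s2: "?s < 2 * (1 + ?b)"
  proof -
    have "?s * 1 \<le> ?s * \<kappa>" using stab k by (intro mult_left_mono) auto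
    then show ?thesis using sk by simp
  qed
  have T: "\<bar>1 + ?b - ?s\<bar> < 1 + ?b"
  proof -
    have "1 + ?b - ?s < 1 + ?b" "- (1 + ?b - ?s) < 1 + ?b" using s2 stab(1) by (simp_all add: algebra_simps)
    then show ?thesis by (simp only: abs_less_iff)
  qed
  obtain N c \<rho> where N: "0 \<le> \<rho>" "\<rho> < 1" "\<And>x y. N (x + y) \<le> N x + N y" "\<And>a x. N (a *\<^sub>R x) = \<bar>a\<bar> * N x"
    "\<And>z. norm z \<le> N z" "\<And>z. N z \<le> c * norm z" "\<And>z. N (?M z) \<le> \<rho> * N z"
    using adapted_norm[OF linear_word_map splitting_word_trace b T] by metis
  have CN: "contracting_norm ?M N c \<rho>"
    by (rule contracting_norm.intro) (use N linear_word_map in auto)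
  define g1 where "g1 = (\<integral>\<xi>. norm \<xi> \<partial>(std_gaussian :: (real^2) measure))"
  obtain e where e: "0 \<le> e" "\<And>(U::real^2 \<Rightarrow> real) \<Gamma>. gradient U \<in> borel_measurable borel \<Longrightarrow>
     (\<forall>x y. norm (\<Gamma> x - \<Gamma> y) \<le> \<kappa> * norm (x - y)) \<Longrightarrow> (\<forall>x. norm (gradient U x - \<Gamma> x) \<le> (\<kappa> - 1) * g1) \<Longrightarrow>
     l2_close (word_kernel U \<gamma> ?w) (word_map \<Gamma> \<gamma> ?w) e"
    using word_kernel_close[of \<kappa> "(\<kappa> - 1) * g1" \<gamma> ?w] by blast
  obtain k0 where k0: "0 \<le> k0" "\<And>(\<Gamma>::real^2 \<Rightarrow> real^2) B z. (\<forall>x. norm (\<Gamma> x - x) \<le> B) \<Longrightarrow>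
     norm (word_map \<Gamma> \<gamma> ?w z - ?M z) \<le> k0 * B"
    using word_map_near_linear[of \<gamma> ?w] by blast
  show ?thesis
  proof (rule exI[of _ N], rule exI[of _ c], rule exI[of _ \<rho>], rule exI[of _ e], rule exI[of _ "k0 * (\<kappa> - 1)"], intro conjI allI impI)
    show "0 \<le> k0 * (\<kappa> - 1)" using k0 k by simp
    fix P :: "(real^2) set" and RP :: real
    assume P: "convex P" "compact P" "P \<noteq> {}" and RP: "\<forall>q\<in>P. norm q \<le> RP"
    interpret SP: smoothed_projection P by unfold_locales (use P in auto)
    let ?U = "SP.potential \<kappa>" and ?F = "heavy_ball_force \<kappa> P"
    have RP0: "0 \<le> RP" using P(3) RP norm_ge_zero order_trans by blast
    interpret LG: lipschitz_gradient ?U \<kappa>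
      by unfold_locales (use k SP.force_lipschitz SP.force_differentiable in \<open>auto simp: SP.gradient_potential\<close>)
    show "?U \<in> potentials \<kappa>" using k by (intro SP.potential_in_potentials) simp
    have Q: "splitting_kernel s ?U h \<gamma> = word_kernel ?U \<gamma> ?w" by (rule splitting_kernel_eq_word_kernel)
    have OABAO: "h\<^sup>2 * \<kappa> < 4" if "s = OABAO"
    proof -
      have "(h\<^sup>2 * \<kappa>) * (1 + ?b) < 4 * (1 + ?b)" using sk that by (simp add: algebra_simps)
      then show ?thesis by (rule mult_right_less_imp_less) (use b in simp)
    qed
    have "(\<lambda>z. word_kernel ?U \<gamma> ?w z \<bind> word_kernel ?U \<gamma> ?w) = word_kernel ?U \<gamma> (?w @ ?w)"
      using word_kernel_append[OF LG.gradient_measurable] by (simp add: fun_eq_iff)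
    then show "phase_spread (\<lambda>z. splitting_kernel s ?U h \<gamma> z \<bind> splitting_kernel s ?U h \<gamma>)"
      unfolding Q using LG.splitting_phase_spread[OF h g OABAO] by simp
    have lipF: "norm (?F x - ?F y) \<le> \<kappa> * norm (x - y)" for x y
    proof -
      have "?F x - ?F y = (x - y) + (\<kappa> - 1) *\<^sub>R (closest_point P x - closest_point P y)"
        by (simp add: heavy_ball_force_def algebra_simps)
      also have "norm \<dots> \<le> norm (x - y) + (\<kappa> - 1) * norm (closest_point P x - closest_point P y)"
        using k by (intro order_trans[OF norm_triangle_ineq]) simp
      also have "\<dots> \<le> norm (x - y) + (\<kappa> - 1) * norm (x - y)"
        using k by (intro add_mono mult_left_mono SP.proj_lipschitz) auto
      finally show ?thesis by (simp add: algebra_simps)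
    qed
    have close: "norm (gradient ?U x - ?F x) \<le> (\<kappa> - 1) * g1" for x
    proof -
      have "gradient ?U x - ?F x = (\<kappa> - 1) *\<^sub>R (SP.smooth_proj x - closest_point P x)"
        by (simp add: SP.gradient_potential SP.force_def heavy_ball_force_def algebra_simps)
      then show ?thesis using SP.smooth_proj_close[of x] k by (simp add: g1_def mult_left_mono)
    qed
    have nearF: "norm (?F x - x) \<le> (\<kappa> - 1) * RP" for x
      using RP SP.proj_in[of x] k by (simp add: heavy_ball_force_def mult_left_mono)
    obtain kl where kl: "0 \<le> kl" "\<And>z z'. norm (word_map ?F \<gamma> ?w z - word_map ?F \<gamma> ?w z') \<le> kl * norm (z - z')"
      using word_map_lipschitz[of \<kappa> \<gamma> ?w] lipF by blast
    have meas: "word_map ?F \<gamma> ?w \<in> borel \<rightarrow>\<^sub>M borel"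
      by (intro borel_measurable_continuous_onI lipschitz_on_continuous_on[where L=kl] lipschitz_onI)
         (use kl in \<open>auto simp only: dist_norm\<close>)
    show "contracting_chain ?M N c \<rho> (splitting_kernel s ?U h \<gamma>) (word_map ?F \<gamma> ?w) e (k0 * (\<kappa> - 1) * RP)"
      unfolding Q
    proof (rule contracting_chain.intro[OF CN contracting_chain_axioms.intro])
      show "word_kernel ?U \<gamma> ?w \<in> borel \<rightarrow>\<^sub>M prob_algebra borel" by (rule word_kernel_prob[OF LG.gradient_measurable])
      show "l2_close (word_kernel ?U \<gamma> ?w) (word_map ?F \<gamma> ?w) e"
        using e(2)[OF LG.gradient_measurable] lipF close by blast
      show "norm (word_map ?F \<gamma> ?w z - ?M z) \<le> k0 * (\<kappa> - 1) * RP" for z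
        using k0(2)[of ?F "(\<kappa> - 1) * RP" z] nearF by (simp add: mult.assoc)
      show "0 \<le> k0 * (\<kappa> - 1) * RP" using k0 k RP0 by simp
    qed (use e meas in auto)
  qed
qed

section \<open>Choice of scale and time\<close>

text \<open>
  The time is chosen as \<open>n = (b + 1) / q * ln R\<close>, up to rounding. Then \<open>exp (- q * n)\<close> is about \<open>1 / R\<^sup>b\<^sup>+\<^sup>1\<close>
  and beats the polynomial growth of the prefactor, the failure probability \<open>n / R\<^sup>2\<close> is small, and at the
  rate \<open>q / (2 * (b + 1))\<close> a distance \<open>R\<close> has only shrunk to about \<open>sqrt R\<close>.
\<close>

lemma scale_choice:
  fixes X C2 b q E1 E2 :: real
  assumes X: "0 \<le> X" "0 \<le> C2" and b: "0 \<le> b" and q: "0 < q" and E: "0 \<le> E1" "0 \<le> E2"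
  shows "\<exists>R n. 1 \<le> R \<and> X * (1 + C2 * R) powr b * exp (- (q * real n)) < 1 / 4 \<and>
    real (Suc n) * (E1 / R\<^sup>2) \<le> 1 / 4 \<and> E2 \<le> R * exp (- (q / (2 * (b + 1))) * real n)"
proof -
  define A1 where "A1 = 8 * (X * (1 + C2) powr b) + 1"
  define A2 where "A2 = 4 * ((b + 1) / q + 2) * E1"
  define A3 where "A3 = E2 * exp (q / (2 * (b + 1)))"
  define R where "R = A1 + A2 + A3\<^sup>2"
  have A: "1 \<le> A1" "0 \<le> A2" "0 \<le> A3" "0 \<le> A3\<^sup>2" using X b q E by (simp_all add: A1_def A2_def A3_def)
  have R: "1 \<le> R" "A1 \<le> R" "A2 \<le> R" "A3\<^sup>2 \<le> R" using A unfolding R_def by linarith+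
  define n where "n = nat \<lceil>(b + 1) / q * ln R\<rceil>"
  have lnR: "0 \<le> ln R" using R by simp
  have n: "(b + 1) / q * ln R \<le> real n" "real n \<le> (b + 1) / q * ln R + 1"
  proof -
    have "0 \<le> (b + 1) / q * ln R" using b q lnR by simp
    then show "(b + 1) / q * ln R \<le> real n" "real n \<le> (b + 1) / q * ln R + 1"
      unfolding n_def by linarith+
  qed
  have ex: "exp (- (q * real n)) \<le> R powr (- (b + 1))"
  proof -
    have "(b + 1) * ln R \<le> q * real n" using n(1) q by (simp add: field_simps)
    then have "- (q * real n) \<le> - (b + 1) * ln R" by linarith
    then show ?thesis using R by (simp add: powr_def)
  qed
  have "X * (1 + C2 * R) powr b * exp (- (q * real n)) \<le> X * ((1 + C2) powr b * R powr b) * R powr (- (b + 1))"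
  proof (intro mult_mono mult_left_mono ex)
    have "1 + C2 * R \<le> (1 + C2) * R" using R X by (simp add: algebra_simps)
    then have "(1 + C2 * R) powr b \<le> ((1 + C2) * R) powr b" using R X b by (intro powr_mono2) auto
    then show "(1 + C2 * R) powr b \<le> (1 + C2) powr b * R powr b" using R X by (simp add: powr_mult)
  qed (use X in auto)
  also have "\<dots> = (X * (1 + C2) powr b) * (R powr b * R powr (- (b + 1)))" by simp
  also have "R powr b * R powr (- (b + 1)) = 1 / R"
    using R by (simp add: powr_add[symmetric] powr_minus_divide)
  also have "(X * (1 + C2) powr b) * (1 / R) < 1 / 4"
  proof -
    have "4 * (X * (1 + C2) powr b) < A1" using X by (simp add: A1_def add_strict_increasing2)
    then have "4 * (X * (1 + C2) powr b) < R" using R by linarith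
    then show ?thesis using R by (simp add: field_simps)
  qed
  finally have 1: "X * (1 + C2 * R) powr b * exp (- (q * real n)) < 1 / 4" .
  have 2: "real (Suc n) * (E1 / R\<^sup>2) \<le> 1 / 4"
  proof -
    have "ln R \<le> R" using R ln_le_minus_one[of R] by linarith
    then have "(b + 1) / q * ln R \<le> (b + 1) / q * R" using b q by (intro mult_left_mono) auto
    then have "real (Suc n) \<le> (b + 1) / q * R + 2 * R" using n(2) R by simp
    then have "real (Suc n) \<le> ((b + 1) / q + 2) * R" by (simp add: distrib_right)
    then have "real (Suc n) * E1 \<le> ((b + 1) / q + 2) * R * E1" using E(1) by (rule mult_right_mono)
    also have "\<dots> = A2 * R / 4" by (simp add: A2_def)
    also have "\<dots> \<le> R * R / 4" using R by (simp add: mult_right_mono)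
    finally show ?thesis using R by (simp add: field_simps power2_eq_square)
  qed
  have 3: "E2 \<le> R * exp (- (q / (2 * (b + 1))) * real n)"
  proof -
    have "q / (2 * (b + 1)) * real n \<le> q / (2 * (b + 1)) * ((b + 1) / q * ln R + 1)"
      using n(2) b q by (intro mult_left_mono) auto
    also have "\<dots> = ln R / 2 + q / (2 * (b + 1))"
    proof -
      have "q / (2 * B) * (B / q * L + 1) = L / 2 + q / (2 * B)" if "0 < B" for B L :: real
        using that q by (simp add: distrib_left)
      from this[of "b + 1" "ln R"] show ?thesis using b by simp
    qed
    finally have "exp (- (ln R / 2 + q / (2 * (b + 1)))) \<le> exp (- (q / (2 * (b + 1))) * real n)" by simp
    then have "R * exp (- (ln R / 2 + q / (2 * (b + 1)))) \<le> R * exp (- (q / (2 * (b + 1))) * real n)"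
      using R by (intro mult_left_mono) auto
    moreover have "R * exp (- (ln R / 2 + q / (2 * (b + 1)))) = exp (ln R / 2) * exp (- (q / (2 * (b + 1))))"
    proof -
      have "R = exp (ln R)" using R by simp
      then have "R * exp (- (ln R / 2 + q / (2 * (b + 1)))) = exp (ln R + - (ln R / 2 + q / (2 * (b + 1))))"
        by (metis exp_add)
      also have "ln R + - (ln R / 2 + q / (2 * (b + 1))) = ln R / 2 + - (q / (2 * (b + 1)))" by simp
      finally show ?thesis by (simp only: exp_add)
    qed
    moreover have "A3 \<le> exp (ln R / 2)"
    proof (rule power2_le_imp_le)
      have "(exp (ln R / 2))\<^sup>2 = R" using R by (simp flip: exp_double)
      then show "A3\<^sup>2 \<le> (exp (ln R / 2))\<^sup>2" using R by simp
    qed simp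
    then have "A3 * exp (- (q / (2 * (b + 1)))) \<le> exp (ln R / 2) * exp (- (q / (2 * (b + 1))))"
      by (rule mult_right_mono) simp
    moreover have "A3 * exp (- (q / (2 * (b + 1)))) = E2" by (simp add: A3_def mult.assoc flip: exp_add)
    ultimately show ?thesis by linarith
  qed
  show ?thesis using R(1) 1 2 3 by blast
qed

lemma bound_lt_tv:
  fixes W :: ennreal
  assumes W: "W \<le> ennreal d" "0 \<le> d" and b: "0 \<le> b" and X: "0 \<le> X" "0 \<le> Y"
    and small: "X * (1 + d) powr b * Y < 1 / 4" and tv: "1 / 4 \<le> tv"
  shows "ennreal X * (1 + W) powr\<^sub>\<infinity> b * ennreal Y < ennreal tv"
proof -
  have "1 + W \<le> ennreal 1 + ennreal d" using W by simp
  also have "\<dots> = ennreal (1 + d)" using W by (intro ennreal_plus[symmetric]) auto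
  finally have "(1 + W) powr\<^sub>\<infinity> b \<le> ennreal ((1 + d) powr b)" using W b by (intro ennreal_powr_le) auto
  then have "ennreal X * (1 + W) powr\<^sub>\<infinity> b * ennreal Y \<le> ennreal X * ennreal ((1 + d) powr b) * ennreal Y"
    by (intro mult_mono) auto
  also have "\<dots> = ennreal (X * (1 + d) powr b * Y)" using X by (simp add: ennreal_mult)
  also have "\<dots> < ennreal tv" using small tv X by (intro ennreal_lessI) auto
  finally show ?thesis .
qed

section \<open>Lower bounds at a fixed condition number\<close>

text \<open>
  Here \<open>P = {0}\<close>, so that the potential is \<open>(norm x)\<^sup>2 / 2\<close> and the chain is a linear contraction plus
  Gaussian noise. Started at distance \<open>R\<close> along the slow mode, it remains far from the bulk of its
  invariant law for a time of order \<open>ln R\<close>.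
\<close>

lemma slow_decay_at_condition_number:
  fixes h \<gamma> \<kappa> X b q :: real and s :: splitting
  assumes h: "0 < h" and g: "0 < \<gamma>" and k: "1 < \<kappa>"
    and stab: "0 < stability_param s h \<gamma>" "stability_param s h \<gamma> < 2 * (1 + damping h \<gamma>) / \<kappa>"
    and X: "0 \<le> X" and b: "0 \<le> b" and q: "0 < q"
    and slow: "(exp (- (q / (2 * (b + 1)))))\<^sup>2 \<le> damping h \<gamma> \<or>
      (\<exists>l. exp (- (q / (2 * (b + 1)))) \<le> l \<and> l\<^sup>2 - (1 + damping h \<gamma> - stability_param s h \<gamma>) * l + damping h \<gamma> = 0)"
  shows "\<exists>U\<in>(potentials \<kappa> :: (real^2 \<Rightarrow> real) set). \<exists>\<pi>. unique_invariant_law (splitting_kernel s U h \<gamma>) \<pi> \<and>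
    (\<exists>z n. ennreal X * (1 + W2 (return borel z) \<pi>) powr\<^sub>\<infinity> b * ennreal (exp (- (q * real n)))
      < ennreal (tv_dist (kernel_iterate (splitting_kernel s U h \<gamma>) n (return borel z)) \<pi>))"
proof -
  let ?u = "exp (- (q / (2 * (b + 1))))" and ?M = "word_map (\<lambda>x::real^2. x) \<gamma> (splitting_word s h)"
  obtain N c \<rho> e k where chain: "\<And>P RP. convex P \<Longrightarrow> compact P \<Longrightarrow> P \<noteq> {} \<Longrightarrow> \<forall>q\<in>P. norm q \<le> RP \<Longrightarrow>
    smoothed_projection.potential P \<kappa> \<in> potentials \<kappa> \<and>
    contracting_chain ?M N c \<rho>
      (splitting_kernel s (smoothed_projection.potential P \<kappa>) h \<gamma>)
      (word_map (heavy_ball_force \<kappa> P) \<gamma> (splitting_word s h)) e (k * RP) \<and>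
    phase_spread (\<lambda>z. splitting_kernel s (smoothed_projection.potential P \<kappa>) h \<gamma> z \<bind> splitting_kernel s (smoothed_projection.potential P \<kappa>) h \<gamma>)"
    using splitting_chain[OF h g k stab] by metis
  define P :: "(real^2) set" where "P = {0}"
  define U where "U = smoothed_projection.potential P \<kappa>"
  define Q where "Q = splitting_kernel s U h \<gamma>"
  define D where "D = word_map (heavy_ball_force \<kappa> P) \<gamma> (splitting_word s h)"
  have PP: "convex P" "compact P" "P \<noteq> {}" "\<forall>q\<in>P. norm q \<le> 0" by (simp_all add: P_def)
  note ch = chain[OF PP, folded U_def, folded Q_def D_def]
  interpret contracting_chain ?M N c \<rho> Q D e "k * 0" using ch by blast
  have U: "U \<in> potentials \<kappa>" using ch by blast
  obtain \<pi> where \<pi>: "unique_invariant_law Q \<pi>"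
    and mom: "(\<integral>\<^sup>+y. ennreal ((N y)\<^sup>2) \<partial>\<pi>) \<le> ennreal (drift_const / (1 - \<rho>))"
    using unique_invariant_law_of_phase_spread ch by blast
  have pi: "prob_space \<pi>" "sets \<pi> = sets borel"
    using \<pi> unfolding unique_invariant_law_def invariant_law_def by blast+
  have D: "D z = ?M z" for z using near[of z] by simp
  let ?E = "drift_const / (1 - \<rho>)"
  have E: "0 \<le> ?E" using drift_const rho by simp
  define r where "r = sqrt (4 * ?E) + 1"
  have r: "0 < r" "4 * ?E \<le> r\<^sup>2"
  proof -
    have s0: "0 \<le> sqrt (4 * ?E)" using E by simp
    then show "0 < r" unfolding r_def by linarith
    have "4 * ?E = (sqrt (4 * ?E))\<^sup>2" using E by simp
    also have "\<dots> \<le> r\<^sup>2" using s0 by (intro power_mono) (simp_all add: r_def)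
    finally show "4 * ?E \<le> r\<^sup>2" .
  qed
  define C2 where "C2 = sqrt (2 + 2 * ?E)"
  have C2: "0 \<le> C2" using E by (simp add: C2_def)
  have r4: "0 \<le> 4 * r + 1" using r by simp
  obtain R n where R: "1 \<le> R" and sm: "X * (1 + C2 * R) powr b * exp (- (q * real n)) < 1 / 4"
    and far: "4 * r + 1 \<le> R * exp (- (q / (2 * (b + 1))) * real n)"
    using scale_choice[OF X C2 b q order_refl r4] by blast
  have un: "exp (- (q / (2 * (b + 1))) * real n) = ?u ^ n" by (simp add: exp_of_nat_mult mult.commute flip: exp_of_nat_mult)
  obtain z0 where z0: "norm z0 \<le> 1" "?u ^ n / 2 \<le> norm ((?M ^^ n) z0)"
    using slow_vector[OF _ slow] by (meson exp_gt_zero)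
  define z where "z = R *\<^sub>R z0"
  have "R * (?u ^ n / 2) \<le> R * norm ((?M ^^ n) z0)" using z0 R by (intro mult_left_mono) auto
  also have "\<dots> = norm ((?M ^^ n) z)" using R by (simp add: z_def linear_scale[OF M_pow])
  finally have "2 * r < norm ((?M ^^ n) z)" using far unfolding un by simp
  then have tv: "1 / 4 \<le> tv_dist (it n z) \<pi>" by (rule tv_slow_decay[OF D pi mom r])
  have nz: "norm z \<le> R" using z0 R by (simp add: z_def mult_left_le)
  have "sqrt (2 * (norm z)\<^sup>2 + 2 * ?E) \<le> sqrt ((2 + 2 * ?E) * R\<^sup>2)"
  proof (rule real_sqrt_le_mono)
    have "(norm z)\<^sup>2 \<le> R\<^sup>2" using nz by (intro power_mono) auto
    moreover have "1 \<le> R\<^sup>2" using R by (simp add: one_le_power)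
    then have "?E * 1 \<le> ?E * R\<^sup>2" using E by (intro mult_left_mono)
    ultimately show "2 * (norm z)\<^sup>2 + 2 * ?E \<le> (2 + 2 * ?E) * R\<^sup>2" by (simp only: distrib_right)
  qed
  also have "\<dots> = C2 * R" using R by (simp add: C2_def real_sqrt_mult)
  finally have "W2 (return borel z) \<pi> \<le> ennreal (C2 * R)"
    using W2_le[OF pi mom E, of z] by (meson ennreal_leI order_trans)
  from bound_lt_tv[OF this _ b X _ sm tv] C2 R
  have "ennreal X * (1 + W2 (return borel z) \<pi>) powr\<^sub>\<infinity> b * ennreal (exp (- (q * real n))) < ennreal (tv_dist (it n z) \<pi>)" by simp
  then show ?thesis using U \<pi> unfolding Q_def by blast
qed

text \<open>
  The polygon and its cycle are blown up by the factor \<open>R\<close>. In units of \<open>R\<close> the tube about the cycle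
  keeps its width while noise and smoothing shrink, and both the starting point and the standard
  deviation of the invariant law are at most of order \<open>R\<close>.
\<close>

lemma attracting_cycle_at_condition_number:
  fixes h \<gamma> \<kappa> X b q :: real and s :: splitting
  assumes h: "0 < h" and g: "0 < \<gamma>" and k17: "17 \<le> \<kappa>"
    and stab: "0 < stability_param s h \<gamma>" "stability_param s h \<gamma> < 2 * (1 + damping h \<gamma>) / \<kappa>"
    and X: "0 \<le> X" and b: "0 \<le> b" and q: "0 < q"
    and fric: "64 * (1 - damping h \<gamma>) \<le> stability_param s h \<gamma> * \<kappa>"
  shows "\<exists>U\<in>(potentials \<kappa> :: (real^2 \<Rightarrow> real) set). \<exists>\<pi>. unique_invariant_law (splitting_kernel s U h \<gamma>) \<pi> \<and>
    (\<exists>z n. ennreal X * (1 + W2 (return borel z) \<pi>) powr\<^sub>\<infinity> b * ennreal (exp (- (q * real n)))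
      < ennreal (tv_dist (kernel_iterate (splitting_kernel s U h \<gamma>) n (return borel z)) \<pi>))"
proof -
  let ?w = "splitting_word s h" and ?\<beta> = "damping h \<gamma>" and ?s = "stability_param s h \<gamma>"
  let ?M = "word_map (\<lambda>x::real^2. x) \<gamma> ?w"
  have k: "1 < \<kappa>" using k17 by simp
  obtain N c \<rho> e k where k0: "0 \<le> k" and chain: "\<And>P RP. convex P \<Longrightarrow> compact P \<Longrightarrow> P \<noteq> {} \<Longrightarrow> \<forall>q\<in>P. norm q \<le> RP \<Longrightarrow>
    smoothed_projection.potential P \<kappa> \<in> potentials \<kappa> \<and>
    contracting_chain ?M N c \<rho>
      (splitting_kernel s (smoothed_projection.potential P \<kappa>) h \<gamma>)
      (word_map (heavy_ball_force \<kappa> P) \<gamma> ?w) e (k * RP) \<and>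
    phase_spread (\<lambda>z. splitting_kernel s (smoothed_projection.potential P \<kappa>) h \<gamma> z \<bind> splitting_kernel s (smoothed_projection.potential P \<kappa>) h \<gamma>)"
    using splitting_chain[OF h g k stab] by metis
  have \<beta>: "0 < ?\<beta>" "?\<beta> < 1" using h g by (simp_all add: damping_def)
  have sk: "?s * \<kappa> < 2 * (1 + ?\<beta>)" using stab(2) k by (simp add: pos_less_divide_eq)
  obtain P0 :: "(real^2) set" and p :: "nat \<Rightarrow> real^2" and K :: nat where P0: "convex P0" "compact P0" "P0 \<noteq> {}" and K: "0 < K"
    and rec: "\<And>t. p (t + 2) = (1 + ?\<beta>) *\<^sub>R p (t + 1) - ?\<beta> *\<^sub>R p t - ?s *\<^sub>R heavy_ball_force \<kappa> P0 (p (t + 1))"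
    and slope: "\<And>t. unit_slope_at (heavy_ball_force \<kappa> P0) (p t)" and neq: "\<And>t. p (t + 1) \<noteq> p t" and per: "\<And>t. p (t + K) = p t"
    using heavy_ball_cycle_exists[OF \<beta> stab(1) sk k17 fric] by metis
  define D0 where "D0 = word_map (heavy_ball_force \<kappa> P0) \<gamma> ?w"
  obtain Z where Z: "\<And>t. D0 (Z t) = Z (t + 1)" and reg: "\<And>t. regular_orbit (heavy_ball_force \<kappa> P0) \<gamma> ?w (Z t)"
    and Zneq: "\<And>t. Z (t + 1) \<noteq> Z t" and Zper: "\<And>t. Z (t + K) = Z t"
    using splitting_phase_cycle[OF h rec slope neq per] unfolding D0_def by metis
  have "\<exists>r>0. \<forall>t. (\<forall>z. norm (z - Z t) \<le> r \<longrightarrow> D0 z = D0 (Z t) + ?M (z - Z t)) \<and> 2 * r < norm (Z (t + 1) - Z t)"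
  proof (rule periodic_uniform[where K=K])
    fix t
    obtain r0 where r0: "r0 > 0" "\<And>z. norm (z - Z t) \<le> r0 \<Longrightarrow> D0 z = D0 (Z t) + ?M (z - Z t)"
      using word_map_locally_affine[OF reg[of t]] unfolding D0_def by blast
    have pos: "0 < norm (Z (t + 1) - Z t)" using Zneq[of t] by simp
    then have "0 < min r0 (norm (Z (t + 1) - Z t) / 3)" using r0(1) by simp
    moreover have "2 * min r0 (norm (Z (t + 1) - Z t) / 3) < norm (Z (t + 1) - Z t)"
      using pos min.cobounded2[of r0 "norm (Z (t + 1) - Z t) / 3"] by linarith
    ultimately show "\<exists>r>0. (\<forall>z. norm (z - Z t) \<le> r \<longrightarrow> D0 z = D0 (Z t) + ?M (z - Z t)) \<and> 2 * r < norm (Z (t + 1) - Z t)"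
      using r0(2) by (meson min.bounded_iff)
  next
    fix t r
    have "Z (t + K + 1) = Z (t + 1)" using Zper[of "t + 1"] by (simp add: add.commute add.left_commute)
    then show "((\<forall>z. norm (z - Z (t + K)) \<le> r \<longrightarrow> D0 z = D0 (Z (t + K)) + ?M (z - Z (t + K))) \<and> 2 * r < norm (Z (t + K + 1) - Z (t + K)))
      = ((\<forall>z. norm (z - Z t) \<le> r \<longrightarrow> D0 z = D0 (Z t) + ?M (z - Z t)) \<and> 2 * r < norm (Z (t + 1) - Z t))"
      by (simp only: Zper)
  qed (use K in \<open>auto intro: order_trans le_less_trans\<close>)
  then obtain r1 where r1: "0 < r1" and aff: "\<And>t z. norm (z - Z t) \<le> r1 \<Longrightarrow> D0 z = D0 (Z t) + ?M (z - Z t)"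
    and sep: "\<And>t. 2 * r1 < norm (Z (t + 1) - Z t)" by blast
  obtain RP0 where RP0: "\<forall>q\<in>P0. norm q \<le> RP0" using P0(2) compact_imp_bounded bounded_iff by metis
  have CC0: "contracting_chain ?M N c \<rho>
      (splitting_kernel s (smoothed_projection.potential P0 \<kappa>) h \<gamma>)
      (word_map (heavy_ball_force \<kappa> P0) \<gamma> ?w) e (k * RP0)"
    using chain[OF P0 RP0] by blast
  then have CN: "contracting_norm ?M N c \<rho>" by (simp add: contracting_chain_def)
  have e: "0 \<le> e" using CC0 by (simp add: contracting_chain_def contracting_chain_axioms_def)
  define E1 where "E1 = e / ((1 - \<rho>) * r1 / c)\<^sup>2"
  have E1: "0 \<le> E1" using e by (simp add: E1_def)
  define E0 where "E0 = 2 * c\<^sup>2 / (1 - \<rho>) * (e + (k * RP0)\<^sup>2) / (1 - \<rho>)"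
  have E0: "0 \<le> E0" using e contracting_norm.rho[OF CN] by (simp add: E0_def)
  define C2 where "C2 = sqrt (2 * (norm (Z 0))\<^sup>2 + 2 * E0)"
  have C2: "0 \<le> C2" using E0 by (simp add: C2_def)
  obtain R n where R: "1 \<le> R" and sm: "X * (1 + C2 * R) powr b * exp (- (q * real n)) < 1 / 4"
    and n: "real (Suc n) * (E1 / R\<^sup>2) \<le> 1 / 4"
    using scale_choice[OF X C2 b q E1 order_refl] by blast
  define P where "P = (*\<^sub>R) R ` P0"
  have PP: "convex P" "compact P" "P \<noteq> {}" "\<forall>q\<in>P. norm q \<le> R * RP0"
    using P0 RP0 R by (auto simp: P_def convex_scaling compact_scaling)
  define U where "U = smoothed_projection.potential P \<kappa>"
  define Q where "Q = splitting_kernel s U h \<gamma>"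
  define D where "D = word_map (heavy_ball_force \<kappa> P) \<gamma> ?w"
  note ch = chain[OF PP, folded U_def, folded Q_def D_def]
  interpret contracting_chain ?M N c \<rho> Q D e "k * (R * RP0)" using ch by blast
  have U: "U \<in> potentials \<kappa>" using ch by blast
  obtain \<pi> where \<pi>: "unique_invariant_law Q \<pi>"
    and mom: "(\<integral>\<^sup>+y. ennreal ((N y)\<^sup>2) \<partial>\<pi>) \<le> ennreal (drift_const / (1 - \<rho>))"
    using unique_invariant_law_of_phase_spread ch by blast
  have pi: "prob_space \<pi>" "sets \<pi> = sets borel"
    using \<pi> unfolding unique_invariant_law_def invariant_law_def by blast+
  have DR: "D (R *\<^sub>R z) = R *\<^sub>R D0 z" for z
    unfolding D_def D0_def P_def using R P0 by (simp add: heavy_ball_force_scaleR word_map_scale)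
  define Y where "Y t = R *\<^sub>R Z t" for t
  have affR: "D z = Y (Suc t) + ?M (z - Y t)" if "N (z - Y t) \<le> R * r1" for z t
  proof -
    define y where "y = z /\<^sub>R R"
    have z: "z = R *\<^sub>R y" using R by (simp add: y_def)
    have zy: "z - Y t = R *\<^sub>R (y - Z t)" by (simp add: z Y_def scaleR_diff_right)
    have "norm (z - Y t) \<le> R * r1" using that N_ge order_trans by blast
    then have "norm (y - Z t) \<le> r1" unfolding zy using R by simp
    then have "D0 y = Z (t + 1) + ?M (y - Z t)" using aff[of y t] Z by simp
    then have "D z = R *\<^sub>R Z (t + 1) + R *\<^sub>R ?M (y - Z t)" unfolding z DR by (simp add: scaleR_add_right)
    then show ?thesis unfolding zy by (simp add: Y_def linear_scale[OF linM])
  qed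
  have sepR: "2 * (R * r1) < norm (Y (Suc t) - Y t)" for t
  proof -
    have "norm (Y (Suc t) - Y t) = R * norm (Z (t + 1) - Z t)"
      using R by (simp add: Y_def flip: scaleR_diff_right)
    moreover have "R * (2 * r1) < R * norm (Z (t + 1) - Z t)" using sep[of t] R by (intro mult_strict_left_mono) auto
    ultimately show ?thesis by simp
  qed
  have nR: "real (Suc n) * (e / ((1 - \<rho>) * (R * r1) / c)\<^sup>2) \<le> 1 / 4"
  proof -
    have "e / ((1 - \<rho>) * (R * r1) / c)\<^sup>2 = E1 / R\<^sup>2"
      by (simp add: E1_def power_mult_distrib power_divide mult_ac)
    then show ?thesis using n by simp
  qed
  have tv: "1 / 4 \<le> tv_dist (it n (Y 0)) \<pi> \<or> 1 / 4 \<le> tv_dist (it (Suc n) (Y 0)) \<pi>"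
    by (rule tv_near_cycle[where Y=Y and r="R * r1", OF pi _ affR sepR nR]) (use R r1 in auto)
  have E: "0 \<le> drift_const / (1 - \<rho>)" using drift_const rho by simp
  have ER: "drift_const / (1 - \<rho>) \<le> E0 * R\<^sup>2"
  proof -
    have "1 \<le> R\<^sup>2" using R by (simp add: one_le_power)
    then have "e * 1 \<le> e * R\<^sup>2" using e by (intro mult_left_mono)
    then have "e + (k * (R * RP0))\<^sup>2 \<le> (e + (k * RP0)\<^sup>2) * R\<^sup>2" by (simp add: power_mult_distrib algebra_simps)
    then have "2 * c\<^sup>2 / (1 - \<rho>) * (e + (k * (R * RP0))\<^sup>2) / (1 - \<rho>) \<le> 2 * c\<^sup>2 / (1 - \<rho>) * ((e + (k * RP0)\<^sup>2) * R\<^sup>2) / (1 - \<rho>)"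
      using rho by (intro divide_right_mono mult_left_mono) auto
    then show ?thesis unfolding drift_const_def E0_def by (simp add: mult_ac)
  qed
  have "sqrt (2 * (norm (Y 0))\<^sup>2 + 2 * (drift_const / (1 - \<rho>))) \<le> sqrt ((2 * (norm (Z 0))\<^sup>2 + 2 * E0) * R\<^sup>2)"
  proof (rule real_sqrt_le_mono)
    have "(norm (Y 0))\<^sup>2 = (norm (Z 0))\<^sup>2 * R\<^sup>2" by (simp add: Y_def power_mult_distrib)
    then show "2 * (norm (Y 0))\<^sup>2 + 2 * (drift_const / (1 - \<rho>)) \<le> (2 * (norm (Z 0))\<^sup>2 + 2 * E0) * R\<^sup>2"
      using ER by (simp add: distrib_right)
  qed
  also have "\<dots> = C2 * R" using R by (simp add: C2_def real_sqrt_mult)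
  finally have W: "W2 (return borel (Y 0)) \<pi> \<le> ennreal (C2 * R)"
    using W2_le[OF pi mom E, of "Y 0"] by (meson ennreal_leI order_trans)
  have smS: "X * (1 + C2 * R) powr b * exp (- (q * real (Suc n))) < 1 / 4"
  proof -
    have "X * (1 + C2 * R) powr b * exp (- (q * real (Suc n))) \<le> X * (1 + C2 * R) powr b * exp (- (q * real n))"
      using X q by (intro mult_left_mono) auto
    then show ?thesis using sm by linarith
  qed
  have CR: "0 \<le> C2 * R" using C2 R by simp
  have "\<exists>m. ennreal X * (1 + W2 (return borel (Y 0)) \<pi>) powr\<^sub>\<infinity> b * ennreal (exp (- (q * real m))) < ennreal (tv_dist (it m (Y 0)) \<pi>)"
    using tv bound_lt_tv[OF W CR b X exp_ge_zero sm] bound_lt_tv[OF W CR b X exp_ge_zero smS] by blast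
  then show ?thesis using U \<pi> unfolding Q_def by blast
qed

text \<open>
  The rate \<open>u = exp (- q / (2 * (b + 1)))\<close> satisfies \<open>128 \<le> (1 - u) * \<kappa>\<close>. So if the linear part has no mode as
  slow as \<open>u\<close>, the last alternative of the trichotomy says that the friction is low enough
  for an attracting cycle.
\<close>

lemma no_accelerated_rate_at:
  fixes h \<gamma> \<kappa> X b q :: real and s :: splitting
  assumes h: "0 < h" and g: "0 < \<gamma>" and k256: "256 \<le> \<kappa>"
    and stab: "0 < stability_param s h \<gamma>" "stability_param s h \<gamma> < 2 * (1 + damping h \<gamma>) / \<kappa>"
    and X: "0 \<le> X" and b: "0 \<le> b" and q: "256 * (2 * (b + 1)) / \<kappa> \<le> q"
  shows "\<exists>U\<in>(potentials \<kappa> :: (real^2 \<Rightarrow> real) set). \<exists>\<pi>. unique_invariant_law (splitting_kernel s U h \<gamma>) \<pi> \<and>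
    (\<exists>z n. ennreal X * (1 + W2 (return borel z) \<pi>) powr\<^sub>\<infinity> b * ennreal (exp (- (q * real n)))
      < ennreal (tv_dist (kernel_iterate (splitting_kernel s U h \<gamma>) n (return borel z)) \<pi>))"
proof -
  let ?\<beta> = "damping h \<gamma>" and ?s = "stability_param s h \<gamma>" and ?u = "exp (- (q / (2 * (b + 1))))"
  have k: "17 \<le> \<kappa>" using k256 by simp
  have \<beta>: "0 < ?\<beta>" "?\<beta> < 1" using h g by (simp_all add: damping_def)
  have "0 < 256 * (2 * (b + 1)) / \<kappa>" using b k by simp
  then have q0: "0 < q" using q by linarith
  have gap: "128 \<le> (1 - ?u) * \<kappa>"
  proof -
    have "256 / \<kappa> \<le> q / (2 * (b + 1))" using q b k by (simp add: field_simps)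
    then have "1 + 256 / \<kappa> \<le> exp (q / (2 * (b + 1)))" using exp_ge_add_one_self[of "q / (2 * (b + 1))"] by linarith
    then have "?u \<le> 1 / (1 + 256 / \<kappa>)" using k by (simp add: exp_minus divide_simps add_pos_pos mult.commute)
    also have "\<dots> = \<kappa> / (\<kappa> + 256)" using k by (simp add: field_simps)
    finally have "256 / (\<kappa> + 256) \<le> 1 - ?u" using k by (simp add: field_simps)
    then have "256 / (\<kappa> + 256) * \<kappa> \<le> (1 - ?u) * \<kappa>" using k by (intro mult_right_mono) auto
    moreover have "128 \<le> 256 / (\<kappa> + 256) * \<kappa>" using k256 by (simp add: field_simps)
    ultimately show ?thesis by linarith
  qed
  have u: "0 < ?u" "?u < 1" using q0 b by auto
  consider "?u\<^sup>2 \<le> ?\<beta> \<or> (\<exists>l. ?u \<le> l \<and> l\<^sup>2 - (1 + ?\<beta> - ?s) * l + ?\<beta> = 0)" | "(1 - ?u) * (1 - ?\<beta>) \<le> 2 * ?s"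
    using spectral_trichotomy[OF \<beta> stab(1) u] by blast
  then show ?thesis
  proof cases
    case 1
    then show ?thesis using k by (intro slow_decay_at_condition_number[OF h g _ stab X b q0]) auto
  next
    case 2
    have "128 * (1 - ?\<beta>) \<le> (1 - ?u) * \<kappa> * (1 - ?\<beta>)" using gap \<beta> by (intro mult_right_mono) auto
    also have "\<dots> = (1 - ?u) * (1 - ?\<beta>) * \<kappa>" by simp
    also have "\<dots> \<le> 2 * ?s * \<kappa>" using 2 k by (intro mult_right_mono) auto
    finally have "64 * (1 - ?\<beta>) \<le> ?s * \<kappa>" by simp
    then show ?thesis by (rule attracting_cycle_at_condition_number[OF h g k stab X b q0])
  qed
qed

text \<open>
  As \<open>\<tau>\<close> is of smaller order than the identity, \<open>c / \<tau> \<kappa>\<close> exceeds any given multiple of \<open>1 / \<kappa>\<close>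
  eventually. Leaving \<open>\<tau>\<close> arbitrary also covers the powers \<open>\<kappa> powr \<alpha>\<close>.
\<close>

lemma no_accelerated_rate:
  fixes s :: splitting
    and h \<gamma> :: "real \<Rightarrow> real \<Rightarrow> nat \<Rightarrow> real"
    and C c a b \<kappa>0 :: real
    and \<tau> :: "real \<Rightarrow> real"
  assumes rule: "tuning_rule h \<gamma>"
    and stable: "stable_rule s h \<gamma>"
    and constants: "0 < C" "0 < c" "0 \<le> b"
    and tau_pos: "\<And>\<kappa>. 1 < \<kappa> \<Longrightarrow> 0 < \<tau> \<kappa>"
    and tau_small: "\<tau> \<in> o[at_top](\<lambda>\<kappa>. \<kappa>)"
  shows
    "\<exists>\<kappa>\<ge>\<kappa>0. \<exists>U\<in>(potentials \<kappa> :: (real^2 \<Rightarrow> real) set).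
        \<exists>\<pi>. unique_invariant_law (splitting_kernel s U (h 1 \<kappa> 2) (\<gamma> 1 \<kappa> 2)) \<pi> \<and>
          (\<exists>z n. ennreal (C * \<kappa> powr a) * (1 + W2 (return borel z) \<pi>) powr\<^sub>\<infinity> b
               * ennreal (exp (- (c * real n / \<tau> \<kappa>)))
             < ennreal (tv_dist (kernel_iterate (splitting_kernel s U (h 1 \<kappa> 2) (\<gamma> 1 \<kappa> 2)) n (return borel z)) \<pi>))"
proof -
  define \<epsilon> where "\<epsilon> = c / (256 * (2 * (b + 1)))"
  have \<epsilon>: "0 < \<epsilon>" using constants by (simp add: \<epsilon>_def)
  obtain \<kappa>1 where \<kappa>1: "\<And>\<kappa>. \<kappa>1 \<le> \<kappa> \<Longrightarrow> norm (\<tau> \<kappa>) \<le> \<epsilon> * norm \<kappa>"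
    using landau_o.smallD[OF tau_small \<epsilon>] unfolding eventually_at_top_linorder by blast
  define \<kappa> where "\<kappa> = max (max \<kappa>0 \<kappa>1) 256"
  have k: "\<kappa>0 \<le> \<kappa>" "\<kappa>1 \<le> \<kappa>" "256 \<le> \<kappa>" by (simp_all add: \<kappa>_def)
  have t: "0 < \<tau> \<kappa>" using tau_pos k by simp
  have "\<tau> \<kappa> \<le> \<epsilon> * \<kappa>" using \<kappa>1[OF k(2)] k(3) t by simp
  then have q: "256 * (2 * (b + 1)) / \<kappa> \<le> c / \<tau> \<kappa>"
    using t k constants by (simp add: \<epsilon>_def divide_simps mult_ac)
  have hg: "0 < h 1 \<kappa> 2" "0 < \<gamma> 1 \<kappa> 2" using rule k by (simp_all add: tuning_rule_def)
  have st: "0 < stability_param s (h 1 \<kappa> 2) (\<gamma> 1 \<kappa> 2)"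
    "stability_param s (h 1 \<kappa> 2) (\<gamma> 1 \<kappa> 2) < 2 * (1 + damping (h 1 \<kappa> 2) (\<gamma> 1 \<kappa> 2)) / \<kappa>"
    using stable k by (simp_all add: stable_rule_def)
  have X: "0 \<le> C * \<kappa> powr a" using constants by simp
  show ?thesis
    using k(1) no_accelerated_rate_at[OF hg k(3) st X constants(3) q, unfolded times_divide_eq_left] by blast
qed

theorem corollary6p7:
  fixes s :: splitting
    and h \<gamma> :: "real \<Rightarrow> real \<Rightarrow> nat \<Rightarrow> real"
    and C c a b \<kappa>0 :: real
    and \<tau> :: "real \<Rightarrow> real"
  assumes rule: "tuning_rule h \<gamma>"
    and stable: "stable_rule s h \<gamma>"
    and constants: "0 < C" "0 < c" "0 \<le> a" "0 \<le> b"
    and tau_pos: "\<And>\<kappa>. 1 < \<kappa> \<Longrightarrow> 0 < \<tau> \<kappa>"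
    and tau_small: "\<tau> \<in> o[at_top](\<lambda>\<kappa>. \<kappa>)"
    and kappa0: "1 < \<kappa>0"
  shows
    "(\<exists>\<kappa>\<ge>\<kappa>0. \<exists>U\<in>(potentials \<kappa> :: (real^2 \<Rightarrow> real) set).
        let Q = splitting_kernel s U (h 1 \<kappa> 2) (\<gamma> 1 \<kappa> 2) in
        \<exists>\<pi>. unique_invariant_law Q \<pi> \<and>
          (\<exists>z n. ennreal (tv_dist (kernel_iterate Q n (return borel z)) \<pi>) >
             ennreal (C * \<kappa> powr a) * (1 + W2 (return borel z) \<pi>) powr\<^sub>\<infinity> b
               * ennreal (exp (- (c * real n / \<tau> \<kappa>)))))
     \<and> (\<forall>\<alpha><1. \<not> (\<forall>\<kappa>\<ge>\<kappa>0. \<forall>U\<in>(potentials \<kappa> :: (real^2 \<Rightarrow> real) set).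
        let Q = splitting_kernel s U (h 1 \<kappa> 2) (\<gamma> 1 \<kappa> 2) in
        \<forall>\<pi>. unique_invariant_law Q \<pi> \<longrightarrow>
          (\<forall>z n. ennreal (tv_dist (kernel_iterate Q n (return borel z)) \<pi>) \<le>
             ennreal (C * \<kappa> powr a) * (1 + W2 (return borel z) \<pi>) powr\<^sub>\<infinity> b
               * ennreal (exp (- (c * real n / \<kappa> powr \<alpha>))))))"
  unfolding Let_def
proof (intro conjI allI impI notI, goal_cases)
  case 1
  show ?case by (rule no_accelerated_rate[OF rule stable constants(1,2,4) tau_pos tau_small])
next
  case (2 \<alpha>)
  have pos: "0 < \<kappa> powr \<alpha>" if "1 < \<kappa>" for \<kappa> :: real using that by simp
  have "(\<lambda>\<kappa>. \<kappa> powr \<alpha>) \<in> o[at_top](\<lambda>\<kappa>. \<kappa> powr 1)" using 2(1) by (simp only: powr_smallo_iff[OF filterlim_ident trivial_limit_at_top_linorder])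
  also have "(\<lambda>\<kappa>. \<kappa> powr 1) \<in> \<Theta>[at_top](\<lambda>\<kappa>::real. \<kappa>)"
    by (intro bigthetaI_cong eventually_mono[OF eventually_gt_at_top[of 0]]) simp
  finally have small: "(\<lambda>\<kappa>. \<kappa> powr \<alpha>) \<in> o[at_top](\<lambda>\<kappa>. \<kappa>)" .
  from no_accelerated_rate[OF rule stable constants(1,2,4) pos small, of \<kappa>0 a] 2(2) show False
    by (meson leD)
qed

end
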